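(* Let $m,k\ge 1$ be integers and $\alpha>0$ be such that $Q_\alpha = m+(\alpha+1)k\ge 3$. Let $R_0>0$, $\kappa>0$, and let $f$ be a solution to $$\mathscr B_\alpha f = -\kappa^2 f\quad\text{in } \Omega_0=\{x\in\mathbb R^{m+k} \mid \rho_\alpha(x)>R_0\}.$$ If for some $0<p\le \frac{2Q_\alpha}{Q_\alpha-1}$ the function $f$ satisfies $$\int_{\Omega_0}|f|^p\,dx<\infty,$$ then $f\equiv 0$ in $\Omega_0$.
   Context: Let $N=m+k$ and write points of $\mathbb R^N$ as $x=(z,\sigma)$ with $z\in\mathbb R^m$, $\sigma\in\mathbb R^k$; $dx=dz\,d\sigma$ is Lebesgue measure. For $\alpha>0$, the Baouendi-Grushin operator is $\mathscr B_\alpha=\Delta_z+\frac{|z|^{2\alpha}}{4}\Delta_\sigma$. The pseudo-gauge is $\rho_\alpha(z,\sigma)=\left(|z|^{2(\alpha+1)}+4(\alpha+1)^2|\sigma|^2\right)^{\frac{1}{2(\alpha+1)}}$, and the homogeneous dimension is $Q_\alpha=m+(\alpha+1)k$. Let $X_i=\partial_{z_i}$ for $i=1,\dots,m$ and $X_{m+j}=\frac{|z|^\alpha}{2}\partial_{\sigma_j}$ for $j=1,\dots,k$, so that $\mathscr B_\alpha=\sum_{i=1}^N X_i^2$. For an open set $\Omega\subset\mathbb R^N$, $\Gamma^1(\Omega)$ is the set of $f\in C(\Omega)$ such that $X_jf\in C(\Omega)$ for all $j$ (derivatives in the distributional sense), and $\Gamma^2(\Omega)$ is the set of $f\in C(\Omega)$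 such that $f, X_jf\in\Gamma^1(\Omega)$ for all $j$. Solutions in an open set $\Omega$ are real-valued and belong to $\Gamma^2(\Omega)$. *)

theory Defs
  imports "HOL-Analysis.Analysis"
begin

text \<open>
  A point of \<open>\<real>\<^sup>m \<times> \<real>\<^sup>k\<close> is a pair \<open>(z, \<sigma>)\<close> of type \<open>(real^'m) \<times> (real^'k)\<close>, with
  \<open>m = CARD('m) \<ge> 1\<close> and \<open>k = CARD('k) \<ge> 1\<close>. The type \<open>'m + 'k\<close> indexes the vector fields:
  \<open>Inl i\<close> stands for \<open>X\<^sub>i\<close> and \<open>Inr j\<close> for \<open>X\<^bsub>m+j\<^esub>\<close>.
\<close>

definition hom_dim :: "'m::finite itself \<Rightarrow> 'k::finite itself \<Rightarrow> real \<Rightarrow> real" where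
  "hom_dim _ _ \<alpha> = real CARD('m) + (\<alpha> + 1) * real CARD('k)"

definition pseudo_gauge :: "real \<Rightarrow> (real^'m::finite) \<times> (real^'k::finite) \<Rightarrow> real" where
  "pseudo_gauge \<alpha> x =
     (norm (fst x) powr (2 * (\<alpha> + 1)) + 4 * (\<alpha> + 1)\<^sup>2 * (norm (snd x))\<^sup>2)
       powr (1 / (2 * (\<alpha> + 1)))"

primrec Cn :: "nat \<Rightarrow> ('a::euclidean_space \<Rightarrow> real) \<Rightarrow> bool" where
  "Cn 0 \<phi> \<longleftrightarrow> continuous_on UNIV \<phi>"
| "Cn (Suc n) \<phi> \<longleftrightarrow> (\<forall>x. \<phi> differentiable (at x)) \<and>
     (\<forall>b\<in>Basis. Cn n (\<lambda>x. frechet_derivative \<phi> (at x) b))"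

definition test_function :: "'a::euclidean_space set \<Rightarrow> ('a \<Rightarrow> real) \<Rightarrow> bool" where
  "test_function \<Omega> \<phi> \<longleftrightarrow>
     (\<forall>n. Cn n \<phi>) \<and> (\<exists>K. compact K \<and> K \<subseteq> \<Omega> \<and> (\<forall>x. x \<notin> K \<longrightarrow> \<phi> x = 0))"

fun X_classical ::
  "real \<Rightarrow> 'm + 'k \<Rightarrow> ((real^'m::finite) \<times> (real^'k::finite) \<Rightarrow> real)
     \<Rightarrow> (real^'m) \<times> (real^'k) \<Rightarrow> real" where
  "X_classical \<alpha> (Inl i) \<phi> x = frechet_derivative \<phi> (at x) (axis i 1, 0)"
| "X_classical \<alpha> (Inr j) \<phi> x =
     norm (fst x) powr \<alpha> / 2 * frechet_derivative \<phi> (at x) (0, axis j 1)"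

text \<open>
  \<open>has_X \<alpha> \<Omega> j f g\<close>: the distributional derivative \<open>X\<^sub>j f\<close> on \<open>\<Omega>\<close> is the function \<open>g\<close>. No
  coefficient is differentiated here: that of \<open>X\<^bsub>m+j\<^esub>\<close> does not depend on \<open>\<sigma>\<close>, so the formal
  adjoint of each \<open>X\<^sub>j\<close> is \<open>-X\<^sub>j\<close>. The integrals are meaningful for \<open>f\<close> and \<open>g\<close> continuous on
  the open set \<open>\<Omega>\<close>, which is the only case used below.
\<close>
definition has_X ::
  "real \<Rightarrow> ((real^'m::finite) \<times> (real^'k::finite)) set \<Rightarrow> 'm + 'k
     \<Rightarrow> ((real^'m) \<times> (real^'k) \<Rightarrow> real) \<Rightarrow> ((real^'m) \<times> (real^'k) \<Rightarrow> real) \<Rightarrow> bool" where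
  "has_X \<alpha> \<Omega> j f g \<longleftrightarrow>
     (\<forall>\<phi>. test_function \<Omega> \<phi> \<longrightarrow>
        (LINT x:\<Omega>|lborel. g x * \<phi> x) = - (LINT x:\<Omega>|lborel. f x * X_classical \<alpha> j \<phi> x))"

definition Gamma1 ::
  "real \<Rightarrow> ((real^'m::finite) \<times> (real^'k::finite)) set
     \<Rightarrow> ((real^'m) \<times> (real^'k) \<Rightarrow> real) set" where
  "Gamma1 \<alpha> \<Omega> =
     {f. continuous_on \<Omega> f \<and> (\<forall>j. \<exists>g. continuous_on \<Omega> g \<and> has_X \<alpha> \<Omega> j f g)}"

text \<open>
  The continuous representative of \<open>X\<^sub>j f\<close>, for \<open>f \<in> \<Gamma>\<^sup>1(\<Omega>)\<close>. On \<open>\<Omega>\<close> it is unique, since two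
  continuous functions inducing the same distribution on an open set agree there; values outside
  \<open>\<Omega>\<close> are arbitrary and never used.
\<close>
definition X_deriv ::
  "real \<Rightarrow> ((real^'m::finite) \<times> (real^'k::finite)) set \<Rightarrow> 'm + 'k
     \<Rightarrow> ((real^'m) \<times> (real^'k) \<Rightarrow> real) \<Rightarrow> (real^'m) \<times> (real^'k) \<Rightarrow> real" where
  "X_deriv \<alpha> \<Omega> j f = (SOME g. continuous_on \<Omega> g \<and> has_X \<alpha> \<Omega> j f g)"

definition Gamma2 ::
  "real \<Rightarrow> ((real^'m::finite) \<times> (real^'k::finite)) set
     \<Rightarrow> ((real^'m) \<times> (real^'k) \<Rightarrow> real) set" where
  "Gamma2 \<alpha> \<Omega> = {f. f \<in> Gamma1 \<alpha> \<Omega> \<and> (\<forall>j. X_deriv \<alpha> \<Omega> j f \<in> Gamma1 \<alpha> \<Omega>)}"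

text \<open>
  The operator \<open>\<Delta>\<^sub>z + |z|\<^bsup>2\<alpha>\<^esup>/4 \<Delta>\<^sub>\<sigma>\<close> in its form \<open>\<Sum>\<^sub>j X\<^sub>j\<^sup>2\<close>, which makes sense pointwise
  on \<open>\<Gamma>\<^sup>2(\<Omega>)\<close>.
\<close>
definition baouendi_grushin ::
  "real \<Rightarrow> ((real^'m::finite) \<times> (real^'k::finite)) set
     \<Rightarrow> ((real^'m) \<times> (real^'k) \<Rightarrow> real) \<Rightarrow> (real^'m) \<times> (real^'k) \<Rightarrow> real" where
  "baouendi_grushin \<alpha> \<Omega> f x = (\<Sum>j\<in>UNIV. X_deriv \<alpha> \<Omega> j (X_deriv \<alpha> \<Omega> j f) x)"

end

theory Submission imports Defs
begin

text \<open>
  Let \<open>\<rho>\<close> be the gauge and \<open>Z\<close> the generator of the anisotropic dilations. Testing the equation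
  with \<open>g(\<rho>) f\<close> and with \<open>g(\<rho>) Z f\<close>, and integrating the divergence of \<open>g(\<rho>) |z|\<^bsup>2\<alpha>\<^esup> f\<^sup>2 Z\<close>,
  gives three identities between the integrals over gauge shells of five quadratic expressions in
  \<open>f\<close> and its horizontal gradient. They play the role of the radial ordinary differential equation in
  Kato's theorem on the absence of positive eigenvalues: suitable combinations are monotone in \<open>\<rho>\<close>
  in the weak sense, and for \<open>f \<noteq> 0\<close> they force \<open>f\<^sup>2\<close> to have mass at least \<open>\<epsilon> R\<close> in
  \<open>R \<le> \<rho> \<le> 4 R\<close> for all large \<open>R\<close>.

  Integrability of \<open>|f|\<^sup>p\<close> excludes this. For \<open>2 \<le> p \<le> 2Q/(Q - 1)\<close> one splits
  \<open>f\<^sup>2 \<le> s\<^bsup>2-p\<^esup> |f|\<^sup>p + s\<^sup>2\<close> with \<open>s = \<eta> R\<^bsup>-(Q-1)/2\<^esup>\<close> and uses the volume growth \<open>R\<^sup>Q\<close>. For \<open>p < 2\<close>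
  a Nash inequality for the fields \<open>X\<^sub>j\<close>, combined with the energy estimate on nested shells and
  iterated, bounds the mass of \<open>f\<^sup>2\<close> in the shells uniformly in \<open>R\<close>.
\<close>

section \<open>Directional derivatives and integration by parts\<close>

text \<open>The difficulty is regularity at z = 0. For f in \<open>Gamma2\<close> the derivatives
  X_j f are continuous, but the full \<sigma>-derivatives, which occur in Z f, are not controlled
  there, so the test function g(\<rho>) Z f is not directly admissible. Mollifying f is not enough
  by itself, because it does not commute with the coefficient |z|^\<alpha>. The remedy is a product
  kernel whose \<sigma>-width is fixed first and whose z-width is chosen afterwards:
  \<sigma>-derivatives of the mollified function cost only powers of the first width, while the
  commutator is governed by the oscillation of |z|^\<alpha> over the second. The identities are
  proved for C^2 functions and arranged so that, in the limit, Z f occurs only with the factor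
  |z|^\<alpha>.

  After that a monotonicity formula is a pointwise inequality in six real variables, modulo
  integrands with vanishing integral. The exponent 2Q/(Q - 1) is the borderline for decay of order
  \<rho>^(-(Q-1)/2), the decay at which f^2 has mass of order R in a shell of volume R^Q.\<close>

definition pd :: "'a::euclidean_space \<Rightarrow> ('a \<Rightarrow> real) \<Rightarrow> ('a \<Rightarrow> real) \<Rightarrow> bool" where
  "pd b F F' \<longleftrightarrow> (\<forall>x. ((\<lambda>t. F (x + t *\<^sub>R b)) has_real_derivative F' x) (at 0))"

lemma pdD: "pd b F F' \<Longrightarrow> ((\<lambda>t. F (x + t *\<^sub>R b)) has_real_derivative F' x) (at 0)"
  by (simp add: pd_def)

lemma pd_line:
  assumes "pd b F F'"
  shows "((\<lambda>t. F (x + t *\<^sub>R b)) has_real_derivative F' (x + s *\<^sub>R b)) (at s)"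
proof -
  have "((\<lambda>t. F ((x + s *\<^sub>R b) + t *\<^sub>R b)) has_real_derivative F' (x + s *\<^sub>R b)) (at 0)"
    using assms by (simp add: pd_def)
  then have "((\<lambda>t. F (x + (s + t) *\<^sub>R b)) has_real_derivative F' (x + s *\<^sub>R b)) (at 0)"
    by (simp add: algebra_simps)
  then show ?thesis
    using DERIV_at_within_shift[of "\<lambda>t. F (x + t *\<^sub>R b)" "F' (x + s *\<^sub>R b)" s 0 UNIV] by simp
qed

lemma pd_cong: "pd b F F' \<Longrightarrow> (\<And>x. F' x = G x) \<Longrightarrow> pd b F G"
  by (simp add: pd_def)

lemma pd_unique: "pd b F F' \<Longrightarrow> pd b F G \<Longrightarrow> F' = G"
  by (rule ext) (auto simp: pd_def intro: DERIV_unique)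

lemma pd_const: "pd b (\<lambda>x. c) (\<lambda>x. 0)"
  by (simp add: pd_def)

lemma pd_add: "pd b F F' \<Longrightarrow> pd b G G' \<Longrightarrow> pd b (\<lambda>x. F x + G x) (\<lambda>x. F' x + G' x)"
  by (auto simp: pd_def intro!: derivative_eq_intros)

lemma pd_mult: "pd b F F' \<Longrightarrow> pd b G G' \<Longrightarrow> pd b (\<lambda>x. F x * G x) (\<lambda>x. F' x * G x + F x * G' x)"
  by (auto simp: pd_def intro!: derivative_eq_intros)

lemma pd_cmult: "pd b F F' \<Longrightarrow> pd b (\<lambda>x. c * F x) (\<lambda>x. c * F' x)"
  by (auto simp: pd_def intro!: derivative_eq_intros)

lemma pd_sum: "(\<And>i. i \<in> I \<Longrightarrow> pd b (F i) (F' i)) \<Longrightarrow> pd b (\<lambda>x. \<Sum>i\<in>I. F i x) (\<lambda>x. \<Sum>i\<in>I. F' i x)"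
  by (auto simp: pd_def intro!: derivative_eq_intros)

lemma pd_power2: "pd b F F' \<Longrightarrow> pd b (\<lambda>x. (F x)\<^sup>2) (\<lambda>x. 2 * F x * F' x)"
  by (auto simp: pd_def intro!: derivative_eq_intros)

lemma pd_chain:
  assumes "pd b F F'" "\<And>t. (g has_real_derivative g' t) (at t)"
  shows "pd b (\<lambda>x. g (F x)) (\<lambda>x. g' (F x) * F' x)"
  unfolding pd_def
proof
  fix x
  show "((\<lambda>t. g (F (x + t *\<^sub>R b))) has_real_derivative g' (F x) * F' x) (at 0)"
    using DERIV_chain2[of g "g' (F x)" "\<lambda>t. F (x + t *\<^sub>R b)" 0 "F' x" UNIV] assms
    by (simp add: pd_def)
qed

lemma pd_has_derivative:
  assumes "\<And>x. (F has_derivative D x) (at x)"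
  shows "pd b F (\<lambda>x. D x b)"
  unfolding pd_def
proof
  fix x
  have "((\<lambda>t. F (x + t *\<^sub>R b)) has_derivative (\<lambda>t. D x (t *\<^sub>R b))) (at 0)"
    using assms[of x] by (auto intro!: has_derivative_compose[of "\<lambda>t. x + t *\<^sub>R b" "\<lambda>t. t *\<^sub>R b" 0 UNIV F "D x"] derivative_eq_intros)
  moreover have "(\<lambda>t. D x (t *\<^sub>R b)) = (\<lambda>t. D x b * t)"
    using has_derivative_linear[OF assms[of x]] by (auto simp: linear_scale)
  ultimately show "((\<lambda>t. F (x + t *\<^sub>R b)) has_real_derivative D x b) (at 0)"
    by (simp add: has_field_derivative_def)
qed

lemma pd_zero_outside:
  assumes "pd b h h'" "closed K" "\<And>x. x \<notin> K \<Longrightarrow> h x = 0" "x \<notin> K"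
  shows "h' x = 0"
proof -
  define g where "g = (\<lambda>t::real. x + t *\<^sub>R b)"
  have "open (g -` (- K))"
    using assms(2) by (intro open_vimage open_Compl) (auto simp: g_def intro!: continuous_intros)
  moreover have "0 \<in> g -` (- K)" using assms(4) by (simp add: g_def)
  moreover have "\<And>t. t \<in> g -` (- K) \<Longrightarrow> 0 = h (g t)" using assms(3) by simp
  moreover have "((\<lambda>t::real. 0::real) has_field_derivative 0) (at 0)" by simp
  ultimately have "((\<lambda>t. h (g t)) has_real_derivative 0) (at 0)"
    using has_field_derivative_transform_within_open[of "\<lambda>_. 0" 0 0 "g -` (- K)" "\<lambda>t. h (g t)"] by blast
  with pdD[OF assms(1), of x] show ?thesis unfolding g_def by (rule DERIV_unique)
qed

lemma integrable_on_compact_support: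
  fixes g :: "'a::euclidean_space \<Rightarrow> real"
  assumes K: "compact K" and g: "continuous_on K g" "\<And>x. x \<notin> K \<Longrightarrow> g x = 0"
  shows "integrable lborel g"
proof -
  have "(\<lambda>x. indicator K x *\<^sub>R g x) = g"
  proof
    show "indicator K x *\<^sub>R g x = g x" for x using g(2)[of x] by (cases "x \<in> K") auto
  qed
  then show ?thesis using borel_integrable_compact[OF K g(1)] by simp
qed

lemma integrable_compact_support:
  fixes f :: "'a::euclidean_space \<Rightarrow> real"
  assumes "continuous_on UNIV f" "compact K" "\<And>x. x \<notin> K \<Longrightarrow> f x = 0"
  shows "integrable lborel f"
  using assms by (intro integrable_on_compact_support[of K]) (auto intro: continuous_on_subset)

lemma bounded_compact_support:
  fixes f :: "'a::euclidean_space \<Rightarrow> real"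
  assumes "continuous_on UNIV f" "compact K" "\<And>x. x \<notin> K \<Longrightarrow> f x = 0"
  obtains M where "M \<ge> 0" "\<And>x. \<bar>f x\<bar> \<le> M"
proof -
  have "compact (f ` K)" using assms compact_continuous_image continuous_on_subset by blast
  then have "bounded (f ` K)" by (rule compact_imp_bounded)
  then obtain M where M: "\<forall>y\<in>f ` K. norm y \<le> M" unfolding bounded_iff by auto
  have "\<bar>f x\<bar> \<le> max M 0" for x using M assms(3)[of x] by (cases "x \<in> K") auto
  then show ?thesis using that[of "max M 0"] by auto
qed

lemma integral_lborel_shift:
  fixes f :: "'a::euclidean_space \<Rightarrow> real"
  assumes "f \<in> borel_measurable borel"
  shows "(LINT x|lborel. f (x + c)) = (LINT x|lborel. f x)"
  by (subst (2) lborel_distr_plus[of c, symmetric]) (simp_all add: integral_distr assms add.commute)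

text \<open>Translation invariance makes each difference quotient \<open>s n\<close> integrate to 0.
  By the mean value theorem the quotients are bounded by sup |h'| and vanish off one compact set, so
  dominated convergence carries this over to \<open>h'\<close>.\<close>

lemma integral_pd_eq_0:
  fixes h :: "'a::euclidean_space \<Rightarrow> real"
  assumes pd: "pd b h h'" and ch: "continuous_on UNIV h" and ch': "continuous_on UNIV h'"
    and K: "compact K" "\<And>x. x \<notin> K \<Longrightarrow> h x = 0"
  shows "(LINT x|lborel. h' x) = 0"
proof -
  have K': "h' x = 0" if "x \<notin> K" for x
    using pd_zero_outside[OF pd _ K(2) that] K(1) compact_imp_closed by blast
  obtain M where M: "M \<ge> 0" "\<And>x. \<bar>h' x\<bar> \<le> M"
    using bounded_compact_support[OF ch' K(1) K'] by blast
  \<comment> \<open>All points from which \<open>K\<close> is reached along \<open>b\<close> in time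
    at most 1; the step lengths 1/(n + 1) never exceed 1.\<close>
  define T where "T = (\<lambda>p. fst p - snd p *\<^sub>R b) ` (K \<times> {0..1::real})"
  have T: "compact T" unfolding T_def
    by (intro compact_continuous_image compact_Times K compact_Icc) (auto intro!: continuous_intros simp: case_prod_unfold)
  define s where "s = (\<lambda>(n::nat) x. (h (x + (1 / real (Suc n)) *\<^sub>R b) - h x) * real (Suc n))"
  have inth: "integrable lborel h" using integrable_compact_support[OF ch K] .
  have ch_sh: "continuous_on UNIV (\<lambda>x. h (x + c))" for c
    by (rule continuous_on_compose2[OF ch]) (auto intro!: continuous_intros)
  have bm: "h \<in> borel_measurable borel" "h' \<in> borel_measurable borel"
    using ch ch' by (auto intro: borel_measurable_continuous_onI)
  have intsh: "integrable lborel (\<lambda>x. h (x + c))" for c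
  proof -
    have "integrable (distr lborel borel ((+) c)) h" using inth by (simp add: lborel_distr_plus)
    then show ?thesis by (subst (asm) integrable_distr_eq) (auto simp: add.commute bm)
  qed
  have s0: "(LINT x|lborel. s n x) = 0" for n
    unfolding s_def using intsh inth integral_lborel_shift[OF bm(1)] by simp
  have lim: "(\<lambda>n. s n x) \<longlonglongrightarrow> h' x" for x
  proof -
    have "((\<lambda>t. (h (x + t *\<^sub>R b) - h x) / t) \<longlongrightarrow> h' x) (at 0)"
      using pdD[OF pd, of x] by (simp add: has_field_derivative_iff)
    moreover have "filterlim (\<lambda>n. 1 / real (Suc n)) (at 0) sequentially"
      unfolding filterlim_at using lim_1_over_n LIMSEQ_Suc[OF lim_1_over_n] by (auto intro!: always_eventually)
    ultimately have "(\<lambda>n. (h (x + (1 / real (Suc n)) *\<^sub>R b) - h x) / (1 / real (Suc n))) \<longlonglongrightarrow> h' x"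
      by (rule filterlim_compose)
    then show ?thesis by (simp add: s_def)
  qed
  have bd: "norm (s n x) \<le> M * indicator T x" for n x
  proof -
    define t where "t = 1 / real (Suc n)"
    have t: "0 < t" "t \<le> 1" by (auto simp: t_def)
    have "\<exists>z. z > 0 \<and> z < t \<and> h (x + t *\<^sub>R b) - h (x + 0 *\<^sub>R b) = (t - 0) * h' (x + z *\<^sub>R b)"
      using pd_line[OF pd] t by (intro MVT2) auto
    then obtain z where z: "0 < z" "z < t" "h (x + t *\<^sub>R b) - h x = t * h' (x + z *\<^sub>R b)" by auto
    have eq: "s n x = h' (x + z *\<^sub>R b)"
      using z(3) t(1) unfolding s_def t_def by (simp add: field_simps)
    show ?thesis
    proof (cases "x \<in> T")
      case True then show ?thesis using M eq by auto
    next
      case False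
      have "x + z *\<^sub>R b \<notin> K"
      proof
        assume "x + z *\<^sub>R b \<in> K"
        then have "x \<in> T" unfolding T_def using z t by (intro image_eqI[of _ _ "(x + z *\<^sub>R b, z)"]) auto
        with False show False ..
      qed
      then show ?thesis using eq K' False by simp
    qed
  qed
  have "(\<lambda>n. LINT x|lborel. s n x) \<longlonglongrightarrow> (LINT x|lborel. h' x)"
  proof (rule integral_dominated_convergence[where w="\<lambda>x. M * indicator T x"])
    show "h' \<in> borel_measurable lborel" using bm by simp
    show "s n \<in> borel_measurable lborel" for n
      unfolding s_def using bm ch_sh by (intro borel_measurable_times borel_measurable_diff) (auto intro: borel_measurable_continuous_onI)
    show "integrable lborel (\<lambda>x. M * indicator T x)"
      using borel_integrable_compact[OF T, of "\<lambda>_. M"] by (simp add: mult.commute)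
    show "AE x in lborel. norm (s n x) \<le> M * indicator T x" for n by (rule AE_I2) (rule bd)
  qed (auto simp: lim)
  then show ?thesis using s0 LIMSEQ_unique[of "\<lambda>n. 0::real"] by simp
qed

text \<open>The increment of \<open>F\<close> in direction \<open>b\<close> is an integral of
  \<open>Fb\<close>. Differentiating it in direction \<open>c\<close> under the integral gives the
  increment of \<open>Fc\<close> as an integral of \<open>Fbc\<close>, and the one-sided derivative
  of this at 0 is both \<open>Fbc x\<close> and \<open>Fcb x\<close>.\<close>

lemma pd_symmetric:
  assumes "pd b F Fb" "pd c F Fc" "pd c Fb Fbc" "pd b Fc Fcb"
    and "continuous_on UNIV F" "continuous_on UNIV Fb" "continuous_on UNIV Fbc" "continuous_on UNIV Fcb"
  shows "Fbc x = Fcb x"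
proof -
  define G where "G = (\<lambda>s t::real. F (x + s *\<^sub>R b + t *\<^sub>R c))"
  have cont: "continuous_on UNIV H \<Longrightarrow> continuous_on S (\<lambda>p. H (x + g p *\<^sub>R b + k p *\<^sub>R c))"
    if "continuous_on S g" "continuous_on S k" for H :: "'a \<Rightarrow> real" and g k :: "'p::topological_space \<Rightarrow> real" and S
    by (rule continuous_on_compose2[of UNIV H]) (auto intro!: continuous_intros that)
  have eq1: "G s t - G 0 t = integral {0..s} (\<lambda>r. Fb (x + r *\<^sub>R b + t *\<^sub>R c))" if "s \<ge> 0" for s t
  proof -
    have "((\<lambda>r. Fb (x + r *\<^sub>R b + t *\<^sub>R c)) has_integral (G s t - G 0 t)) {0..s}"
    proof (rule fundamental_theorem_of_calculus[OF that])
      fix r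
      have "((\<lambda>r. F ((x + t *\<^sub>R c) + r *\<^sub>R b)) has_real_derivative Fb ((x + t *\<^sub>R c) + r *\<^sub>R b)) (at r within {0..s})"
        using pd_line[OF assms(1)] has_field_derivative_at_within by blast
      then show "((\<lambda>s. G s t) has_vector_derivative Fb (x + r *\<^sub>R b + t *\<^sub>R c)) (at r within {0..s})"
        by (simp add: G_def has_real_derivative_iff_has_vector_derivative algebra_simps)
    qed
    then show ?thesis by (simp add: integral_unique)
  qed
  have d1: "((\<lambda>t. integral {0..s} (\<lambda>r. Fb (x + r *\<^sub>R b + t *\<^sub>R c))) has_real_derivative
        integral {0..s} (\<lambda>r. Fbc (x + r *\<^sub>R b + 0 *\<^sub>R c))) (at 0)" for s
  proof -
    have "((\<lambda>t. integral (cbox 0 s) (\<lambda>r. Fb (x + r *\<^sub>R b + t *\<^sub>R c))) has_real_derivative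
        integral (cbox 0 s) (\<lambda>r. Fbc (x + r *\<^sub>R b + 0 *\<^sub>R c))) (at 0 within UNIV)"
    proof (rule leibniz_rule_field_derivative[where U=UNIV and fx = "\<lambda>t r. Fbc (x + r *\<^sub>R b + t *\<^sub>R c)"])
      fix t r :: real
      show "((\<lambda>t. Fb (x + r *\<^sub>R b + t *\<^sub>R c)) has_field_derivative Fbc (x + r *\<^sub>R b + t *\<^sub>R c)) (at t within UNIV)"
        using pd_line[OF assms(3)] by simp
      show "(\<lambda>r. Fb (x + r *\<^sub>R b + t *\<^sub>R c)) integrable_on cbox 0 s"
        by (rule integrable_continuous, rule cont[OF _ _ assms(6)]) (auto intro!: continuous_intros)
      show "continuous_on (UNIV \<times> cbox 0 s) (\<lambda>(t, r). Fbc (x + r *\<^sub>R b + t *\<^sub>R c))"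
        unfolding case_prod_unfold by (rule cont[OF _ _ assms(7)]) (auto intro!: continuous_intros)
    qed auto
    then show ?thesis by simp
  qed
  have d2: "((\<lambda>t. G s t - G 0 t) has_real_derivative Fc (x + s *\<^sub>R b) - Fc x) (at 0)" for s
    unfolding G_def
    using pdD[OF assms(2), of "x + s *\<^sub>R b"] pdD[OF assms(2), of x] by (auto intro!: derivative_eq_intros)
  have eq2: "Fc (x + s *\<^sub>R b) = Fc x + integral {0..s} (\<lambda>r. Fbc (x + r *\<^sub>R b))" if "s \<ge> 0" for s
  proof -
    have "((\<lambda>t. G s t - G 0 t) has_real_derivative integral {0..s} (\<lambda>r. Fbc (x + r *\<^sub>R b + 0 *\<^sub>R c))) (at 0)"
      using d1[of s] eq1[OF that] by simp
    from DERIV_unique[OF this d2] show ?thesis by simp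
  qed
  have "continuous_on {0..1} (\<lambda>r. Fbc (x + r *\<^sub>R b + 0 *\<^sub>R c))"
    by (rule cont[OF _ _ assms(7)]) (auto intro!: continuous_intros)
  then have "((\<lambda>s. integral {0..s} (\<lambda>r. Fbc (x + r *\<^sub>R b))) has_real_derivative Fbc (x + 0 *\<^sub>R b)) (at 0 within {0..1})"
    by (intro integral_has_real_derivative) auto
  then have "((\<lambda>s. Fc x + integral {0..s} (\<lambda>r. Fbc (x + r *\<^sub>R b))) has_real_derivative Fbc x) (at 0 within {0..1})"
    using DERIV_add[OF DERIV_const] by fastforce
  then have 1: "((\<lambda>s. Fc (x + s *\<^sub>R b)) has_vector_derivative Fbc x) (at 0 within {0..1})"
    unfolding has_real_derivative_iff_has_vector_derivative
    by (rule has_vector_derivative_transform[rotated 2]) (auto simp: eq2)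
  have 2: "((\<lambda>s. Fc (x + s *\<^sub>R b)) has_vector_derivative Fcb x) (at 0 within {0..1})"
    using pdD[OF assms(4)] has_field_derivative_at_within has_real_derivative_iff_has_vector_derivative by blast
  show ?thesis
    using vector_derivative_unique_within_closed_interval[of 0 1 0, OF _ _ 1[folded box_real(2)] 2[folded box_real(2)]] by simp
qed

section \<open>Smooth bump functions\<close>

abbreviation smooth :: "('a::euclidean_space \<Rightarrow> real) \<Rightarrow> bool" where
  "smooth f \<equiv> (\<forall>n. Cn n f)"

lemma Cn_SucI:
  assumes "\<And>x. (f has_derivative D x) (at x)" "\<And>b. b \<in> Basis \<Longrightarrow> Cn n (\<lambda>x. D x b)"
  shows "Cn (Suc n) f"
proof -
  have "frechet_derivative f (at x) = D x" for x
    using frechet_derivative_at[OF assms(1)] by simp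
  then show ?thesis using assms by (auto simp: differentiable_def)
qed

lemma Cn_Suc_has_derivative:
  "Cn (Suc n) f \<Longrightarrow> (f has_derivative frechet_derivative f (at x)) (at x)"
  by (simp add: frechet_derivative_works)

lemma Cn_Suc_imp_Cn: "Cn (Suc n) f \<Longrightarrow> Cn n f"
proof (induction n arbitrary: f)
  case 0
  then show ?case by (auto intro: differentiable_imp_continuous_on simp: differentiable_on_def)
next
  case (Suc n)
  then show ?case using Suc.IH by simp
qed

lemma smooth_continuous: "smooth f \<Longrightarrow> continuous_on UNIV f"
  by (drule spec[of _ 0]) simp

lemma smooth_deriv: "smooth f \<Longrightarrow> b \<in> Basis \<Longrightarrow> smooth (\<lambda>x. frechet_derivative f (at x) b)"
proof
  fix n
  assume "smooth f" "b \<in> Basis"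
  then have "Cn (Suc n) f" by blast
  then show "Cn n (\<lambda>x. frechet_derivative f (at x) b)" using \<open>b \<in> Basis\<close> by simp
qed

lemma smooth_has_derivative: "smooth f \<Longrightarrow> (f has_derivative frechet_derivative f (at x)) (at x)"
  by (drule spec[of _ "Suc 0"]) (rule Cn_Suc_has_derivative)

lemma smooth_pd: "smooth f \<Longrightarrow> pd b f (\<lambda>x. frechet_derivative f (at x) b)"
  by (intro pd_has_derivative smooth_has_derivative)

lemma Cn_const: "Cn n (\<lambda>x. c)"
proof (induction n arbitrary: c)
  case (Suc n)
  then show ?case by (intro Cn_SucI[where D="\<lambda>x h. 0"]) auto
qed simp

lemma Cn_add: "Cn n f \<Longrightarrow> Cn n g \<Longrightarrow> Cn n (\<lambda>x. f x + g x)"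
proof (induction n arbitrary: f g)
  case (Suc n)
  show ?case
  proof (rule Cn_SucI)
    show "((\<lambda>x. f x + g x) has_derivative (\<lambda>h. frechet_derivative f (at x) h + frechet_derivative g (at x) h)) (at x)" for x
      by (rule has_derivative_add[OF Cn_Suc_has_derivative[OF Suc.prems(1)] Cn_Suc_has_derivative[OF Suc.prems(2)]])
    show "Cn n (\<lambda>x. frechet_derivative f (at x) b + frechet_derivative g (at x) b)" if "b \<in> Basis" for b
      using Suc.prems that by (intro Suc.IH) auto
  qed
qed (auto intro: continuous_intros)

lemma Cn_mult: "Cn n f \<Longrightarrow> Cn n g \<Longrightarrow> Cn n (\<lambda>x. f x * g x)"
proof (induction n arbitrary: f g)
  case (Suc n)
  show ?case
  proof (rule Cn_SucI)
    show "((\<lambda>x. f x * g x) has_derivative (\<lambda>h. f x * frechet_derivative g (at x) h + frechet_derivative f (at x) h * g x)) (at x)" for x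
      by (rule has_derivative_mult[OF Cn_Suc_has_derivative[OF Suc.prems(1)] Cn_Suc_has_derivative[OF Suc.prems(2)]])
    show "Cn n (\<lambda>x. f x * frechet_derivative g (at x) b + frechet_derivative f (at x) b * g x)" if "b \<in> Basis" for b
      using Suc.prems that Cn_Suc_imp_Cn[OF Suc.prems(1)] Cn_Suc_imp_Cn[OF Suc.prems(2)]
      by (intro Cn_add Suc.IH) auto
  qed
qed (auto intro: continuous_intros)

lemma Cn_sum: "finite I \<Longrightarrow> (\<And>i. i \<in> I \<Longrightarrow> Cn n (f i)) \<Longrightarrow> Cn n (\<lambda>x. \<Sum>i\<in>I. f i x)"
  by (induction I rule: finite_induct) (auto intro: Cn_const Cn_add)

lemma Cn_comp_affine:
  fixes f :: "'b::euclidean_space \<Rightarrow> real" and l :: "'a::euclidean_space \<Rightarrow> 'b"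
  assumes "linear l"
  shows "Cn n f \<Longrightarrow> Cn n (\<lambda>x. f (l x + c))"
proof (induction n arbitrary: f)
  case 0
  have "continuous_on UNIV l" using assms linear_continuous_on linear_conv_bounded_linear by blast
  with 0 show ?case by (auto intro!: continuous_on_compose2[of UNIV f] continuous_intros)
next
  case (Suc n)
  have l: "(l has_derivative l) (at x)" for x
    using assms linear_imp_has_derivative by blast
  show ?case
  proof (rule Cn_SucI)
    fix x
    have "((\<lambda>x. l x + c) has_derivative l) (at x)"
      using has_derivative_add[OF l has_derivative_const] by simp
    then show "((\<lambda>x. f (l x + c)) has_derivative (\<lambda>h. frechet_derivative f (at (l x + c)) (l h))) (at x)"
      by (rule has_derivative_compose) (rule Cn_Suc_has_derivative[OF Suc.prems])
  next
    fix b :: 'a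
    have "frechet_derivative f (at y) (l b) = (\<Sum>b'\<in>Basis. (l b \<bullet> b') * frechet_derivative f (at y) b')" for y
    proof -
      have "linear (frechet_derivative f (at y))"
        using Cn_Suc_has_derivative[OF Suc.prems] has_derivative_linear by blast
      then have "frechet_derivative f (at y) (\<Sum>b'\<in>Basis. (l b \<bullet> b') *\<^sub>R b') = (\<Sum>b'\<in>Basis. (l b \<bullet> b') *\<^sub>R frechet_derivative f (at y) b')"
        by (simp add: linear_sum linear_scale)
      then show ?thesis by (simp add: euclidean_representation)
    qed
    moreover have "Cn n (\<lambda>x. \<Sum>b'\<in>Basis. (l b \<bullet> b') * frechet_derivative f (at (l x + c)) b')"
      using Suc.prems by (intro Cn_sum Cn_mult Cn_const Suc.IH) auto
    ultimately show "Cn n (\<lambda>x. frechet_derivative f (at (l x + c)) (l b))" by simp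
  qed
qed

lemma smooth_comp_affine:
  assumes "smooth f" "linear l"
  shows "smooth (\<lambda>x. f (l x + c))"
  using assms Cn_comp_affine by blast

lemma smooth_inner: "smooth (\<lambda>x. x \<bullet> b)"
proof
  fix n show "Cn n (\<lambda>x. x \<bullet> b)"
  proof (cases n)
    case (Suc m)
    show ?thesis unfolding Suc
      by (rule Cn_SucI[where D="\<lambda>x h. h \<bullet> b"]) (auto intro!: derivative_eq_intros Cn_const)
  qed (auto intro: continuous_intros)
qed

lemma smooth_norm2: "smooth (\<lambda>x. x \<bullet> x)"
proof
  fix n
  have "Cn n (\<lambda>x::'a. \<Sum>b\<in>Basis. (x \<bullet> b) * (x \<bullet> b))"
    using smooth_inner by (intro Cn_sum Cn_mult) auto
  then show "Cn n (\<lambda>x::'a. x \<bullet> x)" by (simp add: euclidean_inner[of x x for x])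
qed

lemma smooth_compose_real:
  fixes h :: "real \<Rightarrow> real"
  assumes "smooth h" "smooth w"
  shows "smooth (\<lambda>x. h (w x))"
proof
  fix n
  show "Cn n (\<lambda>x. h (w x))"
    using assms(1)
  proof (induction n arbitrary: h)
    case 0
    then show ?case using smooth_continuous[OF 0] smooth_continuous[OF assms(2)]
      by (auto intro: continuous_on_compose2)
  next
    case (Suc n)
    show ?case
    proof (rule Cn_SucI)
      fix x
      show "((\<lambda>x. h (w x)) has_derivative (\<lambda>d. frechet_derivative h (at (w x)) (frechet_derivative w (at x) d))) (at x)"
        using smooth_has_derivative[OF assms(2)] smooth_has_derivative[OF Suc.prems] by (rule has_derivative_compose)
    next
      fix b :: 'a assume b: "b \<in> Basis"
      have eq: "frechet_derivative h (at y) d = frechet_derivative h (at y) 1 * d" for y d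
        using linear_scale[OF has_derivative_linear[OF smooth_has_derivative[OF Suc.prems]], of y d 1]
        by (simp add: mult.commute)
      have "Cn n (\<lambda>x. frechet_derivative h (at (w x)) 1 * frechet_derivative w (at x) b)"
        using smooth_deriv[OF Suc.prems, of 1] smooth_deriv[OF assms(2) b] by (intro Cn_mult Suc.IH) auto
      then show "Cn n (\<lambda>x. frechet_derivative h (at (w x)) (frechet_derivative w (at x) b))"
        by (subst eq)
    qed
  qed
qed

text \<open>The powers t^j are included so that the family is closed under differentiation up to
  linear combinations. Smoothness of all members then follows by one induction on the order, with
  \<open>j\<close> arbitrary.\<close>

definition flat :: "nat \<Rightarrow> real \<Rightarrow> real" where
  "flat j t = (if t > 0 then exp (- 1 / t) / t ^ j else 0)"

lemma flat_DERIV: "(flat j has_real_derivative flat (j + 2) t - real j * flat (j + 1) t) (at t)"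
proof -
  consider "t > 0" | "t < 0" | "t = 0" by linarith
  then show ?thesis
  proof cases
    case 1
    have "((\<lambda>t. exp (- 1 / t) / t ^ j) has_real_derivative flat (j + 2) t - real j * flat (j + 1) t) (at t)"
    proof (rule DERIV_cong)
      show "((\<lambda>t. exp (- 1 / t) / t ^ j) has_real_derivative
          (exp (- 1 / t) * (1 / t\<^sup>2) * t ^ j - exp (- 1 / t) * (real j * t ^ (j - 1))) / (t ^ j * t ^ j)) (at t)"
        using 1 by (auto intro!: derivative_eq_intros simp: power2_eq_square)
      have "real j * t ^ (j - 1) = real j * t ^ j / t" using 1 by (cases j) auto
      then show "(exp (- 1 / t) * (1 / t\<^sup>2) * t ^ j - exp (- 1 / t) * (real j * t ^ (j - 1))) / (t ^ j * t ^ j)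
          = flat (j + 2) t - real j * flat (j + 1) t"
        using 1 by (auto simp add: flat_def field_simps power2_eq_square)
    qed
    then show ?thesis
      by (rule has_field_derivative_transform_within_open[of _ _ _ "{0<..}"]) (use 1 in \<open>auto simp: flat_def\<close>)
  next
    case 2
    have "((\<lambda>t. 0) has_real_derivative flat (j + 2) t - real j * flat (j + 1) t) (at t)"
      using 2 by (simp add: flat_def)
    then show ?thesis
      by (rule has_field_derivative_transform_within_open[of _ _ _ "{..<0}"]) (use 2 in \<open>auto simp: flat_def\<close>)
  next
    case 3
    have lim: "((\<lambda>t. flat (j + 1) t) \<longlongrightarrow> 0) (at 0)"
    proof -
      have "((\<lambda>y::real. y ^ (j + 1) / exp y) \<longlongrightarrow> 0) at_top" by (rule tendsto_power_div_exp_0)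
      then have "((\<lambda>t::real. inverse t ^ (j + 1) / exp (inverse t)) \<longlongrightarrow> 0) (at_right 0)"
        by (rule filterlim_compose[OF _ filterlim_inverse_at_top_right])
      moreover have "eventually (\<lambda>t. inverse t ^ (j + 1) / exp (inverse t) = flat (j + 1) t) (at_right 0)"
        by (intro eventually_at_rightI[of 0 1]) (auto simp: flat_def exp_minus field_simps)
      ultimately have r: "(flat (j + 1) \<longlongrightarrow> 0) (at_right 0)" by (rule Lim_transform_eventually)
      have "((\<lambda>t::real. 0::real) \<longlongrightarrow> 0) (at_left 0)" by simp
      moreover have "eventually (\<lambda>t. 0 = flat (j + 1) t) (at_left 0)"
        by (intro eventually_at_leftI[of "-1" 0]) (auto simp: flat_def)
      ultimately have "(flat (j + 1) \<longlongrightarrow> 0) (at_left 0)" by (rule Lim_transform_eventually)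
      with r show ?thesis by (simp add: filterlim_split_at)
    qed
    \<comment> \<open>At 0 the difference quotient of \<open>flat j\<close> is
      \<open>flat (j + 1)\<close> itself.\<close>
    have "eventually (\<lambda>s. flat (j + 1) s = (flat j s - flat j 0) / (s - 0)) (at 0)"
      unfolding eventually_at by (intro exI[of _ 1]) (simp add: flat_def)
    with lim have "((\<lambda>s. (flat j s - flat j 0) / (s - 0)) \<longlongrightarrow> 0) (at 0)" by (rule Lim_transform_eventually)
    then have "(flat j has_real_derivative 0) (at 0)" by (simp only: has_field_derivative_iff)
    moreover have "flat (j + 2) t - real j * flat (j + 1) t = 0" using 3 by (simp add: flat_def)
    ultimately show ?thesis using 3 by (simp only:)
  qed
qed

lemma smooth_flat: "smooth (flat j)"
proof
  fix n show "Cn n (flat j)"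
  proof (induction n arbitrary: j)
    case 0
    show ?case unfolding Cn.simps
      by (rule DERIV_continuous_on[OF has_field_derivative_at_within[OF flat_DERIV]])
  next
    case (Suc n)
    show ?case
    proof (rule Cn_SucI)
      fix x show "(flat j has_derivative (\<lambda>h. (flat (j + 2) x - real j * flat (j + 1) x) * h)) (at x)"
        by (rule flat_DERIV[unfolded has_field_derivative_def])
    next
      fix b :: real
      have "Cn n (\<lambda>x. (flat (j + 2) x + (- real j) * flat (j + 1) x) * b)"
        by (intro Cn_mult Cn_add Cn_const Suc.IH)
      then show "Cn n (\<lambda>x. (flat (j + 2) x - real j * flat (j + 1) x) * b)" by simp
    qed
  qed
qed

lemma smooth_bump_exists:
  assumes "\<delta> > 0"
  obtains \<theta> :: "'a::euclidean_space \<Rightarrow> real" where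
    "smooth \<theta>" "\<And>x. \<theta> x \<ge> 0" "\<And>x. norm x > \<delta> \<Longrightarrow> \<theta> x = 0" "(LINT x|lborel. \<theta> x) = 1"
proof -
  define w where "w = (\<lambda>x::'a. 1 + (- 1 / \<delta>\<^sup>2) * (x \<bullet> x))"
  have w: "smooth w" unfolding w_def
    by (intro allI Cn_add Cn_mult Cn_const smooth_norm2[rule_format])
  define \<eta> where "\<eta> = (\<lambda>x. flat 0 (w x))"
  have s: "smooth \<eta>" unfolding \<eta>_def by (rule smooth_compose_real[OF smooth_flat w])
  have wpos: "w x > 0 \<longleftrightarrow> norm x < \<delta>" for x
  proof -
    have "w x = 1 - (norm x)\<^sup>2 / \<delta>\<^sup>2" by (simp add: w_def dot_square_norm)
    then have "w x > 0 \<longleftrightarrow> (norm x)\<^sup>2 < \<delta>\<^sup>2" using assms by (simp add: pos_divide_less_eq)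
    also have "\<dots> \<longleftrightarrow> norm x < \<delta>" 
    proof
      show "(norm x)\<^sup>2 < \<delta>\<^sup>2 \<Longrightarrow> norm x < \<delta>" by (rule power2_less_imp_less[OF _ less_imp_le[OF assms]])
      show "norm x < \<delta> \<Longrightarrow> (norm x)\<^sup>2 < \<delta>\<^sup>2" by (rule power_strict_mono) auto
    qed
    finally show ?thesis .
  qed
  have nn: "\<eta> x \<ge> 0" for x by (simp add: \<eta>_def flat_def)
  have pos: "\<eta> x > 0" if "norm x < \<delta>" for x using that wpos by (simp add: \<eta>_def flat_def)
  have z: "\<eta> x = 0" if "\<not> norm x < \<delta>" for x using that wpos by (simp add: \<eta>_def flat_def)
  have int: "integrable lborel \<eta>"
    by (rule integrable_compact_support[OF smooth_continuous[OF s], of "cball 0 \<delta>"]) (auto intro: z)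
  have "(LINT x|lborel. \<eta> x) \<noteq> 0"
  proof
    assume "(LINT x|lborel. \<eta> x) = 0"
    then have "AE x in lborel. \<eta> x = 0" using integral_nonneg_eq_0_iff_AE[OF int] nn by simp
    then have "AE x in lborel. x \<notin> ball (0::'a) \<delta>"
    proof (rule AE_mp, intro AE_I2 impI notI)
      fix x assume "\<eta> x = 0" "x \<in> ball (0::'a) \<delta>"
      then show False using pos[of x] by simp
    qed
    moreover have "{x. norm x < \<delta>} = ball (0::'a) \<delta>" by auto
    ultimately have "emeasure lborel (ball (0::'a) \<delta>) = 0"
      using AE_iff_measurable[of "ball (0::'a) \<delta>" lborel "\<lambda>x. x \<notin> ball (0::'a) \<delta>"] by simp
    then have "measure lborel (ball (0::'a) \<delta>) = 0" by (simp add: measure_def)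
    then show False using content_ball_pos[OF assms, of "0::'a"] by simp
  qed
  moreover have "(LINT x|lborel. \<eta> x) \<ge> 0" by (rule Bochner_Integration.integral_nonneg) (rule nn)
  ultimately have I: "(LINT x|lborel. \<eta> x) > 0" by linarith
  show ?thesis
  proof (rule that[of "\<lambda>x. (1 / (LINT x|lborel. \<eta> x)) * \<eta> x"])
    show "smooth (\<lambda>x. (1 / (LINT x|lborel. \<eta> x)) * \<eta> x)" by (intro allI Cn_mult Cn_const s[rule_format])
  qed (use I nn z in auto)
qed

section \<open>Mollification\<close>

definition convol :: "('a::euclidean_space \<Rightarrow> real) \<Rightarrow> ('a \<Rightarrow> real) \<Rightarrow> 'a \<Rightarrow> real" where
  "convol f k x = (LINT y|lborel. f y * k (x - y))"

lemma lborel_integral_eq_cbox: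
  fixes g :: "'a::euclidean_space \<Rightarrow> real"
  assumes "continuous_on UNIV g" "\<And>y. y \<notin> cbox a b \<Longrightarrow> g y = 0"
  shows "(LINT y|lborel. g y) = integral (cbox a b) g"
proof -
  have int: "integrable lborel g"
    using assms by (intro integrable_compact_support[of g "cbox a b"]) auto
  have eq: "indicator (cbox a b) y *\<^sub>R g y = g y" for y
    using assms(2)[of y] by (cases "y \<in> cbox a b") auto
  have "set_integrable lborel (cbox a b) g" unfolding set_integrable_def eq by (rule int)
  from set_borel_integral_eq_integral(2)[OF this] show ?thesis
    by (simp add: set_lebesgue_integral_def eq del: real_scaleR_def)
qed

lemma convol_integrand_continuous:
  fixes f k :: "'a::euclidean_space \<Rightarrow> real"
  assumes f: "continuous_on UNIV f" and k: "continuous_on UNIV k"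
  shows "continuous_on UNIV (\<lambda>y. f y * k (x - y))"
  by (intro continuous_intros f continuous_on_compose2[OF k]) auto

lemma convol_integrable:
  fixes f k :: "'a::euclidean_space \<Rightarrow> real"
  assumes f: "continuous_on UNIV f" and k: "continuous_on UNIV k"
    and r: "\<And>x. norm x > r \<Longrightarrow> k x = 0"
  shows "integrable lborel (\<lambda>y. f y * k (x - y))"
  by (rule integrable_compact_support[OF convol_integrand_continuous[OF f k], of "cball x r"])
    (auto simp: dist_norm intro: r)

text \<open>For all \<open>x\<close> near \<open>x0\<close> the domain of integration can be frozen
  to one box, so that the theorems on parameter integrals over boxes yield continuity and
  derivatives of \<open>convol\<close>.\<close>

lemma convol_near:
  fixes f k :: "'a::euclidean_space \<Rightarrow> real"
  assumes f: "continuous_on UNIV f" and k: "continuous_on UNIV k"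
    and r: "\<And>x. norm x > r \<Longrightarrow> k x = 0"
    and ab: "cball x0 (r + 1) \<subseteq> cbox a b" and x: "dist x0 x \<le> 1"
  shows "convol f k x = integral (cbox a b) (\<lambda>y. f y * k (x - y))"
  unfolding convol_def
proof (rule lborel_integral_eq_cbox[OF convol_integrand_continuous[OF f k]])
  fix y assume "y \<notin> cbox a b"
  then have "y \<notin> cball x0 (r + 1)" using ab by blast
  then have "norm (x - y) > r"
    using x norm_triangle_ineq[of "x0 - x" "x - y"] by (simp add: dist_norm)
  then show "f y * k (x - y) = 0" by (simp add: r)
qed

lemma integral_lborel_reflect:
  fixes f :: "'a::euclidean_space \<Rightarrow> real"
  assumes "f \<in> borel_measurable borel"
  shows "(LINT y|lborel. f (x - y)) = (LINT y|lborel. f y)"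
proof -
  have "(lborel :: 'a measure) = distr lborel borel (\<lambda>y. x - y)"
    using lborel_affine[of "-1" x] by (simp add: density_1)
  then have "(LINT y|lborel. f y) = (LINT y|distr lborel borel (\<lambda>y. x - y). f y)" by simp
  also have "\<dots> = (LINT y|lborel. f (x - y))" using assms by (simp add: integral_distr)
  finally show ?thesis by simp
qed

lemma cbox_superset_cball:
  obtains a b :: "'a::euclidean_space" where "cball x r \<subseteq> cbox a b"
  using bounded_cball bounded_subset_cbox_symmetric by blast

lemma convol_continuous:
  fixes f k :: "'a::euclidean_space \<Rightarrow> real"
  assumes f: "continuous_on UNIV f" and k: "continuous_on UNIV k"
    and r: "\<And>x. norm x > r \<Longrightarrow> k x = 0"
  shows "continuous_on UNIV (convol f k)"
proof -
  have "continuous (at x0) (convol f k)" for x0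
  proof -
    obtain a b where ab: "cball x0 (r + 1) \<subseteq> cbox a b" by (rule cbox_superset_cball)
    have "continuous_on (ball x0 1) (\<lambda>x. integral (cbox a b) (\<lambda>y. f y * k (x - y)))"
    proof (rule integral_continuous_on_param)
      show "continuous_on (ball x0 1 \<times> cbox a b) (\<lambda>(x, y). f y * k (x - y))"
        unfolding case_prod_unfold
        by (intro continuous_intros continuous_on_compose2[OF f] continuous_on_compose2[OF k]) auto
    qed
    moreover have "convol f k x = integral (cbox a b) (\<lambda>y. f y * k (x - y))" if "x \<in> ball x0 1" for x
      using convol_near[OF f k r ab] that by simp
    ultimately have "continuous_on (ball x0 1) (convol f k)"
      using continuous_on_cong[OF refl, of "ball x0 1" "convol f k"] by simp
    then show ?thesis by (simp add: continuous_on_eq_continuous_at)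
  qed
  then show ?thesis by (simp add: continuous_at_imp_continuous_on)
qed

lemma convol_pd:
  fixes f k :: "'a::euclidean_space \<Rightarrow> real"
  assumes f: "continuous_on UNIV f" and k: "continuous_on UNIV k"
    and r: "\<And>x. norm x > r \<Longrightarrow> k x = 0"
    and pd: "pd b k k'" and k': "continuous_on UNIV k'"
  shows "pd b (convol f k) (convol f k')"
\<comment> \<open>The case \<open>b = 0\<close> is separate because the parameter interval
  \<open>U\<close> below has radius \<open>1 / norm b\<close>, which would be 0.\<close>
proof (cases "b = 0")
  case True
  have "k' = (\<lambda>x. 0)"
  proof
    fix x
    have "((\<lambda>t::real. k x) has_real_derivative k' x) (at 0)" using pdD[OF pd, of x] by (simp add: True)
    from DERIV_unique[OF this DERIV_const] show "k' x = 0" by simp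
  qed
  then show ?thesis by (simp add: True pd_def convol_def)
next
  case False
  have r': "k' x = 0" if "norm x > r" for x
    using pd_zero_outside[OF pd, of "cball 0 r" x] r that by auto
  show ?thesis unfolding pd_def
  proof
    fix x0 :: 'a
    obtain a b' where ab: "cball x0 (r + 1) \<subseteq> cbox a b'" by (rule cbox_superset_cball)
    define U where "U = {- 1 / norm b <..< 1 / norm b}"
    have U: "0 \<in> U" "open U" "convex U" using False by (auto simp: U_def)
    have near: "dist x0 (x0 + t *\<^sub>R b) \<le> 1" if "t \<in> U" for t
    proof -
      have "\<bar>t\<bar> * norm b \<le> 1" using that False by (auto simp: U_def abs_le_iff field_simps)
      then show ?thesis by (simp add: dist_norm)
    qed
    have "((\<lambda>t. integral (cbox a b') (\<lambda>y. f y * k (x0 + t *\<^sub>R b - y))) has_field_derivative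
        integral (cbox a b') (\<lambda>y. f y * k' (x0 + 0 *\<^sub>R b - y))) (at 0 within U)"
    proof (rule leibniz_rule_field_derivative[where fx="\<lambda>t y. f y * k' (x0 + t *\<^sub>R b - y)"])
      fix t y
      have "((\<lambda>t. k ((x0 - y) + t *\<^sub>R b)) has_real_derivative k' ((x0 - y) + t *\<^sub>R b)) (at t within U)"
        using pd_line[OF pd] has_field_derivative_at_within by blast
      then have "((\<lambda>t. k (x0 + t *\<^sub>R b - y)) has_real_derivative k' (x0 + t *\<^sub>R b - y)) (at t within U)"
        by (simp add: algebra_simps)
      then show "((\<lambda>t. f y * k (x0 + t *\<^sub>R b - y)) has_real_derivative f y * k' (x0 + t *\<^sub>R b - y)) (at t within U)"
        by (rule DERIV_cmult)
    next
      fix t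
      show "(\<lambda>y. f y * k (x0 + t *\<^sub>R b - y)) integrable_on cbox a b'"
        using convol_integrand_continuous[OF f k] by (intro integrable_continuous) (auto intro: continuous_on_subset)
    next
      show "continuous_on (U \<times> cbox a b') (\<lambda>(t, y). f y * k' (x0 + t *\<^sub>R b - y))"
        unfolding case_prod_unfold
        by (rule continuous_on_mult[OF continuous_on_compose2[OF f] continuous_on_compose2[OF k']])
          (auto intro!: continuous_on_fst continuous_on_snd continuous_on_id continuous_on_diff continuous_on_add continuous_on_const continuous_on_scaleR)
    next
      show "0 \<in> U" "convex U" by (rule U)+
    qed
    moreover have "(at 0 within U) = (at (0::real))" by (rule at_within_open[OF U(1,2)])
    moreover have "integral (cbox a b') (\<lambda>y. f y * k' (x0 + 0 *\<^sub>R b - y)) = convol f k' (x0 + 0 *\<^sub>R b)"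
      by (rule convol_near[OF f k' r' ab near[OF U(1)], symmetric])
    ultimately have "((\<lambda>t. integral (cbox a b') (\<lambda>y. f y * k (x0 + t *\<^sub>R b - y))) has_field_derivative
        convol f k' (x0 + 0 *\<^sub>R b)) (at 0)"
      by (simp only:)
    then have "((\<lambda>t. integral (cbox a b') (\<lambda>y. f y * k (x0 + t *\<^sub>R b - y))) has_field_derivative
        convol f k' x0) (at 0)" by simp
    then show "((\<lambda>t. convol f k (x0 + t *\<^sub>R b)) has_field_derivative convol f k' x0) (at 0)"
      using U(2,1) by (rule has_field_derivative_transform_within_open)
        (simp add: convol_near[OF f k r ab near])
  qed
qed

text \<open>The radius \<open>d\<close> depends on \<open>f\<close>, \<open>K\<close> and
  \<open>e\<close> but not on the kernel. This leaves the kernel free to be made much narrower in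
  some directions afterwards.\<close>

lemma convol_approx:
  fixes f :: "'a::euclidean_space \<Rightarrow> real"
  assumes f: "continuous_on UNIV f" and K: "compact K" and e: "e > 0"
  obtains d where "d > 0"
    "\<And>k x. \<lbrakk>continuous_on UNIV k; \<And>x. k x \<ge> 0; (LINT x|lborel. k x) = 1; \<And>x. norm x > d \<Longrightarrow> k x = 0; x \<in> K\<rbrakk>
      \<Longrightarrow> \<bar>convol f k x - f x\<bar> \<le> e"
proof -
  define K1 where "K1 = (\<lambda>p. fst p + snd p) ` (K \<times> cball (0::'a) 1)"
  have "compact K1" unfolding K1_def
    by (intro compact_continuous_image compact_Times K compact_cball) (auto intro!: continuous_intros)
  then have "uniformly_continuous_on K1 f"
    using f by (intro compact_uniformly_continuous) (auto intro: continuous_on_subset)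
  then obtain d0 where d0: "d0 > 0" "\<And>x y. x \<in> K1 \<Longrightarrow> y \<in> K1 \<Longrightarrow> dist y x < d0 \<Longrightarrow> dist (f y) (f x) < e"
    unfolding uniformly_continuous_on_def using e by metis
  define d where "d = min (d0 / 2) 1"
  have d: "d > 0" "d < d0" "d \<le> 1" using d0 by (auto simp: d_def)
  show ?thesis
  proof (rule that[OF d(1)])
    fix k :: "'a \<Rightarrow> real" and x
    assume k: "continuous_on UNIV k" "\<And>x. k x \<ge> 0" "(LINT x|lborel. k x) = 1" "\<And>x. norm x > d \<Longrightarrow> k x = 0" and x: "x \<in> K"
    have k1: "(LINT y|lborel. k (x - y)) = 1"
      using integral_lborel_reflect[OF borel_measurable_continuous_onI[OF k(1)], of x] k(3) by simp
    have i1: "integrable lborel (\<lambda>y. f y * k (x - y))" by (rule convol_integrable[OF f k(1) k(4)])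
    have i2: "integrable lborel (\<lambda>y. c * k (x - y))" for c
      by (rule convol_integrable[OF continuous_on_const k(1) k(4)])
    have "convol f k x - f x = (LINT y|lborel. f y * k (x - y)) - (LINT y|lborel. f x * k (x - y))"
      using k1 by (simp add: convol_def)
    also have "\<dots> = (LINT y|lborel. (f y - f x) * k (x - y))"
      using i1 i2[of "f x"] by (simp add: left_diff_distrib)
    finally have eq: "convol f k x - f x = (LINT y|lborel. (f y - f x) * k (x - y))" .
    have "\<bar>LINT y|lborel. (f y - f x) * k (x - y)\<bar> \<le> (LINT y|lborel. e * k (x - y))"
    proof (rule order_trans[OF integral_abs_bound integral_mono])
      show "integrable lborel (\<lambda>y. \<bar>(f y - f x) * k (x - y)\<bar>)"
        using i1 i2[of "f x"] by (intro integrable_abs) (simp add: left_diff_distrib)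
      show "integrable lborel (\<lambda>y. e * k (x - y))" by (rule i2)
      fix y
      show "\<bar>(f y - f x) * k (x - y)\<bar> \<le> e * k (x - y)"
      proof (cases "norm (x - y) > d")
        case False
        have "x + 0 \<in> K1" unfolding K1_def by (intro image_eqI[of _ _ "(x, 0)"]) (use x in auto)
        moreover have "y \<in> K1" unfolding K1_def
          by (intro image_eqI[of _ _ "(x, y - x)"]) (use x False d in \<open>auto simp: norm_minus_commute\<close>)
        ultimately have "dist (f y) (f x) < e" using d0(2) False d by (auto simp: dist_norm norm_minus_commute)
        then show ?thesis using k(2)[of "x - y"] by (auto simp: abs_mult dist_real_def intro: mult_right_mono)
      qed (simp add: k)
    qed
    also have "\<dots> = e" using k1 by simp
    finally show "\<bar>convol f k x - f x\<bar> \<le> e" using eq by simp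
  qed
qed

section \<open>Approximation of solutions by smooth functions\<close>

abbreviation ez :: "'m \<Rightarrow> (real^'m::finite) \<times> (real^'k::finite)" where "ez i \<equiv> (axis i 1, 0)"
abbreviation es :: "'k \<Rightarrow> (real^'m::finite) \<times> (real^'k::finite)" where "es j \<equiv> (0, axis j 1)"

lemma ez_Basis: "ez i \<in> Basis"
  by (auto simp: Basis_prod_def axis_in_Basis_iff)

lemma es_Basis: "es j \<in> Basis"
  by (auto simp: Basis_prod_def axis_in_Basis_iff)

definition gweight :: "real \<Rightarrow> (real^'m::finite) \<times> (real^'k::finite) \<Rightarrow> real" where
  "gweight \<alpha> x = norm (fst x) powr \<alpha> / 2"

lemma continuous_norm_powr:
  fixes a :: real
  assumes "a > 0"
  shows "continuous_on S (\<lambda>z::'a::real_normed_vector. norm z powr a)"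
  using assms by (intro continuous_on_powr' continuous_intros) auto

lemma continuous_gweight: "\<alpha> > 0 \<Longrightarrow> continuous_on S (gweight \<alpha>)"
  unfolding gweight_def
  by (intro continuous_intros continuous_on_compose2[OF continuous_norm_powr[of \<alpha> UNIV]]) auto

text \<open>The derivatives are carried as explicit functions of the direction, since they enter the
  identities below as data. The symmetry of \<open>F2\<close> is what allows the dilation field to
  be commuted with partial derivatives.\<close>

definition C2 :: "('a::euclidean_space \<Rightarrow> real) \<Rightarrow> ('a \<Rightarrow> 'a \<Rightarrow> real) \<Rightarrow> ('a \<Rightarrow> 'a \<Rightarrow> 'a \<Rightarrow> real) \<Rightarrow> bool" where
  "C2 F F1 F2 \<longleftrightarrow> continuous_on UNIV F \<and>
     (\<forall>b\<in>Basis. pd b F (F1 b) \<and> continuous_on UNIV (F1 b)) \<and>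
     (\<forall>b\<in>Basis. \<forall>c\<in>Basis. pd c (F1 b) (F2 b c) \<and> continuous_on UNIV (F2 b c) \<and> F2 b c = F2 c b)"

lemma smooth_zero_outside_deriv:
  assumes "smooth k" "\<And>x. norm x > r \<Longrightarrow> k x = 0" "norm x > r"
  shows "frechet_derivative k (at x) b = 0"
  using pd_zero_outside[OF smooth_pd[OF assms(1)], of "cball 0 r" x b] assms by auto

lemma convol_C2:
  fixes f k :: "'a::euclidean_space \<Rightarrow> real"
  assumes f: "continuous_on UNIV f" and k: "smooth k" and r: "\<And>x. norm x > r \<Longrightarrow> k x = 0"
  shows "C2 (convol f k) (\<lambda>b. convol f (\<lambda>x. frechet_derivative k (at x) b))
    (\<lambda>b c. convol f (\<lambda>x. frechet_derivative (\<lambda>x. frechet_derivative k (at x) b) (at x) c))"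
proof -
  let ?k1 = "\<lambda>b x. frechet_derivative k (at x) b"
  let ?k2 = "\<lambda>b c x. frechet_derivative (?k1 b) (at x) c"
  have k1: "smooth (?k1 b)" if "b \<in> Basis" for b using smooth_deriv[OF k that] .
  have k2: "smooth (?k2 b c)" if "b \<in> Basis" "c \<in> Basis" for b c using smooth_deriv[OF k1 that(2)] that by blast
  have r1: "?k1 b x = 0" if "norm x > r" for b x by (rule smooth_zero_outside_deriv[OF k r that])
  have r2: "?k2 b c x = 0" if "norm x > r" "b \<in> Basis" for b c x
    by (rule smooth_zero_outside_deriv[OF k1 r1]) (use that in auto)
  have sym: "?k2 b c = ?k2 c b" if "b \<in> Basis" "c \<in> Basis" for b c
    by (rule ext, rule pd_symmetric[where F=k and Fb="?k1 b" and Fc="?k1 c" and b=b and c=c])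
      (intro smooth_pd smooth_continuous k k1 k2 that)+
  show ?thesis unfolding C2_def
  proof (intro conjI ballI)
    show "continuous_on UNIV (convol f k)" by (rule convol_continuous[OF f smooth_continuous[OF k] r])
    fix b :: 'a assume b: "b \<in> Basis"
    show "pd b (convol f k) (convol f (?k1 b))"
      by (rule convol_pd[OF f smooth_continuous[OF k] r smooth_pd[OF k] smooth_continuous[OF k1[OF b]]])
    show "continuous_on UNIV (convol f (?k1 b))"
      by (rule convol_continuous[OF f smooth_continuous[OF k1[OF b]] r1])
    fix c :: 'a assume c: "c \<in> Basis"
    show "pd c (convol f (?k1 b)) (convol f (?k2 b c))"
      by (rule convol_pd[OF f smooth_continuous[OF k1[OF b]] r1 smooth_pd[OF k1[OF b]] smooth_continuous[OF k2[OF b c]]])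
    show "continuous_on UNIV (convol f (?k2 b c))"
      by (rule convol_continuous[OF f smooth_continuous[OF k2[OF b c]] r2[OF _ b]])
    show "convol f (?k2 b c) = convol f (?k2 c b)" using sym[OF b c] by (simp only:)
  qed
qed

lemma frechet_derivative_reflect:
  assumes "smooth k"
  shows "frechet_derivative (\<lambda>y. k (x - y)) (at y) b = - frechet_derivative k (at (x - y)) b"
proof -
  have "((\<lambda>y. x - y) has_derivative (\<lambda>h. - h)) (at y)" by (auto intro!: derivative_eq_intros)
  then have "((\<lambda>y. k (x - y)) has_derivative (\<lambda>h. frechet_derivative k (at (x - y)) (- h))) (at y)"
    by (rule has_derivative_compose) (rule smooth_has_derivative[OF assms])
  from frechet_derivative_at[OF this] have "frechet_derivative (\<lambda>y. k (x - y)) (at y) b = frechet_derivative k (at (x - y)) (- b)"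
    by metis
  also have "\<dots> = - frechet_derivative k (at (x - y)) b"
    by (rule linear_neg[OF has_derivative_linear[OF smooth_has_derivative[OF assms]]])
  finally show ?thesis .
qed

lemma test_function_reflect:
  assumes "smooth k" "\<And>x. norm x > r \<Longrightarrow> k x = 0" "cball x r \<subseteq> \<Omega>"
  shows "test_function \<Omega> (\<lambda>y. k (x - y))"
  unfolding test_function_def
proof (intro conjI exI[of _ "cball x r"])
  have "smooth (\<lambda>y. k (- y + x))" by (rule smooth_comp_affine[OF assms(1)]) (simp add: linear_iff)
  then show "smooth (\<lambda>y. k (x - y))" by simp
qed (use assms in \<open>auto simp: dist_norm\<close>)

lemma set_integral_eq_convol:
  assumes "\<And>x. norm x > r \<Longrightarrow> k x = 0" "cball x r \<subseteq> \<Omega>" "\<And>y. y \<in> cball x r \<Longrightarrow> h0 y = h y"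
  shows "(LINT y:\<Omega>|lborel. h y * k (x - y)) = convol h0 k x"
  unfolding set_lebesgue_integral_def convol_def
proof (rule Bochner_Integration.integral_cong[OF refl])
  fix y
  show "indicator \<Omega> y *\<^sub>R (h y * k (x - y)) = h0 y * k (x - y)"
  proof (cases "y \<in> cball x r")
    case True then show ?thesis using assms(2,3) by (auto simp: indicator_def)
  next
    case False
    then have "k (x - y) = 0" using assms(1) by (simp add: dist_norm)
    then show ?thesis by simp
  qed
qed

text \<open>The weak derivative is tested with y \<mapsto> k(x - y); the sign produced by the
  reflection cancels the sign of the integration by parts. For the \<sigma>-fields the coefficient
  stays inside the convolution, and this is the source of all commutators. The functions
  \<open>g0\<close>, \<open>h0\<close> are global extensions, for which only agreement on the ball
  matters.\<close>

lemma has_X_convol: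
  fixes g h g0 h0 k :: "(real^'m::finite) \<times> (real^'k::finite) \<Rightarrow> real"
  assumes X: "has_X \<alpha> \<Omega> j g h" and k: "smooth k" and r: "\<And>x. norm x > r \<Longrightarrow> k x = 0" and x: "cball x r \<subseteq> \<Omega>"
    and h0: "\<And>y. y \<in> cball x r \<Longrightarrow> h0 y = h y" and g0: "\<And>y. y \<in> cball x r \<Longrightarrow> g0 y = g y"
  shows "j = Inl i \<Longrightarrow> convol h0 k x = convol g0 (\<lambda>y. frechet_derivative k (at y) (ez i)) x"
    and "j = Inr l \<Longrightarrow> convol h0 k x = convol (\<lambda>y. g0 y * gweight \<alpha> y) (\<lambda>y. frechet_derivative k (at y) (es l)) x"
proof -
  let ?\<phi> = "\<lambda>y. k (x - y)"
  have "convol h0 k x = (LINT y:\<Omega>|lborel. h y * ?\<phi> y)"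
    by (rule set_integral_eq_convol[OF r x h0, symmetric])
  also have "\<dots> = - (LINT y:\<Omega>|lborel. g y * X_classical \<alpha> j ?\<phi> y)"
    using X test_function_reflect[OF k r x] unfolding has_X_def by blast
  finally have eq: "convol h0 k x = - (LINT y:\<Omega>|lborel. g y * X_classical \<alpha> j ?\<phi> y)" .
  have d0: "norm x > r \<Longrightarrow> frechet_derivative k (at x) b = 0" for x b
    by (rule smooth_zero_outside_deriv[OF k r])
  { assume j: "j = Inl i"
    have "convol h0 k x = (LINT y:\<Omega>|lborel. g y * frechet_derivative k (at (x - y)) (ez i))"
      unfolding eq j by (simp add: frechet_derivative_reflect[OF k] set_lebesgue_integral_def)
    also have "\<dots> = convol g0 (\<lambda>y. frechet_derivative k (at y) (ez i)) x"
      by (rule set_integral_eq_convol[OF d0 x g0])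
    finally show "convol h0 k x = convol g0 (\<lambda>y. frechet_derivative k (at y) (ez i)) x" . }
  { assume j: "j = Inr l"
    have "convol h0 k x = (LINT y:\<Omega>|lborel. (g y * gweight \<alpha> y) * frechet_derivative k (at (x - y)) (es l))"
      unfolding eq j by (simp add: frechet_derivative_reflect[OF k] set_lebesgue_integral_def gweight_def mult.assoc)
    also have "\<dots> = convol (\<lambda>y. g0 y * gweight \<alpha> y) (\<lambda>y. frechet_derivative k (at y) (es l)) x"
      by (rule set_integral_eq_convol[OF d0 x]) (assumption, simp only: g0)
    finally show "convol h0 k x = convol (\<lambda>y. g0 y * gweight \<alpha> y) (\<lambda>y. frechet_derivative k (at y) (es l)) x" . }
qed

lemma pd_fst_0: "pd (0, c) (\<lambda>x. f (fst x)) (\<lambda>x. 0)"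
  by (simp add: pd_def)

lemma pd_snd_0: "pd (c, 0) (\<lambda>x. f (snd x)) (\<lambda>x. 0)"
  by (simp add: pd_def)

lemma pd_snd: "pd c f f' \<Longrightarrow> pd (0, c) (\<lambda>x. f (snd x)) (\<lambda>x. f' (snd x))"
  by (simp add: pd_def)

lemma pd_fst: "pd c f f' \<Longrightarrow> pd (c, 0) (\<lambda>x. f (fst x)) (\<lambda>x. f' (fst x))"
  by (simp add: pd_def)

lemma integral_tensor:
  fixes \<theta> :: "'a::euclidean_space \<Rightarrow> real" and \<phi> :: "'b::euclidean_space \<Rightarrow> real"
  assumes "continuous_on UNIV \<theta>" "continuous_on UNIV \<phi>"
    and "\<And>x. norm x > r \<Longrightarrow> \<theta> x = 0" "\<And>x. norm x > s \<Longrightarrow> \<phi> x = 0"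
  shows "(LINT x|lborel. \<theta> (fst x) * \<phi> (snd x)) = (LINT x|lborel. \<theta> x) * (LINT x|lborel. \<phi> x)"
proof -
  have "integrable lborel (\<lambda>x::'a \<times> 'b. \<theta> (fst x) * \<phi> (snd x))"
  proof (rule integrable_compact_support[of _ "cball 0 r \<times> cball 0 s"])
    show "continuous_on UNIV (\<lambda>x::'a \<times> 'b. \<theta> (fst x) * \<phi> (snd x))"
      by (rule continuous_on_mult[OF continuous_on_compose2[OF assms(1)] continuous_on_compose2[OF assms(2)]])
        (auto intro!: continuous_on_fst continuous_on_snd continuous_on_id)
    show "compact (cball (0::'a) r \<times> cball (0::'b) s)" by (intro compact_Times compact_cball)
    show "\<theta> (fst x) * \<phi> (snd x) = 0" if "x \<notin> cball 0 r \<times> cball 0 s" for x :: "'a \<times> 'b"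
      using that assms(3)[of "fst x"] assms(4)[of "snd x"] by (cases x) auto
  qed
  then have "integrable (lborel \<Otimes>\<^sub>M lborel) (\<lambda>x::'a \<times> 'b. \<theta> (fst x) * \<phi> (snd x))"
    by (simp add: lborel_prod)
  from lborel_pair.integral_fst'[OF this] show ?thesis by (simp add: lborel_prod)
qed

lemma convol_bound:
  fixes g k :: "'a::euclidean_space \<Rightarrow> real"
  assumes g: "continuous_on UNIV g" and k: "continuous_on UNIV k" and r: "\<And>x. norm x > r \<Longrightarrow> k x = 0"
    and M: "\<And>y. k (x - y) \<noteq> 0 \<Longrightarrow> \<bar>g y\<bar> \<le> M" and c: "(LINT y|lborel. \<bar>k y\<bar>) \<le> c" and "M \<ge> 0"
  shows "\<bar>convol g k x\<bar> \<le> M * c"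
proof -
  have ka: "continuous_on UNIV (\<lambda>y. \<bar>k y\<bar>)" by (intro continuous_on_rabs k)
  have ra: "\<And>x. norm x > r \<Longrightarrow> \<bar>k x\<bar> = 0" using r by simp
  have "\<bar>convol g k x\<bar> \<le> (LINT y|lborel. M * \<bar>k (x - y)\<bar>)"
    unfolding convol_def
  proof (rule order_trans[OF integral_abs_bound integral_mono])
    show "integrable lborel (\<lambda>y. \<bar>g y * k (x - y)\<bar>)"
      by (rule integrable_abs[OF convol_integrable[OF g k r]])
    show "integrable lborel (\<lambda>y. M * \<bar>k (x - y)\<bar>)"
      by (rule convol_integrable[OF continuous_on_const ka ra])
    show "\<bar>g y * k (x - y)\<bar> \<le> M * \<bar>k (x - y)\<bar>" for y
      using M[of y] by (cases "k (x - y) = 0") (auto simp: abs_mult mult_right_mono)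
  qed
  also have "\<dots> = M * (LINT y|lborel. \<bar>k y\<bar>)"
    using integral_lborel_reflect[OF borel_measurable_continuous_onI[OF ka], of x] by simp
  also have "\<dots> \<le> M * c" using c \<open>M \<ge> 0\<close> by (rule mult_left_mono)
  finally show ?thesis .
qed

text \<open>The kernel is a product \<theta>(z) \<phi>(\<sigma>), and \<sigma>-derivatives fall on
  \<phi> alone while \<theta> has integral 1. Hence \<open>c1\<close> and \<open>c2\<close> depend
  on the \<sigma>-width \<open>\<epsilon>\<close> only and are available before the z-width
  \<open>\<delta>\<close> is chosen.\<close>

lemma tensor_bump_exists:
  fixes TYPE_dummy :: "(real^'m::finite) \<times> (real^'k::finite)"
  assumes "\<epsilon> > 0"
  obtains c1 c2 where "c1 \<ge> 0" "c2 \<ge> 0" and "\<And>\<delta>. \<delta> > 0 \<Longrightarrow> \<exists>k :: (real^'m) \<times> (real^'k) \<Rightarrow> real.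
      smooth k \<and> (\<forall>x. k x \<ge> 0) \<and> (LINT x|lborel. k x) = 1 \<and> (\<forall>x. norm (fst x) > \<delta> \<longrightarrow> k x = 0) \<and>
      (\<forall>x. norm (snd x) > \<epsilon> \<longrightarrow> k x = 0) \<and>
      (\<forall>j. (LINT y|lborel. \<bar>frechet_derivative k (at y) (es j)\<bar>) \<le> c1) \<and>
      (\<forall>j. (LINT y|lborel. \<bar>frechet_derivative (\<lambda>x. frechet_derivative k (at x) (es j)) (at y) (es j)\<bar>) \<le> c2)"
proof -
  obtain \<phi> :: "real^'k \<Rightarrow> real" where \<phi>: "smooth \<phi>" "\<And>x. \<phi> x \<ge> 0" "\<And>x. norm x > \<epsilon> \<Longrightarrow> \<phi> x = 0" "(LINT x|lborel. \<phi> x) = 1"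
    using smooth_bump_exists[OF assms] by blast
  define \<phi>1 where "\<phi>1 = (\<lambda>j::'k. \<lambda>y. frechet_derivative \<phi> (at y) (axis j 1))"
  have s1: "smooth (\<phi>1 j)" for j unfolding \<phi>1_def by (rule smooth_deriv[OF \<phi>(1)]) (simp add: axis_in_Basis_iff)
  have z1: "\<phi>1 j x = 0" if "norm x > \<epsilon>" for j x unfolding \<phi>1_def by (rule smooth_zero_outside_deriv[OF \<phi>(1) \<phi>(3) that])
  define \<phi>2 where "\<phi>2 = (\<lambda>j::'k. \<lambda>y. frechet_derivative (\<phi>1 j) (at y) (axis j 1))"
  have s2: "smooth (\<phi>2 j)" for j unfolding \<phi>2_def by (rule smooth_deriv[OF s1]) (simp add: axis_in_Basis_iff)
  have z2: "\<phi>2 j x = 0" if "norm x > \<epsilon>" for j x unfolding \<phi>2_def by (rule smooth_zero_outside_deriv[OF s1 z1 that])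
  define c1 where "c1 = (\<Sum>j\<in>UNIV. LINT y|lborel. \<bar>\<phi>1 j y\<bar>)"
  define c2 where "c2 = (\<Sum>j\<in>UNIV. LINT y|lborel. \<bar>\<phi>2 j y\<bar>)"
  have c1: "(LINT y|lborel. \<bar>\<phi>1 j y\<bar>) \<le> c1" for j unfolding c1_def by (rule member_le_sum) auto
  have c2: "(LINT y|lborel. \<bar>\<phi>2 j y\<bar>) \<le> c2" for j unfolding c2_def by (rule member_le_sum) auto
  show ?thesis
  proof (rule that[of c1 c2])
    show "c1 \<ge> 0" "c2 \<ge> 0" unfolding c1_def c2_def by (auto intro!: sum_nonneg)
    fix \<delta> :: real assume \<delta>: "\<delta> > 0"
    obtain \<theta> :: "real^'m \<Rightarrow> real" where \<theta>: "smooth \<theta>" "\<And>x. \<theta> x \<ge> 0" "\<And>x. norm x > \<delta> \<Longrightarrow> \<theta> x = 0" "(LINT x|lborel. \<theta> x) = 1"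
      using smooth_bump_exists[OF \<delta>] by blast
    have tens: "smooth (\<lambda>x::(real^'m) \<times> (real^'k). \<theta> (fst x) * \<psi> (snd x))" if "smooth \<psi>" for \<psi>
    proof
      fix n
      have "smooth (\<lambda>x::(real^'m) \<times> (real^'k). \<theta> (fst x + 0))" by (rule smooth_comp_affine[OF \<theta>(1)]) (simp add: linear_fst)
      moreover have "smooth (\<lambda>x::(real^'m) \<times> (real^'k). \<psi> (snd x + 0))" by (rule smooth_comp_affine[OF that]) (simp add: linear_snd)
      ultimately show "Cn n (\<lambda>x::(real^'m) \<times> (real^'k). \<theta> (fst x) * \<psi> (snd x))" by (simp add: Cn_mult)
    qed
    have dtens: "frechet_derivative (\<lambda>x::(real^'m) \<times> (real^'k). \<theta> (fst x) * \<psi> (snd x)) (at x) (es j)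
       = \<theta> (fst x) * frechet_derivative \<psi> (at (snd x)) (axis j 1)" if "smooth \<psi>" for \<psi> x and j :: 'k
    proof -
      have "pd (es j) (\<lambda>x::(real^'m) \<times> (real^'k). \<theta> (fst x) * \<psi> (snd x))
        (\<lambda>x. 0 * \<psi> (snd x) + \<theta> (fst x) * frechet_derivative \<psi> (at (snd x)) (axis j 1))"
        by (intro pd_mult pd_fst_0 pd_snd smooth_pd that)
      from fun_cong[OF pd_unique[OF smooth_pd[OF tens[OF that]] this]] show ?thesis by simp
    qed
    define k where "k = (\<lambda>x::(real^'m) \<times> (real^'k). \<theta> (fst x) * \<phi> (snd x))"
    have k1: "(\<lambda>x. frechet_derivative k (at x) (es j)) = (\<lambda>x. \<theta> (fst x) * \<phi>1 j (snd x))" for j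
      unfolding k_def by (simp add: dtens \<phi>(1) \<phi>1_def)
    have k2: "(\<lambda>y. frechet_derivative (\<lambda>x. frechet_derivative k (at x) (es j)) (at y) (es j)) = (\<lambda>x. \<theta> (fst x) * \<phi>2 j (snd x))" for j
      unfolding k1 by (simp add: dtens s1 \<phi>2_def)
    have abs: "(LINT x|lborel. \<bar>\<theta> (fst x) * \<psi> (snd x)\<bar>) = (LINT x|lborel. \<bar>\<psi> x\<bar>)"
      if "smooth \<psi>" "\<And>x. norm x > \<epsilon> \<Longrightarrow> \<psi> x = 0" for \<psi> :: "real^'k \<Rightarrow> real"
    proof -
      have "(LINT x|lborel. \<bar>\<theta> (fst x) * \<psi> (snd x)\<bar>) = (LINT x|lborel. \<theta> (fst x) * \<bar>\<psi> (snd x)\<bar>)"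
        by (simp add: abs_mult \<theta>(2))
      also have "\<dots> = (LINT x|lborel. \<theta> x) * (LINT x|lborel. \<bar>\<psi> x\<bar>)"
        by (rule integral_tensor[OF smooth_continuous[OF \<theta>(1)] continuous_on_rabs[OF smooth_continuous[OF that(1)]], of \<delta> \<epsilon>])
          (auto simp: \<theta>(3) that(2))
      finally show ?thesis by (simp add: \<theta>(4))
    qed
    have "smooth k" unfolding k_def by (rule tens[OF \<phi>(1)])
    moreover have "\<forall>x. k x \<ge> 0" by (simp add: k_def \<theta>(2) \<phi>(2))
    moreover have "(LINT x|lborel. k x) = 1" unfolding k_def
      by (subst integral_tensor[OF smooth_continuous[OF \<theta>(1)] smooth_continuous[OF \<phi>(1)] \<theta>(3) \<phi>(3)]) (simp_all add: \<theta>(4) \<phi>(4))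
    moreover have "\<forall>x. norm (fst x) > \<delta> \<longrightarrow> k x = 0" by (simp add: k_def \<theta>(3))
    moreover have "\<forall>x. norm (snd x) > \<epsilon> \<longrightarrow> k x = 0" by (simp add: k_def \<phi>(3))
    moreover have "\<forall>j. (LINT y|lborel. \<bar>frechet_derivative k (at y) (es j)\<bar>) \<le> c1"
      using c1 by (simp add: fun_cong[OF k1] abs[OF s1 z1])
    moreover have "\<forall>j. (LINT y|lborel. \<bar>frechet_derivative (\<lambda>x. frechet_derivative k (at x) (es j)) (at y) (es j)\<bar>) \<le> c2"
      using c2 by (simp add: fun_cong[OF k2] abs[OF s2 z2])
    ultimately show "\<exists>k :: (real^'m) \<times> (real^'k) \<Rightarrow> real.
      smooth k \<and> (\<forall>x. k x \<ge> 0) \<and> (LINT x|lborel. k x) = 1 \<and> (\<forall>x. norm (fst x) > \<delta> \<longrightarrow> k x = 0) \<and>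
      (\<forall>x. norm (snd x) > \<epsilon> \<longrightarrow> k x = 0) \<and>
      (\<forall>j. (LINT y|lborel. \<bar>frechet_derivative k (at y) (es j)\<bar>) \<le> c1) \<and>
      (\<forall>j. (LINT y|lborel. \<bar>frechet_derivative (\<lambda>x. frechet_derivative k (at x) (es j)) (at y) (es j)\<bar>) \<le> c2)"
      by blast
  qed
qed

lemma sum_UNIV_Plus:
  fixes h :: "'a::finite + 'b::finite \<Rightarrow> real"
  shows "(\<Sum>j\<in>UNIV. h j) = (\<Sum>i\<in>UNIV. h (Inl i)) + (\<Sum>j\<in>UNIV. h (Inr j))"
  unfolding UNIV_Plus_UNIV[symmetric] by (subst sum.Plus) (auto simp: comp_def)

lemma X_deriv_props:
  assumes "f \<in> Gamma1 \<alpha> \<Omega>"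
  shows "continuous_on \<Omega> (X_deriv \<alpha> \<Omega> j f)" "has_X \<alpha> \<Omega> j f (X_deriv \<alpha> \<Omega> j f)"
proof -
  have "\<exists>g. continuous_on \<Omega> g \<and> has_X \<alpha> \<Omega> j f g" using assms by (auto simp: Gamma1_def)
  from someI_ex[OF this] show "continuous_on \<Omega> (X_deriv \<alpha> \<Omega> j f)" "has_X \<alpha> \<Omega> j f (X_deriv \<alpha> \<Omega> j f)"
    by (auto simp: X_deriv_def)
qed

lemma convol_add:
  fixes f g k :: "'a::euclidean_space \<Rightarrow> real"
  assumes "continuous_on UNIV f" "continuous_on UNIV g" "continuous_on UNIV k" "\<And>x. norm x > r \<Longrightarrow> k x = 0"
  shows "convol (\<lambda>y. f y + g y) k x = convol f k x + convol g k x"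
  unfolding convol_def
  by (simp add: ring_distribs Bochner_Integration.integral_add[OF convol_integrable[OF assms(1,3,4)] convol_integrable[OF assms(2,3,4)]])

lemma convol_sum:
  fixes k :: "'a::euclidean_space \<Rightarrow> real"
  assumes "\<And>i. i \<in> I \<Longrightarrow> continuous_on UNIV (f i)" "continuous_on UNIV k" "\<And>x. norm x > r \<Longrightarrow> k x = 0"
  shows "convol (\<lambda>y. \<Sum>i\<in>I. f i y) k x = (\<Sum>i\<in>I. convol (f i) k x)"
  unfolding convol_def sum_distrib_right
  by (rule Bochner_Integration.integral_sum) (rule convol_integrable[OF assms(1) assms(2,3)])

lemma convol_cmult: "convol (\<lambda>y. c * f y) k x = c * convol f k x"
  unfolding convol_def by (simp add: mult.assoc)

text \<open>Mollifying the equation leaves as defect a sum of commutators of the mollifier with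
  |z|^\<alpha>. Each is at most a constant times the oscillation \<omega> of the coefficient over
  the z-width of the kernel, and the \<sigma>-derivatives of the mollified function are bounded by a
  constant as well. Both constants depend only on the \<sigma>-width, so choosing the z-width last
  makes the product in the final conclusion small.\<close>

lemma Gamma2_approx:
  fixes f :: "(real^'m::finite) \<times> (real^'k::finite) \<Rightarrow> real"
  assumes \<Omega>: "open \<Omega>" and \<alpha>: "\<alpha> > 0" and f: "f \<in> Gamma2 \<alpha> \<Omega>"
    and eq: "\<And>x. x \<in> \<Omega> \<Longrightarrow> baouendi_grushin \<alpha> \<Omega> f x = - \<kappa>\<^sup>2 * f x"
    and K: "compact K" "K \<subseteq> \<Omega>" and e: "e > 0"
  obtains F F1 F2 where "C2 F F1 F2"
    "\<And>x. x \<in> K \<Longrightarrow> \<bar>F x - f x\<bar> \<le> e"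
    "\<And>x i. x \<in> K \<Longrightarrow> \<bar>F1 (ez i) x - X_deriv \<alpha> \<Omega> (Inl i) f x\<bar> \<le> e"
    "\<And>x j. x \<in> K \<Longrightarrow> \<bar>gweight \<alpha> x * F1 (es j) x - X_deriv \<alpha> \<Omega> (Inr j) f x\<bar> \<le> e"
    "\<And>x. x \<in> K \<Longrightarrow> \<bar>(\<Sum>i\<in>UNIV. F2 (ez i) (ez i) x) + (gweight \<alpha> x)\<^sup>2 * (\<Sum>j\<in>UNIV. F2 (es j) (es j) x) + \<kappa>\<^sup>2 * F x\<bar>
        * (1 + (\<Sum>j\<in>UNIV. \<bar>F1 (es j) x\<bar>)) \<le> e"
proof -
  define U where "U = (\<lambda>j. X_deriv \<alpha> \<Omega> j f)"
  define W where "W = (\<lambda>j. X_deriv \<alpha> \<Omega> j (U j))"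
  have f1: "f \<in> Gamma1 \<alpha> \<Omega>" and U1: "U j \<in> Gamma1 \<alpha> \<Omega>" for j
    using f by (auto simp: Gamma2_def U_def)
  have cf: "continuous_on \<Omega> f" using f1 by (simp add: Gamma1_def)
  have cU: "continuous_on \<Omega> (U j)" and XU: "has_X \<alpha> \<Omega> j f (U j)" for j
    using X_deriv_props[OF f1] by (auto simp: U_def)
  have cW: "continuous_on \<Omega> (W j)" and XW: "has_X \<alpha> \<Omega> j (U j) (W j)" for j
    using X_deriv_props[OF U1] by (auto simp: W_def)
  have eqW: "(\<Sum>j\<in>UNIV. W j x) = - \<kappa>\<^sup>2 * f x" if "x \<in> \<Omega>" for x
    using eq[OF that] by (simp add: baouendi_grushin_def W_def U_def)

  obtain r0 where r0: "r0 > 0" "(\<Union>x\<in>K. ball x r0) \<subseteq> \<Omega>"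
    using compact_subset_open_imp_ball_epsilon_subset[OF K(1) \<Omega> K(2)] by blast
  define r where "r = r0 / 2"
  have r: "r > 0" using r0 by (simp add: r_def)
  define K1 where "K1 = (\<lambda>p. fst p + snd p) ` (K \<times> cball (0::(real^'m) \<times> (real^'k)) r)"
  have K1: "compact K1" unfolding K1_def
    by (intro compact_continuous_image compact_Times K compact_cball) (auto intro!: continuous_intros)
  have ball_K1: "cball x r \<subseteq> K1" if "x \<in> K" for x
  proof
    fix y assume "y \<in> cball x r"
    then show "y \<in> K1" unfolding K1_def
      by (intro image_eqI[of _ _ "(x, y - x)"]) (use that in \<open>auto simp: dist_norm norm_minus_commute\<close>)
  qed
  have K1\<Omega>: "K1 \<subseteq> \<Omega>"
  proof
    fix y assume "y \<in> K1"
    then obtain x v where xv: "x \<in> K" "norm v \<le> r" "y = x + v" by (auto simp: K1_def)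
    then have "y \<in> ball x r0" using r0 by (simp add: dist_norm r_def)
    then show "y \<in> \<Omega>" using r0 xv(1) by blast
  qed
  have KK1: "x \<in> K1" if "x \<in> K" for x using ball_K1[OF that] r by (auto intro: subsetD)
  \<comment> \<open>Tietze extensions from \<open>K1\<close>, the closed neighbourhood of
    \<open>K\<close> of radius \<open>r\<close>, so that mollification is defined on the whole
    space; on \<open>K\<close> it sees only values in \<open>K1\<close>.\<close>
  have ext: "\<exists>g0. continuous_on UNIV g0 \<and> (\<forall>x\<in>K1. g0 x = g x)" if "continuous_on \<Omega> g" for g :: "(real^'m) \<times> (real^'k) \<Rightarrow> real"
    by (rule Tietze_unbounded[of K1 g UNIV])
      (use that K1 K1\<Omega> in \<open>auto intro: continuous_on_subset compact_imp_closed\<close>)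
  obtain f0 where f0: "continuous_on UNIV f0" "\<And>x. x \<in> K1 \<Longrightarrow> f0 x = f x" using ext[OF cf] by blast
  obtain U0 where U0: "\<And>j. continuous_on UNIV (U0 j)" "\<And>j x. x \<in> K1 \<Longrightarrow> U0 j x = U j x"
    using ext[OF cU] by metis
  obtain W0 where W0: "\<And>j. continuous_on UNIV (W0 j)" "\<And>j x. x \<in> K1 \<Longrightarrow> W0 j x = W j x"
    using ext[OF cW] by metis

  let ?\<mu> = "gweight \<alpha> :: (real^'m) \<times> (real^'k) \<Rightarrow> real"
  have c\<mu>: "continuous_on S ?\<mu>" for S by (rule continuous_gweight[OF \<alpha>])
  have \<mu>0: "?\<mu> x \<ge> 0" for x by (simp add: gweight_def)
  obtain M where M: "M \<ge> 0" "\<And>y. y \<in> K1 \<Longrightarrow> \<bar>f0 y\<bar> \<le> M" "\<And>y j. y \<in> K1 \<Longrightarrow> \<bar>U0 j y\<bar> \<le> M" "\<And>y. y \<in> K1 \<Longrightarrow> ?\<mu> y \<le> M"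
  proof -
    define s where "s = (\<lambda>y. \<bar>f0 y\<bar> + (\<Sum>j\<in>UNIV. \<bar>U0 j y\<bar>) + ?\<mu> y)"
    have "continuous_on K1 s" unfolding s_def
      by (intro continuous_on_add continuous_on_sum continuous_on_rabs c\<mu> continuous_on_subset[OF f0(1)] continuous_on_subset[OF U0(1)]) auto
    then have "bounded (s ` K1)" using K1 compact_continuous_image compact_imp_bounded by blast
    then obtain M where M: "\<forall>y\<in>s ` K1. norm y \<le> M" unfolding bounded_iff by auto
    have *: "s y \<le> max M 0" if "y \<in> K1" for y using M that by fastforce
    have sU: "\<bar>U0 j y\<bar> \<le> (\<Sum>j\<in>UNIV. \<bar>U0 j y\<bar>)" for j y by (rule member_le_sum) auto
    have sU0: "(\<Sum>j\<in>UNIV. \<bar>U0 j y\<bar>) \<ge> 0" for y by (rule sum_nonneg) auto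
    show ?thesis
    proof (rule that[of "max M 0"])
      fix y j assume y: "y \<in> K1"
      show "\<bar>f0 y\<bar> \<le> max M 0" "\<bar>U0 j y\<bar> \<le> max M 0" "?\<mu> y \<le> max M 0"
        using *[OF y] sU[of j y] sU0[of y] \<mu>0[of y] unfolding s_def by linarith+
    qed simp
  qed

  define e2 where "e2 = e / 2"
  have e2: "e2 > 0" using e by (simp add: e2_def)
  obtain d1 where d1: "d1 > 0" "\<And>k x. \<lbrakk>continuous_on UNIV k; \<And>x. k x \<ge> 0; (LINT x|lborel. k x) = 1; \<And>x. norm x > d1 \<Longrightarrow> k x = 0; x \<in> K\<rbrakk>
      \<Longrightarrow> \<bar>convol f0 k x - f0 x\<bar> \<le> e2"
    using convol_approx[OF f0(1) K(1) e2] by blast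
  have "\<exists>d>0. \<forall>k x. continuous_on UNIV k \<longrightarrow> (\<forall>x. k x \<ge> 0) \<longrightarrow> (LINT x|lborel. k x) = 1 \<longrightarrow> (\<forall>x. norm x > d \<longrightarrow> k x = 0) \<longrightarrow> x \<in> K
      \<longrightarrow> \<bar>convol (U0 j) k x - U0 j x\<bar> \<le> e2" for j
    using convol_approx[OF U0(1) K(1) e2, of j] by metis
  then obtain d2 where d2: "\<And>j. d2 j > 0" "\<And>j k x. \<lbrakk>continuous_on UNIV k; \<And>x. k x \<ge> 0; (LINT x|lborel. k x) = 1; \<And>x. norm x > d2 j \<Longrightarrow> k x = 0; x \<in> K\<rbrakk>
      \<Longrightarrow> \<bar>convol (U0 j) k x - U0 j x\<bar> \<le> e2"
    by metis
  define d where "d = Min (insert r (insert d1 (range d2)))"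
  have fin: "finite (insert r (insert d1 (range d2)))" by simp
  have "d \<in> insert r (insert d1 (range d2))" unfolding d_def by (rule Min_in[OF fin]) simp
  then have dpos: "d > 0" using r d1(1) d2(1) by blast
  have dle: "d \<le> r" "d \<le> d1" "d \<le> d2 j" for j unfolding d_def by (rule Min_le[OF fin], simp)+
  define \<epsilon> where "\<epsilon> = d / 2"
  have \<epsilon>: "\<epsilon> > 0" using dpos by (simp add: \<epsilon>_def)
  obtain c1 c2 where c: "c1 \<ge> 0" "c2 \<ge> 0" and kern: "\<And>\<delta>. \<delta> > 0 \<Longrightarrow> \<exists>k :: (real^'m) \<times> (real^'k) \<Rightarrow> real.
      smooth k \<and> (\<forall>x. k x \<ge> 0) \<and> (LINT x|lborel. k x) = 1 \<and> (\<forall>x. norm (fst x) > \<delta> \<longrightarrow> k x = 0) \<and>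
      (\<forall>x. norm (snd x) > \<epsilon> \<longrightarrow> k x = 0) \<and>
      (\<forall>j. (LINT y|lborel. \<bar>frechet_derivative k (at y) (es j)\<bar>) \<le> c1) \<and>
      (\<forall>j. (LINT y|lborel. \<bar>frechet_derivative (\<lambda>x. frechet_derivative k (at x) (es j)) (at y) (es j)\<bar>) \<le> c2)"
    by (rule tensor_bump_exists[OF \<epsilon>, where ?'m='m and ?'k='k]) (rule that; assumption)

  define n where "n = real CARD('k)"
  \<comment> \<open>The first two factors bound the defect divided by \<omega>: one commutator with
    a first \<sigma>-derivative of the kernel and one, multiplied by the coefficient, with a second.
    The last factor bounds one plus the sum of the \<sigma>-derivatives of \<open>F\<close>.\<close>
  define B where "B = n * (M * c1 + M * (M * c2)) * (1 + n * (M * c1))"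
  have n0: "n \<ge> 0" by (simp add: n_def)
  have B0: "B \<ge> 0" unfolding B_def using n0 M(1) c by (intro mult_nonneg_nonneg add_nonneg_nonneg) auto
  define \<omega> where "\<omega> = e2 / (1 + M * c1 + B)"
  have Dpos: "1 + M * c1 + B > 0" using B0 M(1) c by (auto intro!: add_pos_nonneg)
  have \<omega>: "\<omega> > 0" using e2 Dpos by (simp add: \<omega>_def)
  have \<omega>B: "\<omega> * (M * c1) \<le> e2" "\<omega> * B \<le> e2"
  proof -
    have "\<omega> * (1 + M * c1 + B) = e2" using Dpos by (simp add: \<omega>_def)
    then have "\<omega> + \<omega> * (M * c1) + \<omega> * B = e2" by (simp add: algebra_simps)
    moreover have "\<omega> * (M * c1) \<ge> 0" "\<omega> * B \<ge> 0" using \<omega> M(1) c B0 by auto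
    ultimately show "\<omega> * (M * c1) \<le> e2" "\<omega> * B \<le> e2" using \<omega> by linarith+
  qed
  obtain \<delta> where \<delta>: "\<delta> > 0" "\<delta> \<le> \<epsilon>" "\<And>x y. x \<in> K1 \<Longrightarrow> y \<in> K1 \<Longrightarrow> norm (fst x - fst y) \<le> \<delta> \<Longrightarrow> \<bar>?\<mu> x - ?\<mu> y\<bar> \<le> \<omega>"
  proof -
    have "compact (fst ` K1)" by (intro compact_continuous_image K1 continuous_on_fst continuous_on_id)
    moreover have "continuous_on (fst ` K1) (\<lambda>z. norm z powr \<alpha> / 2)" by (intro continuous_intros continuous_norm_powr \<alpha>) auto
    ultimately have "uniformly_continuous_on (fst ` K1) (\<lambda>z. norm z powr \<alpha> / 2)" by (intro compact_uniformly_continuous)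
    then obtain d' where d': "d' > 0" "\<And>z z'. z \<in> fst ` K1 \<Longrightarrow> z' \<in> fst ` K1 \<Longrightarrow> dist z' z < d' \<Longrightarrow>
        dist (norm z' powr \<alpha> / 2) (norm z powr \<alpha> / 2) < \<omega>"
      unfolding uniformly_continuous_on_def using \<omega> by metis
    show ?thesis
    proof (rule that[of "min \<epsilon> (d' / 2)"])
      fix x y assume "x \<in> K1" "y \<in> K1" "norm (fst x - fst y) \<le> min \<epsilon> (d' / 2)"
      then have "dist (norm (fst x) powr \<alpha> / 2) (norm (fst y) powr \<alpha> / 2) < \<omega>"
        using d'(1) by (intro d'(2)) (auto simp: dist_norm)
      then show "\<bar>?\<mu> x - ?\<mu> y\<bar> \<le> \<omega>" by (simp add: gweight_def dist_real_def)
    qed (use \<epsilon> d' in auto)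
  qed
  obtain k :: "(real^'m) \<times> (real^'k) \<Rightarrow> real" where k: "smooth k" "\<And>x. k x \<ge> 0" "(LINT x|lborel. k x) = 1"
      "\<And>x. norm (fst x) > \<delta> \<Longrightarrow> k x = 0" "\<And>x. norm (snd x) > \<epsilon> \<Longrightarrow> k x = 0"
      "\<And>j. (LINT y|lborel. \<bar>frechet_derivative k (at y) (es j)\<bar>) \<le> c1"
      "\<And>j. (LINT y|lborel. \<bar>frechet_derivative (\<lambda>x. frechet_derivative k (at x) (es j)) (at y) (es j)\<bar>) \<le> c2"
    using kern[OF \<delta>(1)] by blast
  have kd: "k x = 0" if "norm x > d" for x
  proof -
    have "norm x \<le> norm (fst x) + norm (snd x)" using norm_Pair_le[of "fst x" "snd x"] by simp
    then have "norm (fst x) > \<delta> \<or> norm (snd x) > \<epsilon>" using that \<delta>(2) unfolding \<epsilon>_def by linarith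
    then show ?thesis using k(4,5) by blast
  qed
  have kr: "k x = 0" if "norm x > r" for x using kd dle(1) that by auto
  let ?k1 = "\<lambda>b x. frechet_derivative k (at x) b"
  let ?k2 = "\<lambda>b c x. frechet_derivative (?k1 b) (at x) c"
  have sk1: "smooth (?k1 b)" if "b \<in> Basis" for b using smooth_deriv[OF k(1) that] .
  have ck: "continuous_on UNIV k" by (rule smooth_continuous[OF k(1)])
  have ck1: "continuous_on UNIV (?k1 b)" if "b \<in> Basis" for b by (rule smooth_continuous[OF sk1[OF that]])
  have ck2: "continuous_on UNIV (?k2 b c)" if "b \<in> Basis" "c \<in> Basis" for b c by (rule smooth_continuous[OF smooth_deriv[OF sk1[OF that(1)] that(2)]])
  have k1r: "?k1 b x = 0" if "norm x > r" for b x by (rule smooth_zero_outside_deriv[OF k(1) kr that])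
  have k2r: "?k2 b c x = 0" if "norm x > r" "b \<in> Basis" for b c x
    by (rule smooth_zero_outside_deriv[OF sk1[OF that(2)] k1r that(1)])
  have fst0: "k x = 0" if "x \<notin> {x. norm (fst x) \<le> \<delta>}" for x using k(4)[of x] that by auto
  have clo: "closed {x::(real^'m) \<times> (real^'k). norm (fst x) \<le> \<delta>}" by (intro closed_Collect_le continuous_intros)
  have k1f: "?k1 b x = 0" if "x \<notin> {x. norm (fst x) \<le> \<delta>}" for b x
    by (rule pd_zero_outside[OF smooth_pd[OF k(1)] clo fst0 that])
  have k2f: "?k2 b c x = 0" if "x \<notin> {x. norm (fst x) \<le> \<delta>}" "b \<in> Basis" for b c x
    by (rule pd_zero_outside[OF smooth_pd[OF sk1[OF that(2)]] clo k1f that(1)])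

  define F where "F = convol f0 k"
  define F1 where "F1 = (\<lambda>b. convol f0 (?k1 b))"
  define F2 where "F2 = (\<lambda>b c. convol f0 (?k2 b c))"
  have C2: "C2 F F1 F2" unfolding F_def F1_def F2_def by (rule convol_C2[OF f0(1) k(1) kr])
  have b\<Omega>: "cball x r \<subseteq> \<Omega>" if "x \<in> K" for x using ball_K1[OF that] K1\<Omega> by blast
  have inK1: "y \<in> K1" if "x \<in> K" "y \<in> cball x r" for x y using ball_K1 that by blast
  \<comment> \<open>The generic commutator estimate: where the kernel does not vanish the
    z-coordinates differ by at most \<open>\<delta>\<close>, so the coefficient varies by at most
    \<open>\<omega>\<close>.\<close>
  have \<mu>1: "\<bar>convol (\<lambda>y. g y * (?\<mu> y - ?\<mu> x)) k' x\<bar> \<le> M * \<omega> * c"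
    if g: "continuous_on UNIV g" "\<And>y. y \<in> K1 \<Longrightarrow> \<bar>g y\<bar> \<le> M" and k': "continuous_on UNIV k'" "\<And>x. norm x > r \<Longrightarrow> k' x = 0"
      "\<And>x. x \<notin> {x. norm (fst x) \<le> \<delta>} \<Longrightarrow> k' x = 0" "(LINT y|lborel. \<bar>k' y\<bar>) \<le> c" and x: "x \<in> K" for g k' c x
  proof (rule convol_bound[OF _ k'(1,2) _ k'(4)])
    show "continuous_on UNIV (\<lambda>y. g y * (?\<mu> y - ?\<mu> x))" by (intro continuous_intros g c\<mu>)
    show "M * \<omega> \<ge> 0" using M(1) \<omega> by simp
    fix y assume nz: "k' (x - y) \<noteq> 0"
    then have "norm (x - y) \<le> r" "norm (fst (x - y)) \<le> \<delta>" using k'(2,3)[of "x - y"] by force+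
    then have y: "y \<in> K1" "norm (fst y - fst x) \<le> \<delta>" using inK1[OF x] by (auto simp: dist_norm norm_minus_commute)
    then show "\<bar>g y * (?\<mu> y - ?\<mu> x)\<bar> \<le> M * \<omega>"
      using g(2)[OF y(1)] \<delta>(3)[OF y(1) KK1[OF x] y(2)] M(1) by (auto simp: abs_mult intro!: mult_mono)
  qed
  have split: "convol (\<lambda>y. g y * ?\<mu> y) k' x = ?\<mu> x * convol g k' x + convol (\<lambda>y. g y * (?\<mu> y - ?\<mu> x)) k' x"
    if g: "continuous_on UNIV g" and k': "continuous_on UNIV k'" "\<And>x. norm x > r \<Longrightarrow> k' x = 0" for g k' x
  proof -
    have "convol (\<lambda>y. ?\<mu> x * g y + g y * (?\<mu> y - ?\<mu> x)) k' x = ?\<mu> x * convol g k' x + convol (\<lambda>y. g y * (?\<mu> y - ?\<mu> x)) k' x"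
      by (subst convol_add[OF _ _ k']) (auto intro!: continuous_intros g c\<mu> simp: convol_cmult)
    moreover have "(\<lambda>y. ?\<mu> x * g y + g y * (?\<mu> y - ?\<mu> x)) = (\<lambda>y. g y * ?\<mu> y)" by (auto simp: algebra_simps)
    ultimately show ?thesis by simp
  qed
  have Mf: "\<bar>convol f0 (?k1 (es j)) x\<bar> \<le> M * c1" if "x \<in> K" for j x
  proof (rule convol_bound[OF f0(1) ck1[OF es_Basis] k1r _ k(6) M(1)])
    fix y assume "?k1 (es j) (x - y) \<noteq> 0"
    then have "norm (x - y) \<le> r" using k1r[of "x - y" "es j"] by force
    then show "\<bar>f0 y\<bar> \<le> M" using inK1[OF that] by (intro M(2)) (auto simp: dist_norm)
  qed auto
  show ?thesis
  proof (rule that[OF C2])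
    fix x assume x: "x \<in> K"
    show "\<bar>F x - f x\<bar> \<le> e"
      using d1(2)[OF ck k(2,3) _ x] kd dle(2) f0(2)[OF KK1[OF x]] e unfolding F_def e2_def by force
    have Uapp: "\<bar>convol (U0 j) k x - U j x\<bar> \<le> e2" for j
      using d2(2)[OF ck k(2,3) _ x, of j] kd dle(3)[of j] U0(2)[OF KK1[OF x], of j] by force
    have agf: "\<And>y. y \<in> cball x r \<Longrightarrow> f0 y = f y" and agU: "\<And>j y. y \<in> cball x r \<Longrightarrow> U0 j y = U j y" and agW: "\<And>j y. y \<in> cball x r \<Longrightarrow> W0 j y = W j y"
      using inK1[OF x] f0(2) U0(2) W0(2) by blast+
    have UL: "convol (U0 (Inl i)) k x = F1 (ez i) x" for i
      unfolding F1_def by (rule has_X_convol(1)[OF XU k(1) kr b\<Omega>[OF x] agU agf refl])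
    have UR: "convol (U0 (Inr j)) k x = convol (\<lambda>y. f0 y * ?\<mu> y) (?k1 (es j)) x" for j
      by (rule has_X_convol(2)[OF XU k(1) kr b\<Omega>[OF x] agU agf refl])
    have UR1: "convol (U0 (Inr j)) (?k1 (es j)) x = convol (\<lambda>y. f0 y * ?\<mu> y) (?k2 (es j) (es j)) x" for j
      by (rule has_X_convol(2)[OF XU sk1[OF es_Basis] k1r b\<Omega>[OF x] agU agf refl])
    have UL1: "convol (U0 (Inl i)) (?k1 (ez i)) x = F2 (ez i) (ez i) x" for i
      unfolding F2_def by (rule has_X_convol(1)[OF XU sk1[OF ez_Basis] k1r b\<Omega>[OF x] agU agf refl])
    have WL: "convol (W0 (Inl i)) k x = convol (U0 (Inl i)) (?k1 (ez i)) x" for i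
      by (rule has_X_convol(1)[OF XW k(1) kr b\<Omega>[OF x] agW agU refl])
    have WR: "convol (W0 (Inr j)) k x = convol (\<lambda>y. U0 (Inr j) y * ?\<mu> y) (?k1 (es j)) x" for j
      by (rule has_X_convol(2)[OF XW k(1) kr b\<Omega>[OF x] agW agU refl])
    show "\<bar>F1 (ez i) x - X_deriv \<alpha> \<Omega> (Inl i) f x\<bar> \<le> e" for i
      using Uapp[of "Inl i"] e unfolding UL e2_def by (simp add: U_def)
    \<comment> \<open>\<open>E1\<close> comes from taking the coefficient out of X_j f,
      \<open>E2\<close> and \<open>E3\<close> from taking it out twice of X_j X_j f.\<close>
    define E1 where "E1 = (\<lambda>j. convol (\<lambda>y. f0 y * (?\<mu> y - ?\<mu> x)) (?k1 (es j)) x)"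
    define E2 where "E2 = (\<lambda>j. convol (\<lambda>y. U0 (Inr j) y * (?\<mu> y - ?\<mu> x)) (?k1 (es j)) x)"
    define E3 where "E3 = (\<lambda>j. convol (\<lambda>y. f0 y * (?\<mu> y - ?\<mu> x)) (?k2 (es j) (es j)) x)"
    have E1: "\<bar>E1 j\<bar> \<le> M * \<omega> * c1" for j unfolding E1_def
      by (rule \<mu>1[OF f0(1) M(2) ck1[OF es_Basis] k1r k1f k(6) x])
    have E2: "\<bar>E2 j\<bar> \<le> M * \<omega> * c1" for j unfolding E2_def
      by (rule \<mu>1[OF U0(1) M(3) ck1[OF es_Basis] k1r k1f k(6) x])
    have E3: "\<bar>E3 j\<bar> \<le> M * \<omega> * c2" for j unfolding E3_def
      by (rule \<mu>1[OF f0(1) M(2) ck2[OF es_Basis es_Basis] k2r[OF _ es_Basis] k2f[OF _ es_Basis] k(7) x])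
    have R1: "convol (U0 (Inr j)) k x = ?\<mu> x * F1 (es j) x + E1 j" for j
      unfolding UR F1_def E1_def by (rule split[OF f0(1) ck1[OF es_Basis] k1r])
    show "\<bar>?\<mu> x * F1 (es j) x - X_deriv \<alpha> \<Omega> (Inr j) f x\<bar> \<le> e" for j
    proof -
      have "\<bar>E1 j\<bar> \<le> e2" using E1[of j] \<omega>B(1) by (simp add: algebra_simps)
      then show ?thesis using Uapp[of "Inr j"] unfolding R1 e2_def U_def by linarith
    qed
    have R2: "convol (W0 (Inr j)) k x = (?\<mu> x)\<^sup>2 * F2 (es j) (es j) x + (?\<mu> x * E3 j + E2 j)" for j
    proof -
      have "convol (W0 (Inr j)) k x = ?\<mu> x * convol (U0 (Inr j)) (?k1 (es j)) x + E2 j"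
        unfolding WR E2_def by (rule split[OF U0(1) ck1[OF es_Basis] k1r])
      also have "convol (U0 (Inr j)) (?k1 (es j)) x = ?\<mu> x * F2 (es j) (es j) x + E3 j"
        unfolding UR1 F2_def E3_def by (rule split[OF f0(1) ck2[OF es_Basis es_Basis] k2r[OF _ es_Basis]])
      finally show ?thesis by (simp add: algebra_simps power2_eq_square)
    qed
    \<comment> \<open>The mollified equation holds exactly as long as the coefficients stay inside;
      the defect arises only when they are pulled out.\<close>
    have "(\<Sum>j\<in>UNIV. convol (W0 j) k x) + \<kappa>\<^sup>2 * F x = convol (\<lambda>y. (\<Sum>j\<in>UNIV. W0 j y) + \<kappa>\<^sup>2 * f0 y) k x"
      unfolding F_def
      by (subst convol_add[OF _ _ ck kr], (auto intro!: continuous_on_sum continuous_on_mult continuous_on_const W0(1) f0(1))[2], assumption)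
        (simp add: convol_sum[OF W0(1) ck kr] convol_cmult)
    also have "\<dots> = 0" unfolding convol_def
    proof (rule Bochner_Integration.integral_eq_zero_AE, rule AE_I2)
      fix y
      show "((\<Sum>j\<in>UNIV. W0 j y) + \<kappa>\<^sup>2 * f0 y) * k (x - y) = 0"
      proof (cases "y \<in> cball x r")
        case True
        then have "(\<Sum>j\<in>UNIV. W0 j y) + \<kappa>\<^sup>2 * f0 y = 0"
          using eqW[of y] b\<Omega>[OF x] agf[of y] agW[of y] by auto
        then show ?thesis by simp
      next
        case False
        then show ?thesis using kr[of "x - y"] by (simp add: dist_norm)
      qed
    qed
    finally have sum0: "(\<Sum>i\<in>UNIV. F2 (ez i) (ez i) x) + (\<Sum>j\<in>UNIV. (?\<mu> x)\<^sup>2 * F2 (es j) (es j) x + (?\<mu> x * E3 j + E2 j)) + \<kappa>\<^sup>2 * F x = 0"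
      unfolding sum_UNIV_Plus WL UL1 R2 .
    define T where "T = (\<Sum>i\<in>UNIV. F2 (ez i) (ez i) x) + (?\<mu> x)\<^sup>2 * (\<Sum>j\<in>UNIV. F2 (es j) (es j) x) + \<kappa>\<^sup>2 * F x"
    have "T = - (\<Sum>j\<in>UNIV. ?\<mu> x * E3 j + E2 j)"
      using sum0 unfolding T_def by (simp add: sum.distrib sum_distrib_left algebra_simps)
    then have "\<bar>T\<bar> \<le> (\<Sum>j\<in>(UNIV::'k set). \<bar>?\<mu> x * E3 j + E2 j\<bar>)" by simp
    also have "\<dots> \<le> (\<Sum>j\<in>(UNIV::'k set). M * (M * \<omega> * c2) + M * \<omega> * c1)"
    proof (rule sum_mono)
      fix j :: 'k
      have "\<bar>?\<mu> x * E3 j + E2 j\<bar> \<le> ?\<mu> x * \<bar>E3 j\<bar> + \<bar>E2 j\<bar>" using \<mu>0[of x] by (metis abs_mult abs_of_nonneg abs_triangle_ineq)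
      also have "\<dots> \<le> M * (M * \<omega> * c2) + M * \<omega> * c1"
        using M(4)[OF KK1[OF x]] E3[of j] E2[of j] M(1) by (intro add_mono mult_mono) auto
      finally show "\<bar>?\<mu> x * E3 j + E2 j\<bar> \<le> M * (M * \<omega> * c2) + M * \<omega> * c1" .
    qed
    also have "\<dots> = \<omega> * (n * (M * c1 + M * (M * c2)))" by (simp add: n_def algebra_simps)
    finally have T: "\<bar>T\<bar> \<le> \<omega> * (n * (M * c1 + M * (M * c2)))" .
    have S: "(\<Sum>j\<in>(UNIV::'k set). \<bar>F1 (es j) x\<bar>) \<le> n * (M * c1)"
      using sum_mono[of "UNIV::'k set" "\<lambda>j. \<bar>F1 (es j) x\<bar>" "\<lambda>j. M * c1"] Mf[OF x] unfolding F1_def n_def by simp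
    have "\<bar>T\<bar> * (1 + (\<Sum>j\<in>(UNIV::'k set). \<bar>F1 (es j) x\<bar>)) \<le> \<omega> * (n * (M * c1 + M * (M * c2))) * (1 + n * (M * c1))"
      using T S by (intro mult_mono) (auto intro!: add_nonneg_nonneg sum_nonneg mult_nonneg_nonneg simp: n0 M(1) c \<omega> less_imp_le)
    also have "\<dots> = \<omega> * B" by (simp add: B_def)
    also have "\<dots> \<le> e" using \<omega>B(2) e unfolding e2_def by simp
    finally show "\<bar>(\<Sum>i\<in>UNIV. F2 (ez i) (ez i) x) + (?\<mu> x)\<^sup>2 * (\<Sum>j\<in>UNIV. F2 (es j) (es j) x) + \<kappa>\<^sup>2 * F x\<bar>
        * (1 + (\<Sum>j\<in>UNIV. \<bar>F1 (es j) x\<bar>)) \<le> e" unfolding T_def .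
  qed
qed

section \<open>Dilations and gauge cutoffs\<close>

lemma norm_sq_powr: "((norm z)\<^sup>2) powr c = norm z powr (2 * c)"
proof -
  have "(norm z)\<^sup>2 = norm z powr 2" by simp
  then show ?thesis by (simp only: powr_powr)
qed

lemma norm_powr_mult_sq: "z \<noteq> 0 \<Longrightarrow> norm z powr (a - 2) * (norm z)\<^sup>2 = norm z powr a"
  by (simp add: powr_diff)

lemma norm_powr_DERIV:
  fixes z v :: "'a::euclidean_space"
  assumes False: "z \<noteq> 0"
  shows "((\<lambda>t. norm (z + t *\<^sub>R v) powr a) has_real_derivative a * norm z powr (a - 2) * (z \<bullet> v)) (at 0)"
proof -
    let ?q = "\<lambda>t::real. z \<bullet> z + 2 * t * (z \<bullet> v) + t\<^sup>2 * (v \<bullet> v)"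
    have q: "norm (z + t *\<^sub>R v) powr a = ?q t powr (a / 2)" for t
    proof -
      have "?q t = (norm (z + t *\<^sub>R v))\<^sup>2"
        unfolding power2_norm_eq_inner by (simp add: inner_add inner_commute power2_eq_square algebra_simps)
      then show ?thesis by (simp add: norm_sq_powr)
    qed
    have pos: "?q 0 > 0" using False by simp
    have "((\<lambda>t. ?q t powr (a / 2)) has_real_derivative a / 2 * ?q 0 powr (a / 2 - 1) * (2 * (z \<bullet> v))) (at 0)"
      using pos False by (auto intro!: derivative_eq_intros)
    moreover have "?q 0 powr (a / 2 - 1) = norm z powr (a - 2)"
    proof -
      have "?q 0 = (norm z)\<^sup>2" by (simp add: dot_square_norm)
      then show ?thesis by (simp only: norm_sq_powr) (simp add: algebra_simps)
    qed
    ultimately show ?thesis unfolding q by (simp add: algebra_simps)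
qed

lemma pd_norm_powr:
  fixes v :: "'a::euclidean_space"
  assumes a: "a > 1"
  shows "pd v (\<lambda>z. norm z powr a) (\<lambda>z. a * norm z powr (a - 2) * (z \<bullet> v))"
  unfolding pd_def
proof
  fix z :: 'a
  show "((\<lambda>t. norm (z + t *\<^sub>R v) powr a) has_real_derivative a * norm z powr (a - 2) * (z \<bullet> v)) (at 0)"
  proof (cases "z = 0")
    case True
    have "((\<lambda>t. norm (t *\<^sub>R v) powr a / t) \<longlongrightarrow> 0) (at 0)"
    proof (rule Lim_null_comparison)
      show "eventually (\<lambda>t. norm (norm (t *\<^sub>R v) powr a / t) \<le> \<bar>t\<bar> powr (a - 1) * norm v powr a) (at 0)"
      proof (rule eventually_at_filter[THEN iffD2], rule always_eventually, intro allI impI)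
        fix t :: real assume "t \<noteq> 0"
        have "norm (norm (t *\<^sub>R v) powr a / t) = \<bar>t\<bar> powr a / \<bar>t\<bar> * norm v powr a"
          by (simp add: powr_mult)
        also have "\<bar>t\<bar> powr a / \<bar>t\<bar> = \<bar>t\<bar> powr (a - 1)" using \<open>t \<noteq> 0\<close> by (simp add: powr_diff)
        finally show "norm (norm (t *\<^sub>R v) powr a / t) \<le> \<bar>t\<bar> powr (a - 1) * norm v powr a" by simp
      qed
      have "((\<lambda>t::real. \<bar>t\<bar> powr (a - 1) * norm v powr a) \<longlongrightarrow> \<bar>0\<bar> powr (a - 1) * norm v powr a) (at 0)"
        using a by (intro tendsto_intros tendsto_powr') auto
      then show "((\<lambda>t::real. \<bar>t\<bar> powr (a - 1) * norm v powr a) \<longlongrightarrow> 0) (at 0)" by simp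
    qed
    then show ?thesis using True by (simp add: has_field_derivative_iff)
  qed (rule norm_powr_DERIV)
qed

text \<open>This is \<rho>^(2(\<alpha> + 1)). It is C^1 on the whole space, whereas the gauge is not
  differentiable at the origin, so cutoffs are first written as functions of
  \<open>tau\<close>.\<close>

definition tau :: "real \<Rightarrow> (real^'m::finite) \<times> (real^'k::finite) \<Rightarrow> real" where
  "tau \<alpha> x = norm (fst x) powr (2 * (\<alpha> + 1)) + 4 * (\<alpha> + 1)\<^sup>2 * (norm (snd x))\<^sup>2"

definition zpow :: "real \<Rightarrow> (real^'m::finite) \<times> (real^'k::finite) \<Rightarrow> real" where
  "zpow a x = norm (fst x) powr a"

lemma continuous_zpow: "a > 0 \<Longrightarrow> continuous_on S (zpow a)"
  unfolding zpow_def by (intro continuous_intros continuous_on_compose2[OF continuous_norm_powr[of a UNIV]]) auto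

lemma continuous_tau: "\<alpha> > 0 \<Longrightarrow> continuous_on S (tau \<alpha>)"
  unfolding tau_def
  by (intro continuous_intros continuous_on_compose2[OF continuous_norm_powr[of "2 * (\<alpha> + 1)" UNIV]]) auto

lemma tau_nonneg: "tau \<alpha> x \<ge> 0"
  by (simp add: tau_def)

lemma compact_tau_le:
  assumes "\<alpha> > 0"
  shows "compact {x::(real^'m::finite) \<times> (real^'k::finite). tau \<alpha> x \<le> T}"
proof -
  have "closed {x::(real^'m) \<times> (real^'k). tau \<alpha> x \<le> T}"
    by (intro closed_Collect_le continuous_tau assms continuous_on_const)
  moreover have "bounded {x::(real^'m) \<times> (real^'k). tau \<alpha> x \<le> T}"
  proof (rule boundedI)
    fix x :: "(real^'m) \<times> (real^'k)" assume "x \<in> {x. tau \<alpha> x \<le> T}"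
    then have T: "tau \<alpha> x \<le> T" by simp
    have 1: "norm (fst x) powr (2 * (\<alpha> + 1)) \<le> T"
      using T unfolding tau_def by (smt (verit) zero_le_mult_iff zero_le_power2)
    have 2: "(norm (snd x))\<^sup>2 \<le> T"
    proof -
      have "1 * (norm (snd x))\<^sup>2 \<le> 4 * (\<alpha> + 1)\<^sup>2 * (norm (snd x))\<^sup>2"
      proof (rule mult_right_mono)
        have "1 \<le> (\<alpha> + 1)\<^sup>2" using assms by (intro one_le_power) auto
        then show "1 \<le> 4 * (\<alpha> + 1)\<^sup>2" by linarith
      qed simp
      then show ?thesis using T unfolding tau_def by (smt (verit) powr_ge_zero)
    qed
    have "norm (fst x) \<le> 1 + T"
    proof (cases "norm (fst x) \<le> 1")
      case True then show ?thesis using 2 by (smt (verit) zero_le_power2)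
    next
      case False
      then have "norm (fst x) powr 1 \<le> norm (fst x) powr (2 * (\<alpha> + 1))" using assms by (intro powr_mono) auto
      then show ?thesis using 1 False by simp
    qed
    moreover have "norm (snd x) \<le> 1 + T"
    proof (cases "norm (snd x) \<le> 1")
      case True then show ?thesis using 2 by (smt (verit) zero_le_power2)
    next
      case False
      then have "norm (snd x) \<le> (norm (snd x))\<^sup>2" using self_le_power[of "norm (snd x)" 2] by auto
      then show ?thesis using 2 by simp
    qed
    ultimately show "norm x \<le> 2 * (1 + T)" using norm_Pair_le[of "fst x" "snd x"] by simp
  qed
  ultimately show ?thesis by (simp add: compact_eq_bounded_closed)
qed

lemma pd_fst_nth: "pd b (\<lambda>x. fst x $ i) (\<lambda>x. fst b $ i)"
  by (auto simp: pd_def intro!: derivative_eq_intros)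

lemma pd_snd_nth: "pd b (\<lambda>x. snd x $ i) (\<lambda>x. snd b $ i)"
  by (auto simp: pd_def intro!: derivative_eq_intros)

lemma pd_tau_z:
  assumes "\<alpha> > 0"
  shows "pd (ez i) (tau \<alpha>) (\<lambda>x. 2 * (\<alpha> + 1) * zpow (2 * \<alpha>) x * (fst x $ i))"
proof -
  have "pd (axis i 1, 0) (\<lambda>x::(real^'a) \<times> (real^'b). norm (fst x) powr (2 * (\<alpha> + 1)))
      (\<lambda>x. 2 * (\<alpha> + 1) * norm (fst x) powr (2 * (\<alpha> + 1) - 2) * (fst x \<bullet> axis i 1))"
    by (rule pd_fst[OF pd_norm_powr]) (use assms in auto)
  moreover have "pd (axis i 1, 0) (\<lambda>x::(real^'a) \<times> (real^'b). 4 * (\<alpha> + 1)\<^sup>2 * (norm (snd x))\<^sup>2) (\<lambda>x. 0)"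
    by (rule pd_snd_0)
  ultimately have "pd (axis i 1, 0) (tau \<alpha>) (\<lambda>x::(real^'a) \<times> (real^'b). 2 * (\<alpha> + 1) * norm (fst x) powr (2 * (\<alpha> + 1) - 2) * (fst x \<bullet> axis i 1) + 0)"
    unfolding tau_def by (rule pd_add)
  then show ?thesis by (rule pd_cong) (simp add: zpow_def inner_axis)
qed

lemma pd_tau_s: "pd (es j) (tau \<alpha>) (\<lambda>x. 8 * (\<alpha> + 1)\<^sup>2 * (snd x $ j))"
proof -
  have "pd v (\<lambda>z::real^'b. (norm z)\<^sup>2) (\<lambda>z. 2 * (z \<bullet> v))" for v
    unfolding pd_def power2_norm_eq_inner
    by (auto simp: inner_add inner_commute intro!: derivative_eq_intros)
  from pd_cmult[OF pd_snd[OF this[of "axis j 1"]], of "4 * (\<alpha> + 1)\<^sup>2"]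
  have "pd (0, axis j 1) (\<lambda>x::(real^'a) \<times> (real^'b). 4 * (\<alpha> + 1)\<^sup>2 * (norm (snd x))\<^sup>2) (\<lambda>x. 4 * (\<alpha> + 1)\<^sup>2 * (2 * (snd x \<bullet> axis j 1)))" .
  with pd_fst_0 have "pd (0, axis j 1) (tau \<alpha>) (\<lambda>x::(real^'a) \<times> (real^'b). 0 + 4 * (\<alpha> + 1)\<^sup>2 * (2 * (snd x \<bullet> axis j 1)))"
    unfolding tau_def by (rule pd_add)
  then show ?thesis by (rule pd_cong) (simp add: inner_axis)
qed

lemma sum_sq_norm: "(\<Sum>i\<in>UNIV. (z $ i)\<^sup>2) = (norm (z::real^'n::finite))\<^sup>2"
  unfolding power2_norm_eq_inner inner_vec_def by (simp add: power2_eq_square)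

text \<open>For small \<open>a\<close> the weight |z|^a alone is not differentiable at z = 0, but
  its product with a coordinate is, and the divergence of a weighted dilation field needs only that
  product. At z = 0 the formula gives the correct value 0 because \<open>0 powr a = 0\<close> for
  every exponent.\<close>

lemma pd_coord_zpow:
  assumes "a > 0"
  shows "pd (ez i) (\<lambda>x. fst x $ i * zpow a x) (\<lambda>x. zpow a x + a * zpow (a - 2) x * (fst x $ i)\<^sup>2)" (is "pd _ _ ?D")
  unfolding pd_def
proof
  fix x :: "(real^'a) \<times> (real^'b)"
  show "((\<lambda>t. fst (x + t *\<^sub>R (axis i 1, 0)) $ i * zpow a (x + t *\<^sub>R (axis i 1, 0))) has_real_derivative ?D x) (at 0)"
  proof (cases "fst x = 0")
    case True
    have "((\<lambda>t::real. \<bar>t\<bar> powr a) \<longlongrightarrow> \<bar>0\<bar> powr a) (at 0)"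
      using assms by (intro tendsto_intros tendsto_powr') auto
    then have "((\<lambda>t::real. \<bar>t\<bar> powr a) \<longlongrightarrow> 0) (at 0)" by simp
    moreover have "eventually (\<lambda>t. \<bar>t\<bar> powr a = (t * \<bar>t\<bar> powr a - 0) / (t - 0)) (at (0::real))"
      by (auto simp: eventually_at_filter)
    ultimately have "((\<lambda>t. (t * \<bar>t\<bar> powr a - 0) / (t - 0)) \<longlongrightarrow> 0) (at (0::real))"
      by (rule Lim_transform_eventually)
    then show ?thesis using True by (simp add: has_field_derivative_iff zpow_def)
  next
    case False
    have n: "((\<lambda>t. norm (fst x + t *\<^sub>R axis i 1) powr a) has_real_derivative a * norm (fst x) powr (a - 2) * (fst x $ i)) (at 0)"
      using norm_powr_DERIV[OF False, of "axis i 1" a] by (simp add: inner_axis)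
    have "((\<lambda>t. (fst x $ i + t) * norm (fst x + t *\<^sub>R axis i 1) powr a) has_real_derivative
       1 * norm (fst x + 0 *\<^sub>R axis i 1) powr a + (a * norm (fst x) powr (a - 2) * (fst x $ i)) * (fst x $ i + 0)) (at 0)"
      by (rule DERIV_mult[OF _ n]) (auto intro!: derivative_eq_intros)
    then show ?thesis by (simp add: zpow_def axis_def power2_eq_square mult.assoc)
  qed
qed

text \<open>The possible singularity of |z|^(a - 2) is compensated by the square of the coordinate:
  the product is at most |z|^a.\<close>

lemma continuous_coord_zpow:
  assumes a: "a > 0"
  shows "continuous_on UNIV (\<lambda>x::(real^'m::finite) \<times> (real^'k::finite). zpow (a - 2) x * (fst x $ i)\<^sup>2)"
proof -
  have "continuous_on UNIV (\<lambda>z::real^'m. norm z powr (a - 2) * (z $ i)\<^sup>2)"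
    unfolding continuous_on_eq_continuous_within
  proof
    fix z :: "real^'m"
    show "isCont (\<lambda>z. norm z powr (a - 2) * (z $ i)\<^sup>2) z"
    proof (cases "z = 0")
      case False
      then show ?thesis by (intro continuous_intros) auto
    next
      case True
      have "((\<lambda>z::real^'m. norm z powr (a - 2) * (z $ i)\<^sup>2) \<longlongrightarrow> 0) (at 0)"
      proof (rule Lim_null_comparison)
        show "eventually (\<lambda>z::real^'m. norm (norm z powr (a - 2) * (z $ i)\<^sup>2) \<le> norm z powr a) (at 0)"
        proof (rule eventually_at_filter[THEN iffD2], rule always_eventually, intro allI impI)
          fix z :: "real^'m" assume "z \<noteq> 0"
          have "(z $ i)\<^sup>2 \<le> (norm z)\<^sup>2" using component_le_norm_cart[of z i] by (simp add: abs_le_square_iff[symmetric])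
          then have "norm z powr (a - 2) * (z $ i)\<^sup>2 \<le> norm z powr (a - 2) * (norm z)\<^sup>2" by (simp add: mult_left_mono)
          also have "\<dots> = norm z powr a" by (rule norm_powr_mult_sq[OF \<open>z \<noteq> 0\<close>])
          finally show "norm (norm z powr (a - 2) * (z $ i)\<^sup>2) \<le> norm z powr a" by simp
        qed
        show "((\<lambda>z::real^'m. norm z powr a) \<longlongrightarrow> 0) (at 0)"
        proof -
          have "((\<lambda>z::real^'m. norm z powr a) \<longlongrightarrow> norm (0::real^'m) powr a) (at 0)"
            using continuous_norm_powr[OF a, of "UNIV :: (real^'m) set"] unfolding continuous_on_def by blast
          then show ?thesis by simp
        qed
      qed
      then show ?thesis using True by (simp add: isCont_def)
    qed
  qed
  then show ?thesis unfolding zpow_def by (rule continuous_on_compose2) (auto intro!: continuous_intros)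
qed

lemma sum_coord_zpow:
  fixes x :: "(real^'m::finite) \<times> (real^'k::finite)"
  shows "(\<Sum>i\<in>UNIV. zpow a x + a * zpow (a - 2) x * (fst x $ i)\<^sup>2) = (real CARD('m) + a) * zpow a x"
proof -
  have "(\<Sum>i\<in>UNIV. zpow a x + a * zpow (a - 2) x * (fst x $ i)\<^sup>2) = real CARD('m) * zpow a x + a * zpow (a - 2) x * (norm (fst x))\<^sup>2"
    by (simp add: sum.distrib sum_distrib_left[symmetric] sum_sq_norm)
  also have "zpow (a - 2) x * (norm (fst x))\<^sup>2 = zpow a x"
  proof (cases "fst x = 0")
    case False
    then show ?thesis unfolding zpow_def by (rule norm_powr_mult_sq)
  qed (simp add: zpow_def)
  ultimately show ?thesis by (simp add: algebra_simps)
qed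

lemma integral_divergence:
  fixes J J' :: "'i \<Rightarrow> 'a::euclidean_space \<Rightarrow> real"
  assumes "\<And>i. i \<in> I \<Longrightarrow> pd (v i) (J i) (J' i)" "\<And>i. i \<in> I \<Longrightarrow> continuous_on UNIV (J i)" "\<And>i. i \<in> I \<Longrightarrow> continuous_on UNIV (J' i)"
    and K: "compact K" and z: "\<And>i x. i \<in> I \<Longrightarrow> x \<notin> K \<Longrightarrow> J i x = 0"
  shows "integrable lborel (\<lambda>x. \<Sum>i\<in>I. J' i x)" "(LINT x|lborel. (\<Sum>i\<in>I. J' i x)) = 0"
proof -
  have int: "integrable lborel (J' i)" if "i \<in> I" for i
    using pd_zero_outside[OF assms(1)[OF that] compact_imp_closed[OF K] z[OF that]]
    by (intro integrable_compact_support[OF assms(3)[OF that] K])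
  then show "integrable lborel (\<lambda>x. \<Sum>i\<in>I. J' i x)" by (rule Bochner_Integration.integrable_sum)
  have "(LINT x|lborel. (\<Sum>i\<in>I. J' i x)) = (\<Sum>i\<in>I. LINT x|lborel. J' i x)"
    by (rule Bochner_Integration.integral_sum[OF int])
  also have "\<dots> = 0"
    by (intro sum.neutral ballI integral_pd_eq_0[OF assms(1-3) K z])
  finally show "(LINT x|lborel. (\<Sum>i\<in>I. J' i x)) = 0" .
qed

text \<open>The dilation field Z = z \<cdot> \<partial>_z + (\<alpha> + 1) \<sigma> \<cdot>
  \<partial>_\<sigma>, applied to the function whose directional derivatives are
  \<open>w1\<close>.\<close>

definition dil :: "real \<Rightarrow> ((real^'m) \<times> (real^'k) \<Rightarrow> (real^'m::finite) \<times> (real^'k::finite) \<Rightarrow> real) \<Rightarrow> (real^'m) \<times> (real^'k) \<Rightarrow> real" where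
  "dil \<alpha> w1 x = (\<Sum>i\<in>UNIV. fst x $ i * w1 (ez i) x) + (\<alpha> + 1) * (\<Sum>j\<in>UNIV. snd x $ j * w1 (es j) x)"

lemma continuous_fst_nth: "continuous_on S (\<lambda>x. fst x $ i)"
  by (intro continuous_intros)

lemma continuous_snd_nth: "continuous_on S (\<lambda>x. snd x $ i)"
  by (intro continuous_intros)

text \<open>The integrand is the divergence of \<mu> w Z. The last assumption is Euler's relation
  for a weight of degree \<open>a\<close> in z, so that Z with this weight has divergence (Q + a)
  \<mu>. The cases used are \<mu> = 1 and \<mu> = |z|^a.\<close>

lemma integral_dilation:
  fixes w :: "(real^'m::finite) \<times> (real^'k::finite) \<Rightarrow> real"
  assumes w: "continuous_on UNIV w" "\<And>b. b \<in> Basis \<Longrightarrow> pd b w (w1 b)" "\<And>b. b \<in> Basis \<Longrightarrow> continuous_on UNIV (w1 b)"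
    and K: "compact K" "\<And>x. x \<notin> K \<Longrightarrow> w x = 0"
    and \<mu>: "continuous_on UNIV \<mu>" "\<And>i. pd (ez i) (\<lambda>x. fst x $ i * \<mu> x) (\<nu> i)" "\<And>i. continuous_on UNIV (\<nu> i)"
      "\<And>j. pd (es j) \<mu> (\<lambda>x. 0)" "\<And>x. (\<Sum>i\<in>UNIV. \<nu> i x) = (real CARD('m) + a) * \<mu> x"
  shows "integrable lborel (\<lambda>x. \<mu> x * (dil \<alpha> w1 x + (hom_dim TYPE('m) TYPE('k) \<alpha> + a) * w x))"
    and "(LINT x|lborel. \<mu> x * (dil \<alpha> w1 x + (hom_dim TYPE('m) TYPE('k) \<alpha> + a) * w x)) = 0"
proof -
  let ?A = "\<lambda>x. \<Sum>i\<in>UNIV. \<nu> i x * w x + (fst x $ i * \<mu> x) * w1 (ez i) x"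
  let ?B = "\<lambda>x. \<Sum>j\<in>UNIV. (\<alpha> + 1) * ((1 * \<mu> x + snd x $ j * 0) * w x + (snd x $ j * \<mu> x) * w1 (es j) x)"
  note [continuous_intros] = continuous_fst_nth continuous_snd_nth w(1) w(3)[OF ez_Basis] w(3)[OF es_Basis] \<mu>(1,3)
  have A: "integrable lborel ?A" "(LINT x|lborel. ?A x) = 0"
  proof -
    show "integrable lborel ?A"
      by (rule integral_divergence(1)[where v=ez and J="\<lambda>i x. (fst x $ i * \<mu> x) * w x" and K=K])
        (auto intro!: pd_mult[OF \<mu>(2) w(2)[OF ez_Basis]] continuous_intros K)
    show "(LINT x|lborel. ?A x) = 0"
      by (rule integral_divergence(2)[where v=ez and J="\<lambda>i x. (fst x $ i * \<mu> x) * w x" and K=K])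
        (auto intro!: pd_mult[OF \<mu>(2) w(2)[OF ez_Basis]] continuous_intros K)
  qed
  have pB: "pd (es j) (\<lambda>x. (\<alpha> + 1) * ((snd x $ j * \<mu> x) * w x))
      (\<lambda>x. (\<alpha> + 1) * ((1 * \<mu> x + snd x $ j * 0) * w x + (snd x $ j * \<mu> x) * w1 (es j) x))" for j
    using pd_cmult[OF pd_mult[OF pd_mult[OF pd_snd_nth[of "es j" j] \<mu>(4)[of j]] w(2)[OF es_Basis[of j]]], of "\<alpha> + 1"] by simp
  have B: "integrable lborel ?B" "(LINT x|lborel. ?B x) = 0"
  proof -
    show "integrable lborel ?B"
      by (rule integral_divergence(1)[where v=es and J="\<lambda>j x. (\<alpha> + 1) * ((snd x $ j * \<mu> x) * w x)" and K=K])
        (intro pB, auto intro!: continuous_intros K)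
    show "(LINT x|lborel. ?B x) = 0"
      by (rule integral_divergence(2)[where v=es and J="\<lambda>j x. (\<alpha> + 1) * ((snd x $ j * \<mu> x) * w x)" and K=K])
        (intro pB, auto intro!: continuous_intros K)
  qed
  have eq: "\<mu> x * (dil \<alpha> w1 x + (hom_dim TYPE('m) TYPE('k) \<alpha> + a) * w x) = ?A x + ?B x" for x
  proof -
    have "?A x = (\<Sum>i\<in>UNIV. \<nu> i x) * w x + \<mu> x * (\<Sum>i\<in>UNIV. fst x $ i * w1 (ez i) x)"
      by (simp add: sum.distrib sum_distrib_left sum_distrib_right mult_ac)
    moreover have "?B x = (\<alpha> + 1) * (real CARD('k) * \<mu> x * w x + \<mu> x * (\<Sum>j\<in>UNIV. snd x $ j * w1 (es j) x))"
      by (simp add: sum_distrib_left[symmetric] sum.distrib mult_ac)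
    ultimately show ?thesis unfolding \<mu>(5) dil_def hom_dim_def by (simp add: algebra_simps)
  qed
  show "integrable lborel (\<lambda>x. \<mu> x * (dil \<alpha> w1 x + (hom_dim TYPE('m) TYPE('k) \<alpha> + a) * w x))"
    unfolding eq using A(1) B(1) by (rule Bochner_Integration.integrable_add)
  show "(LINT x|lborel. \<mu> x * (dil \<alpha> w1 x + (hom_dim TYPE('m) TYPE('k) \<alpha> + a) * w x)) = 0"
    unfolding eq using Bochner_Integration.integral_add[OF A(1) B(1)] A(2) B(2) by simp
qed

lemma integral_dilation_one:
  fixes w :: "(real^'m::finite) \<times> (real^'k::finite) \<Rightarrow> real"
  assumes w: "continuous_on UNIV w" "\<And>b. b \<in> Basis \<Longrightarrow> pd b w (w1 b)" "\<And>b. b \<in> Basis \<Longrightarrow> continuous_on UNIV (w1 b)"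
    and K: "compact K" "\<And>x. x \<notin> K \<Longrightarrow> w x = 0"
  shows "integrable lborel (\<lambda>x. dil \<alpha> w1 x + hom_dim TYPE('m) TYPE('k) \<alpha> * w x)"
    and "(LINT x|lborel. dil \<alpha> w1 x + hom_dim TYPE('m) TYPE('k) \<alpha> * w x) = 0"
proof -
  have pd: "pd (ez i) (\<lambda>x::(real^'m) \<times> (real^'k). fst x $ i * 1) (\<lambda>x. 1)" for i
    using pd_fst_nth[of "ez i" i] by simp
  have s: "(\<Sum>i\<in>(UNIV::'m set). 1) = (real CARD('m) + 0) * 1" by simp
  show "integrable lborel (\<lambda>x. dil \<alpha> w1 x + hom_dim TYPE('m) TYPE('k) \<alpha> * w x)"
    using integral_dilation(1)[OF w K continuous_on_const pd continuous_on_const pd_const s] by simp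
  show "(LINT x|lborel. dil \<alpha> w1 x + hom_dim TYPE('m) TYPE('k) \<alpha> * w x) = 0"
    using integral_dilation(2)[OF w K continuous_on_const pd continuous_on_const pd_const s] by simp
qed

lemma pd_zpow_s: "pd (es j) (zpow a) (\<lambda>x. 0)"
  by (simp add: pd_def zpow_def)

lemma integral_dilation_zpow:
  fixes w :: "(real^'m::finite) \<times> (real^'k::finite) \<Rightarrow> real"
  assumes a: "a > 0" and w: "continuous_on UNIV w" "\<And>b. b \<in> Basis \<Longrightarrow> pd b w (w1 b)" "\<And>b. b \<in> Basis \<Longrightarrow> continuous_on UNIV (w1 b)"
    and K: "compact K" "\<And>x. x \<notin> K \<Longrightarrow> w x = 0"
  shows "integrable lborel (\<lambda>x. zpow a x * (dil \<alpha> w1 x + (hom_dim TYPE('m) TYPE('k) \<alpha> + a) * w x))"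
    and "(LINT x|lborel. zpow a x * (dil \<alpha> w1 x + (hom_dim TYPE('m) TYPE('k) \<alpha> + a) * w x)) = 0"
proof -
  have c: "continuous_on UNIV (\<lambda>x. zpow a x + a * zpow (a - 2) x * (fst x $ i)\<^sup>2)" for i
    unfolding mult.assoc
    by (rule continuous_on_add[OF continuous_zpow[OF a] continuous_on_mult[OF continuous_on_const continuous_coord_zpow[OF a]]])
  note * = continuous_zpow[OF a] pd_coord_zpow[OF a] c pd_zpow_s sum_coord_zpow
  show "integrable lborel (\<lambda>x. zpow a x * (dil \<alpha> w1 x + (hom_dim TYPE('m) TYPE('k) \<alpha> + a) * w x))"
    by (rule integral_dilation(1)[OF w K *])
  show "(LINT x|lborel. zpow a x * (dil \<alpha> w1 x + (hom_dim TYPE('m) TYPE('k) \<alpha> + a) * w x)) = 0"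
    by (rule integral_dilation(2)[OF w K *])
qed

section \<open>Cutoff functions of the gauge\<close>

locale radial_cutoff =
  fixes \<alpha> :: real and h h' :: "real \<Rightarrow> real" and T :: real
  assumes \<alpha>: "\<alpha> > 0" and h: "\<And>t. (h has_real_derivative h' t) (at t)" and ch': "continuous_on UNIV h'"
    and hT: "\<And>t. t > T \<Longrightarrow> h t = 0"
begin

lemma ch: "continuous_on S h"
  using DERIV_continuous_on[OF has_field_derivative_at_within[OF h]] .

lemma cont_h: "continuous_on S (\<lambda>x. h (tau \<alpha> x))"
  by (rule continuous_on_compose2[OF ch continuous_tau[OF \<alpha>]]) auto

lemma cont_h': "continuous_on S (\<lambda>x. h' (tau \<alpha> x))"
  by (rule continuous_on_compose2[OF ch' continuous_tau[OF \<alpha>]]) auto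

lemma pd_h_z: "pd (ez i) (\<lambda>x. h (tau \<alpha> x)) (\<lambda>x. h' (tau \<alpha> x) * (2 * (\<alpha> + 1) * zpow (2 * \<alpha>) x * (fst x $ i)))"
  by (rule pd_chain[OF pd_tau_z[OF \<alpha>] h])

lemma pd_h_s: "pd (es j) (\<lambda>x. h (tau \<alpha> x)) (\<lambda>x. h' (tau \<alpha> x) * (8 * (\<alpha> + 1)\<^sup>2 * (snd x $ j)))"
  by (rule pd_chain[OF pd_tau_s h])

definition hgrad :: "(real^'m::finite) \<times> (real^'k::finite) \<Rightarrow> (real^'m) \<times> (real^'k) \<Rightarrow> real" where
  "hgrad b x = h' (tau \<alpha> x) * (2 * (\<alpha> + 1) * zpow (2 * \<alpha>) x * (fst x \<bullet> fst b) + 8 * (\<alpha> + 1)\<^sup>2 * (snd x \<bullet> snd b))"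

lemma hgrad_ez: "hgrad (ez i) x = h' (tau \<alpha> x) * (2 * (\<alpha> + 1) * zpow (2 * \<alpha>) x * (fst x $ i))"
  by (simp add: hgrad_def inner_axis)

lemma hgrad_es: "hgrad (es j) x = h' (tau \<alpha> x) * (8 * (\<alpha> + 1)\<^sup>2 * (snd x $ j))"
  by (simp add: hgrad_def inner_axis)

lemma Basis_cases:
  fixes b :: "(real^'m::finite) \<times> (real^'k::finite)"
  assumes "b \<in> Basis"
  obtains i where "b = ez i" | j where "b = es j"
  using assms by (auto simp: Basis_prod_def Basis_vec_def)

lemma pd_h: "b \<in> Basis \<Longrightarrow> pd b (\<lambda>x. h (tau \<alpha> x)) (hgrad b)"
  by (erule Basis_cases) (auto intro: pd_cong[OF pd_h_z] pd_cong[OF pd_h_s] simp: hgrad_ez hgrad_es)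

lemma cont_hgrad: "continuous_on S (hgrad b)"
  unfolding hgrad_def using \<alpha> by (intro continuous_intros cont_h' continuous_zpow) auto

text \<open>Euler's relation: \<open>tau\<close> is homogeneous of degree 2(\<alpha> + 1) under the
  dilations.\<close>

lemma dil_hgrad: "dil \<alpha> hgrad x = 2 * (\<alpha> + 1) * tau \<alpha> x * h' (tau \<alpha> x)"
proof -
  have z: "zpow (2 * \<alpha>) x * (norm (fst x))\<^sup>2 = norm (fst x) powr (2 * (\<alpha> + 1))"
  proof (cases "fst x = 0")
    case False
    then show ?thesis using norm_powr_mult_sq[OF False, of "2 * (\<alpha> + 1)"] by (simp add: zpow_def)
  qed (simp add: zpow_def)
  define \<beta> where "\<beta> = \<alpha> + 1"
  define p where "p = h' (tau \<alpha> x)"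
  have 1: "(\<Sum>i\<in>UNIV. fst x $ i * (p * (2 * \<beta> * zpow (2 * \<alpha>) x * (fst x $ i)))) = p * (2 * \<beta> * zpow (2 * \<alpha>) x * (\<Sum>i\<in>UNIV. (fst x $ i)\<^sup>2))"
    by (simp add: sum_distrib_left power2_eq_square mult_ac)
  have 2: "(\<Sum>j\<in>UNIV. snd x $ j * (p * (8 * \<beta>\<^sup>2 * (snd x $ j)))) = p * (8 * \<beta>\<^sup>2 * (\<Sum>j\<in>UNIV. (snd x $ j)\<^sup>2))"
    by (simp add: sum_distrib_left power2_eq_square mult_ac)
  have "dil \<alpha> hgrad x = p * (2 * \<beta> * zpow (2 * \<alpha>) x * (\<Sum>i\<in>UNIV. (fst x $ i)\<^sup>2)
     + \<beta> * (8 * \<beta>\<^sup>2 * (\<Sum>j\<in>UNIV. (snd x $ j)\<^sup>2)))"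
    unfolding dil_def hgrad_ez hgrad_es p_def[symmetric] \<beta>_def[symmetric] 1 2 by (simp add: algebra_simps)
  also have "\<dots> = p * (2 * \<beta> * (zpow (2 * \<alpha>) x * (norm (fst x))\<^sup>2) + \<beta> * (8 * \<beta>\<^sup>2 * (norm (snd x))\<^sup>2))"
    by (simp add: sum_sq_norm)
  also have "\<dots> = 2 * (\<alpha> + 1) * tau \<alpha> x * h' (tau \<alpha> x)" 
    unfolding z p_def[symmetric] unfolding \<beta>_def[symmetric] tau_def by (simp add: algebra_simps power2_eq_square)
  finally show ?thesis .
qed

end

lemma dil_mult: "dil \<alpha> (\<lambda>b x. u1 b x * v x + u x * v1 b x) x = dil \<alpha> u1 x * v x + u x * dil \<alpha> v1 x"
  unfolding dil_def by (simp add: sum.distrib sum_distrib_left sum_distrib_right algebra_simps)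

lemma C2_D:
  assumes "C2 F F1 F2"
  shows "continuous_on UNIV F" "\<And>b. b \<in> Basis \<Longrightarrow> pd b F (F1 b)" "\<And>b. b \<in> Basis \<Longrightarrow> continuous_on UNIV (F1 b)"
    "\<And>b c. b \<in> Basis \<Longrightarrow> c \<in> Basis \<Longrightarrow> pd c (F1 b) (F2 b c)"
    "\<And>b c. b \<in> Basis \<Longrightarrow> c \<in> Basis \<Longrightarrow> continuous_on UNIV (F2 b c)"
    "\<And>b c. b \<in> Basis \<Longrightarrow> c \<in> Basis \<Longrightarrow> F2 b c = F2 c b"
  using assms unfolding C2_def by blast+

definition Bop :: "real \<Rightarrow> ((real^'m) \<times> (real^'k) \<Rightarrow> (real^'m) \<times> (real^'k) \<Rightarrow> (real^'m::finite) \<times> (real^'k::finite) \<Rightarrow> real) \<Rightarrow> (real^'m) \<times> (real^'k) \<Rightarrow> real" where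
  "Bop \<alpha> F2 x = (\<Sum>i\<in>UNIV. F2 (ez i) (ez i) x) + (gweight \<alpha> x)\<^sup>2 * (\<Sum>j\<in>UNIV. F2 (es j) (es j) x)"

definition gradsq :: "real \<Rightarrow> ((real^'m) \<times> (real^'k) \<Rightarrow> (real^'m::finite) \<times> (real^'k::finite) \<Rightarrow> real) \<Rightarrow> (real^'m) \<times> (real^'k) \<Rightarrow> real" where
  "gradsq \<alpha> F1 x = (\<Sum>i\<in>UNIV. (F1 (ez i) x)\<^sup>2) + (gweight \<alpha> x)\<^sup>2 * (\<Sum>j\<in>UNIV. (F1 (es j) x)\<^sup>2)"

lemma gweight_sq: "(gweight \<alpha> x)\<^sup>2 = zpow (2 * \<alpha>) x / 4"
proof -
  have "(norm (fst x) powr \<alpha>)\<^sup>2 = norm (fst x) powr (2 * \<alpha>)" by (simp add: power2_eq_square powr_add[symmetric])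
  then show ?thesis by (simp add: gweight_def zpow_def power_divide)
qed

definition grad_inner :: "real \<Rightarrow> ((real^'m) \<times> (real^'k) \<Rightarrow> (real^'m::finite) \<times> (real^'k::finite) \<Rightarrow> real) \<Rightarrow> ((real^'m) \<times> (real^'k) \<Rightarrow> (real^'m) \<times> (real^'k) \<Rightarrow> real) \<Rightarrow> (real^'m) \<times> (real^'k) \<Rightarrow> real" where
  "grad_inner \<alpha> u1 v1 x = (\<Sum>i\<in>UNIV. u1 (ez i) x * v1 (ez i) x) + (gweight \<alpha> x)\<^sup>2 * (\<Sum>j\<in>UNIV. u1 (es j) x * v1 (es j) x)"

lemma grad_inner_self: "grad_inner \<alpha> F1 F1 x = gradsq \<alpha> F1 x"
  by (simp add: grad_inner_def gradsq_def power2_eq_square)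

lemma grad_inner_mult: "grad_inner \<alpha> (\<lambda>b x. u1 b x * v x + u x * v1 b x) w1 x = grad_inner \<alpha> u1 w1 x * v x + u x * grad_inner \<alpha> v1 w1 x"
  unfolding grad_inner_def by (simp add: sum.distrib sum_distrib_left sum_distrib_right algebra_simps)

text \<open>The coefficient |z|^(2\<alpha>)/4 does not depend on \<sigma>, so the operator is in
  divergence form and only the product rule and vanishing integrals of derivatives are
  involved.\<close>

lemma weak_form:
  fixes F u :: "(real^'m::finite) \<times> (real^'k::finite) \<Rightarrow> real"
  assumes \<alpha>: "\<alpha> > 0" and F: "C2 F F1 F2"
    and u: "continuous_on UNIV u" "\<And>b. b \<in> Basis \<Longrightarrow> pd b u (u1 b)" "\<And>b. b \<in> Basis \<Longrightarrow> continuous_on UNIV (u1 b)"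
    and K: "compact K" "\<And>x. x \<notin> K \<Longrightarrow> u x = 0"
  shows "integrable lborel (\<lambda>x. grad_inner \<alpha> u1 F1 x + u x * Bop \<alpha> F2 x)"
    and "(LINT x|lborel. grad_inner \<alpha> u1 F1 x + u x * Bop \<alpha> F2 x) = 0"
proof -
  let ?P = "zpow (2 * \<alpha>)"
  let ?A = "\<lambda>x. \<Sum>i\<in>UNIV. u1 (ez i) x * F1 (ez i) x + u x * F2 (ez i) (ez i) x"
  let ?B = "\<lambda>x. \<Sum>j\<in>UNIV. 0 * (u x * F1 (es j) x) + ?P x * (u1 (es j) x * F1 (es j) x + u x * F2 (es j) (es j) x)"
  note F = C2_D[OF F]
  have cP: "continuous_on UNIV ?P" by (rule continuous_zpow) (use \<alpha> in auto)
  note [continuous_intros] = cP u(1) u(3)[OF ez_Basis] u(3)[OF es_Basis] F(3)[OF ez_Basis] F(3)[OF es_Basis]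
    F(5)[OF ez_Basis ez_Basis] F(5)[OF es_Basis es_Basis]
  have pA: "pd (ez i) (\<lambda>x. u x * F1 (ez i) x) (\<lambda>x. u1 (ez i) x * F1 (ez i) x + u x * F2 (ez i) (ez i) x)" for i
    by (rule pd_mult[OF u(2)[OF ez_Basis] F(4)[OF ez_Basis ez_Basis]])
  have A: "integrable lborel ?A" "(LINT x|lborel. ?A x) = 0"
  proof -
    show "integrable lborel ?A"
      by (rule integral_divergence(1)[where v=ez and J="\<lambda>i x. u x * F1 (ez i) x" and K=K, OF pA])
        (auto intro!: continuous_intros K)
    show "(LINT x|lborel. ?A x) = 0"
      by (rule integral_divergence(2)[where v=ez and J="\<lambda>i x. u x * F1 (ez i) x" and K=K, OF pA])
        (auto intro!: continuous_intros K)
  qed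
  have pB: "pd (es j) (\<lambda>x. ?P x * (u x * F1 (es j) x)) (\<lambda>x. 0 * (u x * F1 (es j) x) + ?P x * (u1 (es j) x * F1 (es j) x + u x * F2 (es j) (es j) x))" for j
    by (rule pd_mult[OF pd_zpow_s pd_mult[OF u(2)[OF es_Basis] F(4)[OF es_Basis es_Basis]]])
  have B: "integrable lborel ?B" "(LINT x|lborel. ?B x) = 0"
  proof -
    show "integrable lborel ?B"
      by (rule integral_divergence(1)[where v=es and J="\<lambda>j x. ?P x * (u x * F1 (es j) x)" and K=K, OF pB])
        (auto intro!: continuous_intros K)
    show "(LINT x|lborel. ?B x) = 0"
      by (rule integral_divergence(2)[where v=es and J="\<lambda>j x. ?P x * (u x * F1 (es j) x)" and K=K, OF pB])
        (auto intro!: continuous_intros K)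
  qed
  have eq: "grad_inner \<alpha> u1 F1 x + u x * Bop \<alpha> F2 x = ?A x + ?B x / 4" for x
  proof -
    have "?B x = ?P x * (\<Sum>j\<in>UNIV. u1 (es j) x * F1 (es j) x + u x * F2 (es j) (es j) x)"
      by (simp add: sum_distrib_left)
    then show ?thesis unfolding grad_inner_def Bop_def gweight_sq
      by (simp add: sum.distrib sum_distrib_left[symmetric] ring_distribs add_divide_distrib)
  qed
  have B4: "integrable lborel (\<lambda>x. ?B x / 4)" using B(1) by simp
  show "integrable lborel (\<lambda>x. grad_inner \<alpha> u1 F1 x + u x * Bop \<alpha> F2 x)"
    unfolding eq using A(1) B4 by (rule Bochner_Integration.integrable_add)
  have "(LINT x|lborel. ?A x + ?B x / 4) = (LINT x|lborel. ?A x) + (LINT x|lborel. ?B x) / 4"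
    using Bochner_Integration.integral_add[OF A(1) B4] by simp
  then show "(LINT x|lborel. grad_inner \<alpha> u1 F1 x + u x * Bop \<alpha> F2 x) = 0"
    unfolding eq using A(2) B(2) by simp
qed

section \<open>Integral identities for C^2 functions\<close>

context radial_cutoff
begin

text \<open>The constant 4(\<alpha> + 1)^2 in the gauge is made for this: multiplying the
  \<sigma>-gradient 8(\<alpha> + 1)^2 \<sigma> by |z|^(2\<alpha>)/4 produces the same factor
  2(\<alpha> + 1)|z|^(2\<alpha>) as the z-gradient, with exactly the weight \<alpha> + 1 of Z.
  Radial cutoffs therefore bring in F only through Z F.\<close>

lemma grad_inner_hgrad: "grad_inner \<alpha> hgrad F1 x = 2 * (\<alpha> + 1) * h' (tau \<alpha> x) * zpow (2 * \<alpha>) x * dil \<alpha> F1 x"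
proof -
  define \<beta> where "\<beta> = \<alpha> + 1"
  define p where "p = h' (tau \<alpha> x)"
  have 1: "(\<Sum>i\<in>UNIV. (p * (2 * \<beta> * zpow (2 * \<alpha>) x * (fst x $ i))) * F1 (ez i) x) = p * 2 * \<beta> * zpow (2 * \<alpha>) x * (\<Sum>i\<in>UNIV. fst x $ i * F1 (ez i) x)"
    by (simp add: sum_distrib_left mult_ac)
  have 2: "(\<Sum>j\<in>UNIV. (p * (8 * \<beta>\<^sup>2 * (snd x $ j))) * F1 (es j) x) = p * 8 * \<beta>\<^sup>2 * (\<Sum>j\<in>UNIV. snd x $ j * F1 (es j) x)"
    by (simp add: sum_distrib_left mult_ac)
  show ?thesis
    unfolding grad_inner_def dil_def hgrad_ez hgrad_es p_def[symmetric] \<beta>_def[symmetric] 1 2 gweight_sq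
    by (simp add: algebra_simps power2_eq_square)
qed

lemma cont_dil:
  assumes "\<And>b. b \<in> Basis \<Longrightarrow> continuous_on UNIV (w1 b)"
  shows "continuous_on UNIV (dil \<alpha> w1)"
proof -
  note [continuous_intros] = continuous_fst_nth continuous_snd_nth assms[OF ez_Basis] assms[OF es_Basis]
  show ?thesis unfolding dil_def by (intro continuous_intros)
qed

lemma h_zero: "x \<notin> {x. tau \<alpha> x \<le> T} \<Longrightarrow> h (tau \<alpha> x) = 0"
  by (simp add: hT)

text \<open>Green's formula with the test function h(\<open>tau\<close>) F.\<close>

lemma cutoff_energy_identity:
  fixes F :: "(real^'m::finite) \<times> (real^'k::finite) \<Rightarrow> real"
  assumes F: "C2 F F1 F2"
  shows "(LINT x|lborel. h (tau \<alpha> x) * gradsq \<alpha> F1 x + 2 * (\<alpha> + 1) * h' (tau \<alpha> x) * zpow (2 * \<alpha>) x * dil \<alpha> F1 x * F x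
     + h (tau \<alpha> x) * F x * Bop \<alpha> F2 x) = 0"
proof -
  note F' = C2_D[OF F]
  have "(LINT x|lborel. grad_inner \<alpha> (\<lambda>b x. hgrad b x * F x + h (tau \<alpha> x) * F1 b x) F1 x + (h (tau \<alpha> x) * F x) * Bop \<alpha> F2 x) = 0"
    by (rule weak_form(2)[OF \<alpha> F _ _ _ compact_tau_le[OF \<alpha>, of T]])
      (auto intro!: continuous_on_mult continuous_on_add cont_h cont_hgrad F'(1,3) pd_mult pd_h F'(2) simp: hT)
  then show ?thesis unfolding grad_inner_mult grad_inner_self grad_inner_hgrad by (simp add: algebra_simps)
qed

text \<open>The divergence of h(\<open>tau\<close>) |z|^(2\<alpha>) F^2 Z integrates to 0.\<close>

lemma cutoff_transport_identity:
  fixes F :: "(real^'m::finite) \<times> (real^'k::finite) \<Rightarrow> real"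
  assumes F: "C2 F F1 F2"
  shows "(LINT x|lborel. zpow (2 * \<alpha>) x * (2 * h (tau \<alpha> x) * F x * dil \<alpha> F1 x
     + (2 * (\<alpha> + 1) * tau \<alpha> x * h' (tau \<alpha> x) + (hom_dim TYPE('m) TYPE('k) \<alpha> + 2 * \<alpha>) * h (tau \<alpha> x)) * (F x)\<^sup>2)) = 0"
proof -
  note F' = C2_D[OF F]
  let ?w = "\<lambda>x. h (tau \<alpha> x) * (F x)\<^sup>2"
  let ?w1 = "\<lambda>b x. hgrad b x * (F x)\<^sup>2 + h (tau \<alpha> x) * (2 * F x * F1 b x)"
  have a: "2 * \<alpha> > 0" using \<alpha> by simp
  have "(LINT x|lborel. zpow (2 * \<alpha>) x * (dil \<alpha> ?w1 x + (hom_dim TYPE('m) TYPE('k) \<alpha> + 2 * \<alpha>) * ?w x)) = 0"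
    by (rule integral_dilation_zpow(2)[OF a _ _ _ compact_tau_le[OF \<alpha>, of T]])
      (auto intro!: continuous_on_mult continuous_on_add continuous_on_power continuous_on_const cont_h cont_hgrad F'(1,3) pd_mult pd_power2 pd_h F'(2) simp: hT)
  moreover have "dil \<alpha> ?w1 x = dil \<alpha> hgrad x * (F x)\<^sup>2 + h (tau \<alpha> x) * (2 * F x * dil \<alpha> F1 x)" for x
  proof -
    have "dil \<alpha> (\<lambda>b x. 2 * F x * F1 b x) x = 2 * F x * dil \<alpha> F1 x"
      unfolding dil_def by (simp add: sum_distrib_left algebra_simps)
    then show ?thesis by (simp add: dil_mult)
  qed
  ultimately show ?thesis by (simp add: dil_hgrad algebra_simps)
qed

text \<open>The divergence of h(\<open>tau\<close>) F^2 Z integrates to 0. It serves to trade a term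
  F Z F for F^2 when the equation is inserted below.\<close>

lemma cutoff_mass_identity:
  fixes F :: "(real^'m::finite) \<times> (real^'k::finite) \<Rightarrow> real"
  assumes F: "C2 F F1 F2"
  shows "(LINT x|lborel. 2 * h (tau \<alpha> x) * F x * dil \<alpha> F1 x
     + (2 * (\<alpha> + 1) * tau \<alpha> x * h' (tau \<alpha> x) + hom_dim TYPE('m) TYPE('k) \<alpha> * h (tau \<alpha> x)) * (F x)\<^sup>2) = 0"
   and "integrable lborel (\<lambda>x. 2 * h (tau \<alpha> x) * F x * dil \<alpha> F1 x
     + (2 * (\<alpha> + 1) * tau \<alpha> x * h' (tau \<alpha> x) + hom_dim TYPE('m) TYPE('k) \<alpha> * h (tau \<alpha> x)) * (F x)\<^sup>2)"
proof -
  note F' = C2_D[OF F]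
  let ?w = "\<lambda>x. h (tau \<alpha> x) * (F x)\<^sup>2"
  let ?w1 = "\<lambda>b x. hgrad b x * (F x)\<^sup>2 + h (tau \<alpha> x) * (2 * F x * F1 b x)"
  have *: "continuous_on UNIV ?w" "\<And>b. b \<in> Basis \<Longrightarrow> pd b ?w (?w1 b)" "\<And>b. b \<in> Basis \<Longrightarrow> continuous_on UNIV (?w1 b)"
    "\<And>x. x \<notin> {x. tau \<alpha> x \<le> T} \<Longrightarrow> ?w x = 0"
    by (auto intro!: continuous_on_mult continuous_on_add continuous_on_power continuous_on_const cont_h cont_hgrad F'(1,3) pd_mult pd_power2 pd_h F'(2) simp: hT)
  have "dil \<alpha> ?w1 x = dil \<alpha> hgrad x * (F x)\<^sup>2 + h (tau \<alpha> x) * (2 * F x * dil \<alpha> F1 x)" for x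
  proof -
    have "dil \<alpha> (\<lambda>b x. 2 * F x * F1 b x) x = 2 * F x * dil \<alpha> F1 x"
      unfolding dil_def by (simp add: sum_distrib_left algebra_simps)
    then show ?thesis by (simp add: dil_mult)
  qed
  then have eq: "dil \<alpha> ?w1 x + hom_dim TYPE('m) TYPE('k) \<alpha> * ?w x = 2 * h (tau \<alpha> x) * F x * dil \<alpha> F1 x
     + (2 * (\<alpha> + 1) * tau \<alpha> x * h' (tau \<alpha> x) + hom_dim TYPE('m) TYPE('k) \<alpha> * h (tau \<alpha> x)) * (F x)\<^sup>2" for x
    by (simp add: dil_hgrad algebra_simps)
  note I = integral_dilation_one[OF *(1,2,3) compact_tau_le[OF \<alpha>, of T] *(4), where \<alpha>=\<alpha>]
  show "(LINT x|lborel. 2 * h (tau \<alpha> x) * F x * dil \<alpha> F1 x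
     + (2 * (\<alpha> + 1) * tau \<alpha> x * h' (tau \<alpha> x) + hom_dim TYPE('m) TYPE('k) \<alpha> * h (tau \<alpha> x)) * (F x)\<^sup>2) = 0"
    by (rule I(2)[unfolded eq]) auto
  show "integrable lborel (\<lambda>x. 2 * h (tau \<alpha> x) * F x * dil \<alpha> F1 x
     + (2 * (\<alpha> + 1) * tau \<alpha> x * h' (tau \<alpha> x) + hom_dim TYPE('m) TYPE('k) \<alpha> * h (tau \<alpha> x)) * (F x)\<^sup>2)"
    by (rule I(1)[unfolded eq]) auto
qed

text \<open>A Rellich-Pohozaev identity: Green's formula with the test function
  h(\<open>tau\<close>) Z F. Commuting Z with the partial derivatives produces terms with second
  derivatives of F, which are half of Z applied to the squared gradient and are removed by
  integrating along Z.\<close>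

lemma cutoff_dilation_identity:
  fixes F :: "(real^'m::finite) \<times> (real^'k::finite) \<Rightarrow> real"
  assumes F: "C2 F F1 F2"
  shows "(LINT x|lborel. h (tau \<alpha> x) * dil \<alpha> F1 x * Bop \<alpha> F2 x
      + 2 * (\<alpha> + 1) * h' (tau \<alpha> x) * zpow (2 * \<alpha>) x * (dil \<alpha> F1 x)\<^sup>2
      + ((1 - hom_dim TYPE('m) TYPE('k) \<alpha> / 2) * h (tau \<alpha> x) - (\<alpha> + 1) * tau \<alpha> x * h' (tau \<alpha> x)) * gradsq \<alpha> F1 x) = 0"
    and "integrable lborel (\<lambda>x. h (tau \<alpha> x) * dil \<alpha> F1 x * Bop \<alpha> F2 x
      + 2 * (\<alpha> + 1) * h' (tau \<alpha> x) * zpow (2 * \<alpha>) x * (dil \<alpha> F1 x)\<^sup>2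
      + ((1 - hom_dim TYPE('m) TYPE('k) \<alpha> / 2) * h (tau \<alpha> x) - (\<alpha> + 1) * tau \<alpha> x * h' (tau \<alpha> x)) * gradsq \<alpha> F1 x)"
proof -
  note F' = C2_D[OF F]
  define Z1 where "Z1 = (\<lambda>b. dil \<alpha> (\<lambda>c. F2 b c))"
  define e1 where "e1 = (\<lambda>x. \<Sum>i\<in>UNIV. (F1 (ez i) x)\<^sup>2)"
  define e2 where "e2 = (\<lambda>x. \<Sum>j\<in>UNIV. (F1 (es j) x)\<^sup>2)"
  define s1 where "s1 = (\<lambda>x. \<Sum>i\<in>UNIV. F1 (ez i) x * Z1 (ez i) x)"
  define s2 where "s2 = (\<lambda>x. \<Sum>j\<in>UNIV. F1 (es j) x * Z1 (es j) x)"
  define Q where "Q = hom_dim TYPE('m) TYPE('k) \<alpha>"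
  let ?H = "\<lambda>x::(real^'m) \<times> (real^'k). h (tau \<alpha> x)" and ?H' = "\<lambda>x::(real^'m) \<times> (real^'k). h' (tau \<alpha> x)"
  let ?P = "\<lambda>x::(real^'m) \<times> (real^'k). (gweight \<alpha> x)\<^sup>2"
  define Zd where "Zd = (\<lambda>b x. (\<Sum>i\<in>UNIV. fst b $ i * F1 (ez i) x + fst x $ i * F2 (ez i) b x)
        + (\<alpha> + 1) * (\<Sum>j\<in>UNIV. snd b $ j * F1 (es j) x + snd x $ j * F2 (es j) b x))"
  have pdZ: "pd b (dil \<alpha> F1) (Zd b)" if b: "b \<in> Basis" for b
    unfolding dil_def Zd_def
    by (intro pd_add pd_sum pd_cmult pd_mult pd_fst_nth pd_snd_nth F'(4)[OF ez_Basis b] F'(4)[OF es_Basis b])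
  have cZd: "continuous_on UNIV (Zd b)" if b: "b \<in> Basis" for b
    unfolding Zd_def
    by (intro continuous_on_add continuous_on_sum continuous_on_mult continuous_on_const continuous_fst_nth continuous_snd_nth
        F'(3)[OF ez_Basis] F'(3)[OF es_Basis] F'(5)[OF ez_Basis b] F'(5)[OF es_Basis b])
  \<comment> \<open>The commutator of \<partial>_z with Z is \<partial>_z; for \<partial>_\<sigma>
    below it is (\<alpha> + 1) \<partial>_\<sigma>. The symmetry of \<open>F2\<close> enters
    here.\<close>
  have Zdz: "Zd (ez i) x = F1 (ez i) x + Z1 (ez i) x" for i x
  proof -
    have "(\<Sum>l\<in>UNIV. axis i (1::real) $ l * F1 (ez l) x) = F1 (ez i) x"
      by (simp add: axis_def if_distrib[of "\<lambda>c. c * _"] cong: if_cong)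
    then show ?thesis unfolding Zd_def Z1_def dil_def
      using F'(6)[OF ez_Basis ez_Basis] F'(6)[OF ez_Basis es_Basis, of i] by (simp add: sum.distrib)
  qed
  have Zds: "Zd (es j) x = (\<alpha> + 1) * F1 (es j) x + Z1 (es j) x" for j x
  proof -
    have "(\<Sum>l\<in>UNIV. axis j (1::real) $ l * F1 (es l) x) = F1 (es j) x"
      by (simp add: axis_def if_distrib[of "\<lambda>c. c * _"] cong: if_cong)
    then show ?thesis unfolding Zd_def Z1_def dil_def
      using F'(6)[OF es_Basis ez_Basis, of j] F'(6)[OF es_Basis es_Basis, of j] by (simp add: sum.distrib algebra_simps)
  qed
  let ?A = "\<lambda>x. grad_inner \<alpha> (\<lambda>b x. hgrad b x * dil \<alpha> F1 x + ?H x * Zd b x) F1 x + (?H x * dil \<alpha> F1 x) * Bop \<alpha> F2 x"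
  have A: "integrable lborel ?A" "(LINT x|lborel. ?A x) = 0"
  proof -
    have *: "continuous_on UNIV (\<lambda>x. ?H x * dil \<alpha> F1 x)" "\<And>b. b \<in> Basis \<Longrightarrow> pd b (\<lambda>x. ?H x * dil \<alpha> F1 x) (\<lambda>x. hgrad b x * dil \<alpha> F1 x + ?H x * Zd b x)"
      "\<And>b. b \<in> Basis \<Longrightarrow> continuous_on UNIV (\<lambda>x. hgrad b x * dil \<alpha> F1 x + ?H x * Zd b x)" "\<And>x. x \<notin> {x. tau \<alpha> x \<le> T} \<Longrightarrow> ?H x * dil \<alpha> F1 x = 0"
      by (auto intro!: continuous_on_mult continuous_on_add cont_h cont_hgrad cont_dil F'(3) cZd pd_mult pd_h pdZ simp: hT)
    show "integrable lborel ?A" "(LINT x|lborel. ?A x) = 0"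
      by (rule weak_form[OF \<alpha> F *(1,2,3) compact_tau_le[OF \<alpha>, of T] *(4)]; assumption)+
  qed
  have A_eq: "?A x = 2 * (\<alpha> + 1) * ?H' x * zpow (2 * \<alpha>) x * (dil \<alpha> F1 x)\<^sup>2
      + ?H x * (e1 x + (\<alpha> + 1) * ?P x * e2 x + s1 x + ?P x * s2 x) + ?H x * dil \<alpha> F1 x * Bop \<alpha> F2 x" for x
  proof -
    have "grad_inner \<alpha> Zd F1 x = e1 x + (\<alpha> + 1) * ?P x * e2 x + s1 x + ?P x * s2 x"
      unfolding grad_inner_def Zdz Zds e1_def e2_def s1_def s2_def
      by (simp add: sum.distrib sum_distrib_left algebra_simps power2_eq_square)
    then show ?thesis unfolding grad_inner_mult grad_inner_hgrad by (simp add: algebra_simps power2_eq_square)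
  qed
  have pe: "pd b (\<lambda>x. \<Sum>i\<in>UNIV. (F1 (g i) x)\<^sup>2) (\<lambda>x. \<Sum>i\<in>UNIV. 2 * F1 (g i) x * F2 (g i) b x)"
    and ce: "continuous_on UNIV (\<lambda>x. \<Sum>i\<in>UNIV. (F1 (g i) x)\<^sup>2)"
    and ce': "continuous_on UNIV (\<lambda>x. \<Sum>i\<in>UNIV. 2 * F1 (g i) x * F2 (g i) b x)"
    if g: "\<And>i. g i \<in> Basis" and b: "b \<in> Basis" for g :: "'n::finite \<Rightarrow> (real^'m) \<times> (real^'k)" and b
  proof -
    show "pd b (\<lambda>x. \<Sum>i\<in>UNIV. (F1 (g i) x)\<^sup>2) (\<lambda>x. \<Sum>i\<in>UNIV. 2 * F1 (g i) x * F2 (g i) b x)"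
      by (intro pd_sum pd_power2 F'(4) g b)
    show "continuous_on UNIV (\<lambda>x. \<Sum>i\<in>UNIV. (F1 (g i) x)\<^sup>2)"
      by (intro continuous_on_sum continuous_on_power F'(3) g)
    show "continuous_on UNIV (\<lambda>x. \<Sum>i\<in>UNIV. 2 * F1 (g i) x * F2 (g i) b x)"
      by (intro continuous_on_sum continuous_on_mult continuous_on_const F'(3) F'(5) g b)
  qed
  have de: "dil \<alpha> (\<lambda>b x. \<Sum>i\<in>UNIV. 2 * F1 (g i) x * F2 (g i) b x) x = 2 * (\<Sum>i\<in>UNIV. F1 (g i) x * Z1 (g i) x)"
    for g :: "'n::finite \<Rightarrow> (real^'m) \<times> (real^'k)" and x
  proof -
    have "(\<Sum>l\<in>UNIV. fst x $ l * (\<Sum>i\<in>UNIV. 2 * F1 (g i) x * F2 (g i) (ez l) x)) = (\<Sum>i\<in>UNIV. \<Sum>l\<in>UNIV. 2 * F1 (g i) x * (fst x $ l * F2 (g i) (ez l) x))"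
      unfolding sum_distrib_left by (subst sum.swap) (simp add: mult_ac)
    moreover have "(\<Sum>l\<in>UNIV. snd x $ l * (\<Sum>i\<in>UNIV. 2 * F1 (g i) x * F2 (g i) (es l) x)) = (\<Sum>i\<in>UNIV. \<Sum>l\<in>UNIV. 2 * F1 (g i) x * (snd x $ l * F2 (g i) (es l) x))"
      unfolding sum_distrib_left by (subst sum.swap) (simp add: mult_ac)
    ultimately show ?thesis unfolding dil_def Z1_def
      by (simp add: sum_distrib_left sum.distrib[symmetric] algebra_simps)
  qed
  let ?w1 = "\<lambda>e g b x. hgrad b x * e x + ?H x * (\<Sum>i\<in>UNIV. 2 * F1 (g i) x * F2 (g i) b x)"
  have w: "continuous_on UNIV (\<lambda>x. ?H x * (\<Sum>i\<in>UNIV. (F1 (g i) x)\<^sup>2))"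
     "\<And>b. b \<in> Basis \<Longrightarrow> pd b (\<lambda>x. ?H x * (\<Sum>i\<in>UNIV. (F1 (g i) x)\<^sup>2)) (?w1 (\<lambda>x. \<Sum>i\<in>UNIV. (F1 (g i) x)\<^sup>2) g b)"
     "\<And>b. b \<in> Basis \<Longrightarrow> continuous_on UNIV (?w1 (\<lambda>x. \<Sum>i\<in>UNIV. (F1 (g i) x)\<^sup>2) g b)"
     "\<And>x. x \<notin> {x. tau \<alpha> x \<le> T} \<Longrightarrow> ?H x * (\<Sum>i\<in>UNIV. (F1 (g i) x)\<^sup>2) = 0"
    if g: "\<And>i. g i \<in> Basis" for g :: "'n::finite \<Rightarrow> (real^'m) \<times> (real^'k)"
  proof -
    show "continuous_on UNIV (\<lambda>x. ?H x * (\<Sum>i\<in>UNIV. (F1 (g i) x)\<^sup>2))"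
      by (rule continuous_on_mult[OF cont_h ce[of g, OF g ez_Basis]])
    show "pd b (\<lambda>x. ?H x * (\<Sum>i\<in>UNIV. (F1 (g i) x)\<^sup>2)) (?w1 (\<lambda>x. \<Sum>i\<in>UNIV. (F1 (g i) x)\<^sup>2) g b)" if "b \<in> Basis" for b
      by (rule pd_mult[OF pd_h[OF that] pe[of g, OF g that]])
    show "continuous_on UNIV (?w1 (\<lambda>x. \<Sum>i\<in>UNIV. (F1 (g i) x)\<^sup>2) g b)" if "b \<in> Basis" for b
      by (intro continuous_on_add continuous_on_mult[OF cont_hgrad ce[of g, OF g ez_Basis]] continuous_on_mult[OF cont_h ce'[of g, OF g that]])
    show "?H x * (\<Sum>i\<in>UNIV. (F1 (g i) x)\<^sup>2) = 0" if "x \<notin> {x. tau \<alpha> x \<le> T}" for x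
      using h_zero[OF that] by simp
  qed
  let ?B = "\<lambda>x. 2 * (\<alpha> + 1) * tau \<alpha> x * ?H' x * e1 x + 2 * ?H x * s1 x + Q * ?H x * e1 x"
  have B: "integrable lborel ?B" "(LINT x|lborel. ?B x) = 0"
  proof -
    note W = w[of "ez :: 'm \<Rightarrow> _", OF ez_Basis]
    have eq: "dil \<alpha> (?w1 (\<lambda>x. \<Sum>i\<in>UNIV. (F1 (ez i) x)\<^sup>2) (ez :: 'm \<Rightarrow> _)) x + Q * (?H x * (\<Sum>i\<in>UNIV. (F1 (ez i) x)\<^sup>2)) = ?B x" for x
      unfolding dil_mult de dil_hgrad e1_def s1_def by (simp add: algebra_simps)
    note I = integral_dilation_one[OF W(1,2,3) compact_tau_le[OF \<alpha>, of T] W(4), where \<alpha>=\<alpha>, folded Q_def]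
    show "integrable lborel ?B" by (rule I(1)[unfolded eq]) auto
    show "(LINT x|lborel. ?B x) = 0" by (rule I(2)[unfolded eq]) auto
  qed
  let ?C = "\<lambda>x. zpow (2 * \<alpha>) x * (2 * (\<alpha> + 1) * tau \<alpha> x * ?H' x * e2 x + 2 * ?H x * s2 x + (Q + 2 * \<alpha>) * ?H x * e2 x)"
  have C: "integrable lborel ?C" "(LINT x|lborel. ?C x) = 0"
  proof -
    note W = w[of "es :: 'k \<Rightarrow> _", OF es_Basis]
    have a: "2 * \<alpha> > 0" using \<alpha> by simp
    have eq: "zpow (2 * \<alpha>) x * (dil \<alpha> (?w1 (\<lambda>x. \<Sum>i\<in>UNIV. (F1 (es i) x)\<^sup>2) (es :: 'k \<Rightarrow> _)) x + (Q + 2 * \<alpha>) * (?H x * (\<Sum>i\<in>UNIV. (F1 (es i) x)\<^sup>2))) = ?C x" for x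
      unfolding dil_mult de dil_hgrad e2_def s2_def by (simp add: algebra_simps)
    note I = integral_dilation_zpow[OF a W(1,2,3) compact_tau_le[OF \<alpha>, of T] W(4), where \<alpha>=\<alpha>, folded Q_def]
    show "integrable lborel ?C" by (rule I(1)[unfolded eq]) auto
    show "(LINT x|lborel. ?C x) = 0" by (rule I(2)[unfolded eq]) auto
  qed
  \<comment> \<open>\<open>?B / 2\<close> and \<open>?C / 8\<close> cancel \<open>s1\<close> and
    \<open>s2\<close>. The factor 1/8 is 1/2 times the 1/4 in the squared coefficient.\<close>
  have eq: "h (tau \<alpha> x) * dil \<alpha> F1 x * Bop \<alpha> F2 x
      + 2 * (\<alpha> + 1) * h' (tau \<alpha> x) * zpow (2 * \<alpha>) x * (dil \<alpha> F1 x)\<^sup>2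
      + ((1 - Q / 2) * h (tau \<alpha> x) - (\<alpha> + 1) * tau \<alpha> x * h' (tau \<alpha> x)) * gradsq \<alpha> F1 x
      = ?A x - ((1/2) * ?B x + (1/8) * ?C x)" for x
  proof -
    have g: "gradsq \<alpha> F1 x = e1 x + zpow (2 * \<alpha>) x / 4 * e2 x"
      by (simp add: gradsq_def e1_def e2_def gweight_sq)
    show ?thesis unfolding A_eq gweight_sq g by (simp add: field_simps)
  qed
  have BC: "integrable lborel (\<lambda>x. (1/2) * ?B x + (1/8) * ?C x)"
    by (rule Bochner_Integration.integrable_add[OF integrable_mult_right[OF B(1)] integrable_mult_right[OF C(1)]])
  have BC0: "(LINT x|lborel. (1/2) * ?B x + (1/8) * ?C x) = 0"
    using Bochner_Integration.integral_add[OF integrable_mult_right[OF B(1), of "1/2"] integrable_mult_right[OF C(1), of "1/8"]] B(2) C(2) by simp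
  show "(LINT x|lborel. h (tau \<alpha> x) * dil \<alpha> F1 x * Bop \<alpha> F2 x
      + 2 * (\<alpha> + 1) * h' (tau \<alpha> x) * zpow (2 * \<alpha>) x * (dil \<alpha> F1 x)\<^sup>2
      + ((1 - hom_dim TYPE('m) TYPE('k) \<alpha> / 2) * h (tau \<alpha> x) - (\<alpha> + 1) * tau \<alpha> x * h' (tau \<alpha> x)) * gradsq \<alpha> F1 x) = 0"
    unfolding Q_def[symmetric] eq using Bochner_Integration.integral_diff[OF A(1) BC] A(2) BC0 by simp
  show "integrable lborel (\<lambda>x. h (tau \<alpha> x) * dil \<alpha> F1 x * Bop \<alpha> F2 x
      + 2 * (\<alpha> + 1) * h' (tau \<alpha> x) * zpow (2 * \<alpha>) x * (dil \<alpha> F1 x)\<^sup>2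
      + ((1 - hom_dim TYPE('m) TYPE('k) \<alpha> / 2) * h (tau \<alpha> x) - (\<alpha> + 1) * tau \<alpha> x * h' (tau \<alpha> x)) * gradsq \<alpha> F1 x)"
    unfolding Q_def[symmetric] eq using A(1) BC by (rule Bochner_Integration.integrable_diff)
qed

end

lemma integral_uniform_limit:
  fixes I :: "'a::euclidean_space \<Rightarrow> real"
  assumes K: "compact K" and lim: "uniform_limit K In I sequentially"
    and cn: "\<And>n. continuous_on K (In n)"
    and zn: "\<And>n x. x \<notin> K \<Longrightarrow> In n x = 0" and z: "\<And>x. x \<notin> K \<Longrightarrow> I x = 0"
  shows "(\<lambda>n. LINT x|lborel. In n x) \<longlonglongrightarrow> (LINT x|lborel. I x)"
proof -
  have c: "continuous_on K I"
    by (rule uniform_limit_theorem[OF _ lim]) (auto simp: cn)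
  note intK = integrable_on_compact_support[OF K]
  define m where "m = measure lborel K"
  have m: "m \<ge> 0" by (simp add: m_def)
  show ?thesis
  proof (rule tendstoI)
    fix e :: real assume e: "e > 0"
    define d where "d = e / (m + 1)"
    have d: "d > 0" "d * m < e" using e m by (auto simp: d_def field_simps)
    show "\<forall>\<^sub>F n in sequentially. dist (LINT x|lborel. In n x) (LINT x|lborel. I x) < e"
      using uniform_limitD[OF lim d(1)]
    proof eventually_elim
      case (elim n)
      have "dist (LINT x|lborel. In n x) (LINT x|lborel. I x) = \<bar>LINT x|lborel. In n x - I x\<bar>"
        using Bochner_Integration.integral_diff[OF intK[OF cn zn] intK[OF c z], of n] by (simp add: dist_real_def)
      also have "\<dots> \<le> (LINT x|lborel. d * indicator K x)"
      proof (rule order_trans[OF integral_abs_bound integral_mono])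
        show "integrable lborel (\<lambda>x. \<bar>In n x - I x\<bar>)"
          by (intro integrable_abs Bochner_Integration.integrable_diff intK c cn z zn)
        show "integrable lborel (\<lambda>x. d * indicator K x)"
          using borel_integrable_compact[OF K, of "\<lambda>_. d"] by (simp add: mult.commute)
        show "\<bar>In n x - I x\<bar> \<le> d * indicator K x" for x
          using elim z[of x] zn[of x n] by (cases "x \<in> K") (auto simp: dist_real_def less_imp_le)
      qed
      also have "\<dots> = d * m" by (simp add: m_def)
      finally show ?case using d(2) by linarith
    qed
  qed
qed

lemma integral_uniform_limit_zero:
  fixes I :: "'a::euclidean_space \<Rightarrow> real"
  assumes "compact K" "uniform_limit K In I sequentially" "\<And>n. continuous_on K (In n)"
    and "\<And>n x. x \<notin> K \<Longrightarrow> In n x = 0" "\<And>x. x \<notin> K \<Longrightarrow> I x = 0"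
    and int: "\<And>n. (LINT x|lborel. In n x) = 0"
  shows "(LINT x|lborel. I x) = 0"
  using integral_uniform_limit[OF assms(1-5)] unfolding int by (simp add: LIMSEQ_const_iff)

locale radial_cutoff0 = radial_cutoff +
  fixes t0 :: real
  assumes ht0: "\<And>t. t < t0 \<Longrightarrow> h t = 0"
begin

lemma h'_zero:
  assumes "t < t0 \<or> t > T"
  shows "h' t = 0"
proof -
  have "((\<lambda>t. 0) has_real_derivative 0) (at t)" by simp
  moreover have "open ({..<t0} \<union> {T<..})" by auto
  moreover have "t \<in> {..<t0} \<union> {T<..}" using assms by auto
  ultimately have "(h has_real_derivative 0) (at t)"
    by (rule has_field_derivative_transform_within_open) (auto simp: ht0 hT)
  then show ?thesis using h DERIV_unique by blast
qed

lemma h_zero': "t < t0 \<or> t > T \<Longrightarrow> h t = 0"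
  using ht0 hT by auto

end

section \<open>Integral identities for solutions\<close>

text \<open>
  In \<open>approx\<close> the defect of the equation is small even after multiplication by the full
  derivatives \<open>\<partial>\<^bsub>\<sigma>\<^esub> F\<close>, which near \<open>z = 0\<close> are not controlled by the fields \<open>X\<^sub>j\<close>; the identity
  obtained from the dilation field needs this.
\<close>

locale grushin_solution =
  fixes \<alpha> \<kappa> :: real and \<Omega> :: "((real^'m::finite) \<times> (real^'k::finite)) set"
    and f :: "(real^'m) \<times> (real^'k) \<Rightarrow> real" and U :: "'m \<Rightarrow> (real^'m) \<times> (real^'k) \<Rightarrow> real" and V :: "'k \<Rightarrow> (real^'m) \<times> (real^'k) \<Rightarrow> real"
  assumes \<alpha>: "\<alpha> > 0" and \<Omega>: "open \<Omega>" and cf: "continuous_on \<Omega> f" and cU: "\<And>i. continuous_on \<Omega> (U i)" and cV: "\<And>j. continuous_on \<Omega> (V j)"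
    and approx: "\<And>K e. \<lbrakk>compact K; K \<subseteq> \<Omega>; e > 0\<rbrakk> \<Longrightarrow> \<exists>F F1 F2. C2 F F1 F2 \<and> (\<forall>x\<in>K. \<bar>F x - f x\<bar> \<le> e \<and>
      (\<forall>i. \<bar>F1 (ez i) x - U i x\<bar> \<le> e) \<and> (\<forall>j. \<bar>gweight \<alpha> x * F1 (es j) x - V j x\<bar> \<le> e) \<and>
      \<bar>Bop \<alpha> F2 x + \<kappa>\<^sup>2 * F x\<bar> * (1 + (\<Sum>j\<in>UNIV. \<bar>F1 (es j) x\<bar>)) \<le> e)"
begin

text \<open>
  \<open>dd\<close> is the squared horizontal gradient of \<open>f\<close> and \<open>qq\<close> is \<open>|z|\<^sup>\<alpha> Z f\<close>: the weight \<open>|z|\<^sup>\<alpha>\<close> makes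
  the \<open>\<sigma>\<close>-part of \<open>Z f\<close> expressible by the continuous functions \<open>V j\<close>.
\<close>

definition dd :: "(real^'m) \<times> (real^'k) \<Rightarrow> real" where
  "dd x = (\<Sum>i\<in>UNIV. (U i x)\<^sup>2) + (\<Sum>j\<in>UNIV. (V j x)\<^sup>2)"

definition qq :: "(real^'m) \<times> (real^'k) \<Rightarrow> real" where
  "qq x = zpow \<alpha> x * (\<Sum>i\<in>UNIV. fst x $ i * U i x) + 2 * (\<alpha> + 1) * (\<Sum>j\<in>UNIV. snd x $ j * V j x)"

lemma cont_dd: "continuous_on \<Omega> dd"
  unfolding dd_def by (intro continuous_on_add continuous_on_sum continuous_on_power cU cV)

lemma cont_qq: "continuous_on \<Omega> qq"
  unfolding qq_def
  by (intro continuous_on_add continuous_on_mult continuous_on_const continuous_on_sum continuous_zpow[OF \<alpha>] continuous_fst_nth continuous_snd_nth cU cV)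

text \<open>Z F_n itself need not converge near z = 0; only |z|^\<alpha> Z F_n does. The one place
  where Z F_n stands without weight is its product with the defect of the equation, and that product
  tends to 0.\<close>

lemma approx_sequence:
  assumes K: "compact K" "K \<subseteq> \<Omega>"
  obtains F F1 F2 where "\<And>n. C2 (F n) (F1 n) (F2 n)"
    "uniform_limit K F f sequentially"
    "uniform_limit K (\<lambda>n x. zpow \<alpha> x * dil \<alpha> (F1 n) x) qq sequentially"
    "uniform_limit K (\<lambda>n. gradsq \<alpha> (F1 n)) dd sequentially"
    "uniform_limit K (\<lambda>n x. Bop \<alpha> (F2 n) x + \<kappa>\<^sup>2 * F n x) (\<lambda>x. 0) sequentially"
    "uniform_limit K (\<lambda>n x. dil \<alpha> (F1 n) x * (Bop \<alpha> (F2 n) x + \<kappa>\<^sup>2 * F n x)) (\<lambda>x. 0) sequentially"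
proof -
  define e where "e = (\<lambda>n. 1 / real (Suc n))"
  have e: "e n > 0" "e n \<le> 1" for n by (auto simp: e_def)
  have e0: "e \<longlonglongrightarrow> 0" unfolding e_def using LIMSEQ_Suc[OF lim_1_over_n] by simp
  have "\<forall>n. \<exists>F F1 F2. C2 F F1 F2 \<and> (\<forall>x\<in>K. \<bar>F x - f x\<bar> \<le> e n \<and>
      (\<forall>i. \<bar>F1 (ez i) x - U i x\<bar> \<le> e n) \<and> (\<forall>j. \<bar>gweight \<alpha> x * F1 (es j) x - V j x\<bar> \<le> e n) \<and>
      \<bar>Bop \<alpha> F2 x + \<kappa>\<^sup>2 * F x\<bar> * (1 + (\<Sum>j\<in>UNIV. \<bar>F1 (es j) x\<bar>)) \<le> e n)"
    using approx[OF K e(1)] by blast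
  from choice[OF this] obtain F where "\<forall>n. \<exists>F1 F2. C2 (F n) F1 F2 \<and> (\<forall>x\<in>K. \<bar>F n x - f x\<bar> \<le> e n \<and>
      (\<forall>i. \<bar>F1 (ez i) x - U i x\<bar> \<le> e n) \<and> (\<forall>j. \<bar>gweight \<alpha> x * F1 (es j) x - V j x\<bar> \<le> e n) \<and>
      \<bar>Bop \<alpha> F2 x + \<kappa>\<^sup>2 * F n x\<bar> * (1 + (\<Sum>j\<in>UNIV. \<bar>F1 (es j) x\<bar>)) \<le> e n)" ..
  from choice[OF this] obtain F1 where "\<forall>n. \<exists>F2. C2 (F n) (F1 n) F2 \<and> (\<forall>x\<in>K. \<bar>F n x - f x\<bar> \<le> e n \<and>
      (\<forall>i. \<bar>F1 n (ez i) x - U i x\<bar> \<le> e n) \<and> (\<forall>j. \<bar>gweight \<alpha> x * F1 n (es j) x - V j x\<bar> \<le> e n) \<and>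
      \<bar>Bop \<alpha> F2 x + \<kappa>\<^sup>2 * F n x\<bar> * (1 + (\<Sum>j\<in>UNIV. \<bar>F1 n (es j) x\<bar>)) \<le> e n)" ..
  from choice[OF this] obtain F2 where "\<forall>n. C2 (F n) (F1 n) (F2 n) \<and> (\<forall>x\<in>K. \<bar>F n x - f x\<bar> \<le> e n \<and>
      (\<forall>i. \<bar>F1 n (ez i) x - U i x\<bar> \<le> e n) \<and> (\<forall>j. \<bar>gweight \<alpha> x * F1 n (es j) x - V j x\<bar> \<le> e n) \<and>
      \<bar>Bop \<alpha> (F2 n) x + \<kappa>\<^sup>2 * F n x\<bar> * (1 + (\<Sum>j\<in>UNIV. \<bar>F1 n (es j) x\<bar>)) \<le> e n)" ..
  then have C2: "C2 (F n) (F1 n) (F2 n)" and aF: "x \<in> K \<Longrightarrow> \<bar>F n x - f x\<bar> \<le> e n"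
    and aU: "x \<in> K \<Longrightarrow> \<bar>F1 n (ez i) x - U i x\<bar> \<le> e n" and aV: "x \<in> K \<Longrightarrow> \<bar>gweight \<alpha> x * F1 n (es j) x - V j x\<bar> \<le> e n"
    and aR: "x \<in> K \<Longrightarrow> \<bar>Bop \<alpha> (F2 n) x + \<kappa>\<^sup>2 * F n x\<bar> * (1 + (\<Sum>j\<in>UNIV. \<bar>F1 n (es j) x\<bar>)) \<le> e n" for n x i j
    by blast+
  have ul: "uniform_limit K G g sequentially" if "\<And>n x. x \<in> K \<Longrightarrow> \<bar>G n x - g x\<bar> \<le> C * e n" for G and g :: "(real^'m) \<times> (real^'k) \<Rightarrow> real" and C
  proof (rule uniform_limitI)
    fix \<epsilon> :: real assume \<epsilon>: "\<epsilon> > 0"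
    have "(\<lambda>n. C * e n) \<longlonglongrightarrow> C * 0" by (intro tendsto_intros e0)
    then have "\<forall>\<^sub>F n in sequentially. C * e n < \<epsilon>" using \<epsilon> by (auto intro: order_tendstoD)
    then show "\<forall>\<^sub>F n in sequentially. \<forall>x\<in>K. dist (G n x) (g x) < \<epsilon>"
    proof eventually_elim
      case (elim n)
      then show ?case using that[of _ n] by (force simp: dist_real_def)
    qed
  qed
  have bdd: "bounded (g ` K)" if "continuous_on K g" for g :: "(real^'m) \<times> (real^'k) \<Rightarrow> real"
    using compact_continuous_image[OF that K(1)] by (rule compact_imp_bounded)
  have cK: "continuous_on K f" "continuous_on K (U i)" "continuous_on K (V j)" for i j
    using K(2) cf cU cV by (auto intro: continuous_on_subset)
  have uF: "uniform_limit K F f sequentially" by (rule ul[where C=1]) (simp add: aF)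
  have uU: "uniform_limit K (\<lambda>n. F1 n (ez i)) (U i) sequentially" for i by (rule ul[where C=1]) (simp add: aU)
  have uV: "uniform_limit K (\<lambda>n x. gweight \<alpha> x * F1 n (es j) x) (V j) sequentially" for j by (rule ul[where C=1]) (simp add: aV)
  have uc: "uniform_limit K (\<lambda>n::nat. g) g sequentially" for g :: "(real^'m) \<times> (real^'k) \<Rightarrow> real" by (rule uniform_limit_const)
  have uniform_limit_KK_cmult: "uniform_limit K (\<lambda>n x. g x * G n x) (\<lambda>x. g x * l x) sequentially"
    if "continuous_on K g" "continuous_on K l" "uniform_limit K G l sequentially" for g l :: "(real^'m) \<times> (real^'k) \<Rightarrow> real" and G
    by (rule uniform_lim_mult[OF uc that(3) bdd[OF that(1)] bdd[OF that(2)]])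
  have usq: "uniform_limit K (\<lambda>n x. (G n x)\<^sup>2) (\<lambda>x. (l x)\<^sup>2) sequentially"
    if "continuous_on K l" "uniform_limit K G l sequentially" for l :: "(real^'m) \<times> (real^'k) \<Rightarrow> real" and G
    unfolding power2_eq_square by (rule uniform_lim_mult[OF that(2) that(2) bdd[OF that(1)] bdd[OF that(1)]])
  have usum: "uniform_limit K (\<lambda>n x. \<Sum>i\<in>UNIV. G i n x) (\<lambda>x. \<Sum>i\<in>UNIV. l i x) sequentially"
    if "\<And>i. uniform_limit K (G i) (l i) sequentially" for l :: "'i::finite \<Rightarrow> (real^'m) \<times> (real^'k) \<Rightarrow> real" and G
  proof -
    have "uniform_limit K (\<lambda>n x. \<Sum>i\<in>I. G i n x) (\<lambda>x. \<Sum>i\<in>I. l i x) sequentially" if "finite I" for I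
      using that by (induction I rule: finite_induct) (simp_all add: uniform_limit_const uniform_limit_add \<open>\<And>i. uniform_limit K (G i) (l i) sequentially\<close>)
    then show ?thesis by simp
  qed
  have uq: "uniform_limit K (\<lambda>n x. zpow \<alpha> x * dil \<alpha> (F1 n) x) qq sequentially"
  proof -
    have eq: "zpow \<alpha> x * dil \<alpha> (F1 n) x = zpow \<alpha> x * (\<Sum>i\<in>UNIV. fst x $ i * F1 n (ez i) x)
       + (2 * (\<alpha> + 1)) * (\<Sum>j\<in>UNIV. snd x $ j * (gweight \<alpha> x * F1 n (es j) x))" for n x
    proof -
      have "(\<Sum>j\<in>UNIV. snd x $ j * (gweight \<alpha> x * F1 n (es j) x)) = zpow \<alpha> x / 2 * (\<Sum>j\<in>UNIV. snd x $ j * F1 n (es j) x)"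
        unfolding sum_distrib_left gweight_def zpow_def by (simp add: mult_ac)
      then show ?thesis unfolding dil_def by (simp add: algebra_simps)
    qed
    show ?thesis unfolding eq qq_def
      by (intro uniform_limit_add uniform_limit_KK_cmult[OF continuous_zpow[OF \<alpha>]] uniform_limit_KK_cmult[OF continuous_on_const] usum uniform_limit_KK_cmult[OF continuous_fst_nth] uniform_limit_KK_cmult[OF continuous_snd_nth] uU uV
        continuous_on_sum continuous_on_mult continuous_fst_nth continuous_snd_nth cK)
  qed
  have ud: "uniform_limit K (\<lambda>n. gradsq \<alpha> (F1 n)) dd sequentially"
  proof -
    have eq: "gradsq \<alpha> (F1 n) = (\<lambda>x. (\<Sum>i\<in>UNIV. (F1 n (ez i) x)\<^sup>2) + (\<Sum>j\<in>UNIV. (gweight \<alpha> x * F1 n (es j) x)\<^sup>2))" for n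
      unfolding gradsq_def by (simp add: sum_distrib_left power_mult_distrib)
    show ?thesis unfolding eq dd_def
      by (intro uniform_limit_add usum usq uU uV cK)
  qed
  have r1: "\<bar>Bop \<alpha> (F2 n) x + \<kappa>\<^sup>2 * F n x\<bar> \<le> e n" if "x \<in> K" for n x
  proof -
    have "\<bar>Bop \<alpha> (F2 n) x + \<kappa>\<^sup>2 * F n x\<bar> * 1 \<le> \<bar>Bop \<alpha> (F2 n) x + \<kappa>\<^sup>2 * F n x\<bar> * (1 + (\<Sum>j\<in>UNIV. \<bar>F1 n (es j) x\<bar>))"
      by (intro mult_left_mono) (auto intro: sum_nonneg)
    from order_trans[OF this aR[OF that]] show ?thesis by simp
  qed
  have ur: "uniform_limit K (\<lambda>n x. Bop \<alpha> (F2 n) x + \<kappa>\<^sup>2 * F n x) (\<lambda>x. 0) sequentially"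
    by (rule ul[where C=1]) (simp add: r1)
  obtain M where M: "M \<ge> 0" "\<And>x. x \<in> K \<Longrightarrow> norm x \<le> M" "\<And>x i. x \<in> K \<Longrightarrow> \<bar>U i x\<bar> \<le> M"
  proof -
    define s where "s = (\<lambda>x. norm x + (\<Sum>i\<in>UNIV. \<bar>U i x\<bar>))"
    have "continuous_on K s" unfolding s_def by (intro continuous_intros cK)
    from bdd[OF this] obtain M where M: "\<forall>y\<in>s ` K. norm y \<le> M" unfolding bounded_iff by auto
    have *: "s y \<le> max M 0" if "y \<in> K" for y using M that by fastforce
    have sU: "\<bar>U i y\<bar> \<le> (\<Sum>i\<in>UNIV. \<bar>U i y\<bar>)" for i y by (rule member_le_sum) auto
    have sU0: "(\<Sum>i\<in>UNIV. \<bar>U i y\<bar>) \<ge> 0" for y by (rule sum_nonneg) auto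
    show ?thesis
    proof (rule that[of "max M 0"])
      fix y i assume y: "y \<in> K"
      show "norm y \<le> max M 0" "\<bar>U i y\<bar> \<le> max M 0"
        using *[OF y] sU[of i y] sU0[of y] norm_ge_zero[of y] unfolding s_def by linarith+
    qed simp
  qed
  have ud2: "uniform_limit K (\<lambda>n x. dil \<alpha> (F1 n) x * (Bop \<alpha> (F2 n) x + \<kappa>\<^sup>2 * F n x)) (\<lambda>x. 0) sequentially"
  proof (rule ul)
    fix n x assume x: "x \<in> K"
    define S where "S = (\<Sum>j\<in>UNIV. \<bar>F1 n (es j) x\<bar>)"
    have S0: "S \<ge> 0" unfolding S_def by (rule sum_nonneg) auto
    \<comment> \<open>With this \<open>c\<close> one has |Z F| \<le> c (1 + S), and 1 + S is exactly
      the factor by which the defect is multiplied in \<open>approx\<close>.\<close>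
    define c where "c = real CARD('m) * (M * (M + 1)) + (\<alpha> + 1) * M"
    have "\<bar>\<Sum>i\<in>UNIV. fst x $ i * F1 n (ez i) x\<bar> \<le> (\<Sum>i\<in>(UNIV::'m set). M * (M + 1))"
    proof (rule order_trans[OF sum_abs sum_mono])
      fix i :: 'm
      have "\<bar>fst x $ i\<bar> \<le> M" using component_le_norm_cart[of "fst x" i] norm_fst_le[where x="fst x" and y="snd x", unfolded prod.collapse] M(2)[OF x] by linarith
      moreover have "\<bar>F1 n (ez i) x\<bar> \<le> M + 1" using aU[OF x, of n i] M(3)[OF x, of i] e(2)[of n] by linarith
      ultimately show "\<bar>fst x $ i * F1 n (ez i) x\<bar> \<le> M * (M + 1)"
        unfolding abs_mult using M(1) by (intro mult_mono) auto
    qed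
    moreover have "\<bar>\<Sum>j\<in>UNIV. snd x $ j * F1 n (es j) x\<bar> \<le> M * S" unfolding S_def sum_distrib_left
    proof (rule order_trans[OF sum_abs sum_mono])
      fix j :: 'k
      have "\<bar>snd x $ j\<bar> \<le> M" using component_le_norm_cart[of "snd x" j] norm_snd_le[where x="fst x" and y="snd x", unfolded prod.collapse] M(2)[OF x] by linarith
      then show "\<bar>snd x $ j * F1 n (es j) x\<bar> \<le> M * \<bar>F1 n (es j) x\<bar>"
        unfolding abs_mult by (rule mult_right_mono) simp
    qed
    ultimately have "\<bar>dil \<alpha> (F1 n) x\<bar> \<le> real CARD('m) * (M * (M + 1)) + (\<alpha> + 1) * (M * S)"
    proof -
      assume 1: "\<bar>\<Sum>i\<in>UNIV. fst x $ i * F1 n (ez i) x\<bar> \<le> (\<Sum>i\<in>(UNIV::'m set). M * (M + 1))"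
        and 2: "\<bar>\<Sum>j\<in>UNIV. snd x $ j * F1 n (es j) x\<bar> \<le> M * S"
      have "\<bar>dil \<alpha> (F1 n) x\<bar> \<le> \<bar>\<Sum>i\<in>UNIV. fst x $ i * F1 n (ez i) x\<bar> + (\<alpha> + 1) * \<bar>\<Sum>j\<in>UNIV. snd x $ j * F1 n (es j) x\<bar>"
        unfolding dil_def using \<alpha> by (intro order_trans[OF abs_triangle_ineq]) (simp add: abs_mult)
      also have "\<dots> \<le> real CARD('m) * (M * (M + 1)) + (\<alpha> + 1) * (M * S)"
        using 1 2 \<alpha> by (intro add_mono mult_left_mono) auto
      finally show ?thesis .
    qed
    also have "\<dots> \<le> c * (1 + S)"
    proof -
      have "0 \<le> real CARD('m) * (M * (M + 1)) * S + (\<alpha> + 1) * M" using M(1) S0 \<alpha> by simp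
      then show ?thesis unfolding c_def by (simp add: algebra_simps)
    qed
    finally have D: "\<bar>dil \<alpha> (F1 n) x\<bar> \<le> c * (1 + S)" .
    have c0: "c \<ge> 0" unfolding c_def using M(1) \<alpha> by simp
    have "\<bar>dil \<alpha> (F1 n) x * (Bop \<alpha> (F2 n) x + \<kappa>\<^sup>2 * F n x)\<bar> \<le> c * (1 + S) * \<bar>Bop \<alpha> (F2 n) x + \<kappa>\<^sup>2 * F n x\<bar>"
      unfolding abs_mult using D by (rule mult_right_mono) simp
    also have "\<dots> = c * (\<bar>Bop \<alpha> (F2 n) x + \<kappa>\<^sup>2 * F n x\<bar> * (1 + S))" by simp
    also have "\<dots> \<le> c * e n" using aR[OF x, of n] c0 unfolding S_def by (intro mult_left_mono) auto
    finally show "\<bar>dil \<alpha> (F1 n) x * (Bop \<alpha> (F2 n) x + \<kappa>\<^sup>2 * F n x) - 0\<bar> \<le> (real CARD('m) * (M * (M + 1)) + (\<alpha> + 1) * M) * e n"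
      by (simp add: c_def)
  qed
  show ?thesis by (rule that[OF C2 uF uq ud ur ud2])
qed

end

lemma continuous_C2_ops:
  fixes F :: "(real^'m::finite) \<times> (real^'k::finite) \<Rightarrow> real"
  assumes "C2 F F1 F2" "\<alpha> > 0"
  shows "continuous_on S F" "continuous_on S (dil \<alpha> F1)" "continuous_on S (gradsq \<alpha> F1)" "continuous_on S (Bop \<alpha> F2)"
proof -
  note F = C2_D[OF assms(1)]
  note [continuous_intros] = continuous_fst_nth continuous_snd_nth continuous_gweight[OF assms(2)]
    continuous_on_subset[OF F(1) subset_UNIV] continuous_on_subset[OF F(3)[OF ez_Basis] subset_UNIV] continuous_on_subset[OF F(3)[OF es_Basis] subset_UNIV]
    continuous_on_subset[OF F(5)[OF ez_Basis ez_Basis] subset_UNIV] continuous_on_subset[OF F(5)[OF es_Basis es_Basis] subset_UNIV]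
  show "continuous_on S F" "continuous_on S (dil \<alpha> F1)" "continuous_on S (gradsq \<alpha> F1)" "continuous_on S (Bop \<alpha> F2)"
    unfolding dil_def gradsq_def Bop_def by (intro continuous_intros)+
qed

locale solution_cutoff = grushin_solution \<alpha> \<kappa> \<Omega> f U V + radial_cutoff0 \<alpha> h h' T t0
  for \<alpha> \<kappa> \<Omega> and f :: "(real^'m::finite) \<times> (real^'k::finite) \<Rightarrow> real" and U V h h' T t0 +
  assumes sub: "{x. t0 \<le> tau \<alpha> x \<and> tau \<alpha> x \<le> T} \<subseteq> \<Omega>"
begin

abbreviation "KK \<equiv> {x :: (real^'m) \<times> (real^'k). t0 \<le> tau \<alpha> x \<and> tau \<alpha> x \<le> T}"

lemma KK_compact: "compact KK"
proof -
  have "KK = {x. tau \<alpha> x \<le> T} \<inter> {x. t0 \<le> tau \<alpha> x}" by auto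
  moreover have "closed {x::(real^'m) \<times> (real^'k). t0 \<le> tau \<alpha> x}"
    by (intro closed_Collect_le continuous_on_const continuous_tau \<alpha>)
  ultimately show ?thesis using compact_Int_closed[OF compact_tau_le[OF \<alpha>]] by simp
qed

lemma H_zero: "x \<notin> KK \<Longrightarrow> h (tau \<alpha> x) = 0" "x \<notin> KK \<Longrightarrow> h' (tau \<alpha> x) = 0"
  by (auto intro!: h_zero' h'_zero)

lemma bdd: "continuous_on KK g \<Longrightarrow> bounded (g ` KK)" for g :: "(real^'m) \<times> (real^'k) \<Rightarrow> real"
  using compact_continuous_image[OF _ KK_compact] compact_imp_bounded by blast

lemma continuous_on_KK: "continuous_on KK f" "continuous_on KK dd" "continuous_on KK qq"
  using sub cf cont_dd cont_qq by (auto intro: continuous_on_subset)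

lemma uniform_limit_KK_cmult: "continuous_on KK g \<Longrightarrow> continuous_on KK l \<Longrightarrow> uniform_limit KK G l sequentially \<Longrightarrow>
   uniform_limit KK (\<lambda>n x. g x * G n x) (\<lambda>x. g x * l x) sequentially" for g l :: "(real^'m) \<times> (real^'k) \<Rightarrow> real"
  by (rule uniform_lim_mult[OF uniform_limit_const _ bdd bdd])

lemma uniform_limit_KK_mult: "continuous_on KK g \<Longrightarrow> continuous_on KK l \<Longrightarrow> uniform_limit KK G g sequentially \<Longrightarrow> uniform_limit KK L l sequentially \<Longrightarrow>
   uniform_limit KK (\<lambda>n x. G n x * L n x) (\<lambda>x. g x * l x) sequentially" for g l :: "(real^'m) \<times> (real^'k) \<Rightarrow> real"
  by (rule uniform_lim_mult[OF _ _ bdd bdd])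

lemma solution_energy_identity:
  "(LINT x|lborel. h (tau \<alpha> x) * dd x + 2 * (\<alpha> + 1) * h' (tau \<alpha> x) * zpow \<alpha> x * qq x * f x - \<kappa>\<^sup>2 * h (tau \<alpha> x) * (f x)\<^sup>2) = 0"
proof -
  obtain F F1 F2 where F: "\<And>n. C2 (F n) (F1 n) (F2 n)"
    "uniform_limit KK F f sequentially"
    "uniform_limit KK (\<lambda>n x. zpow \<alpha> x * dil \<alpha> (F1 n) x) qq sequentially"
    "uniform_limit KK (\<lambda>n. gradsq \<alpha> (F1 n)) dd sequentially"
    "uniform_limit KK (\<lambda>n x. Bop \<alpha> (F2 n) x + \<kappa>\<^sup>2 * F n x) (\<lambda>x. 0) sequentially"
    "uniform_limit KK (\<lambda>n x. dil \<alpha> (F1 n) x * (Bop \<alpha> (F2 n) x + \<kappa>\<^sup>2 * F n x)) (\<lambda>x. 0) sequentially"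
    using approx_sequence[OF KK_compact sub] by blast
  have z2: "zpow (2 * \<alpha>) x = zpow \<alpha> x * zpow \<alpha> x" for x :: "(real^'m) \<times> (real^'k)"
    by (simp add: zpow_def powr_add[symmetric])
  let ?I = "\<lambda>n x. h (tau \<alpha> x) * gradsq \<alpha> (F1 n) x + 2 * (\<alpha> + 1) * h' (tau \<alpha> x) * zpow (2 * \<alpha>) x * dil \<alpha> (F1 n) x * F n x + h (tau \<alpha> x) * F n x * Bop \<alpha> (F2 n) x"
  \<comment> \<open>The weight |z|^(2\<alpha>) is split so that one factor |z|^\<alpha> accompanies
    Z F, and the operator is rewritten as defect minus \<kappa>^2 F. Every group now has a uniform
    limit.\<close>
  have eq: "?I n x = h (tau \<alpha> x) * gradsq \<alpha> (F1 n) x + (2 * (\<alpha> + 1) * h' (tau \<alpha> x) * zpow \<alpha> x) * ((zpow \<alpha> x * dil \<alpha> (F1 n) x) * F n x)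
     + h (tau \<alpha> x) * (F n x * (Bop \<alpha> (F2 n) x + \<kappa>\<^sup>2 * F n x)) - \<kappa>\<^sup>2 * h (tau \<alpha> x) * (F n x * F n x)" for n x
    unfolding z2 by (simp add: algebra_simps)
  have lim: "uniform_limit KK ?I (\<lambda>x. h (tau \<alpha> x) * dd x + (2 * (\<alpha> + 1) * h' (tau \<alpha> x) * zpow \<alpha> x) * (qq x * f x)
     + h (tau \<alpha> x) * (f x * 0) - \<kappa>\<^sup>2 * h (tau \<alpha> x) * (f x * f x)) sequentially"
    unfolding eq
    by (intro uniform_limit_add uniform_limit_minus uniform_limit_KK_cmult uniform_limit_KK_mult F continuous_on_mult continuous_on_const cont_h cont_h' continuous_zpow \<alpha> continuous_on_KK)
  have "(LINT x|lborel. h (tau \<alpha> x) * dd x + (2 * (\<alpha> + 1) * h' (tau \<alpha> x) * zpow \<alpha> x) * (qq x * f x)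
     + h (tau \<alpha> x) * (f x * 0) - \<kappa>\<^sup>2 * h (tau \<alpha> x) * (f x * f x)) = 0"
  proof (rule integral_uniform_limit_zero[OF KK_compact lim])
    show "continuous_on KK (?I n)" for n
      using \<alpha> by (intro continuous_on_add continuous_on_mult continuous_on_const cont_h cont_h' continuous_zpow continuous_C2_ops[OF F(1) \<alpha>]) auto
    show "(LINT x|lborel. ?I n x) = 0" for n by (rule cutoff_energy_identity[OF F(1)])
  qed (simp_all add: H_zero)
  then show ?thesis by (simp add: algebra_simps power2_eq_square)
qed

lemma solution_transport_identity:
  "(LINT x|lborel. 2 * h (tau \<alpha> x) * zpow \<alpha> x * f x * qq x
     + (2 * (\<alpha> + 1) * tau \<alpha> x * h' (tau \<alpha> x) + (hom_dim TYPE('m) TYPE('k) \<alpha> + 2 * \<alpha>) * h (tau \<alpha> x)) * zpow (2 * \<alpha>) x * (f x)\<^sup>2) = 0"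
proof -
  obtain F F1 F2 where F: "\<And>n. C2 (F n) (F1 n) (F2 n)"
    "uniform_limit KK F f sequentially"
    "uniform_limit KK (\<lambda>n x. zpow \<alpha> x * dil \<alpha> (F1 n) x) qq sequentially"
    using approx_sequence[OF KK_compact sub] by blast
  have z2: "zpow (2 * \<alpha>) x = zpow \<alpha> x * zpow \<alpha> x" for x :: "(real^'m) \<times> (real^'k)"
    by (simp add: zpow_def powr_add[symmetric])
  let ?Q = "hom_dim TYPE('m) TYPE('k) \<alpha> + 2 * \<alpha>"
  let ?I = "\<lambda>n x. zpow (2 * \<alpha>) x * (2 * h (tau \<alpha> x) * F n x * dil \<alpha> (F1 n) x
     + (2 * (\<alpha> + 1) * tau \<alpha> x * h' (tau \<alpha> x) + ?Q * h (tau \<alpha> x)) * (F n x)\<^sup>2)"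
  let ?c = "\<lambda>x. (2 * (\<alpha> + 1) * tau \<alpha> x * h' (tau \<alpha> x) + ?Q * h (tau \<alpha> x)) * zpow (2 * \<alpha>) x"
  have eq: "?I n x = (2 * h (tau \<alpha> x) * zpow \<alpha> x) * (F n x * (zpow \<alpha> x * dil \<alpha> (F1 n) x)) + ?c x * (F n x * F n x)" for n x
    unfolding z2 by (simp add: algebra_simps power2_eq_square)
  have a: "2 * \<alpha> > 0" using \<alpha> by simp
  have lim: "uniform_limit KK ?I (\<lambda>x. (2 * h (tau \<alpha> x) * zpow \<alpha> x) * (f x * qq x) + ?c x * (f x * f x)) sequentially"
    unfolding eq
    by (intro uniform_limit_add uniform_limit_KK_cmult uniform_limit_KK_mult F continuous_on_add continuous_on_mult continuous_on_const cont_h cont_h' continuous_zpow \<alpha> a continuous_tau continuous_on_KK)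
  have "(LINT x|lborel. (2 * h (tau \<alpha> x) * zpow \<alpha> x) * (f x * qq x) + ?c x * (f x * f x)) = 0"
  proof (rule integral_uniform_limit_zero[OF KK_compact lim])
    show "continuous_on KK (?I n)" for n
      by (intro continuous_on_add continuous_on_mult continuous_on_const continuous_on_power cont_h cont_h' continuous_zpow continuous_tau a \<alpha> continuous_C2_ops[OF F(1) \<alpha>])
    show "(LINT x|lborel. ?I n x) = 0" for n by (rule cutoff_transport_identity[OF F(1)])
  qed (simp_all add: H_zero)
  then show ?thesis by (simp add: algebra_simps power2_eq_square)
qed

text \<open>Inserting the equation into the dilation identity would leave -\<kappa>^2 h F Z F, which
  carries no weight at z = 0. Adding \<kappa>^2/2 times the mass identity before passing to the
  limit turns it into Z F times the defect, plus terms in F^2.\<close>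

lemma solution_dilation_identity:
  "(LINT x|lborel. \<kappa>\<^sup>2 / 2 * (2 * (\<alpha> + 1) * tau \<alpha> x * h' (tau \<alpha> x) + hom_dim TYPE('m) TYPE('k) \<alpha> * h (tau \<alpha> x)) * (f x)\<^sup>2
      + 2 * (\<alpha> + 1) * h' (tau \<alpha> x) * (qq x)\<^sup>2
      + ((1 - hom_dim TYPE('m) TYPE('k) \<alpha> / 2) * h (tau \<alpha> x) - (\<alpha> + 1) * tau \<alpha> x * h' (tau \<alpha> x)) * dd x) = 0"
proof -
  obtain F F1 F2 where F: "\<And>n. C2 (F n) (F1 n) (F2 n)"
    "uniform_limit KK F f sequentially"
    "uniform_limit KK (\<lambda>n x. zpow \<alpha> x * dil \<alpha> (F1 n) x) qq sequentially"
    "uniform_limit KK (\<lambda>n. gradsq \<alpha> (F1 n)) dd sequentially"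
    "uniform_limit KK (\<lambda>n x. Bop \<alpha> (F2 n) x + \<kappa>\<^sup>2 * F n x) (\<lambda>x. 0) sequentially"
    "uniform_limit KK (\<lambda>n x. dil \<alpha> (F1 n) x * (Bop \<alpha> (F2 n) x + \<kappa>\<^sup>2 * F n x)) (\<lambda>x. 0) sequentially"
    using approx_sequence[OF KK_compact sub] by blast
  have z2: "zpow (2 * \<alpha>) x = zpow \<alpha> x * zpow \<alpha> x" for x :: "(real^'m) \<times> (real^'k)"
    by (simp add: zpow_def powr_add[symmetric])
  let ?Q = "hom_dim TYPE('m) TYPE('k) \<alpha>"
  let ?c = "\<lambda>x. \<kappa>\<^sup>2 / 2 * (2 * (\<alpha> + 1) * tau \<alpha> x * h' (tau \<alpha> x) + ?Q * h (tau \<alpha> x))"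
  let ?d = "\<lambda>x. (1 - ?Q / 2) * h (tau \<alpha> x) - (\<alpha> + 1) * tau \<alpha> x * h' (tau \<alpha> x)"
  let ?A = "\<lambda>n x. h (tau \<alpha> x) * dil \<alpha> (F1 n) x * Bop \<alpha> (F2 n) x
      + 2 * (\<alpha> + 1) * h' (tau \<alpha> x) * zpow (2 * \<alpha>) x * (dil \<alpha> (F1 n) x)\<^sup>2 + ?d x * gradsq \<alpha> (F1 n) x"
  let ?B = "\<lambda>n x. 2 * h (tau \<alpha> x) * F n x * dil \<alpha> (F1 n) x
     + (2 * (\<alpha> + 1) * tau \<alpha> x * h' (tau \<alpha> x) + ?Q * h (tau \<alpha> x)) * (F n x)\<^sup>2"
  let ?I = "\<lambda>n x. ?A n x + \<kappa>\<^sup>2 / 2 * ?B n x"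
  have eq: "?I n x = h (tau \<alpha> x) * (dil \<alpha> (F1 n) x * (Bop \<alpha> (F2 n) x + \<kappa>\<^sup>2 * F n x))
     + (2 * (\<alpha> + 1) * h' (tau \<alpha> x)) * ((zpow \<alpha> x * dil \<alpha> (F1 n) x) * (zpow \<alpha> x * dil \<alpha> (F1 n) x)) + ?d x * gradsq \<alpha> (F1 n) x + ?c x * (F n x * F n x)" for n x
    unfolding z2 by (simp add: field_simps power2_eq_square)
  have lim: "uniform_limit KK ?I (\<lambda>x. h (tau \<alpha> x) * 0 + (2 * (\<alpha> + 1) * h' (tau \<alpha> x)) * (qq x * qq x) + ?d x * dd x + ?c x * (f x * f x)) sequentially"
    unfolding eq
    by (intro uniform_limit_add uniform_limit_KK_cmult uniform_limit_KK_mult F continuous_on_diff continuous_on_add continuous_on_mult continuous_on_const cont_h cont_h' continuous_zpow \<alpha> continuous_tau continuous_on_KK)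
  have a: "2 * \<alpha> > 0" using \<alpha> by simp
  have "(LINT x|lborel. h (tau \<alpha> x) * 0 + (2 * (\<alpha> + 1) * h' (tau \<alpha> x)) * (qq x * qq x) + ?d x * dd x + ?c x * (f x * f x)) = 0"
  proof (rule integral_uniform_limit_zero[OF KK_compact lim])
    show "continuous_on KK (?I n)" for n
      by (intro continuous_on_diff continuous_on_add continuous_on_mult continuous_on_const continuous_on_power cont_h cont_h' continuous_zpow continuous_tau a \<alpha> continuous_C2_ops[OF F(1) \<alpha>])
    show "(LINT x|lborel. ?I n x) = 0" for n
      using Bochner_Integration.integral_add[OF cutoff_dilation_identity(2)[OF F(1)] integrable_mult_right[OF cutoff_mass_identity(2)[OF F(1)], of "\<kappa>\<^sup>2 / 2"]]
        cutoff_dilation_identity(1)[OF F(1)] cutoff_mass_identity(1)[OF F(1)] by simp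
  qed (simp_all add: H_zero)
  then show ?thesis by (simp add: algebra_simps power2_eq_square)
qed

end

section \<open>Radial functionals\<close>

text \<open>The support starts strictly beyond \<open>R\<close>, so there is an open margin on which
  the function vanishes. The case r2 < r1 is allowed and gives the zero function.\<close>

definition Cc :: "real \<Rightarrow> (real \<Rightarrow> real) \<Rightarrow> bool" where
  "Cc R g \<longleftrightarrow> continuous_on UNIV g \<and> (\<exists>r1 r2. R < r1 \<and> (\<forall>r. r \<notin> {r1..r2} \<longrightarrow> g r = 0))"

definition C1c :: "real \<Rightarrow> (real \<Rightarrow> real) \<Rightarrow> (real \<Rightarrow> real) \<Rightarrow> bool" where
  "C1c R g g' \<longleftrightarrow> (\<forall>r. (g has_real_derivative g' r) (at r)) \<and> continuous_on UNIV g' \<and>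
     (\<exists>r1 r2. R < r1 \<and> (\<forall>r. r \<notin> {r1..r2} \<longrightarrow> g r = 0))"

lemma Cc_zero: "Cc R g \<Longrightarrow> r \<le> R \<Longrightarrow> g r = 0"
  unfolding Cc_def by force

lemma Cc_mono: "Cc R g \<Longrightarrow> R' \<le> R \<Longrightarrow> Cc R' g"
  unfolding Cc_def by (meson order_le_less_trans)

lemma C1c_mono: "C1c R g g' \<Longrightarrow> R' \<le> R \<Longrightarrow> C1c R' g g'"
  unfolding C1c_def by (meson order_le_less_trans)

lemma DERIV_zero_outside:
  assumes "\<And>r. (g has_real_derivative g' r) (at r)" "\<forall>r. r \<notin> {r1..r2} \<longrightarrow> g r = (0::real)" "r \<notin> {r1..r2}"
  shows "g' r = 0"
proof -
  have "((\<lambda>t. 0) has_real_derivative 0) (at r)" by simp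
  moreover have "open (- {r1..r2})" by auto
  moreover have "r \<in> - {r1..r2}" using assms(3) by simp
  ultimately have "(g has_real_derivative 0) (at r)"
    by (rule has_field_derivative_transform_within_open) (use assms(2) in auto)
  then show ?thesis using assms(1) DERIV_unique by blast
qed

lemma C1c_Cc: assumes "C1c R g g'" shows "Cc R g" "Cc R g'"
proof -
  obtain r1 r2 where r: "R < r1" "\<forall>r. r \<notin> {r1..r2} \<longrightarrow> g r = 0" and d: "\<And>r. (g has_real_derivative g' r) (at r)"
    and c: "continuous_on UNIV g'" using assms unfolding C1c_def by blast
  show "Cc R g" unfolding Cc_def
    using r DERIV_continuous_on[OF has_field_derivative_at_within[OF d]] by blast
  show "Cc R g'" unfolding Cc_def using r(1) c DERIV_zero_outside[OF d r(2)] by blast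
qed

text \<open>The factor \<open>p\<close> may be singular at or below \<open>R\<close>, as powers of
  1/r are: the product vanishes on an open neighbourhood of that half-line.\<close>

lemma Cc_mult:
  assumes g: "Cc R g" and p: "continuous_on {R<..} p"
  shows "Cc R (\<lambda>r. g r * p r)"
proof -
  obtain r1 r2 where r: "R < r1" "\<forall>r. r \<notin> {r1..r2} \<longrightarrow> g r = 0" and c: "continuous_on UNIV g"
    using g unfolding Cc_def by blast
  have "continuous_on ({R<..} \<union> {..<r1}) (\<lambda>r. g r * p r)"
  proof (rule continuous_on_open_Un)
    show "continuous_on {R<..} (\<lambda>r. g r * p r)" using p continuous_on_subset[OF c] by (intro continuous_on_mult) auto
    have "continuous_on {..<r1} (\<lambda>r. g r * p r) \<longleftrightarrow> continuous_on {..<r1} (\<lambda>r. 0::real)"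
      by (rule continuous_on_cong[OF refl]) (use r in auto)
    then show "continuous_on {..<r1} (\<lambda>r. g r * p r)" by simp
  qed auto
  moreover have "{R<..} \<union> {..<r1} = UNIV" using r(1) by auto
  ultimately show ?thesis unfolding Cc_def using r by auto
qed

lemma Cc_add: assumes "Cc R g" "Cc R k" shows "Cc R (\<lambda>r. g r + k r)"
proof -
  obtain r1 r2 where r: "R < r1" "\<forall>r. r \<notin> {r1..r2} \<longrightarrow> g r = 0" and c: "continuous_on UNIV g"
    using assms(1) unfolding Cc_def by blast
  obtain s1 s2 where s: "R < s1" "\<forall>r. r \<notin> {s1..s2} \<longrightarrow> k r = 0" and c': "continuous_on UNIV k"
    using assms(2) unfolding Cc_def by blast
  have "g r + k r = 0" if "r \<notin> {min r1 s1..max r2 s2}" for r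
  proof -
    have "r \<notin> {r1..r2}" "r \<notin> {s1..s2}" using that by auto
    then show ?thesis using r(2) s(2) by simp
  qed
  moreover have "R < min r1 s1" using r(1) s(1) by simp
  ultimately show ?thesis unfolding Cc_def using continuous_on_add[OF c c'] by blast
qed

lemma Cc_cmult: "Cc R g \<Longrightarrow> Cc R (\<lambda>r. c * g r)"
  using Cc_mult[of R g "\<lambda>_. c"] by (simp add: mult.commute)

lemma C1c_mult:
  assumes g: "C1c R g g'" and p: "\<And>r. r > R \<Longrightarrow> (p has_real_derivative p' r) (at r)" and p': "continuous_on {R<..} p'"
  shows "C1c R (\<lambda>r. g r * p r) (\<lambda>r. g' r * p r + g r * p' r)"
proof -
  obtain r1 r2 where r: "R < r1" "\<forall>r. r \<notin> {r1..r2} \<longrightarrow> g r = 0" and d: "\<And>r. (g has_real_derivative g' r) (at r)"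
    using g unfolding C1c_def by blast
  have p0: "continuous_on {R<..} p"
    using p by (intro DERIV_continuous_on[of _ _ p']) (auto intro: has_field_derivative_at_within)
  have D: "((\<lambda>r. g r * p r) has_real_derivative g' r * p r + g r * p' r) (at r)" for r
  proof (cases "r > R")
    case True
    then show ?thesis using DERIV_mult[OF d p[OF True]] by (simp add: algebra_simps)
  next
    case False
    then have z: "r \<notin> {r1..r2}" using r(1) by auto
    have "((\<lambda>t. 0) has_real_derivative 0) (at r)" by simp
    moreover have "open {..<r1}" "r \<in> {..<r1}" using False r(1) by auto
    ultimately have "((\<lambda>r. g r * p r) has_real_derivative 0) (at r)"
      by (rule has_field_derivative_transform_within_open) (use r(2) in auto)
    then show ?thesis using DERIV_zero_outside[OF d r(2) z] r(2) z by simp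
  qed
  have "Cc R (\<lambda>r. g' r * p r + g r * p' r)"
    by (intro Cc_add Cc_mult C1c_Cc[OF g] p0 p')
  then show ?thesis unfolding C1c_def Cc_def using D r by auto
qed

lemma pseudo_gauge_tau: "pseudo_gauge \<alpha> x = tau \<alpha> x powr (1 / (2 * (\<alpha> + 1)))"
  by (simp add: pseudo_gauge_def tau_def)

lemma pseudo_gauge_nonneg: "pseudo_gauge \<alpha> x \<ge> 0"
  by (simp add: pseudo_gauge_tau)

lemma tau_eq_gauge: "\<alpha> > 0 \<Longrightarrow> tau \<alpha> x = pseudo_gauge \<alpha> x powr (2 * (\<alpha> + 1))"
  using tau_nonneg[of \<alpha> x] by (simp add: pseudo_gauge_tau powr_powr)

lemma continuous_gauge: "\<alpha> > 0 \<Longrightarrow> continuous_on S (pseudo_gauge \<alpha>)"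
  unfolding pseudo_gauge_tau by (intro continuous_on_powr' continuous_tau continuous_on_const) (auto simp: tau_nonneg)

lemma open_gauge: "\<alpha> > 0 \<Longrightarrow> open {x. pseudo_gauge \<alpha> x > R}"
  by (intro open_Collect_less continuous_on_const continuous_gauge)

lemma compact_gauge:
  fixes r1 r2 :: real
  assumes "\<alpha> > 0"
  shows "compact {x::(real^'m::finite) \<times> (real^'k::finite). r1 \<le> pseudo_gauge \<alpha> x \<and> pseudo_gauge \<alpha> x \<le> r2}"
proof -
  have sub: "{x::(real^'m) \<times> (real^'k). r1 \<le> pseudo_gauge \<alpha> x \<and> pseudo_gauge \<alpha> x \<le> r2} =
     {x. tau \<alpha> x \<le> r2 powr (2 * (\<alpha> + 1))} \<inter> {x. r1 \<le> pseudo_gauge \<alpha> x \<and> pseudo_gauge \<alpha> x \<le> r2}"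
    using assms pseudo_gauge_nonneg by (auto simp: tau_eq_gauge intro!: powr_mono2)
  have "closed {x::(real^'m) \<times> (real^'k). r1 \<le> pseudo_gauge \<alpha> x \<and> pseudo_gauge \<alpha> x \<le> r2}"
    by (intro closed_Collect_conj closed_Collect_le continuous_on_const continuous_gauge assms)
  then show ?thesis by (subst sub) (rule compact_Int_closed[OF compact_tau_le[OF assms]])
qed

section \<open>The five densities and the functional J\<close>

locale grushin_exterior = grushin_solution \<alpha> \<kappa> "{x. pseudo_gauge \<alpha> x > R\<^sub>0}" f U V
  for \<alpha> \<kappa> R\<^sub>0 :: real and f :: "(real^'m::finite) \<times> (real^'k::finite) \<Rightarrow> real" and U V +
  fixes Q :: real
  assumes R0: "R\<^sub>0 > 0" and Q: "Q = hom_dim TYPE('m) TYPE('k) \<alpha>"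
begin

abbreviation rho :: "(real^'m) \<times> (real^'k) \<Rightarrow> real" where "rho \<equiv> pseudo_gauge \<alpha>"

definition wa :: "(real^'m) \<times> (real^'k) \<Rightarrow> real" where "wa x = (qq x)\<^sup>2 / tau \<alpha> x"
definition wc :: "(real^'m) \<times> (real^'k) \<Rightarrow> real" where "wc x = zpow \<alpha> x * f x * qq x * rho x / tau \<alpha> x"
definition wn :: "(real^'m) \<times> (real^'k) \<Rightarrow> real" where "wn x = zpow (2 * \<alpha>) x * (f x)\<^sup>2 * (rho x)\<^sup>2 / tau \<alpha> x"

lemma tau_pos: "rho x > 0 \<Longrightarrow> tau \<alpha> x > 0"
  using \<alpha> by (simp add: tau_eq_gauge)

lemma rho_pos: "rho x > R\<^sub>0 \<Longrightarrow> rho x > 0"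
  using R0 by linarith

text \<open>\<open>qq\<close> is the scalar product of the horizontal gradient with a vector
  \<open>p\<close> of squared length \<open>tau\<close>, hence \<open>wa\<close> \<le>
  \<open>dd\<close> by Cauchy-Schwarz: \<open>wa\<close> is the radial part of the gradient. The
  bound for \<open>wn\<close> is |z| \<le> \<rho>. These inequalities are all that the later algebra
  knows about f.\<close>

lemma weight_inequalities:
  assumes x: "rho x > R\<^sub>0"
  shows "0 \<le> wa x" "wa x \<le> dd x" "0 \<le> wn x" "wn x \<le> (f x)\<^sup>2" "(wc x)\<^sup>2 \<le> wa x * wn x"
proof -
  have t: "tau \<alpha> x > 0" by (rule tau_pos[OF rho_pos[OF x]])
  have z2: "zpow (2 * \<alpha>) x = (zpow \<alpha> x)\<^sup>2" by (simp add: zpow_def power2_eq_square powr_add[symmetric])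
  show "0 \<le> wa x" using t by (simp add: wa_def)
  show "0 \<le> wn x" using t by (simp add: wn_def zpow_def)
  show "(wc x)\<^sup>2 \<le> wa x * wn x" unfolding wc_def wa_def wn_def z2 by (simp add: power_mult_distrib power_divide power2_eq_square mult_ac)
  show "wa x \<le> dd x"
  proof -
    define p where "p = (zpow \<alpha> x *\<^sub>R fst x, (2 * (\<alpha> + 1)) *\<^sub>R snd x)"
    define v where "v = ((\<chi> i. U i x) :: real^'m, (\<chi> j. V j x) :: real^'k)"
    have "qq x = p \<bullet> v" unfolding p_def v_def qq_def by (simp add: inner_vec_def sum_distrib_left mult_ac)
    moreover have "v \<bullet> v = dd x" unfolding v_def dd_def by (simp add: inner_vec_def power2_eq_square)
    moreover have "p \<bullet> p = tau \<alpha> x"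
    proof -
      have "zpow \<alpha> x * (zpow \<alpha> x * (fst x \<bullet> fst x)) = norm (fst x) powr (2 * (\<alpha> + 1))"
      proof (cases "fst x = 0")
        case False
        have "zpow \<alpha> x * (zpow \<alpha> x * (fst x \<bullet> fst x)) = norm (fst x) powr (2 * (\<alpha> + 1) - 2) * (norm (fst x))\<^sup>2"
          by (simp add: zpow_def dot_square_norm powr_add[symmetric] flip: mult.assoc)
        then show ?thesis using norm_powr_mult_sq[OF False, of "2 * (\<alpha> + 1)"] by simp
      qed simp
      moreover have "p \<bullet> p = zpow \<alpha> x * (zpow \<alpha> x * (fst x \<bullet> fst x)) + (2 * (\<alpha> + 1)) * ((2 * (\<alpha> + 1)) * (snd x \<bullet> snd x))"
        unfolding p_def by (simp only: inner_Pair inner_scaleR_left inner_scaleR_right)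
      ultimately show ?thesis unfolding tau_def dot_square_norm by (simp add: power2_eq_square algebra_simps)
    qed
    ultimately have "(qq x)\<^sup>2 \<le> tau \<alpha> x * dd x" using Cauchy_Schwarz_ineq[of p v] by simp
    then show ?thesis using t by (simp add: wa_def pos_divide_le_eq mult.commute)
  qed
  show "wn x \<le> (f x)\<^sup>2"
  proof -
    have 1: "norm (fst x) powr (2 * (\<alpha> + 1)) \<le> tau \<alpha> x" unfolding tau_def using \<alpha> by simp
    have "(norm (fst x) powr (2 * (\<alpha> + 1))) powr (1 / (2 * (\<alpha> + 1))) \<le> rho x"
      unfolding pseudo_gauge_tau by (rule powr_mono2[OF _ _ 1]) (use \<alpha> in auto)
    then have "norm (fst x) \<le> rho x" using \<alpha> by (simp add: powr_powr)
    then have "zpow (2 * \<alpha>) x \<le> rho x powr (2 * \<alpha>)" unfolding zpow_def using \<alpha> by (intro powr_mono2) auto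
    then have "zpow (2 * \<alpha>) x * (rho x)\<^sup>2 \<le> rho x powr (2 * \<alpha>) * (rho x)\<^sup>2" by (rule mult_right_mono) simp
    also have "\<dots> = rho x powr (2 * \<alpha>) * rho x powr 2" using rho_pos[OF x] by simp
    also have "\<dots> = tau \<alpha> x" using \<alpha> by (simp add: tau_eq_gauge powr_add[symmetric] algebra_simps del: powr_numeral)
    finally have "zpow (2 * \<alpha>) x * (rho x)\<^sup>2 * (f x)\<^sup>2 \<le> tau \<alpha> x * (f x)\<^sup>2" by (rule mult_right_mono) simp
    then show ?thesis using t by (simp add: wn_def pos_divide_le_eq mult_ac)
  qed
qed

lemma continuous_weights:
  "continuous_on {x. rho x > R\<^sub>0} wa" "continuous_on {x. rho x > R\<^sub>0} (\<lambda>x. (f x)\<^sup>2)" "continuous_on {x. rho x > R\<^sub>0} wc"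
  "continuous_on {x. rho x > R\<^sub>0} dd" "continuous_on {x. rho x > R\<^sub>0} wn"
proof -
  have t: "\<And>x. x \<in> {x. rho x > R\<^sub>0} \<Longrightarrow> tau \<alpha> x \<noteq> 0" using tau_pos rho_pos by fastforce
  have a: "2 * \<alpha> > 0" using \<alpha> by simp
  note c = cf cont_qq continuous_tau[OF \<alpha>] continuous_gauge[OF \<alpha>] continuous_zpow[OF \<alpha>] continuous_zpow[OF a]
  show "continuous_on {x. rho x > R\<^sub>0} wa" "continuous_on {x. rho x > R\<^sub>0} (\<lambda>x. (f x)\<^sup>2)" "continuous_on {x. rho x > R\<^sub>0} wc"
    "continuous_on {x. rho x > R\<^sub>0} wn"
    unfolding wa_def wc_def wn_def using t by (auto intro!: continuous_on_divide continuous_on_mult continuous_on_power c)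
  show "continuous_on {x. rho x > R\<^sub>0} dd" by (rule cont_dd)
qed

text \<open>
  A function of \<open>(r, a, b, c, d, n)\<close> is evaluated at the gauge and at the five densities
  \<open>wa\<close>, \<open>f\<^sup>2\<close>, \<open>wc\<close>, \<open>dd\<close>, \<open>wn\<close>. Up to powers of \<open>\<rho>\<close> and of \<open>|z|/\<rho>\<close> the densities \<open>wa\<close>, \<open>wc\<close>, \<open>wn\<close> are
  \<open>(Z f)\<^sup>2\<close>, \<open>f Z f\<close> and \<open>f\<^sup>2\<close>.
\<close>

definition ev :: "(real \<Rightarrow> real \<Rightarrow> real \<Rightarrow> real \<Rightarrow> real \<Rightarrow> real \<Rightarrow> real) \<Rightarrow> (real^'m) \<times> (real^'k) \<Rightarrow> real" where
  "ev G x = G (rho x) (wa x) ((f x)\<^sup>2) (wc x) (dd x) (wn x)"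

definition J :: "(real \<Rightarrow> real \<Rightarrow> real \<Rightarrow> real \<Rightarrow> real \<Rightarrow> real \<Rightarrow> real) \<Rightarrow> real" where
  "J G = (LINT x|lborel. ev G x)"

text \<open>For \<rho> \<le> R_0 nothing is known about the densities, so the integrand has to
  vanish there for all values of its arguments.\<close>

definition adm :: "(real \<Rightarrow> real \<Rightarrow> real \<Rightarrow> real \<Rightarrow> real \<Rightarrow> real \<Rightarrow> real) \<Rightarrow> bool" where
  "adm G \<longleftrightarrow> integrable lborel (ev G) \<and> (\<forall>r a b c d n. r \<le> R\<^sub>0 \<longrightarrow> G r a b c d n = 0)"

text \<open>This reduces inequalities between integrals to inequalities between real numbers: the
  densities become free variables subject to the constraints of
  \<open>weight_inequalities\<close>.\<close>

lemma J_mono: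
  assumes "adm G" "adm H"
    and "\<And>r a b c d n. \<lbrakk>r > R\<^sub>0; 0 \<le> a; a \<le> d; 0 \<le> n; n \<le> b; c\<^sup>2 \<le> a * n\<rbrakk> \<Longrightarrow> G r a b c d n \<le> H r a b c d n"
  shows "J G \<le> J H"
  unfolding J_def
proof (rule integral_mono)
  fix x
  show "ev G x \<le> ev H x"
  proof (cases "rho x > R\<^sub>0")
    case True
    show ?thesis unfolding ev_def by (rule assms(3)[OF True]) (rule weight_inequalities[OF True])+
  next
    case False
    then show ?thesis using assms(1,2) unfolding ev_def adm_def by simp
  qed
qed (use assms in \<open>auto simp: adm_def\<close>)

lemma adm_add: "adm G \<Longrightarrow> adm H \<Longrightarrow> adm (\<lambda>r a b c d n. G r a b c d n + H r a b c d n)"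
  unfolding adm_def ev_def by auto

lemma adm_cmult: "adm G \<Longrightarrow> adm (\<lambda>r a b c d n. k * G r a b c d n)"
  unfolding adm_def ev_def by auto

lemma adm_diff: "adm G \<Longrightarrow> adm H \<Longrightarrow> adm (\<lambda>r a b c d n. G r a b c d n - H r a b c d n)"
  unfolding adm_def ev_def by auto

lemma J_add: "adm G \<Longrightarrow> adm H \<Longrightarrow> J (\<lambda>r a b c d n. G r a b c d n + H r a b c d n) = J G + J H"
  unfolding J_def adm_def ev_def by (intro Bochner_Integration.integral_add) auto

lemma J_cmult: "J (\<lambda>r a b c d n. k * G r a b c d n) = k * J G"
  unfolding J_def ev_def by simp

lemma J_diff: "adm G \<Longrightarrow> adm H \<Longrightarrow> J (\<lambda>r a b c d n. G r a b c d n - H r a b c d n) = J G - J H"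
  unfolding J_def adm_def ev_def by (intro Bochner_Integration.integral_diff) auto

lemma radial_integrable:
  assumes g: "Cc R\<^sub>0 g" and w: "continuous_on {x. rho x > R\<^sub>0} w"
  shows "integrable lborel (\<lambda>x. g (rho x) * w x)"
proof -
  obtain r1 r2 where r: "R\<^sub>0 < r1" "\<forall>r. r \<notin> {r1..r2} \<longrightarrow> g r = 0" and c: "continuous_on UNIV g"
    using g unfolding Cc_def by blast
  let ?K = "{x::(real^'m) \<times> (real^'k). r1 \<le> rho x \<and> rho x \<le> r2}"
  have "continuous_on ?K (\<lambda>x. g (rho x) * w x)"
    using r(1) by (intro continuous_on_mult continuous_on_compose2[OF c continuous_gauge[OF \<alpha>]] continuous_on_subset[OF w]) auto
  from borel_integrable_compact[OF compact_gauge[OF \<alpha>] this]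
  have "integrable lborel (\<lambda>x. indicator ?K x *\<^sub>R (g (rho x) * w x))" .
  moreover have "(\<lambda>x. indicator ?K x *\<^sub>R (g (rho x) * w x)) = (\<lambda>x. g (rho x) * w x)"
    using r(2) by (auto simp: indicator_def fun_eq_iff)
  ultimately show ?thesis by simp
qed

lemma adm_basic:
  assumes "Cc R\<^sub>0 g"
  shows "adm (\<lambda>r a b c d n. g r * a)" "adm (\<lambda>r a b c d n. g r * b)" "adm (\<lambda>r a b c d n. g r * c)"
    "adm (\<lambda>r a b c d n. g r * d)" "adm (\<lambda>r a b c d n. g r * n)"
  unfolding adm_def ev_def using Cc_zero[OF assms] radial_integrable[OF assms] continuous_weights by auto

lemma adm_lin:
  assumes "Cc R\<^sub>0 ga" "Cc R\<^sub>0 gb" "Cc R\<^sub>0 gc" "Cc R\<^sub>0 gd" "Cc R\<^sub>0 gn"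
  shows "adm (\<lambda>r a b c d n. ga r * a + gb r * b + gc r * c + gd r * d + gn r * n)"
  by (intro adm_add adm_basic assms)

lemma adm_cong: "adm G \<Longrightarrow> (\<And>r a b c d n. G r a b c d n = H r a b c d n) \<Longrightarrow> adm H"
  unfolding adm_def ev_def by simp

text \<open>The substitution t = r^(2(\<alpha> + 1)) rewrites a cutoff in \<rho> as one in
  \<open>tau\<close>. Since g vanishes near 0, the singularity of the root at t = 0 is harmless. If
  r2 \<le> 0 then g vanishes on the positive half-line and \<open>T = 0\<close> will do.\<close>

lemma radial_solution_cutoff:
  assumes g: "C1c R\<^sub>0 g g'"
  obtains h h' T t0 where "solution_cutoff \<alpha> \<kappa> {x. rho x > R\<^sub>0} f U V h h' T t0"
    "\<forall>x. h (tau \<alpha> x) = g (rho x)" "\<forall>x. 2 * (\<alpha> + 1) * h' (tau \<alpha> x) = rho x * g' (rho x) / tau \<alpha> x"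
proof -
  obtain r1 r2 where r: "R\<^sub>0 < r1" "\<forall>r. r \<notin> {r1..r2} \<longrightarrow> g r = 0" and d: "\<And>r. (g has_real_derivative g' r) (at r)"
    and c: "continuous_on UNIV g'" using g unfolding C1c_def by blast
  have z': "g' r = 0" if "r \<notin> {r1..r2}" for r by (rule DERIV_zero_outside[OF d r(2) that])
  define \<beta>2 where "\<beta>2 = 2 * (\<alpha> + 1)"
  have b: "\<beta>2 > 0" using \<alpha> by (simp add: \<beta>2_def)
  have r1: "r1 > 0" using r R0 by linarith
  define h where "h = (\<lambda>t::real. if t \<le> 0 then 0 else g (t powr (1 / \<beta>2)))"
  define h' where "h' = (\<lambda>t::real. if t \<le> 0 then 0 else g' (t powr (1 / \<beta>2)) * ((1 / \<beta>2) * t powr (1 / \<beta>2 - 1)))"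
  define t0 where "t0 = r1 powr \<beta>2"
  define T where "T = (if r2 > 0 then r2 powr \<beta>2 else 0)"
  have t0: "t0 > 0" using r1 by (simp add: t0_def)
  have lt_t0: "t powr (1 / \<beta>2) < r1" if "0 < t" "t < t0" for t
  proof -
    have "t powr (1 / \<beta>2) < t0 powr (1 / \<beta>2)" using that b by (intro powr_less_mono2) auto
    then show ?thesis using r1 b by (simp add: t0_def powr_powr)
  qed
  have gt_T: "t powr (1 / \<beta>2) > r2" if "t > T" "t > 0" for t
  proof (cases "r2 > 0")
    case True
    then have "T powr (1 / \<beta>2) < t powr (1 / \<beta>2)" using that b by (intro powr_less_mono2) (auto simp: T_def)
    then show ?thesis using True b by (simp add: T_def powr_powr)
  next
    case False
    then show ?thesis using that powr_gt_zero[of t "1 / \<beta>2"] by linarith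
  qed
  have hz: "h t = 0" "h' t = 0" if "t < t0" for t
    using lt_t0[OF _ that] r(2) z' by (auto simp: h_def h'_def)
  have sc: "solution_cutoff \<alpha> \<kappa> {x. rho x > R\<^sub>0} f U V h h' T t0"
  proof
    show "\<alpha> > 0" by (rule \<alpha>)
    show "(h has_real_derivative h' t) (at t)" for t
    proof (cases "t < t0")
      case True
      have "((\<lambda>t. 0) has_real_derivative 0) (at t)" by simp
      moreover have "open {..<t0}" "t \<in> {..<t0}" using True by auto
      ultimately have "(h has_real_derivative 0) (at t)"
        by (rule has_field_derivative_transform_within_open) (auto simp: hz)
      then show ?thesis using hz(2)[OF True] by simp
    next
      case False
      then have t: "t > 0" using t0 by linarith
      have "((\<lambda>t. t powr (1 / \<beta>2)) has_real_derivative (1 / \<beta>2) * t powr (1 / \<beta>2 - 1)) (at t)"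
        using t by (rule has_real_derivative_powr)
      from DERIV_chain2[OF d this]
      have "((\<lambda>t. g (t powr (1 / \<beta>2))) has_real_derivative h' t) (at t)"
        using t by (simp add: h'_def)
      moreover have "open {0::real<..}" "t \<in> {0::real<..}" using t by auto
      ultimately show ?thesis
        by (rule has_field_derivative_transform_within_open) (auto simp: h_def)
    qed
    show "continuous_on UNIV h'"
    proof -
      have "continuous_on ({..<t0} \<union> {0<..}) h'"
      proof (rule continuous_on_open_Un)
        have "continuous_on {..<t0} h' \<longleftrightarrow> continuous_on {..<t0} (\<lambda>t. 0::real)"
          by (rule continuous_on_cong[OF refl]) (simp add: hz)
        then show "continuous_on {..<t0} h'" by simp
        have "continuous_on {0<..} h' \<longleftrightarrow> continuous_on {0<..} (\<lambda>t. g' (t powr (1 / \<beta>2)) * ((1 / \<beta>2) * t powr (1 / \<beta>2 - 1)))"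
          by (rule continuous_on_cong[OF refl]) (auto simp: h'_def)
        also have "\<dots>"
          by (intro continuous_on_mult continuous_on_const continuous_on_compose2[OF c] continuous_on_powr continuous_on_id) auto
        finally show "continuous_on {0<..} h'" .
      qed auto
      moreover have "{..<t0} \<union> {0<..} = UNIV" using t0 by auto
      ultimately show ?thesis by simp
    qed
    show "h t = 0" if "t > T" for t
      using gt_T[OF that] r(2) by (auto simp: h_def)
    show "h t = 0" if "t < t0" for t using hz that by blast
    show "{x. t0 \<le> tau \<alpha> x \<and> tau \<alpha> x \<le> T} \<subseteq> {x. rho x > R\<^sub>0}"
    proof (intro subsetI CollectI, elim CollectE conjE)
      fix x :: "(real^'m) \<times> (real^'k)" assume "t0 \<le> tau \<alpha> x" "tau \<alpha> x \<le> T"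
      then have "t0 powr (1 / \<beta>2) \<le> rho x" unfolding pseudo_gauge_tau \<beta>2_def[symmetric]
        using t0 b by (intro powr_mono2) auto
      then have "r1 \<le> rho x" using r1 b by (simp add: t0_def powr_powr)
      then show "rho x > R\<^sub>0" using r(1) by linarith
    qed
  qed
  have e1: "h (tau \<alpha> x) = g (rho x)" for x :: "(real^'m) \<times> (real^'k)"
  proof (cases "tau \<alpha> x \<le> 0")
    case True
    then have "rho x = 0" using tau_nonneg[of \<alpha> x] by (simp add: pseudo_gauge_tau)
    then show ?thesis using True r(2) r1 by (simp add: h_def)
  qed (simp add: h_def pseudo_gauge_tau \<beta>2_def)
  have e2: "2 * (\<alpha> + 1) * h' (tau \<alpha> x) = rho x * g' (rho x) / tau \<alpha> x" for x :: "(real^'m) \<times> (real^'k)"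
  proof (cases "tau \<alpha> x \<le> 0")
    case True
    then have "rho x = 0" using tau_nonneg[of \<alpha> x] by (simp add: pseudo_gauge_tau)
    then show ?thesis using True by (simp add: h'_def)
  next
    case False
    have rh: "rho x = tau \<alpha> x powr (1 / \<beta>2)" by (simp add: pseudo_gauge_tau \<beta>2_def)
    have "tau \<alpha> x powr (1 / \<beta>2 - 1) = rho x / tau \<alpha> x" using False by (simp add: powr_diff rh)
    then have "h' (tau \<alpha> x) = g' (rho x) * ((1 / \<beta>2) * (rho x / tau \<alpha> x))" using False by (simp add: h'_def rh)
    then show ?thesis unfolding \<beta>2_def[symmetric] using b by simp
  qed
  show ?thesis using that[OF sc] e1 e2 by blast
qed

text \<open>The second identity is twice \<open>solution_dilation_identity\<close>. The third is
  kept as an integral because its weights become \<open>wn\<close> and \<open>wc\<close> only after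
  a change of cutoff.\<close>

lemma radial_identities:
  assumes g: "C1c R\<^sub>0 g g'"
  shows "J (\<lambda>r a b c d n. g' r * c + g r * d - \<kappa>\<^sup>2 * g r * b) = 0" (is ?C)
    and "J (\<lambda>r a b c d n. r * g' r * (2 * a - d + \<kappa>\<^sup>2 * b) + g r * ((2 - Q) * d + \<kappa>\<^sup>2 * Q * b)) = 0" (is ?E)
    and "(LINT x|lborel. 2 * g (rho x) * zpow \<alpha> x * f x * qq x + (rho x * g' (rho x) + (Q + 2 * \<alpha>) * g (rho x)) * zpow (2 * \<alpha>) x * (f x)\<^sup>2) = 0" (is ?N)
proof -
  obtain h h' T t0 where sc: "solution_cutoff \<alpha> \<kappa> {x. rho x > R\<^sub>0} f U V h h' T t0"
    and e: "\<forall>x. h (tau \<alpha> x) = g (rho x)" "\<forall>x. 2 * (\<alpha> + 1) * h' (tau \<alpha> x) = rho x * g' (rho x) / tau \<alpha> x"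
    by (rule radial_solution_cutoff[OF g])
  note e1 = e(1)[rule_format] and e2 = e(2)[rule_format]
  interpret solution_cutoff \<alpha> \<kappa> "{x. rho x > R\<^sub>0}" f U V h h' T t0 by (rule sc)
  have e3: "2 * (\<alpha> + 1) * tau \<alpha> x * h' (tau \<alpha> x) = rho x * g' (rho x)" for x :: "(real^'m) \<times> (real^'k)"
  proof (cases "tau \<alpha> x = 0")
    case True
    then have "rho x = 0" by (simp add: pseudo_gauge_tau)
    then show ?thesis using True by simp
  next
    case False
    have "2 * (\<alpha> + 1) * tau \<alpha> x * h' (tau \<alpha> x) = tau \<alpha> x * (2 * (\<alpha> + 1) * h' (tau \<alpha> x))" by simp
    also have "\<dots> = rho x * g' (rho x)" unfolding e2 using False by simp
    finally show ?thesis .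
  qed
  show ?C
    using solution_energy_identity unfolding J_def ev_def e1 e2 wc_def by (simp add: algebra_simps)
  show ?E
  proof -
    have "2 * (\<kappa>\<^sup>2 / 2 * (2 * (\<alpha> + 1) * tau \<alpha> x * h' (tau \<alpha> x) + Q * h (tau \<alpha> x)) * (f x)\<^sup>2
      + 2 * (\<alpha> + 1) * h' (tau \<alpha> x) * (qq x)\<^sup>2
      + ((1 - Q / 2) * h (tau \<alpha> x) - (\<alpha> + 1) * tau \<alpha> x * h' (tau \<alpha> x)) * dd x)
      = rho x * g' (rho x) * (2 * wa x - dd x + \<kappa>\<^sup>2 * (f x)\<^sup>2) + g (rho x) * ((2 - Q) * dd x + \<kappa>\<^sup>2 * Q * (f x)\<^sup>2)" for x
    proof -
      have *: "(\<alpha> + 1) * tau \<alpha> x * h' (tau \<alpha> x) = rho x * g' (rho x) / 2" using e3[of x] by (simp add: algebra_simps)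
      show ?thesis unfolding * e1 e2 e3 wa_def by (simp add: field_simps)
    qed
    then show ?thesis using solution_dilation_identity[folded Q] unfolding J_def ev_def
      by (metis (no_types, lifting) Bochner_Integration.integral_cong integral_mult_right_zero mult_zero_right)
  qed
  show ?N using solution_transport_identity[folded Q] unfolding e1 e3 .
qed

text \<open>The cutoff g(r) r^s is inserted with s = 1 - 2(\<alpha> + 1), so that \<rho>^s = \<rho>
  / \<open>tau\<close>. This creates the weights in \<open>wn\<close> and \<open>wc\<close> and
  turns Q + 2\<alpha> into Q + 2\<alpha> + s = Q - 1.\<close>

lemma transport_identity:
  assumes g: "C1c R\<^sub>0 g g'"
  shows "J (\<lambda>r a b c d n. g' r * n + (Q - 1) * (g r / r) * n + 2 * g r * c) = 0"
proof -
  define s where "s = 1 - 2 * (\<alpha> + 1)"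
  have "C1c R\<^sub>0 (\<lambda>r. g r * r powr s) (\<lambda>r. g' r * r powr s + g r * (s * r powr (s - 1)))"
    using R0 by (intro C1c_mult[OF g] has_real_derivative_powr continuous_on_mult continuous_on_const continuous_on_powr continuous_on_id) auto
  note I = radial_identities(3)[OF this]
  have "2 * (g (rho x) * rho x powr s) * zpow \<alpha> x * f x * qq x
     + (rho x * (g' (rho x) * rho x powr s + g (rho x) * (s * rho x powr (s - 1))) + (Q + 2 * \<alpha>) * (g (rho x) * rho x powr s)) * zpow (2 * \<alpha>) x * (f x)\<^sup>2
     = g' (rho x) * wn x + (Q - 1) * (g (rho x) / rho x) * wn x + 2 * g (rho x) * wc x" for x
  proof (cases "rho x > R\<^sub>0")
    case False
    then show ?thesis using Cc_zero[OF C1c_Cc(1)[OF g]] Cc_zero[OF C1c_Cc(2)[OF g]] by simp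
  next
    case True
    note p = rho_pos[OF True]
    have t: "tau \<alpha> x = rho x * rho x / (rho x powr s * rho x)"
    proof -
      have "rho x powr s = rho x powr 1 / rho x powr (2 * (\<alpha> + 1))" unfolding s_def by (rule powr_diff)
      then have "rho x powr s = rho x / tau \<alpha> x" using p \<alpha> by (simp add: tau_eq_gauge)
      then show ?thesis using p tau_pos[OF p] by (simp add: field_simps)
    qed
    have s1: "rho x powr (s - 1) = rho x powr s / rho x" using p by (simp add: powr_diff)
    have ps: "rho x powr s > 0" using p by simp
    have wn: "wn x = zpow (2 * \<alpha>) x * (f x)\<^sup>2 * rho x * rho x powr s"
      unfolding wn_def t using p ps by (simp add: field_simps power2_eq_square)
    have wc: "wc x = zpow \<alpha> x * f x * qq x * rho x powr s"
      unfolding wc_def t using p ps by (simp add: field_simps power2_eq_square)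
    show ?thesis unfolding s1 wn wc using p by (simp add: field_simps s_def)
  qed
  then show ?thesis using I unfolding J_def ev_def by simp
qed

end

section \<open>Growth of nontrivial solutions\<close>

lemma quad_nonneg:
  fixes a c n u t :: real
  assumes "0 \<le> a" "0 \<le> n" "c\<^sup>2 \<le> a * n"
  shows "0 \<le> u\<^sup>2 * a + 2 * t * u * c + t\<^sup>2 * n"
proof (cases "a = 0")
  case True
  then have "c = 0" using assms(3) by simp
  then show ?thesis using True assms(2) by simp
next
  case False
  then have a: "a > 0" using assms(1) by simp
  have "a * (u\<^sup>2 * a + 2 * t * u * c + t\<^sup>2 * n) = (u * a + t * c)\<^sup>2 + t\<^sup>2 * (a * n - c\<^sup>2)"
    by (simp add: power2_eq_square algebra_simps)
  also have "\<dots> \<ge> 0" using assms(3) by (intro add_nonneg_nonneg mult_nonneg_nonneg) auto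
  finally show ?thesis using a by (simp add: zero_le_mult_iff)
qed

section \<open>Weights and cutoffs in the radial variable\<close>

definition Itg :: "(real \<Rightarrow> real) \<Rightarrow> real" where "Itg g = integral UNIV g"

lemma Itg_interval:
  assumes "continuous_on UNIV g" "\<And>r. r \<notin> {a..b} \<Longrightarrow> g r = 0"
  shows "(g has_integral Itg g) {a..b}" "(g has_integral Itg g) UNIV"
proof -
  have "g integrable_on {a..b}" using assms(1) by (intro integrable_continuous_interval) (auto intro: continuous_on_subset)
  then have 1: "(g has_integral integral {a..b} g) {a..b}" by (rule integrable_integral)
  then have 2: "(g has_integral integral {a..b} g) UNIV"
    by (rule has_integral_on_superset) (use assms(2) in auto)
  then have "Itg g = integral {a..b} g" unfolding Itg_def by (rule integral_unique)
  with 1 2 show "(g has_integral Itg g) {a..b}" "(g has_integral Itg g) UNIV" by simp_all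
qed

lemma Itg_pos:
  assumes g: "Cc R g" "\<And>r. g r \<ge> 0" and t: "g t > 0"
  shows "Itg g > 0"
proof -
  obtain r1 r2 where r: "R < r1" "\<forall>r. r \<notin> {r1..r2} \<longrightarrow> g r = 0" and c: "continuous_on UNIV g"
    using g(1) unfolding Cc_def by blast
  define b where "b = max r2 (r1 + 1)"
  have z: "g r = 0" if "r \<notin> {r1..b}" for r
  proof -
    have "r \<notin> {r1..r2}" using that by (auto simp: b_def)
    then show ?thesis using r(2) by blast
  qed
  have tt: "t \<in> {r1..b}" using t z by force
  have i: "(g has_integral Itg g) {r1..b}" by (rule Itg_interval(1)[OF c z])
  have I: "Itg g = integral {r1..b} g" by (rule integral_unique[OF i, symmetric])
  have "Itg g \<noteq> 0"
    using integral_eq_0_iff[of r1 b g] continuous_on_subset[OF c] g(2) tt t unfolding I b_def by force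
  moreover have "Itg g \<ge> 0" unfolding I using i g(2)
    by (intro integral_nonneg) auto
  ultimately show ?thesis by linarith
qed

lemma Itg_nonneg: "(\<And>r. g r \<ge> 0) \<Longrightarrow> Itg g \<ge> 0"
  unfolding Itg_def by (metis integral_nonneg UNIV_I not_integrable_integral order_refl)

text \<open>The combination is normalised to have integral 0, so its primitive has compact support.
  The primitive is nonnegative because the positive part lies to the left of the negative part.
  Testing a weak monotonicity formula with it compares averages over two shells.\<close>

lemma bump_difference:
  assumes g1: "continuous_on UNIV g1" "\<And>r. g1 r \<ge> 0" "\<And>r. r \<notin> {r1..r2} \<Longrightarrow> g1 r = 0"
    and g2: "continuous_on UNIV g2" "\<And>r. g2 r \<ge> 0" "\<And>r. r \<notin> {r3..r4} \<Longrightarrow> g2 r = 0"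
    and R: "R < r1" "r1 \<le> r2" "r2 < r3" "r3 \<le> r4"
  obtains G where "C1c R G (\<lambda>r. Itg g2 * g1 r - Itg g1 * g2 r)" "\<And>r. G r \<ge> 0"
proof -
  define k where "k = (\<lambda>r. Itg g2 * g1 r - Itg g1 * g2 r)"
  have ck: "continuous_on S k" for S unfolding k_def
    by (intro continuous_intros continuous_on_subset[OF g1(1)] continuous_on_subset[OF g2(1)]) auto
  define s0 where "s0 = r1 - 1"
  define G where "G = (\<lambda>t. integral {s0..t} k)"
  have ki: "k integrable_on {a..b}" for a b by (rule integrable_continuous_interval[OF ck])
  have k0: "k r = 0" if "r < r1 \<or> r > r4" for r
    using that R g1(3)[of r] g2(3)[of r] by (auto simp: k_def)
  have G0: "G t = 0" if "t < r1" for t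
  proof -
    have "integral {s0..t} k = integral {s0..t} (\<lambda>_. 0)"
      by (rule integral_cong) (use that k0 in auto)
    then show ?thesis by (simp add: G_def)
  qed
  have tot: "integral {s0..r4} k = 0"
  proof -
    have "(g1 has_integral Itg g1) {s0..r4}" by (rule Itg_interval(1)[OF g1(1)]) (use g1(3) R in \<open>auto simp: s0_def\<close>)
    moreover have "(g2 has_integral Itg g2) {s0..r4}" by (rule Itg_interval(1)[OF g2(1)]) (use g2(3) R in \<open>auto simp: s0_def\<close>)
    ultimately have "(k has_integral Itg g2 * Itg g1 - Itg g1 * Itg g2) {s0..r4}"
      unfolding k_def by (intro has_integral_diff has_integral_mult_right)
    then show ?thesis by (simp add: integral_unique)
  qed
  have G4: "G t = 0" if "t > r4" for t
  proof -
    have "integral {s0..r4} k + integral {r4..t} k = G t" unfolding G_def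
      using that R by (intro Henstock_Kurzweil_Integration.integral_combine ki) (auto simp: s0_def)
    moreover have "integral {r4..t} k = 0"
    proof -
      have "integral {r4..t} k = integral {r4..t} (\<lambda>_. 0)"
        by (rule integral_spike[of "{r4}"]) (use k0 in auto)
      then show ?thesis by simp
    qed
    ultimately show ?thesis using tot by simp
  qed
  have D: "(G has_real_derivative k t) (at t)" for t
  proof (cases "t < r1")
    case True
    have "((\<lambda>t. 0) has_real_derivative 0) (at t)" by simp
    moreover have "open {..<r1}" "t \<in> {..<r1}" using True by auto
    ultimately have "(G has_real_derivative 0) (at t)"
      by (rule has_field_derivative_transform_within_open) (auto simp: G0)
    then show ?thesis using k0 True by simp
  next
    case False
    then have "(G has_real_derivative k t) (at t within {s0..t+1})" unfolding G_def
      by (intro integral_has_real_derivative ck) (auto simp: s0_def)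
    moreover have "t \<in> interior {s0..t+1}" using False by (simp add: s0_def)
    ultimately show ?thesis by (metis at_within_interior)
  qed
  \<comment> \<open>Up to r2 the integrand is nonnegative; beyond r2 the primitive is minus an
    integral of a nonpositive function, the total being 0.\<close>
  have nn: "G t \<ge> 0" for t
  proof (cases "t \<le> r2")
    case True
    then show ?thesis unfolding G_def
      using R g1(2) g2(3) Itg_nonneg[OF g2(2)] by (intro integral_nonneg ki) (auto simp: k_def)
  next
    case False
    show ?thesis
    proof (cases "t > r4")
      case True then show ?thesis using G4 by simp
    next
      case t4: False
      have "G t + integral {t..r4} k = 0" unfolding G_def tot[symmetric]
        using False t4 R by (intro Henstock_Kurzweil_Integration.integral_combine ki) (auto simp: s0_def)
      moreover have "0 \<le> integral {t..r4} (\<lambda>r. - k r)"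
        using False g1(3) g2(2) Itg_nonneg[OF g1(2)] by (intro integral_nonneg integrable_neg ki) (auto simp: k_def)
      ultimately show ?thesis by simp
    qed
  qed
  show ?thesis
  proof (rule that[OF _ nn])
    have "\<forall>r. r \<notin> {r1..r4} \<longrightarrow> G r = 0" using G0 G4 by auto
    then have "C1c R G k" unfolding C1c_def using D ck R(1) by blast
    then show "C1c R G (\<lambda>r. Itg g2 * g1 r - Itg g1 * g2 r)" by (simp add: k_def)
  qed
qed

text \<open>A parabola between R and 4R, divided by its maximum 9/4 R^2, which is attained at 5R/2.
  At 2R and 3R it has the value 8/9.\<close>

definition bump :: "real \<Rightarrow> real \<Rightarrow> real" where
  "bump R r = max 0 ((r - R) * (4 * R - r) / (9 / 4 * R\<^sup>2))"

lemma max_sq_DERIV: "((\<lambda>u. (max 0 u)\<^sup>2) has_real_derivative 2 * max 0 u) (at (u::real))"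
proof -
  consider "u > 0" | "u < 0" | "u = 0" by linarith
  then show ?thesis
  proof cases
    case 1
    have "((\<lambda>u. u\<^sup>2) has_real_derivative 2 * max 0 u) (at u)" using 1 by (auto intro!: derivative_eq_intros)
    moreover have "open {0::real<..}" "u \<in> {0<..}" using 1 by auto
    ultimately show ?thesis by (rule has_field_derivative_transform_within_open) auto
  next
    case 2
    have "((\<lambda>u. 0) has_real_derivative 2 * max 0 u) (at u)" using 2 by simp
    moreover have "open {..<0::real}" "u \<in> {..<0}" using 2 by auto
    ultimately show ?thesis by (rule has_field_derivative_transform_within_open) auto
  next
    case 3
    have "((\<lambda>h::real. max 0 h) \<longlongrightarrow> max 0 0) (at 0)" by (intro tendsto_intros)
    then have "((\<lambda>h::real. max 0 h) \<longlongrightarrow> 0) (at 0)" by simp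
    moreover have "eventually (\<lambda>h. max 0 h = ((max 0 h)\<^sup>2 - 0) / (h - 0)) (at (0::real))"
      by (auto simp: eventually_at_filter power2_eq_square max_def)
    ultimately have "((\<lambda>h. ((max 0 h)\<^sup>2 - 0) / (h - 0)) \<longlongrightarrow> 0) (at (0::real))"
      by (rule Lim_transform_eventually)
    then show ?thesis using 3 by (simp add: has_field_derivative_iff)
  qed
qed

lemma bump_props:
  assumes R: "R \<ge> 3"
  shows "bump R r \<ge> 0" "bump R r \<le> 1" "r \<notin> {R..4*R} \<Longrightarrow> bump R r = 0" "continuous_on S (bump R)"
    "r \<in> {2*R..3*R} \<Longrightarrow> bump R r \<ge> 8 / 9"
proof -
  have R2: "9 / 4 * R\<^sup>2 > 0" using R by simp
  show "bump R r \<ge> 0" by (simp add: bump_def)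
  have "(r - R) * (4 * R - r) \<le> 9 / 4 * R\<^sup>2"
  proof -
    have "0 \<le> (r - 5 / 2 * R)\<^sup>2" by simp
    then show ?thesis by (simp add: power2_eq_square algebra_simps)
  qed
  then show "bump R r \<le> 1" using R2 by (simp add: bump_def pos_divide_le_eq)
  show "bump R r = 0" if "r \<notin> {R..4*R}"
  proof -
    have "(r - R) * (4 * R - r) \<le> 0" using that R by (auto simp: mult_le_0_iff)
    then have "(r - R) * (4 * R - r) / (9 / 4 * R\<^sup>2) \<le> 0" using R2 by (rule divide_nonpos_pos)
    then show ?thesis unfolding bump_def by simp
  qed
  show "continuous_on S (bump R)" unfolding bump_def using R2 by (intro continuous_intros) auto
  show "bump R r \<ge> 8 / 9" if "r \<in> {2*R..3*R}"
  proof -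
    have "0 \<le> (r - 2 * R) * (3 * R - r)" using that by (intro mult_nonneg_nonneg) auto
    then have "2 * R\<^sup>2 \<le> (r - R) * (4 * R - r)" by (simp add: power2_eq_square algebra_simps)
    then have "8 / 9 \<le> (r - R) * (4 * R - r) / (9 / 4 * R\<^sup>2)" using R2 by (simp add: pos_le_divide_eq)
    then show ?thesis unfolding bump_def by simp
  qed
qed

definition bump_sq' :: "real \<Rightarrow> real \<Rightarrow> real" where
  "bump_sq' R r = 2 * bump R r * ((5 * R - 2 * r) / (9 / 4 * R\<^sup>2))"

lemma bump_sq_DERIV:
  assumes R: "R \<ge> 3"
  shows "((\<lambda>r. (bump R r)\<^sup>2) has_real_derivative bump_sq' R r) (at r)" "\<bar>bump_sq' R r\<bar> \<le> 1" "continuous_on S (bump_sq' R)"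
    "r \<notin> {R..4*R} \<Longrightarrow> bump_sq' R r = 0"
proof -
  have R2: "9 / 4 * R\<^sup>2 > 0" using R by simp
  have "((\<lambda>r. (r - R) * (4 * R - r) / (9 / 4 * R\<^sup>2)) has_real_derivative (5 * R - 2 * r) / (9 / 4 * R\<^sup>2)) (at r)"
    using R2 by (auto intro!: derivative_eq_intros simp: field_simps)
  from DERIV_chain2[OF max_sq_DERIV this] show "((\<lambda>r. (bump R r)\<^sup>2) has_real_derivative bump_sq' R r) (at r)"
    unfolding bump_def bump_sq'_def .
  show "continuous_on S (bump_sq' R)" unfolding bump_sq'_def using R2 by (intro continuous_intros bump_props R) auto
  show z: "bump_sq' R r = 0" if "r \<notin> {R..4*R}" for r using bump_props(3)[OF R that] by (simp add: bump_sq'_def)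
  show "\<bar>bump_sq' R r\<bar> \<le> 1"
  proof (cases "r \<in> {R..4*R}")
    case True
    have "\<bar>5 * R - 2 * r\<bar> \<le> 3 * R" using True by auto
    then have "\<bar>(5 * R - 2 * r) / (9 / 4 * R\<^sup>2)\<bar> \<le> 3 * R / (9 / 4 * R\<^sup>2)"
      unfolding abs_divide abs_of_pos[OF R2] using R2 by (intro divide_right_mono) auto
    also have "\<dots> \<le> 1 / 2" using R by (simp add: field_simps power2_eq_square)
    finally have "\<bar>2 * bump R r\<bar> * \<bar>(5 * R - 2 * r) / (9 / 4 * R\<^sup>2)\<bar> \<le> 2 * (1 / 2)"
      using bump_props(1,2)[OF R, of r] by (intro mult_mono) auto
    then show ?thesis by (simp add: bump_sq'_def abs_mult)
  qed (simp add: z)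
qed

text \<open>The fourth power is the square of the C^1 function \<open>(bump R r)\<^sup>2\<close>,
  the form needed for a Caccioppoli estimate. Since (8/9)^4 \<ge> 1/2 on an interval of length R,
  the integral is at least R/2.\<close>

lemma bump_fourth_props:
  assumes R: "R \<ge> 3" "R > R'"
  shows "C1c R' (\<lambda>r. ((bump R r)\<^sup>2)\<^sup>2) (\<lambda>r. 2 * (bump R r)\<^sup>2 * bump_sq' R r)"
    and "Itg (\<lambda>r. ((bump R r)\<^sup>2)\<^sup>2) \<ge> R / 2"
proof -
  have c: "continuous_on UNIV (\<lambda>r. ((bump R r)\<^sup>2)\<^sup>2)" by (intro continuous_intros bump_props R)
  have z: "r \<notin> {R..4*R} \<Longrightarrow> ((bump R r)\<^sup>2)\<^sup>2 = 0" for r using bump_props(3)[OF R(1)] by simp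
  show "C1c R' (\<lambda>r. ((bump R r)\<^sup>2)\<^sup>2) (\<lambda>r. 2 * (bump R r)\<^sup>2 * bump_sq' R r)"
    unfolding C1c_def
  proof (intro conjI allI exI)
    show "((\<lambda>r. ((bump R r)\<^sup>2)\<^sup>2) has_real_derivative 2 * (bump R r)\<^sup>2 * bump_sq' R r) (at r)" for r
      by (rule DERIV_cong[OF DERIV_power[OF bump_sq_DERIV(1)[OF R(1)], of 2]]) simp
    show "continuous_on UNIV (\<lambda>r. 2 * (bump R r)\<^sup>2 * bump_sq' R r)" by (intro continuous_intros bump_props bump_sq_DERIV R)
    show "R' < R" by (rule R)
    show "r \<notin> {R..4*R} \<longrightarrow> ((bump R r)\<^sup>2)\<^sup>2 = 0" for r using z by blast
  qed
  have "integral {2*R..3*R} (\<lambda>r. 1 / 2) \<le> integral {R..4*R} (\<lambda>r. ((bump R r)\<^sup>2)\<^sup>2)"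
  proof -
    have "integral {2*R..3*R} (\<lambda>r. 1 / 2) \<le> integral {2*R..3*R} (\<lambda>r. ((bump R r)\<^sup>2)\<^sup>2)"
    proof (rule integral_le)
      show "(\<lambda>r. ((bump R r)\<^sup>2)\<^sup>2) integrable_on {2 * R..3 * R}"
        by (rule integrable_continuous_interval) (rule continuous_on_subset[OF c subset_UNIV])
      fix r assume "r \<in> {2*R..3*R}"
      then have "(8/9) ^ 4 \<le> bump R r ^ 4" by (intro power_mono bump_props(5)[OF R(1)]) auto
      moreover have "1 / 2 \<le> (8/9::real) ^ 4" by (simp add: power_divide)
      ultimately show "1 / 2 \<le> ((bump R r)\<^sup>2)\<^sup>2" by (simp add: power_mult[symmetric])
    qed auto
    also have "\<dots> \<le> integral {R..4*R} (\<lambda>r. ((bump R r)\<^sup>2)\<^sup>2)"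
      using R by (intro integral_subset_le integrable_continuous_interval continuous_on_subset[OF c subset_UNIV]) auto
    finally show ?thesis .
  qed
  moreover have "Itg (\<lambda>r. ((bump R r)\<^sup>2)\<^sup>2) = integral {R..4*R} (\<lambda>r. ((bump R r)\<^sup>2)\<^sup>2)"
    by (rule integral_unique[symmetric], rule Itg_interval(1)[OF c z])
  ultimately show "Itg (\<lambda>r. ((bump R r)\<^sup>2)\<^sup>2) \<ge> R / 2" using R by simp
qed

section \<open>Weak monotonicity of energies\<close>

context grushin_exterior
begin

text \<open>A linear form in the five densities with radial coefficients, times a radial weight;
  \<open>pe\<close> is the coefficient of d.\<close>

definition radial_form :: "(real \<Rightarrow> real) \<Rightarrow> (real \<Rightarrow> real) \<Rightarrow> (real \<Rightarrow> real) \<Rightarrow> (real \<Rightarrow> real) \<Rightarrow> (real \<Rightarrow> real) \<Rightarrow> (real \<Rightarrow> real)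
    \<Rightarrow> real \<Rightarrow> real \<Rightarrow> real \<Rightarrow> real \<Rightarrow> real \<Rightarrow> real \<Rightarrow> real" where
  "radial_form g pa pb pc pe pn r a b c d n = g r * (pa r * a + pb r * b + pc r * c + pe r * d + pn r * n)"

lemma adm_radial_form:
  assumes "Cc R\<^sub>0 g" "continuous_on {R\<^sub>0<..} pa" "continuous_on {R\<^sub>0<..} pb" "continuous_on {R\<^sub>0<..} pc"
    "continuous_on {R\<^sub>0<..} pe" "continuous_on {R\<^sub>0<..} pn"
  shows "adm (radial_form g pa pb pc pe pn)"
  by (rule adm_cong[OF adm_lin[OF Cc_mult[OF assms(1,2)] Cc_mult[OF assms(1,3)] Cc_mult[OF assms(1,4)] Cc_mult[OF assms(1,5)] Cc_mult[OF assms(1,6)]]])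
    (simp add: radial_form_def algebra_simps)

lemma J_eq:
  assumes "adm G" "adm H"
    and "\<And>r a b c d n. r > R\<^sub>0 \<Longrightarrow> G r a b c d n = H r a b c d n"
  shows "J G = J H"
  using assms by (intro antisym J_mono) auto

definition dilation_form where "dilation_form g g' r a b c d n = r * g' r * (2 * a - d + \<kappa>\<^sup>2 * b) + g r * ((2 - Q) * d + \<kappa>\<^sup>2 * Q * b)"
  for g g' :: "real \<Rightarrow> real" and r a b c d n :: real
definition energy_form where "energy_form g g' r a b c d n = g' r * c + g r * d - \<kappa>\<^sup>2 * g r * b"
  for g g' :: "real \<Rightarrow> real" and r a b c d n :: real
definition transport_form where "transport_form g g' r a b c d n = g' r * n + (Q - 1) * (g r / r) * n + 2 * g r * c"
  for g g' :: "real \<Rightarrow> real" and r a b c d n :: real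

lemma dilation_form_vanishes: assumes "C1c R\<^sub>0 g g'" shows "adm (dilation_form g g')" "J (dilation_form g g') = 0"
proof -
  have "adm (\<lambda>r a b c d n. radial_form g' (\<lambda>r. 2 * r) (\<lambda>r. \<kappa>\<^sup>2 * r) (\<lambda>r. 0) (\<lambda>r. - r) (\<lambda>r. 0) r a b c d n
      + radial_form g (\<lambda>r. 0) (\<lambda>r. \<kappa>\<^sup>2 * Q) (\<lambda>r. 0) (\<lambda>r. 2 - Q) (\<lambda>r. 0) r a b c d n)"
    by (intro adm_add adm_radial_form C1c_Cc[OF assms] continuous_intros)
  then show "adm (dilation_form g g')" by (rule adm_cong) (simp add: radial_form_def dilation_form_def algebra_simps)
  show "J (dilation_form g g') = 0" using radial_identities(2)[OF assms] unfolding dilation_form_def[abs_def] .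
qed

lemma energy_form_vanishes: assumes "C1c R\<^sub>0 g g'" shows "adm (energy_form g g')" "J (energy_form g g') = 0"
proof -
  have "adm (\<lambda>r a b c d n. radial_form g' (\<lambda>r. 0) (\<lambda>r. 0) (\<lambda>r. 1) (\<lambda>r. 0) (\<lambda>r. 0) r a b c d n
      + radial_form g (\<lambda>r. 0) (\<lambda>r. - \<kappa>\<^sup>2) (\<lambda>r. 0) (\<lambda>r. 1) (\<lambda>r. 0) r a b c d n)"
    by (intro adm_add adm_radial_form C1c_Cc[OF assms] continuous_intros)
  then show "adm (energy_form g g')" by (rule adm_cong) (simp add: radial_form_def energy_form_def algebra_simps)
  show "J (energy_form g g') = 0" using radial_identities(1)[OF assms] unfolding energy_form_def[abs_def] .
qed

lemma cont_inv: "continuous_on {R\<^sub>0<..} (\<lambda>r. c / r)"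
  using R0 by (intro continuous_intros) auto

lemma transport_form_vanishes: assumes "C1c R\<^sub>0 g g'" shows "adm (transport_form g g')" "J (transport_form g g') = 0"
proof -
  have "adm (\<lambda>r a b c d n. radial_form g' (\<lambda>r. 0) (\<lambda>r. 0) (\<lambda>r. 0) (\<lambda>r. 0) (\<lambda>r. 1) r a b c d n
      + radial_form g (\<lambda>r. 0) (\<lambda>r. 0) (\<lambda>r. 2) (\<lambda>r. 0) (\<lambda>r. (Q - 1) / r) r a b c d n)"
    by (intro adm_add adm_radial_form C1c_Cc[OF assms] continuous_on_const cont_inv)
  then show "adm (transport_form g g')" by (rule adm_cong) (simp add: radial_form_def transport_form_def algebra_simps)
  show "J (transport_form g g') = 0" using transport_identity[OF assms] unfolding transport_form_def[abs_def] .
qed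

text \<open>The scheme of all monotonicity proofs: the three identities provide integrands with
  vanishing integral, and it suffices to find multipliers \<open>g1\<close>, \<open>g2\<close>,
  \<open>g3\<close> for which their sum dominates \<open>T\<close> pointwise.\<close>

lemma J_le_0:
  assumes "adm T" "C1c R\<^sub>0 g1 g1'" "C1c R\<^sub>0 g2 g2'" "C1c R\<^sub>0 g3 g3'"
    and le: "\<And>r a b c d n. \<lbrakk>r > R\<^sub>0; 0 \<le> a; a \<le> d; 0 \<le> n; n \<le> b; c\<^sup>2 \<le> a * n\<rbrakk> \<Longrightarrow>
      T r a b c d n \<le> dilation_form g1 g1' r a b c d n + energy_form g2 g2' r a b c d n + transport_form g3 g3' r a b c d n"
  shows "J T \<le> 0"
proof -
  note E = dilation_form_vanishes[OF assms(2)] and C = energy_form_vanishes[OF assms(3)] and N = transport_form_vanishes[OF assms(4)]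
  have "J T \<le> J (\<lambda>r a b c d n. dilation_form g1 g1' r a b c d n + energy_form g2 g2' r a b c d n + transport_form g3 g3' r a b c d n)"
    using le by (intro J_mono adm_add E C N assms(1))
  also have "\<dots> = J (\<lambda>r a b c d n. dilation_form g1 g1' r a b c d n + energy_form g2 g2' r a b c d n) + J (transport_form g3 g3')"
    by (rule J_add[OF adm_add[OF E(1) C(1)] N(1)])
  also have "\<dots> = 0" using J_add[OF E(1) C(1)] E(2) C(2) N(2) by simp
  finally show ?thesis .
qed

text \<open>A weakly nondecreasing density has larger averages over shells further out. The
  hypothesis \<open>mono\<close> is tested with the primitive from \<open>bump_difference\<close>;
  the factors \<open>Itg\<close> normalise the averages.\<close>

lemma transport:
  assumes p: "continuous_on {R\<^sub>0<..} pa" "continuous_on {R\<^sub>0<..} pb" "continuous_on {R\<^sub>0<..} pc"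
      "continuous_on {R\<^sub>0<..} pe" "continuous_on {R\<^sub>0<..} pn"
    and mono: "\<And>g g'. C1c R g g' \<Longrightarrow> (\<And>r. g r \<ge> 0) \<Longrightarrow> J (radial_form g' pa pb pc pe pn) \<le> 0"
    and g1: "continuous_on UNIV g1" "\<And>r. g1 r \<ge> 0" "\<And>r. r \<notin> {r1..r2} \<Longrightarrow> g1 r = 0"
    and g2: "continuous_on UNIV g2" "\<And>r. g2 r \<ge> 0" "\<And>r. r \<notin> {r3..r4} \<Longrightarrow> g2 r = 0"
    and R: "R\<^sub>0 \<le> R" "R < r1" "r1 \<le> r2" "r2 < r3" "r3 \<le> r4"
  shows "Itg g2 * J (radial_form g1 pa pb pc pe pn) \<le> Itg g1 * J (radial_form g2 pa pb pc pe pn)"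
proof -
  have "R\<^sub>0 < r1" "R\<^sub>0 < r3" using R by linarith+
  then have C1: "Cc R\<^sub>0 g1" and C2: "Cc R\<^sub>0 g2" unfolding Cc_def using g1 g2 by blast+
  note A1 = adm_radial_form[OF C1 p] and A2 = adm_radial_form[OF C2 p]
  obtain G where G: "C1c R G (\<lambda>r. Itg g2 * g1 r - Itg g1 * g2 r)" "\<And>r. G r \<ge> 0"
    using bump_difference[OF g1 g2 R(2-5)] by blast
  have "J (radial_form (\<lambda>r. Itg g2 * g1 r - Itg g1 * g2 r) pa pb pc pe pn) \<le> 0" by (rule mono[OF G])
  also have "radial_form (\<lambda>r. Itg g2 * g1 r - Itg g1 * g2 r) pa pb pc pe pn =
     (\<lambda>r a b c d n. Itg g2 * radial_form g1 pa pb pc pe pn r a b c d n - Itg g1 * radial_form g2 pa pb pc pe pn r a b c d n)"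
    by (intro ext) (simp add: radial_form_def algebra_simps)
  also have "J \<dots> = Itg g2 * J (radial_form g1 pa pb pc pe pn) - Itg g1 * J (radial_form g2 pa pb pc pe pn)"
    using J_diff[OF adm_cmult[OF A1, of "Itg g2"] adm_cmult[OF A2, of "Itg g1"]] by (simp add: J_cmult)
  finally show ?thesis by simp
qed

lemma DERIV_power_div: "r \<noteq> 0 \<Longrightarrow> ((\<lambda>r::real. r ^ s) has_real_derivative real s * r ^ s / r) (at r)"
  by (rule DERIV_cong[OF DERIV_pow]) (cases s; simp)

lemma DERIV_power_mult: "r \<noteq> 0 \<Longrightarrow> ((\<lambda>r::real. r ^ s * r) has_real_derivative (real s + 1) * r ^ s) (at r)"
  by (rule DERIV_cong[OF DERIV_mult[OF DERIV_power_div DERIV_ident]]) (simp_all add: field_simps)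

text \<open>
  \<open>Phi s\<close> and \<open>Gam\<close> are the weak forms of Kato's auxiliary energies. Monotonicity in \<open>r\<close> becomes
  the inequality \<open>J (Phi s g') \<le> 0\<close> for all \<open>g \<ge> 0\<close>; for \<open>Phi s\<close> the defect is a multiple of a nonnegative
  quadratic form in \<open>a\<close>, \<open>c\<close>, \<open>n\<close>, plus a positive multiple of \<open>b\<close>.
\<close>

abbreviation Phi :: "nat \<Rightarrow> (real \<Rightarrow> real) \<Rightarrow> real \<Rightarrow> real \<Rightarrow> real \<Rightarrow> real \<Rightarrow> real \<Rightarrow> real \<Rightarrow> real" where
  "Phi s g \<equiv> radial_form g (\<lambda>r. 2 * (r ^ s * r\<^sup>2)) (\<lambda>r. \<kappa>\<^sup>2 * (r ^ s * r\<^sup>2)) (\<lambda>r. (Q - 1 + real s) * (r ^ s * r)) (\<lambda>r. - (r ^ s * r\<^sup>2))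
     (\<lambda>r. (Q - 1 + real s) * (real s + 1) / 2 * r ^ s)"

lemma Phi_cont:
  "continuous_on {R\<^sub>0<..} (\<lambda>r. 2 * (r ^ s * r\<^sup>2))" "continuous_on {R\<^sub>0<..} (\<lambda>r. \<kappa>\<^sup>2 * (r ^ s * r\<^sup>2))" "continuous_on {R\<^sub>0<..} (\<lambda>r. (Q - 1 + real s) * (r ^ s * r))"
  "continuous_on {R\<^sub>0<..} (\<lambda>r. - (r ^ s * r\<^sup>2))" "continuous_on {R\<^sub>0<..} (\<lambda>r. (Q - 1 + real s) * (real s + 1) / 2 * r ^ s)"
  by (intro continuous_intros)+

lemma Phi_mono:
  assumes g: "C1c R\<^sub>0 g g'" "\<And>r. g r \<ge> 0"
  shows "J (Phi s g') \<le> 0"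
proof (rule J_le_0)
  define w where "w = Q - 1"
  let ?k = "(w + real s) * (real s + 1) / 2"
  have ne: "r > R\<^sub>0 \<Longrightarrow> r \<noteq> 0" for r using R0 by linarith
  have cp: "continuous_on {R\<^sub>0<..} (\<lambda>r. k * r ^ s / r)" for k :: real using R0 by (intro continuous_intros) auto
  show "adm (Phi s g')" by (intro adm_radial_form C1c_Cc[OF g(1)] Phi_cont)
  show "C1c R\<^sub>0 (\<lambda>r. g r * (r ^ s * r)) (\<lambda>r. g' r * (r ^ s * r) + g r * ((real s + 1) * r ^ s))"
    by (rule C1c_mult[OF g(1) DERIV_power_mult]) (use ne in \<open>auto intro!: continuous_intros\<close>)
  show "C1c R\<^sub>0 (\<lambda>r. g r * ((w + real s) * (r ^ s * r))) (\<lambda>r. g' r * ((w + real s) * (r ^ s * r)) + g r * ((w + real s) * ((real s + 1) * r ^ s)))"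
    by (rule C1c_mult[OF g(1) DERIV_cmult[OF DERIV_power_mult]]) (use ne in \<open>auto intro!: continuous_intros\<close>)
  show "C1c R\<^sub>0 (\<lambda>r. g r * (?k * r ^ s)) (\<lambda>r. g' r * (?k * r ^ s) + g r * (?k * (real s * r ^ s / r)))"
  proof (rule C1c_mult[OF g(1)])
    show "((\<lambda>r. ?k * r ^ s) has_real_derivative ?k * (real s * r ^ s / r)) (at r)" if "r > R\<^sub>0" for r
      by (rule DERIV_cmult[OF DERIV_power_div[OF ne[OF that]]])
    show "continuous_on {R\<^sub>0<..} (\<lambda>r. ?k * (real s * r ^ s / r))" by (intro continuous_on_mult_left cp)
  qed
  fix r a b c d n :: real
  assume *: "r > R\<^sub>0" "0 \<le> a" "a \<le> d" "0 \<le> n" "n \<le> b" "c\<^sup>2 \<le> a * n"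
  define p where "p = r ^ s"
  define t where "t = real s"
  define G where "G = g r"
  define G' where "G' = g' r"
  have r: "r > 0" using *(1) R0 by linarith
  have p: "p > 0" using r by (simp add: p_def)
  have Qw: "Q = w + 1" by (simp add: w_def)
  \<comment> \<open>The multipliers are fixed by matching the coefficients of g'. In the remainder
    the terms in d cancel, and what is left is this completed square plus a positive multiple of
    b.\<close>
  define X where "X = r\<^sup>2 * a + 2 * ((w + t) / 2) * r * c + ((w + t) / 2)\<^sup>2 * n"
  have X: "X \<ge> 0" unfolding X_def by (rule quad_nonneg) (use * in auto)
  have "r * (G' * (p * r) + G * ((t + 1) * p)) * (2 * a - d + \<kappa>\<^sup>2 * b) + G * (p * r) * ((1 - w) * d + \<kappa>\<^sup>2 * (w + 1) * b)
      + ((G' * ((w + t) * (p * r)) + G * ((w + t) * ((t + 1) * p))) * c + G * ((w + t) * (p * r)) * d - \<kappa>\<^sup>2 * (G * ((w + t) * (p * r))) * b)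
      + ((G' * ((w + t) * (t + 1) / 2 * p) + G * ((w + t) * (t + 1) / 2 * (t * p / r))) * n + w * (G * ((w + t) * (t + 1) / 2 * p) / r) * n
        + 2 * (G * ((w + t) * (t + 1) / 2 * p)) * c)
      - G' * (2 * (p * r\<^sup>2) * a + \<kappa>\<^sup>2 * (p * r\<^sup>2) * b + (w + t) * (p * r) * c + - (p * r\<^sup>2) * d + (w + t) * (t + 1) / 2 * p * n)
      = G * p / r * ((2 * t + 2) * X + 2 * \<kappa>\<^sup>2 * b * r\<^sup>2)"
    unfolding X_def using r by (simp add: field_simps power2_eq_square)
  moreover have "G * p / r * ((2 * t + 2) * X + 2 * \<kappa>\<^sup>2 * b * r\<^sup>2) \<ge> 0"
    using X p r * g(2)[of r] by (simp add: G_def t_def)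
  ultimately show "Phi s g' r a b c d n
    \<le> dilation_form (\<lambda>r. g r * (r ^ s * r)) (\<lambda>r. g' r * (r ^ s * r) + g r * ((real s + 1) * r ^ s)) r a b c d n +
      energy_form (\<lambda>r. g r * ((w + real s) * (r ^ s * r))) (\<lambda>r. g' r * ((w + real s) * (r ^ s * r)) + g r * ((w + real s) * ((real s + 1) * r ^ s))) r a b c d n +
      transport_form (\<lambda>r. g r * (?k * r ^ s)) (\<lambda>r. g' r * (?k * r ^ s) + g r * (?k * (real s * r ^ s / r))) r a b c d n"
    unfolding radial_form_def dilation_form_def energy_form_def transport_form_def
    unfolding p_def[symmetric] t_def[symmetric] G_def[symmetric] G'_def[symmetric] Qw by simp
qed

text \<open>In \<open>Phi s\<close> the coefficient of n is quadratic in s, that of c is linear, and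
  the others are constant up to the common power of r. Positive n-mass on one shell therefore makes
  \<open>Phi s\<close> positive there once s is large, and monotonicity transports the positivity to
  every larger radius.\<close>

lemma Phi_positive_far:
  assumes g0: "continuous_on UNIV g0" "\<And>r. g0 r \<ge> 0" "\<And>r. r \<notin> {r1..r2} \<Longrightarrow> g0 r = 0" and R: "R\<^sub>0 < r1" "r1 \<le> r2"
    and pos: "J (\<lambda>r a b c d n. g0 r * n) > 0" and Q3: "Q \<ge> 3"
  obtains s :: nat where "s \<ge> 1" "\<forall>g. Cc r2 g \<longrightarrow> (\<forall>r. 0 \<le> g r) \<longrightarrow> (\<exists>t. 0 < g t) \<longrightarrow> 0 < J (Phi s g)"
proof -
  have C0: "Cc R\<^sub>0 g0" unfolding Cc_def using g0 R by blast
  define A where "A = J (radial_form g0 (\<lambda>r. 2 * r\<^sup>2) (\<lambda>r. \<kappa>\<^sup>2 * r\<^sup>2) (\<lambda>r. 0) (\<lambda>r. - r\<^sup>2) (\<lambda>r. 0))"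
  define B where "B = J (radial_form g0 (\<lambda>r. 0) (\<lambda>r. 0) (\<lambda>r. r) (\<lambda>r. 0) (\<lambda>r. 0))"
  define N where "N = J (radial_form g0 (\<lambda>r. 0) (\<lambda>r. 0) (\<lambda>r. 0) (\<lambda>r. 0) (\<lambda>r. 1))"
  have N: "N > 0" using pos unfolding N_def radial_form_def by simp
  obtain s0 :: nat where s0: "real s0 > 2 * (\<bar>A\<bar> + \<bar>B\<bar> + 1) / N" using reals_Archimedean2 by blast
  define s where "s = Suc s0"
  \<comment> \<open>The threshold at which the n-term outweighs the a-, b-, d-terms in A and the
    c-term in B whatever their signs.\<close>
  have sN: "(real s + 1) / 2 * N \<ge> \<bar>A\<bar> + \<bar>B\<bar> + 1"
  proof -
    have "2 * (\<bar>A\<bar> + \<bar>B\<bar> + 1) < real s0 * N" using s0 N by (simp add: pos_divide_less_eq)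
    moreover have "\<bar>A\<bar> + \<bar>B\<bar> + 1 \<le> P / 2 + N" if "2 * (\<bar>A\<bar> + \<bar>B\<bar> + 1) < P" for P
      using that N by argo
    ultimately have "\<bar>A\<bar> + \<bar>B\<bar> + 1 \<le> real s0 * N / 2 + N" by blast
    moreover have "(real s + 1) / 2 * N = real s0 * N / 2 + N" by (simp add: s_def field_simps)
    ultimately show ?thesis by simp
  qed
  \<comment> \<open>Dividing by r^s removes the common power from \<open>Phi s\<close>, so that A, B
    and N can be fixed before s.\<close>
  have gs: "Cc R\<^sub>0 (\<lambda>r. g0 r * (1 / r ^ s))"
    using R0 by (intro Cc_mult[OF C0] continuous_intros) auto
  have J1: "J (Phi s (\<lambda>r. g0 r * (1 / r ^ s))) > 0"
  proof -
    let ?F = "\<lambda>r a b c d n. radial_form g0 (\<lambda>r. 2 * r\<^sup>2) (\<lambda>r. \<kappa>\<^sup>2 * r\<^sup>2) (\<lambda>r. 0) (\<lambda>r. - r\<^sup>2) (\<lambda>r. 0) r a b c d n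
      + ((Q - 1 + real s) * radial_form g0 (\<lambda>r. 0) (\<lambda>r. 0) (\<lambda>r. r) (\<lambda>r. 0) (\<lambda>r. 0) r a b c d n
        + (Q - 1 + real s) * (real s + 1) / 2 * radial_form g0 (\<lambda>r. 0) (\<lambda>r. 0) (\<lambda>r. 0) (\<lambda>r. 0) (\<lambda>r. 1) r a b c d n)"
    have a: "adm (radial_form g0 (\<lambda>r. 2 * r\<^sup>2) (\<lambda>r. \<kappa>\<^sup>2 * r\<^sup>2) (\<lambda>r. 0) (\<lambda>r. - r\<^sup>2) (\<lambda>r. 0))"
      "adm (radial_form g0 (\<lambda>r. 0) (\<lambda>r. 0) (\<lambda>r. r) (\<lambda>r. 0) (\<lambda>r. 0))" "adm (radial_form g0 (\<lambda>r. 0) (\<lambda>r. 0) (\<lambda>r. 0) (\<lambda>r. 0) (\<lambda>r. 1))"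
      by (intro adm_radial_form C0 continuous_intros)+
    have "J (Phi s (\<lambda>r. g0 r * (1 / r ^ s))) = J ?F"
    proof (rule J_eq)
      show "adm (Phi s (\<lambda>r. g0 r * (1 / r ^ s)))" by (intro adm_radial_form gs Phi_cont)
      show "adm ?F" by (intro adm_add adm_cmult a)
      fix r a b c d n :: real assume "r > R\<^sub>0"
      then have "r \<noteq> 0" using R0 by linarith
      then show "Phi s (\<lambda>r. g0 r * (1 / r ^ s)) r a b c d n = ?F r a b c d n" by (simp add: radial_form_def field_simps)
    qed
    also have "\<dots> = A + ((Q - 1 + real s) * B + (Q - 1 + real s) * (real s + 1) / 2 * N)"
      unfolding A_def B_def N_def
      by (subst J_add[OF a(1) adm_add[OF adm_cmult[OF a(2)] adm_cmult[OF a(3)]]], subst J_add[OF adm_cmult[OF a(2)] adm_cmult[OF a(3)]])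
        (simp only: J_cmult)
    also have "\<dots> = A + (Q - 1 + real s) * (B + (real s + 1) / 2 * N)" by (simp add: algebra_simps)
    also have "\<dots> \<ge> A + 1 * (B + (real s + 1) / 2 * N)"
      using sN Q3 by (intro add_left_mono mult_right_mono) auto
    finally have *: "A + 1 * (B + (real s + 1) / 2 * N) \<le> J (Phi s (\<lambda>r. g0 r * (1 / r ^ s)))" .
    have "0 < z" if "A + 1 * (B + M) \<le> z" "\<bar>A\<bar> + \<bar>B\<bar> + 1 \<le> M" for M z
      using that abs_ge_minus_self[of A] abs_ge_minus_self[of B] by simp
    from this[OF * sN] show ?thesis .
  qed
  show ?thesis
  proof (rule that[of s])
    show "s \<ge> 1" by (simp add: s_def)
  next
    show "\<forall>g. Cc r2 g \<longrightarrow> (\<forall>r. 0 \<le> g r) \<longrightarrow> (\<exists>t. 0 < g t) \<longrightarrow> 0 < J (Phi s g)"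
  proof (intro allI impI)
    fix g :: "real \<Rightarrow> real" assume "Cc r2 g" "\<forall>r. 0 \<le> g r" "\<exists>t. 0 < g t"
    then have g: "Cc r2 g" "\<And>r. g r \<ge> 0" "\<exists>t. g t > 0" by auto
    then obtain t where t: "g t > 0" by blast
    obtain r3 r4 where r34: "r2 < r3" "\<forall>r. r \<notin> {r3..r4} \<longrightarrow> g r = 0" and cg: "continuous_on UNIV g"
      using g(1) unfolding Cc_def by blast
    have r4: "r3 \<le> r4"
    proof (rule ccontr)
      assume "\<not> r3 \<le> r4"
      then have "t \<notin> {r3..r4}" by auto
      then show False using r34(2) t by auto
    qed
    have "Itg g * J (Phi s (\<lambda>r. g0 r * (1 / r ^ s))) \<le> Itg (\<lambda>r. g0 r * (1 / r ^ s)) * J (Phi s g)"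
    proof (rule transport[OF Phi_cont, where R="R\<^sub>0" and ?r1.0=r1 and ?r2.0=r2 and ?r3.0=r3 and ?r4.0=r4])
      show "J (Phi s k') \<le> 0" if "C1c R\<^sub>0 k k'" "\<And>r. k r \<ge> 0" for k k' by (rule Phi_mono[OF that])
      show "continuous_on UNIV (\<lambda>r. g0 r * (1 / r ^ s))" using gs unfolding Cc_def by blast
      show "g0 r * (1 / r ^ s) \<ge> 0" for r
      proof (cases "r \<in> {r1..r2}")
        case True
        then have "r > 0" using R R0 by auto
        then show ?thesis using g0(2)[of r] by simp
      qed (simp add: g0(3))
    qed (use g0 g cg r34 r4 R in auto)
    moreover have "Itg g * J (Phi s (\<lambda>r. g0 r * (1 / r ^ s))) > 0"
      using Itg_pos[OF g(1,2) t] J1 by simp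
    moreover have "Itg (\<lambda>r. g0 r * (1 / r ^ s)) \<ge> 0"
    proof (rule Itg_nonneg)
      fix r show "g0 r * (1 / r ^ s) \<ge> 0"
      proof (cases "r \<in> {r1..r2}")
        case True
        then have "r > 0" using R R0 by auto
        then show ?thesis using g0(2)[of r] by simp
      qed (simp add: g0(3))
    qed
    moreover have "0 < y" if "z \<le> x * y" "0 < z" "0 \<le> x" for x y z :: real
      using mult_nonneg_nonpos[of x y] that by linarith
    ultimately show "J (Phi s g) > 0" by blast
  qed
  qed
qed

text \<open>With e = 1 this is \<open>Phi 0\<close> divided by r^2, plus the extra term r^(-3/2) n.
  That term is large enough to absorb the surplus of order r^(-2) of \<open>Phi s\<close> over
  \<open>Phi 0\<close> far out, and small enough to be paid for by the derivative of
  \<open>energy_weight\<close>.\<close>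

abbreviation Gam :: "(real \<Rightarrow> real) \<Rightarrow> (real \<Rightarrow> real) \<Rightarrow> real \<Rightarrow> real \<Rightarrow> real \<Rightarrow> real \<Rightarrow> real \<Rightarrow> real \<Rightarrow> real" where
  "Gam e g \<equiv> radial_form g (\<lambda>r. e r * 2) (\<lambda>r. e r * \<kappa>\<^sup>2) (\<lambda>r. e r * ((Q - 1) / r)) (\<lambda>r. - e r)
     (\<lambda>r. e r * ((Q - 1) / 2 / r\<^sup>2 + 1 / (r * sqrt r)))"

lemma Gam_cont:
  assumes e: "continuous_on {R\<^sub>0<..} e"
  shows "continuous_on {R\<^sub>0<..} (\<lambda>r. e r * 2)" "continuous_on {R\<^sub>0<..} (\<lambda>r. e r * \<kappa>\<^sup>2)" "continuous_on {R\<^sub>0<..} (\<lambda>r. e r * ((Q - 1) / r))"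
    "continuous_on {R\<^sub>0<..} (\<lambda>r. - e r)" "continuous_on {R\<^sub>0<..} (\<lambda>r. e r * ((Q - 1) / 2 / r\<^sup>2 + 1 / (r * sqrt r)))"
  using R0 by (intro continuous_intros e; auto)+

definition slow_growth :: bool where
  "slow_growth \<longleftrightarrow> (\<forall>\<epsilon>>0. \<forall>R'. \<exists>R\<ge>R'. \<forall>h. Cc R\<^sub>0 h \<longrightarrow> (\<forall>r. 0 \<le> h r \<and> h r \<le> 1) \<longrightarrow> (\<forall>r. r \<notin> {R..4*R} \<longrightarrow> h r = 0) \<longrightarrow>
     J (\<lambda>r a b c d n. h r * b) \<le> \<epsilon> * R)"

lemma slow_growthD:
  assumes "slow_growth" "\<epsilon> > 0"
  obtains R where "R \<ge> R'" "\<And>h. \<lbrakk>Cc R\<^sub>0 h; \<And>r. 0 \<le> h r; \<And>r. h r \<le> 1; \<And>r. r \<notin> {R..4*R} \<Longrightarrow> h r = 0\<rbrakk> \<Longrightarrow> J (\<lambda>r a b c d n. h r * b) \<le> \<epsilon> * R"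
  using assms unfolding slow_growth_def by metis

text \<open>If \<open>Gam\<close> were never positive beyond R, comparing it with the positive
  \<open>Phi s\<close>, the c-terms being removed by \<open>transport_form\<close>, would show that
  the n-density is strictly increasing. Its mass in a shell, and with it that of f^2, would then
  grow linearly, against \<open>slow_growth\<close>.\<close>

lemma Gam_positive_somewhere:
  assumes s: "s \<ge> 1" and Phi: "\<forall>g. Cc r2 g \<longrightarrow> (\<forall>r. 0 \<le> g r) \<longrightarrow> (\<exists>t. 0 < g t) \<longrightarrow> 0 < J (Phi s g)"
    and sg: slow_growth and r2: "R\<^sub>0 < r2"
  obtains g where "Cc R g" "\<And>r. g r \<ge> 0" "J (Gam (\<lambda>r. 1) g) > 0"
proof (rule ccontr)
  assume "\<not> thesis"
  then have neg: "J (Gam (\<lambda>r. 1) g) \<le> 0" if "Cc R g" "\<And>r. g r \<ge> 0" for g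
    using that(1,2) \<open>\<And>g. Cc R g \<Longrightarrow> (\<And>r. 0 \<le> g r) \<Longrightarrow> 0 < J (Gam (\<lambda>r. 1) g) \<Longrightarrow> thesis\<close> by (meson not_le_imp_less)
  define t where "t = real s"
  have t: "t \<ge> 1" using s by (simp add: t_def)
  \<comment> \<open>Beyond this radius (t^2 + t)/(2r) \<le> 1/sqrt r, so the extra term in
    \<open>Gam\<close> beats the surplus of \<open>Phi s\<close>.\<close>
  define R1 where "R1 = max (max R r2) (max 1 (((t\<^sup>2 + t) / 2)\<^sup>2))"
  have R1: "R1 \<ge> R" "R1 \<ge> r2" "R1 \<ge> 1" "R1 \<ge> ((t\<^sup>2 + t) / 2)\<^sup>2" "R1 > R\<^sub>0" using r2 by (auto simp: R1_def)
  have neg_n: "J (radial_form k' (\<lambda>r. 0) (\<lambda>r. 0) (\<lambda>r. 0) (\<lambda>r. 0) (\<lambda>r. 1)) < 0"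
    if k: "C1c R1 k k'" "\<And>r. k r \<ge> 0" "\<exists>t. k t > 0" for k k'
  proof -
    have k0: "C1c R\<^sub>0 k k'" using C1c_mono[OF k(1)] R1(5) by simp
    have Cck: "Cc R1 k" "Cc R1 k'" by (rule C1c_Cc[OF k(1)])+
    have kz: "k r = 0" if "r \<le> R1" for r by (rule Cc_zero[OF Cck(1) that])
    \<comment> \<open>The weight k r in \<open>Gam\<close> matches the weight k / r^(s + 1) in
      \<open>Phi s\<close>: both give 2a - d + \<kappa>^2 b the factor k r.\<close>
    define g where "g = (\<lambda>r. k r * r)"
    have Cg: "Cc R1 g" unfolding g_def by (intro Cc_mult Cck continuous_intros)
    have g0: "g r \<ge> 0" for r using k(2)[of r] kz[of r] R1(3) by (cases "r \<le> R1") (auto simp: g_def)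
    have A: "J (Phi s (\<lambda>r. k r * (1 / (r ^ s * r)))) > 0"
    proof (rule Phi[rule_format])
      have "Cc R1 (\<lambda>r. k r * (1 / (r ^ s * r)))" using R1(3) by (intro Cc_mult Cck continuous_intros) auto
      then show "Cc r2 (\<lambda>r. k r * (1 / (r ^ s * r)))" using R1(2) by (rule Cc_mono)
      show "k r * (1 / (r ^ s * r)) \<ge> 0" for r using k(2)[of r] kz[of r] R1(3) by (cases "r \<le> R1") auto
      obtain u where u: "k u > 0" using k(3) by blast
      then have "u > R1" using kz[of u] by force
      then have "k u * (1 / (u ^ s * u)) > 0" using u R1(3) by simp
      then show "\<exists>t. 0 < k t * (1 / (t ^ s * t))" by blast
    qed
    have G: "J (Gam (\<lambda>r. 1) g) \<le> 0" by (rule neg[OF Cc_mono[OF Cg R1(1)] g0])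
    let ?nf = "radial_form k' (\<lambda>r. 0) (\<lambda>r. 0) (\<lambda>r. 0) (\<lambda>r. 0) (\<lambda>r. 1)"
    have ag: "adm (Gam (\<lambda>r. 1) g)" using R1(5) by (intro adm_radial_form Gam_cont continuous_intros Cc_mono[OF Cg]) auto
    have an: "adm ?nf" using R1(5) by (intro adm_radial_form continuous_intros Cc_mono[OF Cck(2)]) auto
    have ap: "adm (Phi s (\<lambda>r. k r * (1 / (r ^ s * r))))"
      using R1(5) R0 by (intro adm_radial_form Phi_cont Cc_mult Cc_mono[OF Cck(1)] continuous_intros) auto
    note N = transport_form_vanishes[OF k0]
    have "J (Phi s (\<lambda>r. k r * (1 / (r ^ s * r)))) \<le>
      J (\<lambda>r a b c d n. Gam (\<lambda>r. 1) g r a b c d n + (t / 2 * transport_form k k' r a b c d n - t / 2 * ?nf r a b c d n))"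
    proof (rule J_mono[OF ap])
      show "adm (\<lambda>r a b c d n. Gam (\<lambda>r. 1) g r a b c d n + (t / 2 * transport_form k k' r a b c d n - t / 2 * ?nf r a b c d n))"
        by (intro adm_add adm_diff adm_cmult ag an N)
      fix r a b c d n :: real
      assume *: "r > R\<^sub>0" "0 \<le> n"
      have r: "r > 0" using *(1) R0 by linarith
      show "Phi s (\<lambda>r. k r * (1 / (r ^ s * r))) r a b c d n \<le> Gam (\<lambda>r. 1) g r a b c d n + (t / 2 * transport_form k k' r a b c d n - t / 2 * ?nf r a b c d n)"
      proof (cases "r \<le> R1")
        case True
        then show ?thesis using kz[OF True] by (simp add: radial_form_def g_def transport_form_def)
      next
        case False
        have sq: "(t\<^sup>2 + t) / 2 \<le> sqrt r"
          using R1(4) False t by (intro real_le_rsqrt) auto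
        have "Gam (\<lambda>r. 1) g r a b c d n + (t / 2 * transport_form k k' r a b c d n - t / 2 * ?nf r a b c d n)
          - Phi s (\<lambda>r. k r * (1 / (r ^ s * r))) r a b c d n = k r * n * (1 / sqrt r - (t\<^sup>2 + t) / 2 / r)"
          using r unfolding radial_form_def g_def transport_form_def t_def[symmetric] by (simp add: field_simps power2_eq_square)
        moreover have "(t\<^sup>2 + t) / 2 / r \<le> 1 / sqrt r"
        proof -
          have "(t\<^sup>2 + t) / 2 / r \<le> sqrt r / r" using sq r by (intro divide_right_mono) auto
          also have "\<dots> = 1 / sqrt r" using r real_sqrt_mult_self[of r] by (simp add: field_simps)
          finally show ?thesis .
        qed
        moreover have "k r * n * (1 / sqrt r - (t\<^sup>2 + t) / 2 / r) \<ge> 0" if "(t\<^sup>2 + t) / 2 / r \<le> 1 / sqrt r"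
          using that k(2)[of r] *(2) by simp
        ultimately show ?thesis by linarith
      qed
    qed
    also have "\<dots> = J (Gam (\<lambda>r. 1) g) + (t / 2 * J (transport_form k k') - t / 2 * J ?nf)"
      by (subst J_add[OF ag adm_diff[OF adm_cmult[OF N(1)] adm_cmult[OF an]]], subst J_diff[OF adm_cmult[OF N(1)] adm_cmult[OF an]])
        (simp only: J_cmult)
    finally have "0 < - (t / 2 * J ?nf)" using A G N(2) by simp
    then show ?thesis using t by (simp add: zero_less_mult_iff mult_less_0_iff)
  qed
  let ?nl = "\<lambda>g. radial_form g (\<lambda>r. 0) (\<lambda>r. 0) (\<lambda>r. 0) (\<lambda>r. 0) (\<lambda>r. 1)"
  have c0: "continuous_on {R\<^sub>0<..} (\<lambda>r. 0::real)" "continuous_on {R\<^sub>0<..} (\<lambda>r. 1::real)" by auto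
  have n_mono: "J (?nl k') \<le> 0" if k: "C1c R1 k k'" "\<And>r. k r \<ge> 0" for k k'
  proof (cases "\<exists>t. k t > 0")
    case True
    then show ?thesis using neg_n[OF k] by simp
  next
    case False
    then have "k = (\<lambda>r. 0)" using k(2) by (intro ext antisym) (auto simp: not_less)
    then have "k' = (\<lambda>r. 0)" using k(1) unfolding C1c_def by (intro ext) (auto intro: DERIV_unique)
    then have "?nl k' = (\<lambda>r a b c d n. 0 * radial_form k' (\<lambda>r. 0) (\<lambda>r. 0) (\<lambda>r. 0) (\<lambda>r. 0) (\<lambda>r. 1) r a b c d n)"
      by (intro ext) (simp add: radial_form_def)
    then show ?thesis using J_cmult[of 0] by simp
  qed
  define R2 where "R2 = max 3 (R1 + 1)"
  have R2: "R2 \<ge> 3" "R2 > R1" by (auto simp: R2_def)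
  define k where "k = (\<lambda>r. ((bump R2 r)\<^sup>2)\<^sup>2)"
  define k' where "k' = (\<lambda>r. 2 * (bump R2 r)\<^sup>2 * bump_sq' R2 r)"
  have kk: "C1c R1 k k'" unfolding k_def k'_def by (rule bump_fourth_props(1)[OF R2])
  have "bump R2 (2 * R2) \<ge> 8 / 9" by (rule bump_props(5)[OF R2(1)]) (use R2 in auto)
  then have "k (2 * R2) > 0" by (simp add: k_def)
  then have negk: "J (?nl k') < 0" by (intro neg_n[OF kk]) (auto simp: k_def)
  have ck': "continuous_on UNIV k'" using kk unfolding C1c_def by blast
  have zk': "k' r = 0" if "r \<notin> {R2..4*R2}" for r using bump_props(3)[OF R2(1) that] by (simp add: k'_def)
  \<comment> \<open>The n-mass against k' is negative, so the negative part of k' is a nonnegative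
    weight with positive n-mass and can serve as the inner weight in
    \<open>transport\<close>.\<close>
  define gm where "gm = (\<lambda>r. max 0 (- k' r))"
  define gp where "gp = (\<lambda>r. max 0 (k' r))"
  have cgm: "continuous_on UNIV gm" "continuous_on UNIV gp" unfolding gm_def gp_def by (intro continuous_intros ck')+
  have "R\<^sub>0 < R2" using R2 R1(5) by linarith
  moreover have "gm r = 0" "gp r = 0" if "r \<notin> {R2..4*R2}" for r using zk'[OF that] by (auto simp: gm_def gp_def)
  ultimately have Cgm: "Cc R\<^sub>0 gm" "Cc R\<^sub>0 gp" unfolding Cc_def using cgm by blast+
  have am: "adm (?nl gm)" "adm (?nl gp)" by (intro adm_radial_form Cgm c0)+
  have "J (?nl k') = J (?nl gp) - J (?nl gm)"
  proof -
    have "?nl k' = (\<lambda>r a b c d n. ?nl gp r a b c d n - ?nl gm r a b c d n)"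
      by (intro ext) (auto simp: radial_form_def gm_def gp_def max_def algebra_simps)
    then show ?thesis using J_diff[OF am(2,1)] by simp
  qed
  moreover have "J (?nl gp) \<ge> 0"
  proof -
    have "J (\<lambda>r a b c d n. 0 * ?nl gp r a b c d n) \<le> J (?nl gp)"
      by (rule J_mono[OF adm_cmult[OF am(2)] am(2)]) (auto simp: radial_form_def gp_def)
    then show ?thesis by (simp add: J_def ev_def)
  qed
  ultimately have Jm: "J (?nl gm) > 0" using negk by linarith
  define I1 where "I1 = Itg gm"
  have I1: "I1 \<ge> 0" unfolding I1_def by (rule Itg_nonneg) (simp add: gm_def)
  \<comment> \<open>Chosen so that transport yields R3/2 times this n-mass on one side and at most
    R3/4 times it on the other.\<close>
  define \<epsilon> where "\<epsilon> = J (?nl gm) / (4 * (I1 + 1))"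
  have \<epsilon>: "\<epsilon> > 0" using Jm I1 by (simp add: \<epsilon>_def)
  obtain R3 where R3: "R3 \<ge> 4 * R2 + 1" "\<And>h. \<lbrakk>Cc R\<^sub>0 h; \<And>r. 0 \<le> h r; \<And>r. h r \<le> 1; \<And>r. r \<notin> {R3..4*R3} \<Longrightarrow> h r = 0\<rbrakk> \<Longrightarrow> J (\<lambda>r a b c d n. h r * b) \<le> \<epsilon> * R3"
    using slow_growthD[OF sg \<epsilon>] by metis
  have R33: "R3 \<ge> 3" "R3 > R1" "R3 > R\<^sub>0" using R3(1) R2 R1(5) by linarith+
  define \<eta> where "\<eta> = (\<lambda>r. ((bump R3 r)\<^sup>2)\<^sup>2)"
  have \<eta>: "C1c R\<^sub>0 \<eta> (\<lambda>r. 2 * (bump R3 r)\<^sup>2 * bump_sq' R3 r)" "Itg \<eta> \<ge> R3 / 2"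
    unfolding \<eta>_def by (rule bump_fourth_props[OF R33(1,3)])+
  note C\<eta> = C1c_Cc(1)[OF \<eta>(1)]
  have \<eta>b: "0 \<le> \<eta> r" "\<eta> r \<le> 1" "r \<notin> {R3..4*R3} \<Longrightarrow> \<eta> r = 0" for r
    using bump_props(1-3)[OF R33(1), of r] by (auto simp: \<eta>_def power_le_one)
  have c\<eta>: "continuous_on UNIV \<eta>" using C\<eta> unfolding Cc_def by blast
  have "Itg \<eta> * J (?nl gm) \<le> Itg gm * J (?nl \<eta>)"
  proof (rule transport[OF c0(1) c0(1) c0(1) c0(1) c0(2) n_mono, where R=R1])
    show "continuous_on UNIV gm" by (rule cgm)
    show "gm r = 0" if "r \<notin> {R2..4*R2}" for r using zk'[OF that] by (simp add: gm_def)
    show "\<eta> r = 0" if "r \<notin> {R3..4*R3}" for r by (rule \<eta>b(3)[OF that])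
  qed (use R1 R2 R3 R33 \<eta>b c\<eta> in \<open>auto simp: gm_def\<close>)
  also have "J (?nl \<eta>) \<le> J (\<lambda>r a b c d n. \<eta> r * b)"
    by (rule J_mono[OF adm_radial_form[OF C\<eta> c0(1) c0(1) c0(1) c0(1) c0(2)] adm_basic(2)[OF C\<eta>]])
      (auto simp: radial_form_def intro!: mult_left_mono \<eta>b)
  also have "J (\<lambda>r a b c d n. \<eta> r * b) \<le> \<epsilon> * R3" by (rule R3(2)[OF C\<eta> \<eta>b])
  finally have "Itg \<eta> * J (?nl gm) \<le> I1 * (\<epsilon> * R3)" using I1 by (simp add: I1_def mult_left_mono)
  moreover have "R3 / 2 * J (?nl gm) \<le> Itg \<eta> * J (?nl gm)" using \<eta>(2) Jm by (intro mult_right_mono) auto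
  moreover have "I1 * (\<epsilon> * R3) \<le> R3 * (J (?nl gm) / 4)"
  proof -
    have "\<epsilon> * (I1 + 1) = J (?nl gm) / 4" using I1 by (simp add: \<epsilon>_def field_simps)
    then have "I1 * \<epsilon> \<le> J (?nl gm) / 4" using \<epsilon> by (simp add: algebra_simps)
    then have "R3 * (I1 * \<epsilon>) \<le> R3 * (J (?nl gm) / 4)" using R33 by (intro mult_left_mono) auto
    then show ?thesis by (simp add: mult_ac)
  qed
  ultimately have "R3 * J (?nl gm) \<le> 0" by simp
  then show False using R33 Jm by (simp add: mult_le_0_iff)
qed

end

text \<open>To be read with x = 1/r and y = r^(-3/2). The left side is what the unweighted energy
  loses, the right side what a growing weight gains. The losses are of order y and are absorbed by P
  and by \<kappa>^2 b through K \<ge> 2 and K \<kappa>^2 \<ge> 5. The gain contains -K y T, which is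
  covered by the term -2 T x on the left because K y \<le> 2 x.\<close>

lemma energy_increment_nonneg:
  fixes a b c d n e x y w K \<kappa> :: real
  assumes r: "0 < x" "x \<le> 1" "0 < y" and e: "1 \<le> e" "e \<le> 2" and K: "K \<ge> 2" "K * \<kappa>\<^sup>2 \<ge> 5" "K * y \<le> 2 * x" and w: "w \<ge> 2"
    and q: "0 \<le> a" "a \<le> d" "0 \<le> n" "n \<le> b" "c\<^sup>2 \<le> a * n"
  shows "e * (2 * (a - d) * x - w * (w - 2) / 2 * n * x ^ 3 - 2 * c * y + (3 / 2 - w) * n * y * x)
    \<le> K * y * (2 * a - d + \<kappa>\<^sup>2 * b + w * c * x + (w / 2 * x\<^sup>2 + y) * n)"
proof -
  \<comment> \<open>P completes the square in c, and T is the nonradial part d - a of the gradient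
    plus a nonnegative multiple of n. The last factor on the right is P - T + \<kappa>^2 b + y
    n.\<close>
  define P where "P = a + w * c * x + w\<^sup>2 / 4 * n * x\<^sup>2"
  define T where "T = (d - a) + w * (w - 2) / 4 * n * x\<^sup>2"
  define c1 where "c1 = c + w * n * x / 2"
  have P: "P \<ge> 0" using quad_nonneg[OF q(1,3,5), of 1 "w * x / 2"] by (simp add: P_def power2_eq_square algebra_simps)
  have T: "T \<ge> 0" using q w by (simp add: T_def)
  have quad: "0 \<le> P + 2 * c1 + n"
    using quad_nonneg[OF q(1,3,5), of 1 "1 + w * x / 2"] by (simp add: P_def c1_def power2_eq_square algebra_simps)
  have "- 2 * c1 * y \<le> (P + n) * y" using quad r(3) mult_right_mono[of 0 "P + 2 * c1 + n" y] by (simp add: algebra_simps)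
  moreover have "3 / 2 * n * y * x \<le> 3 / 2 * n * y" using r q(3) mult_left_mono[of x 1 "3 / 2 * n * y"] by simp
  ultimately have 1: "- 2 * T * x + (- 2 * c1 * y + 3 / 2 * n * y * x) \<le> - 2 * T * x + (P * y + 5 / 2 * n * y)"
    by (simp add: algebra_simps)
  have "2 * (a - d) * x - w * (w - 2) / 2 * n * x ^ 3 - 2 * c * y + (3 / 2 - w) * n * y * x
     = - 2 * T * x + (- 2 * c1 * y + 3 / 2 * n * y * x)"
    by (simp add: T_def c1_def power2_eq_square power3_eq_cube field_simps)
  then have "e * (2 * (a - d) * x - w * (w - 2) / 2 * n * x ^ 3 - 2 * c * y + (3 / 2 - w) * n * y * x)
     \<le> e * (- 2 * T * x + (P * y + 5 / 2 * n * y))"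
    using 1 e by (simp only:) (intro mult_left_mono; simp)
  also have "\<dots> = - (2 * e * T * x) + e * (P * y + 5 / 2 * n * y)" by (simp add: algebra_simps)
  also have "\<dots> \<le> - (2 * T * x) + 2 * (P * y + 5 / 2 * n * y)"
  proof (rule add_mono)
    have "1 * (2 * T * x) \<le> e * (2 * T * x)" using e T r by (intro mult_right_mono) auto
    then show "- (2 * e * T * x) \<le> - (2 * T * x)" by (simp add: mult_ac)
    show "e * (P * y + 5 / 2 * n * y) \<le> 2 * (P * y + 5 / 2 * n * y)" using e P q r by (intro mult_right_mono) auto
  qed
  also have "\<dots> \<le> K * y * (P - T + \<kappa>\<^sup>2 * b + y * n)"
  proof -
    have "K * y * T \<le> 2 * x * T" using K(3) T by (rule mult_right_mono)
    moreover have "2 * (P * y) \<le> K * (P * y)" using K(1) P r by (intro mult_right_mono) auto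
    moreover have "5 * (n * y) \<le> (K * \<kappa>\<^sup>2) * (n * y)" using K(2) q r by (intro mult_right_mono) auto
    moreover have "(K * \<kappa>\<^sup>2) * (n * y) \<le> (K * \<kappa>\<^sup>2) * (b * y)" using K(2) q r by (intro mult_left_mono mult_right_mono) auto
    moreover have "0 \<le> K * y * (y * n)" using K r q by simp
    ultimately show ?thesis by (simp add: algebra_simps)
  qed
  also have "P - T + \<kappa>\<^sup>2 * b + y * n = 2 * a - d + \<kappa>\<^sup>2 * b + w * c * x + (w / 2 * x\<^sup>2 + y) * n"
    by (simp add: P_def T_def power2_eq_square field_simps)
  finally show ?thesis .
qed

text \<open>The bookkeeping behind \<open>Gam_mono\<close>, with v = (Q - 1)/2, h = 3/2 and x = 1/r
  treated as independent variables so that no division remains and the identity is one of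
  polynomials.\<close>

lemma energy_increment_identity:
  fixes G G' K Y E x a b c d n v h k2 :: real
  shows "(G' * E + G * (K * Y - E * x)) * (2 * a - d + k2 * b) + G * (E * x) * ((2 - (2 * v + 1)) * d + k2 * (2 * v + 1) * b)
       + ((G' * (2 * v * (E * x)) + G * (2 * v * (K * Y * x - E * x\<^sup>2))) * c + G * (2 * v * (E * x)) * d - k2 * (G * (2 * v * (E * x))) * b)
       + ((G' * (E * (v * x\<^sup>2 + Y)) + G * (K * Y * (v * x\<^sup>2 + Y) + E * (- (2 * v) * x ^ 3 - h * Y * x))) * n
         + 2 * v * (G * (E * (v * x\<^sup>2 + Y)) * x) * n + 2 * (G * (E * (v * x\<^sup>2 + Y))) * c)
       - G' * (E * (2 * a - d + k2 * b + 2 * v * c * x + (v * x\<^sup>2 + Y) * n))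
    = G * (K * Y * (2 * a - d + k2 * b + 2 * v * c * x + (v * x\<^sup>2 + Y) * n)
       - E * (2 * (a - d) * x - 2 * v * (v - 1) * n * x ^ 3 - 2 * c * Y + (h - 2 * v) * n * Y * x))"
  by algebra

section \<open>The weighted energy and the contradiction with slow growth\<close>

context grushin_exterior
begin

text \<open>A bounded increasing weight with derivative K r^(-3/2), the order of the losses of the
  energy. Being between 1 and 2 far out, it does not disturb the size of the energy.\<close>

definition energy_weight :: "real \<Rightarrow> real \<Rightarrow> real" where "energy_weight K r = 2 - 2 * K / sqrt r"

lemma energy_weight_DERIV: "r > 0 \<Longrightarrow> (energy_weight K has_real_derivative K / (r * sqrt r)) (at r)"
proof -
  assume r: "r > 0"
  have "((\<lambda>r. 2 - 2 * K / sqrt r) has_real_derivative 2 * K * (inverse (sqrt r) / 2) / (sqrt r * sqrt r)) (at r)"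
    using r by (auto intro!: derivative_eq_intros)
  moreover have "2 * K * (inverse (sqrt r) / 2) / (sqrt r * sqrt r) = K / (r * sqrt r)"
    using r by (simp add: field_simps)
  ultimately show ?thesis unfolding energy_weight_def[abs_def] by simp
qed

lemma energy_weight_bounds:
  assumes "K > 0" "r \<ge> 4 * K\<^sup>2"
  shows "1 \<le> energy_weight K r" "energy_weight K r \<le> 2" "K * (1 / (r * sqrt r)) \<le> 2 * (1 / r)"
proof -
  have s: "2 * K \<le> sqrt r" using assms by (intro real_le_rsqrt) (simp add: power_mult_distrib)
  have r: "r > 0" using assms by (smt (verit) zero_less_power)
  have s0: "sqrt r > 0" using r by simp
  show "1 \<le> energy_weight K r" using s s0 by (simp add: energy_weight_def field_simps)
  show "energy_weight K r \<le> 2" using assms(1) r by (simp add: energy_weight_def)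
  have "K \<le> 2 * sqrt r" using s assms(1) by linarith
  then show "K * (1 / (r * sqrt r)) \<le> 2 * (1 / r)" using r s0 by (simp add: field_simps)
qed

lemma cont_energy_weight: "continuous_on {R\<^sub>0<..} (energy_weight K)"
  unfolding energy_weight_def using R0 by (intro continuous_intros) auto

text \<open>The multipliers are those for which the terms with g' add up to \<open>Gam\<close>. The
  remaining terms are g times the difference estimated in
  \<open>energy_increment_nonneg\<close>.\<close>

lemma Gam_mono:
  assumes g: "C1c R g g'" "\<And>r. g r \<ge> 0" and K: "K \<ge> 2" "K * \<kappa>\<^sup>2 \<ge> 5" and R: "R \<ge> R\<^sub>0" "R \<ge> 1" "R \<ge> 4 * K\<^sup>2" and Q3: "Q \<ge> 3"
  shows "J (Gam (energy_weight K) g') \<le> 0"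
proof (rule J_le_0)
  define w where "w = Q - 1"
  define e where "e = energy_weight K"
  define y where "y = (\<lambda>r::real. 1 / (r * sqrt r))"
  have g0: "C1c R\<^sub>0 g g'" by (rule C1c_mono[OF g(1) R(1)])
  note C = C1c_Cc[OF g0]
  have ne: "r > R\<^sub>0 \<Longrightarrow> r > 0" for r using R0 by linarith
  have De: "r > R\<^sub>0 \<Longrightarrow> (e has_real_derivative K * y r) (at r)" for r using energy_weight_DERIV[OF ne] by (simp add: e_def y_def)
  have Dy: "(y has_real_derivative - (3 / 2) * y r / r) (at r)" if "r > R\<^sub>0" for r
  proof -
    have r: "r > 0" using ne[OF that] .
    have "((\<lambda>r. 1 / (r * sqrt r)) has_real_derivative - (sqrt r + r * (inverse (sqrt r) / 2)) / ((r * sqrt r) * (r * sqrt r))) (at r)"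
      using r by (auto intro!: derivative_eq_intros)
    moreover have "- (sqrt r + r * (inverse (sqrt r) / 2)) / ((r * sqrt r) * (r * sqrt r)) = - (3 / 2) * y r / r"
    proof -
      define q where "q = sqrt r"
      have q: "q > 0" "r = q * q" using r by (auto simp: q_def)
      show ?thesis unfolding y_def q_def[symmetric] using q(1) by (simp add: q(2) field_simps)
    qed
    ultimately show ?thesis unfolding y_def by simp
  qed
  have ce: "continuous_on {R\<^sub>0<..} e" unfolding e_def by (rule cont_energy_weight)
  have cy: "continuous_on {R\<^sub>0<..} y" unfolding y_def using R0 by (intro continuous_intros) auto
  show "adm (Gam (energy_weight K) g')" by (intro adm_radial_form C Gam_cont cont_energy_weight)
  let ?p1 = "\<lambda>r. e r / r" and ?p1' = "\<lambda>r. K * y r / r - e r / r\<^sup>2"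
  let ?p3 = "\<lambda>r. e r * (w / 2 / r\<^sup>2 + y r)" and ?p3' = "\<lambda>r. K * y r * (w / 2 / r\<^sup>2 + y r) + e r * (- w / r ^ 3 - 3 / 2 * y r / r)"
  have D1: "(?p1 has_real_derivative ?p1' r) (at r)" if "r > R\<^sub>0" for r
    using ne[OF that] by (auto intro!: derivative_eq_intros De[OF that] simp: field_simps power2_eq_square)
  have c1: "continuous_on {R\<^sub>0<..} ?p1'" using R0 by (intro continuous_intros cy ce) auto
  show "C1c R\<^sub>0 (\<lambda>r. g r * ?p1 r) (\<lambda>r. g' r * ?p1 r + g r * ?p1' r)" by (rule C1c_mult[OF g0 D1 c1])
  show "C1c R\<^sub>0 (\<lambda>r. g r * (w * ?p1 r)) (\<lambda>r. g' r * (w * ?p1 r) + g r * (w * ?p1' r))"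
    by (rule C1c_mult[OF g0 DERIV_cmult[OF D1] continuous_on_mult_left[OF c1]])
  show "C1c R\<^sub>0 (\<lambda>r. g r * ?p3 r) (\<lambda>r. g' r * ?p3 r + g r * ?p3' r)"
  proof (rule C1c_mult[OF g0])
    fix r assume r: "r > R\<^sub>0"
    have "((\<lambda>r. w / 2 / r\<^sup>2) has_real_derivative - w / r ^ 3) (at r)"
      using ne[OF r] by (auto intro!: derivative_eq_intros simp: field_simps power2_eq_square power3_eq_cube)
    from DERIV_mult[OF De[OF r] DERIV_add[OF this Dy[OF r]]]
    show "(?p3 has_real_derivative ?p3' r) (at r)" by (rule DERIV_cong) (simp add: algebra_simps)
  next
    show "continuous_on {R\<^sub>0<..} ?p3'" using R0 by (intro continuous_intros cy ce) auto
  qed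
  fix r a b c d n :: real
  assume *: "r > R\<^sub>0" "0 \<le> a" "a \<le> d" "0 \<le> n" "n \<le> b" "c\<^sup>2 \<le> a * n"
  show "Gam (energy_weight K) g' r a b c d n \<le> dilation_form (\<lambda>r. g r * ?p1 r) (\<lambda>r. g' r * ?p1 r + g r * ?p1' r) r a b c d n +
      energy_form (\<lambda>r. g r * (w * ?p1 r)) (\<lambda>r. g' r * (w * ?p1 r) + g r * (w * ?p1' r)) r a b c d n +
      transport_form (\<lambda>r. g r * ?p3 r) (\<lambda>r. g' r * ?p3 r + g r * ?p3' r) r a b c d n"
  proof (cases "r \<le> R")
    case True
    then have "g r = 0" "g' r = 0" using Cc_zero C1c_Cc[OF g(1)] by auto
    then show ?thesis by (simp add: radial_form_def dilation_form_def energy_form_def transport_form_def)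
  next
    case False
    have r: "r > 0" "r \<ge> 1" "r \<ge> 4 * K\<^sup>2" using False R by auto
    have Qw: "Q = w + 1" by (simp add: w_def)
    define Y where "Y = y r"
    define E where "E = e r"
    define G where "G = g r"
    define G' where "G' = g' r"
    define x where "x = 1 / r"
    have x: "0 < x" "x \<le> 1" "r = 1 / x" using r by (auto simp: x_def)
    have Y0: "Y > 0" using r by (simp add: Y_def y_def)
    have Eb: "1 \<le> E" "E \<le> 2" "K * Y \<le> 2 * x"
      using energy_weight_bounds[of K r] K(1) r unfolding E_def e_def Y_def y_def x_def by auto
    let ?b1 = "2 * (a - d) * x - w * (w - 2) / 2 * n * x ^ 3 - 2 * c * Y + (3 / 2 - w) * n * Y * x"
    let ?G = "2 * a - d + \<kappa>\<^sup>2 * b + w * c * x + (w / 2 * x\<^sup>2 + Y) * n"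
    have ineq: "E * ?b1 \<le> K * Y * ?G"
      by (rule energy_increment_nonneg) (use x Y0 Eb K Q3 * in \<open>auto simp: w_def\<close>)
    let ?q1 = "K * Y * x - E * x\<^sup>2"
    let ?q3 = "K * Y * (w / 2 * x\<^sup>2 + Y) + E * (- w * x ^ 3 - 3 / 2 * Y * x)"
    have L: "Gam (energy_weight K) g' r a b c d n = G' * (E * ?G)"
      unfolding radial_form_def e_def[symmetric] E_def[symmetric] G'_def[symmetric] Qw
      using r by (simp add: x_def Y_def y_def field_simps power2_eq_square)
    have R1: "dilation_form (\<lambda>r. g r * ?p1 r) (\<lambda>r. g' r * ?p1 r + g r * ?p1' r) r a b c d n
       = r * (G' * (E * x) + G * ?q1) * (2 * a - d + \<kappa>\<^sup>2 * b) + G * (E * x) * ((2 - (w + 1)) * d + \<kappa>\<^sup>2 * (w + 1) * b)"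
      unfolding dilation_form_def unfolding Qw E_def[symmetric] G'_def[symmetric] G_def[symmetric] Y_def[symmetric]
      by (simp add: x_def power_divide)
    have R2: "energy_form (\<lambda>r. g r * (w * ?p1 r)) (\<lambda>r. g' r * (w * ?p1 r) + g r * (w * ?p1' r)) r a b c d n
       = (G' * (w * (E * x)) + G * (w * ?q1)) * c + G * (w * (E * x)) * d - \<kappa>\<^sup>2 * (G * (w * (E * x))) * b"
      unfolding energy_form_def E_def[symmetric] G'_def[symmetric] G_def[symmetric] Y_def[symmetric]
      by (simp add: x_def power_divide)
    have R3: "transport_form (\<lambda>r. g r * ?p3 r) (\<lambda>r. g' r * ?p3 r + g r * ?p3' r) r a b c d n
       = (G' * (E * (w / 2 * x\<^sup>2 + Y)) + G * ?q3) * n + w * (G * (E * (w / 2 * x\<^sup>2 + Y)) * x) * n + 2 * (G * (E * (w / 2 * x\<^sup>2 + Y))) * c"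
      unfolding transport_form_def unfolding Qw E_def[symmetric] G'_def[symmetric] G_def[symmetric] Y_def[symmetric]
      by (simp add: x_def power_divide)
    have rx: "r * x = 1" using r by (simp add: x_def)
    have R1': "r * (G' * (E * x) + G * ?q1) = G' * E + G * (K * Y - E * x)"
    proof -
      have "r * (G' * (E * x) + G * ?q1) = (r * x) * (G' * E + G * (K * Y - E * x))"
        by (simp add: algebra_simps power2_eq_square)
      then show ?thesis by (simp add: rx)
    qed
    have "(G' * E + G * (K * Y - E * x)) * (2 * a - d + \<kappa>\<^sup>2 * b) + G * (E * x) * ((2 - (w + 1)) * d + \<kappa>\<^sup>2 * (w + 1) * b)
       + ((G' * (w * (E * x)) + G * (w * ?q1)) * c + G * (w * (E * x)) * d - \<kappa>\<^sup>2 * (G * (w * (E * x))) * b)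
       + ((G' * (E * (w / 2 * x\<^sup>2 + Y)) + G * ?q3) * n + w * (G * (E * (w / 2 * x\<^sup>2 + Y)) * x) * n + 2 * (G * (E * (w / 2 * x\<^sup>2 + Y))) * c)
       - G' * (E * ?G) = G * (K * Y * ?G - E * ?b1)"
      using energy_increment_identity[of G' E G K Y x a d "\<kappa>\<^sup>2" b "w / 2" c "3 / 2" n]
      by (simp add: right_diff_distrib left_diff_distrib diff_divide_distrib)
    moreover have "G * (K * Y * ?G - E * ?b1) \<ge> 0" using ineq g(2)[of r] by (simp add: G_def)
    ultimately show ?thesis unfolding L R1 R2 R3 R1' by linarith
  qed
qed

text \<open>Positive n-mass somewhere makes \<open>Phi s\<close> positive far out, hence
  \<open>Gam\<close> positive on some shell, hence by monotonicity the weighted \<open>Gam\<close>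
  has integral of order at least R over R \<le> \<rho> \<le> 4R. But \<open>Gam\<close> is bounded
  by a multiple of d + b, and a Caccioppoli estimate reduces d to b, so slow growth is
  violated.\<close>

lemma weighted_mass_zero:
  assumes g0: "continuous_on UNIV g0" "\<And>r. g0 r \<ge> 0" "\<And>r. r \<notin> {r1..r2} \<Longrightarrow> g0 r = 0" and R: "R\<^sub>0 < r1" "r1 \<le> r2"
    and Q3: "Q \<ge> 3" and \<kappa>: "\<kappa> > 0" and sg: slow_growth
  shows "J (\<lambda>r a b c d n. g0 r * n) \<le> 0"
proof (rule ccontr)
  assume "\<not> ?thesis"
  then have pos: "J (\<lambda>r a b c d n. g0 r * n) > 0" by simp
  obtain s where s: "s \<ge> 1" "\<forall>g. Cc r2 g \<longrightarrow> (\<forall>r. 0 \<le> g r) \<longrightarrow> (\<exists>t. 0 < g t) \<longrightarrow> 0 < J (Phi s g)"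
    using Phi_positive_far[OF g0 R pos Q3] by blast
  \<comment> \<open>The simplest value satisfying both K \<ge> 2 and K \<kappa>^2 \<ge> 5.\<close>
  define K where "K = 2 + 5 / \<kappa>\<^sup>2"
  have K: "K \<ge> 2" "K * \<kappa>\<^sup>2 \<ge> 5" "K > 0" using \<kappa> by (auto simp: K_def distrib_right add_pos_nonneg)
  define R' where "R' = max R\<^sub>0 (max 1 (4 * K\<^sup>2))"
  have R': "R' \<ge> R\<^sub>0" "R' \<ge> 1" "R' \<ge> 4 * K\<^sup>2" by (auto simp: R'_def)
  have "R\<^sub>0 < r2" using R by linarith
  obtain g where g: "Cc R' g" "\<And>r. g r \<ge> 0" "J (Gam (\<lambda>r. 1) g) > 0"
    using Gam_positive_somewhere[OF s sg \<open>R\<^sub>0 < r2\<close>] by blast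
  have gz: "g r = 0" if "r \<le> R'" for r by (rule Cc_zero[OF g(1) that])
  \<comment> \<open>Dividing by the weight turns positivity of the unweighted energy, known for
    \<open>g\<close>, into positivity of the weighted one, which is monotone.\<close>
  define g1 where "g1 = (\<lambda>r. g r * (1 / energy_weight K r))"
  have eb: "1 \<le> energy_weight K r" "energy_weight K r \<le> 2" if "r > R'" for r using energy_weight_bounds[OF K(3), of r] that R'(3) by auto
  have "Cc R' g1" unfolding g1_def
  proof (rule Cc_mult[OF g(1)])
    have "continuous_on {R'<..} (energy_weight K)" by (rule continuous_on_subset[OF cont_energy_weight]) (use R' in auto)
    moreover have "\<forall>r\<in>{R'<..}. energy_weight K r \<noteq> 0" using eb by force
    ultimately show "continuous_on {R'<..} (\<lambda>r. 1 / energy_weight K r)" by (intro continuous_intros) auto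
  qed
  note Cg1 = this
  have g1: "g1 r \<ge> 0" for r
  proof (cases "r \<le> R'")
    case True then show ?thesis by (simp add: g1_def gz)
  next
    case False then show ?thesis using eb[of r] g(2)[of r] by (simp add: g1_def)
  qed
  obtain q1 q2 where q: "R' < q1" "\<forall>r. r \<notin> {q1..q2} \<longrightarrow> g1 r = 0" and cg1: "continuous_on UNIV g1"
    using Cg1 unfolding Cc_def by blast
  define q3 where "q3 = max q1 q2"
  have q3: "g1 r = 0" if "r \<notin> {q1..q3}" for r
  proof -
    have "r \<notin> {q1..q2}" using that by (auto simp: q3_def)
    then show ?thesis using q(2) by blast
  qed
  have q13: "q1 \<le> q3" by (simp add: q3_def)
  have J1: "J (Gam (energy_weight K) g1) = J (Gam (\<lambda>r. 1) g)"
  proof (rule J_eq)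
    show "adm (Gam (energy_weight K) g1)" by (intro adm_radial_form Gam_cont cont_energy_weight Cc_mono[OF Cg1 R'(1)])
    show "adm (Gam (\<lambda>r. 1) g)" by (intro adm_radial_form Gam_cont continuous_on_const Cc_mono[OF g(1) R'(1)])
    fix r a b c d n :: real
    show "Gam (energy_weight K) g1 r a b c d n = Gam (\<lambda>r. 1) g r a b c d n"
    proof (cases "r \<le> R'")
      case True then show ?thesis by (simp add: radial_form_def g1_def gz)
    next
      case False
      then have "energy_weight K r \<noteq> 0" using eb[of r] by force
      then show ?thesis by (simp add: radial_form_def g1_def field_simps)
    qed
  qed
  define M where "M = J (Gam (energy_weight K) g1)"
  have M: "M > 0" using g(3) J1 by (simp add: M_def)
  define w where "w = Q - 1"
  have w: "w \<ge> 2" using Q3 by (simp add: w_def)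
  define C1 where "C1 = 3 + \<kappa>\<^sup>2 + w"
  have C1: "C1 > 0" using w by (simp add: C1_def add_pos_pos add_pos_nonneg)
  define I1 where "I1 = Itg g1"
  have I1: "I1 \<ge> 0" unfolding I1_def by (rule Itg_nonneg[OF g1])
  \<comment> \<open>\<open>C1\<close> dominates the coefficients of \<open>Gam\<close>, 2 bounds the
    weight, and 2 \<kappa>^2 + 5 = (2 \<kappa>^2 + 1) + 4 adds the Caccioppoli constants in front of
    \<open>\<eta>\<close> and of the square of \<open>\<theta>'\<close>.\<close>
  define D where "D = 2 * C1 * (2 * \<kappa>\<^sup>2 + 5)"
  have D: "D > 0" using C1 by (simp add: D_def add_nonneg_pos)
  define \<epsilon> where "\<epsilon> = M / (4 * ((I1 + 1) * D))"
  have \<epsilon>: "\<epsilon> > 0" using M I1 D by (simp add: \<epsilon>_def)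
  obtain R3 where R3: "R3 \<ge> max 3 (q3 + 1)" "\<And>h. \<lbrakk>Cc R\<^sub>0 h; \<And>r. 0 \<le> h r; \<And>r. h r \<le> 1; \<And>r. r \<notin> {R3..4*R3} \<Longrightarrow> h r = 0\<rbrakk> \<Longrightarrow> J (\<lambda>r a b c d n. h r * b) \<le> \<epsilon> * R3"
    using slow_growthD[OF sg \<epsilon>] by metis
  have R33: "R3 \<ge> 3" "R3 > q3" "R3 > R'" "R3 > R\<^sub>0" using R3(1) q13 q(1) R' by auto
  define \<theta> where "\<theta> = (\<lambda>r. (bump R3 r)\<^sup>2)"
  define \<eta> where "\<eta> = (\<lambda>r. (\<theta> r)\<^sup>2)"
  define \<theta>' where "\<theta>' = bump_sq' R3"
  have \<eta>: "C1c R\<^sub>0 \<eta> (\<lambda>r. 2 * \<theta> r * \<theta>' r)" "Itg \<eta> \<ge> R3 / 2"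
    unfolding \<eta>_def \<theta>_def \<theta>'_def by (rule bump_fourth_props[OF R33(1,4)])+
  note C\<eta> = C1c_Cc(1)[OF \<eta>(1)]
  have \<eta>b: "0 \<le> \<eta> r" "\<eta> r \<le> 1" "r \<notin> {R3..4*R3} \<Longrightarrow> \<eta> r = 0" for r
    using bump_props(1-3)[OF R33(1), of r] by (auto simp: \<eta>_def \<theta>_def power_le_one)
  have c\<eta>: "continuous_on UNIV \<eta>" using C\<eta> unfolding Cc_def by blast
  have \<theta>'b: "0 \<le> (\<theta>' r)\<^sup>2" "(\<theta>' r)\<^sup>2 \<le> 1" "r \<notin> {R3..4*R3} \<Longrightarrow> (\<theta>' r)\<^sup>2 = 0" for r
    using bump_sq_DERIV(2,4)[OF R33(1), of r] by (auto simp: \<theta>'_def abs_square_le_1)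
  have "continuous_on UNIV (\<lambda>r. (\<theta>' r)\<^sup>2)" unfolding \<theta>'_def by (intro continuous_intros bump_sq_DERIV(3)[OF R33(1)])
  then have C\<theta>: "Cc R\<^sub>0 (\<lambda>r. (\<theta>' r)\<^sup>2)" unfolding Cc_def using \<theta>'b(3) R33(4) by blast
  have "Itg \<eta> * J (Gam (energy_weight K) g1) \<le> Itg g1 * J (Gam (energy_weight K) \<eta>)"
  proof (rule transport[OF Gam_cont[OF cont_energy_weight], where R=R' and ?r1.0=q1 and ?r2.0=q3 and ?r3.0=R3 and ?r4.0="4*R3"])
    show "J (Gam (energy_weight K) k') \<le> 0" if "C1c R' k k'" "\<And>r. k r \<ge> 0" for k k'
      by (rule Gam_mono[OF that K(1,2) R' Q3])
    show "\<eta> r = 0" if "r \<notin> {R3..4*R3}" for r by (rule \<eta>b(3)[OF that])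
  qed (use cg1 g1 q3 c\<eta> \<eta>b(1) R' q(1) q13 R33 in auto)
  moreover have "J (Gam (energy_weight K) \<eta>) \<le> D * (\<epsilon> * R3)"
  proof -
    \<comment> \<open>Caccioppoli: as \<open>\<eta>\<close> is the square of
      \<open>\<theta>\<close>, the mixed term 2 \<theta> \<theta>' c in \<open>energy_form\<close>
      is completed to a square, and \<eta> d is bounded by multiples of b up to a form that
      integrates to 0.\<close>
    let ?H = "\<lambda>r a b c d n. 2 * C1 * (2 * energy_form \<eta> (\<lambda>r. 2 * \<theta> r * \<theta>' r) r a b c d n + ((2 * \<kappa>\<^sup>2 + 1) * (\<eta> r * b) + 4 * ((\<theta>' r)\<^sup>2 * b)))"
    note CCa = energy_form_vanishes[OF \<eta>(1)]
    note a1 = adm_basic(2)[OF C\<eta>] and a2 = adm_basic(2)[OF C\<theta>]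
    have "J (Gam (energy_weight K) \<eta>) \<le> J ?H"
    proof (rule J_mono)
      show "adm (Gam (energy_weight K) \<eta>)" by (intro adm_radial_form Gam_cont cont_energy_weight C\<eta>)
      show "adm ?H" by (intro adm_cmult adm_add CCa a1 a2)
      fix r a b c d n :: real
      assume *: "r > R\<^sub>0" "0 \<le> a" "a \<le> d" "0 \<le> n" "n \<le> b" "c\<^sup>2 \<le> a * n"
      have q: "0 \<le> (\<theta> r)\<^sup>2 * a + 2 * (2 * \<theta>' r) * \<theta> r * c + (2 * \<theta>' r)\<^sup>2 * n"
        by (rule quad_nonneg[OF *(2,4,6)])
      have "(\<theta> r)\<^sup>2 * a \<le> (\<theta> r)\<^sup>2 * d" "(2 * \<theta>' r)\<^sup>2 * n \<le> (2 * \<theta>' r)\<^sup>2 * b" using * by (auto intro: mult_left_mono)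
      with q have "\<eta> r * (d + b) \<le> 2 * energy_form \<eta> (\<lambda>r. 2 * \<theta> r * \<theta>' r) r a b c d n + ((2 * \<kappa>\<^sup>2 + 1) * (\<eta> r * b) + 4 * ((\<theta>' r)\<^sup>2 * b))"
        by (simp add: energy_form_def \<eta>_def algebra_simps power2_eq_square)
      then have 1: "2 * C1 * (\<eta> r * (d + b)) \<le> ?H r a b c d n" using C1 by (intro mult_left_mono) auto
      show "Gam (energy_weight K) \<eta> r a b c d n \<le> ?H r a b c d n"
      proof (cases "r \<le> R'")
        case True
        then have "r \<notin> {R3..4*R3}" using R33 by auto
        then show ?thesis using 1 \<eta>b(3)[of r] by (simp add: radial_form_def)
      next
        case False
        have r: "r \<ge> 1" using False R' by simp
        have cb: "c \<le> (d + b) / 2"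
        proof -
          have "0 \<le> a - 2 * c + n" using quad_nonneg[OF *(2,4,6), of 1 "-1"] by simp
          then show ?thesis using *(3,5) by simp
        qed
        have db: "0 \<le> d" "0 \<le> b" using * by linarith+
        have w1: "w / r * c \<le> w * ((d + b) / 2)"
        proof -
          have "w / r * c \<le> w / r * ((d + b) / 2)" using cb w r by (intro mult_left_mono) auto
          also have "\<dots> \<le> w * ((d + b) / 2)" using w r db by (intro mult_right_mono) (auto simp: divide_le_eq_1 field_simps mult_le_cancel_left1)
          finally show ?thesis .
        qed
        have w2: "(w / 2 / r\<^sup>2 + 1 / (r * sqrt r)) * n \<le> (w / 2 + 1) * b"
        proof (rule mult_mono)
          have "w / 2 / r\<^sup>2 \<le> w / 2 / 1" using w r by (intro divide_left_mono) (auto intro: one_le_power)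
          moreover have "1 / (r * sqrt r) \<le> 1"
          proof -
            have "1 * 1 \<le> r * sqrt r" using r by (intro mult_mono) auto
            then show ?thesis by simp
          qed
          ultimately show "w / 2 / r\<^sup>2 + 1 / (r * sqrt r) \<le> w / 2 + 1" by simp
        qed (use * w in auto)
        have "2 * a + \<kappa>\<^sup>2 * b + w / r * c + - 1 * d + (w / 2 / r\<^sup>2 + 1 / (r * sqrt r)) * n \<le> C1 * (d + b)"
        proof -
          have "0 \<le> w * d / 2" "0 \<le> \<kappa>\<^sup>2 * d" using w db by auto
          moreover have "C1 * (d + b) = 3 * d + 3 * b + \<kappa>\<^sup>2 * d + \<kappa>\<^sup>2 * b + w * d + w * b"
            by (simp add: C1_def algebra_simps)
          moreover have "w * ((d + b) / 2) = w * d / 2 + w * b / 2" "(w / 2 + 1) * b = w * b / 2 + b"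
            by (simp_all add: field_simps)
          moreover have "2 * a + k + X + - 1 * d + Y \<le> 3 * d + 3 * b + l + k + p + q"
            if "0 \<le> p / 2" "0 \<le> l" "X \<le> p / 2 + q / 2" "Y \<le> q / 2 + b" for X Y k l p q :: real
            using that *(3) db by linarith
          ultimately show ?thesis using w1 w2 by metis
        qed
        then have "energy_weight K r * (2 * a + \<kappa>\<^sup>2 * b + w / r * c + - 1 * d + (w / 2 / r\<^sup>2 + 1 / (r * sqrt r)) * n) \<le> energy_weight K r * (C1 * (d + b))"
          using eb[of r] False by (intro mult_left_mono) auto
        also have "\<dots> \<le> 2 * (C1 * (d + b))" using eb[of r] False C1 db by (intro mult_right_mono) auto
        finally have "\<eta> r * (energy_weight K r * (2 * a + \<kappa>\<^sup>2 * b + w / r * c + - 1 * d + (w / 2 / r\<^sup>2 + 1 / (r * sqrt r)) * n)) \<le> \<eta> r * (2 * (C1 * (d + b)))"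
          using \<eta>b(1) by (rule mult_left_mono)
        moreover have "Gam (energy_weight K) \<eta> r a b c d n = \<eta> r * (energy_weight K r * (2 * a + \<kappa>\<^sup>2 * b + w / r * c + - 1 * d + (w / 2 / r\<^sup>2 + 1 / (r * sqrt r)) * n))"
          unfolding radial_form_def w_def by (simp add: algebra_simps)
        ultimately show ?thesis using 1 by (simp add: mult_ac)
      qed
    qed
    also have "J ?H = 2 * C1 * (2 * J (energy_form \<eta> (\<lambda>r. 2 * \<theta> r * \<theta>' r)) + ((2 * \<kappa>\<^sup>2 + 1) * J (\<lambda>r a b c d n. \<eta> r * b) + 4 * J (\<lambda>r a b c d n. (\<theta>' r)\<^sup>2 * b)))"
      unfolding J_cmult[of "2 * C1"]
      by (subst J_add[OF adm_cmult[OF CCa(1)] adm_add[OF adm_cmult[OF a1] adm_cmult[OF a2]]], subst J_add[OF adm_cmult[OF a1] adm_cmult[OF a2]])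
        (simp only: J_cmult)
    also have "\<dots> \<le> 2 * C1 * (2 * 0 + ((2 * \<kappa>\<^sup>2 + 1) * (\<epsilon> * R3) + 4 * (\<epsilon> * R3)))"
      using C1 R3(2)[OF C\<eta> \<eta>b] R3(2)[OF C\<theta> \<theta>'b] unfolding CCa(2)
      by (intro mult_left_mono add_mono) auto
    also have "\<dots> = D * (\<epsilon> * R3)" by (simp add: D_def algebra_simps)
    finally show ?thesis .
  qed
  ultimately have "Itg \<eta> * M \<le> I1 * (D * (\<epsilon> * R3))" using I1 by (simp add: M_def I1_def) (meson mult_left_mono order_trans)
  moreover have "R3 / 2 * M \<le> Itg \<eta> * M" using \<eta>(2) M by (intro mult_right_mono) auto
  moreover have "I1 * (D * (\<epsilon> * R3)) \<le> R3 * (M / 4)"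
  proof -
    have e4: "\<epsilon> * ((I1 + 1) * D) = M / 4"
    proof -
      have "\<epsilon> = M / 4 / ((I1 + 1) * D)" by (simp add: \<epsilon>_def)
      moreover have "(I1 + 1) * D \<noteq> 0" using I1 D by simp
      ultimately show ?thesis using nonzero_eq_divide_eq by blast
    qed
    have "I1 * D * \<epsilon> \<le> (I1 + 1) * D * \<epsilon>" using \<epsilon> D by (intro mult_right_mono) auto
    then have "I1 * D * \<epsilon> \<le> M / 4" using e4 by (metis mult.commute)
    then have "R3 * (I1 * D * \<epsilon>) \<le> R3 * (M / 4)" using R33 by (intro mult_left_mono) auto
    then show ?thesis by (simp add: mult_ac)
  qed
  ultimately have "R3 * M \<le> 0" by simp
  then show False using R33 M by (simp add: mult_le_0_iff)
qed

text \<open>The density n carries the weight |z|^(2\<alpha>), so vanishing n-mass gives f = 0 only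
  where z is nonzero. Points with z = 0 are limits of such points along a z-direction.\<close>

theorem vanishing:
  assumes Q3: "Q \<ge> 3" and \<kappa>: "\<kappa> > 0" and sg: slow_growth and x: "rho x > R\<^sub>0"
  shows "f x = 0"
proof -
  have main: "f y = 0" if y: "rho y > R\<^sub>0" "fst y \<noteq> 0" for y
  proof (rule ccontr)
    assume fy: "f y \<noteq> 0"
    have wn: "wn y > 0" using fy y tau_pos[OF rho_pos[OF y(1)]] rho_pos[OF y(1)] by (simp add: wn_def zpow_def)
    define \<delta> where "\<delta> = (rho y - R\<^sub>0) / 2"
    have \<delta>: "\<delta> > 0" using y by (simp add: \<delta>_def)
    define g0 where "g0 = (\<lambda>r. max 0 (\<delta> - \<bar>r - rho y\<bar>))"
    have c0: "continuous_on UNIV g0" unfolding g0_def by (intro continuous_intros)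
    have n0: "g0 r \<ge> 0" for r by (simp add: g0_def)
    have z0: "g0 r = 0" if "r \<notin> {rho y - \<delta>..rho y + \<delta>}" for r using that by (auto simp: g0_def)
    have R1: "R\<^sub>0 < rho y - \<delta>" using y(1) by (simp add: \<delta>_def field_simps)
    have C0: "Cc R\<^sub>0 g0" unfolding Cc_def using c0 z0 R1 by blast
    have J0: "J (\<lambda>r a b c d n. g0 r * n) \<le> 0"
      by (rule weighted_mass_zero[OF c0 n0 z0 R1 _ Q3 \<kappa> sg]) (use \<delta> in auto)
    let ?F = "\<lambda>x. g0 (rho x) * wn x"
    have int: "integrable lborel ?F" by (rule radial_integrable[OF C0 continuous_weights(5)])
    have F0: "?F x \<ge> 0" for x
    proof (cases "rho x > R\<^sub>0")
      case True then show ?thesis using weight_inequalities(3) n0 by simp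
    next
      case False then show ?thesis using Cc_zero[OF C0] by simp
    qed
    have "(LINT x|lborel. ?F x) = 0"
      using J0 F0 unfolding J_def ev_def by (intro antisym Bochner_Integration.integral_nonneg) auto
    then have ae: "AE x in lborel. ?F x = 0" using integral_nonneg_eq_0_iff_AE[OF int] F0 by simp
    have op: "open {x. rho x > R\<^sub>0}" by (rule open_gauge[OF \<alpha>])
    have cF: "continuous_on {x. rho x > R\<^sub>0} ?F"
      by (intro continuous_on_mult continuous_weights continuous_on_compose2[OF c0 continuous_gauge[OF \<alpha>]]) auto
    have "open ({x. rho x > R\<^sub>0} \<inter> ?F -` {0<..})" using cF op by (rule continuous_open_preimage) auto
    moreover have "y \<in> {x. rho x > R\<^sub>0} \<inter> ?F -` {0<..}" using y wn \<delta> by (simp add: g0_def)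
    ultimately obtain e where e: "e > 0" "ball y e \<subseteq> {x. rho x > R\<^sub>0} \<inter> ?F -` {0<..}" unfolding open_contains_ball by blast
    have "AE x in lborel. x \<notin> ball y e"
    proof (rule AE_mp[OF ae], intro AE_I2 impI notI)
      fix x assume "?F x = 0" "x \<in> ball y e"
      then show False using e(2) by force
    qed
    moreover have "{x. \<not> x \<notin> ball y e} = ball y e" by auto
    ultimately have "emeasure lborel (ball y e) = 0"
      using AE_iff_measurable[of "ball y e" lborel "\<lambda>x. x \<notin> ball y e"] by simp
    then have "measure lborel (ball y e) = 0" by (simp add: measure_def)
    then show False using content_ball_pos[OF e(1), of y] by simp
  qed
  show ?thesis
  proof (cases "fst x = 0")
    case False then show ?thesis using main x by blast
  next
    case True
    fix i :: 'm
    have op: "open {x. rho x > R\<^sub>0}" by (rule open_gauge[OF \<alpha>])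
    have "isCont f x" using cf x unfolding continuous_on_eq_continuous_at[OF op] by blast
    moreover have path: "((\<lambda>t::real. x + t *\<^sub>R (ez i)) \<longlongrightarrow> x) (at 0)"
      by (rule tendsto_eq_intros | simp add: zero_prod_def)+
    ultimately have lim: "((\<lambda>t::real. f (x + t *\<^sub>R (ez i))) \<longlongrightarrow> f x) (at 0)"
      by (rule isCont_tendsto_compose)
    have "eventually (\<lambda>t::real. x + t *\<^sub>R (ez i) \<in> {x. rho x > R\<^sub>0}) (at 0)"
      using path op x by (intro topological_tendstoD) auto
    moreover have "eventually (\<lambda>t::real. t \<noteq> 0) (at 0)" by (auto simp: eventually_at_filter)
    ultimately have "eventually (\<lambda>t::real. f (x + t *\<^sub>R (ez i)) = 0) (at 0)"
    proof eventually_elim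
      case (elim t)
      have "fst (x + t *\<^sub>R (ez i)) = t *\<^sub>R axis i 1" using True by simp
      then have "fst (x + t *\<^sub>R (ez i)) \<noteq> 0" using elim(2) by (simp add: axis_eq_0_iff)
      then show ?case using main elim(1) by blast
    qed
    then have "((\<lambda>t::real. f (x + t *\<^sub>R (ez i))) \<longlongrightarrow> 0) (at 0)" by (rule tendsto_eventually)
    from tendsto_unique[OF _ lim this] show ?thesis by simp
  qed
qed

end

section \<open>A Nash inequality\<close>

lemma nn_integral_lborel_shift:
  fixes g :: "'a::euclidean_space \<Rightarrow> ennreal"
  assumes [measurable]: "g \<in> borel_measurable borel"
  shows "(\<integral>\<^sup>+x. g (x + c) \<partial>lborel) = (\<integral>\<^sup>+x. g x \<partial>lborel)"
  by (subst (2) lborel_distr_plus[of c, symmetric]) (simp add: nn_integral_distr add.commute)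

lemma nn_integral_lborel_affine:
  fixes g :: "'a::euclidean_space \<Rightarrow> ennreal"
  assumes [measurable]: "g \<in> borel_measurable borel" and c: "c > 0"
  shows "(\<integral>\<^sup>+x. g x \<partial>lborel) = ennreal (c ^ DIM('a)) * (\<integral>\<^sup>+x. g (t + c *\<^sub>R x) \<partial>lborel)"
proof -
  have "(\<integral>\<^sup>+x. g x \<partial>lborel) = (\<integral>\<^sup>+x. g x \<partial>density (distr lborel borel (\<lambda>x. t + c *\<^sub>R x)) (\<lambda>_. \<bar>c\<bar> ^ DIM('a)))"
    by (subst lborel_affine[of c t]) (use c in auto)
  also have "\<dots> = (\<integral>\<^sup>+x. ennreal (c ^ DIM('a)) * g (t + c *\<^sub>R x) \<partial>lborel)"
    using c by (simp add: nn_integral_density nn_integral_distr)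
  also have "\<dots> = ennreal (c ^ DIM('a)) * (\<integral>\<^sup>+x. g (t + c *\<^sub>R x) \<partial>lborel)"
    by (rule nn_integral_cmult) simp
  finally show ?thesis .
qed

lemma nn_integral_lborel_Pair:
  fixes \<Psi> :: "'a::euclidean_space \<times> 'b::euclidean_space \<Rightarrow> ennreal"
  assumes "\<Psi> \<in> borel_measurable borel"
  shows "(\<integral>\<^sup>+x. \<Psi> x \<partial>lborel) = (\<integral>\<^sup>+z. \<integral>\<^sup>+s. \<Psi> (z, s) \<partial>lborel \<partial>lborel)"
proof -
  have "\<Psi> \<in> borel_measurable (lborel \<Otimes>\<^sub>M lborel)" using assms by (simp add: lborel_prod)
  from lborel.nn_integral_fst[OF this] show ?thesis by (simp add: lborel_prod)
qed

lemma nn_integral_lborel_swap: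
  fixes \<Psi> :: "'a::euclidean_space \<times> 'b::euclidean_space \<Rightarrow> ennreal"
  assumes "\<Psi> \<in> borel_measurable borel"
  shows "(\<integral>\<^sup>+z. \<integral>\<^sup>+s. \<Psi> (z, s) \<partial>lborel \<partial>lborel) = (\<integral>\<^sup>+s. \<integral>\<^sup>+z. \<Psi> (z, s) \<partial>lborel \<partial>lborel)"
proof -
  have "\<Psi> \<in> borel_measurable (lborel \<Otimes>\<^sub>M lborel)" using assms by (simp add: lborel_prod)
  from lborel_pair.Fubini'[of "\<lambda>x y. \<Psi> (x, y)"] this show ?thesis by simp
qed

text \<open>For fixed z the map is a translation in \<sigma>, and the remaining map is a translation
  in z, so Fubini applies without a Jacobian.\<close>

lemma nn_integral_shear:
  fixes \<Psi> :: "'a::euclidean_space \<times> 'b::euclidean_space \<Rightarrow> ennreal"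
  assumes [measurable]: "\<Psi> \<in> borel_measurable borel" and [measurable]: "c \<in> borel_measurable borel"
  shows "(\<integral>\<^sup>+x. \<Psi> (fst x + h, snd x + c (fst x)) \<partial>lborel) = (\<integral>\<^sup>+x. \<Psi> x \<partial>lborel)"
proof -
  have m: "(\<lambda>x. \<Psi> (fst x + h, snd x + c (fst x))) \<in> borel_measurable borel"
  proof -
    have "(\<lambda>x::'a \<times> 'b. (fst x + h, snd x + c (fst x))) \<in> borel \<Otimes>\<^sub>M borel \<rightarrow>\<^sub>M borel \<Otimes>\<^sub>M borel" by measurable
    then have "(\<lambda>x::'a \<times> 'b. (fst x + h, snd x + c (fst x))) \<in> borel \<rightarrow>\<^sub>M borel" by (simp add: borel_prod)
    then show ?thesis by measurable
  qed
  have mz: "(\<lambda>s. \<Psi> (z, s)) \<in> borel_measurable borel" for z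
  proof -
    have "(\<lambda>s::'b. (z, s)) \<in> borel \<rightarrow>\<^sub>M borel \<Otimes>\<^sub>M borel" by measurable
    then have "(\<lambda>s::'b. (z, s)) \<in> borel \<rightarrow>\<^sub>M borel" by (simp add: borel_prod)
    then show ?thesis by measurable
  qed
  have mi: "(\<lambda>z. \<integral>\<^sup>+s. \<Psi> (z, s) \<partial>lborel) \<in> borel_measurable borel"
  proof -
    have "\<Psi> \<in> borel_measurable (lborel \<Otimes>\<^sub>M lborel)" by (simp add: lborel_prod)
    then have "(\<lambda>z. \<integral>\<^sup>+s. \<Psi> (z, s) \<partial>lborel) \<in> borel_measurable lborel"
      by (rule lborel.borel_measurable_nn_integral_fst)
    then show ?thesis by simp
  qed
  have "(\<integral>\<^sup>+x. \<Psi> (fst x + h, snd x + c (fst x)) \<partial>lborel) = (\<integral>\<^sup>+z. \<integral>\<^sup>+s. \<Psi> (z + h, s + c z) \<partial>lborel \<partial>lborel)"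
    by (subst nn_integral_lborel_Pair[OF m]) simp
  also have "\<dots> = (\<integral>\<^sup>+z. \<integral>\<^sup>+s. \<Psi> (z + h, s) \<partial>lborel \<partial>lborel)"
    by (simp add: nn_integral_lborel_shift[OF mz])
  also have "\<dots> = (\<integral>\<^sup>+z. \<integral>\<^sup>+s. \<Psi> (z, s) \<partial>lborel \<partial>lborel)"
    by (rule nn_integral_lborel_shift[OF mi])
  also have "\<dots> = (\<integral>\<^sup>+x. \<Psi> x \<partial>lborel)" by (rule nn_integral_lborel_Pair[symmetric]) simp
  finally show ?thesis .
qed

lemma integral_square_le:
  fixes \<phi> :: "real \<Rightarrow> real"
  assumes "continuous_on {0..1} \<phi>"
  shows "(integral {0..1} \<phi>)\<^sup>2 \<le> integral {0..1} (\<lambda>t. (\<phi> t)\<^sup>2)"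
proof -
  define m where "m = integral {0..1} \<phi>"
  have i: "\<phi> integrable_on {0..1}" "(\<lambda>t. (\<phi> t)\<^sup>2) integrable_on {0..1}"
    using assms by (auto intro!: integrable_continuous_interval continuous_intros)
  have "((\<lambda>t. (\<phi> t)\<^sup>2 - 2 * m * \<phi> t + m\<^sup>2) has_integral (integral {0..1} (\<lambda>t. (\<phi> t)\<^sup>2) - 2 * m * m + m\<^sup>2)) {0..1}"
    using i has_integral_const_real[of "m\<^sup>2" 0 1]
    by (intro has_integral_add has_integral_diff has_integral_mult_right) (auto simp: m_def integrable_integral)
  moreover have "(\<phi> t)\<^sup>2 - 2 * m * \<phi> t + m\<^sup>2 \<ge> 0" for t
  proof -
    have "(\<phi> t)\<^sup>2 - 2 * m * \<phi> t + m\<^sup>2 = (\<phi> t - m)\<^sup>2" by (simp add: power2_eq_square algebra_simps)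
    then show ?thesis by simp
  qed
  ultimately have "0 \<le> integral {0..1} (\<lambda>t. (\<phi> t)\<^sup>2) - 2 * m * m + m\<^sup>2" by (rule has_integral_nonneg)
  then show ?thesis by (simp add: m_def power2_eq_square)
qed

text \<open>The increment is an integral over the segment, and the square of a mean is at most the
  mean of the square. The segment is parametrised by [0,1] so that the length t may later depend on
  x.\<close>

lemma pd_increment_sq:
  fixes G :: "'a::euclidean_space \<Rightarrow> real"
  assumes pd: "pd b G D" and c: "continuous_on UNIV D"
  shows "ennreal ((G (x + t *\<^sub>R b) - G x)\<^sup>2) \<le> (\<integral>\<^sup>+l. ennreal (t\<^sup>2 * (D (x + (l * t) *\<^sub>R b))\<^sup>2) * indicator {0..1} l \<partial>lborel)"
proof -
  let ?\<phi> = "\<lambda>l. t * D (x + (l * t) *\<^sub>R b)"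
  have c\<phi>: "continuous_on S ?\<phi>" for S by (intro continuous_intros continuous_on_compose2[OF c]) auto
  have "(?\<phi> has_integral (G (x + (1 * t) *\<^sub>R b) - G (x + (0 * t) *\<^sub>R b))) {0..1}"
  proof (rule fundamental_theorem_of_calculus)
    fix l
    have "((\<lambda>l. l * t) has_real_derivative t) (at l)" by (auto intro!: derivative_eq_intros)
    from DERIV_chain2[OF pd_line[OF pd, of x "l * t"] this]
    have "((\<lambda>l. G (x + (l * t) *\<^sub>R b)) has_real_derivative D (x + (l * t) *\<^sub>R b) * t) (at l)" .
    then show "((\<lambda>l. G (x + (l * t) *\<^sub>R b)) has_vector_derivative t * D (x + (l * t) *\<^sub>R b)) (at l within {0..1})"
      by (simp add: has_real_derivative_iff_has_vector_derivative has_vector_derivative_at_within mult.commute)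
  qed simp
  from integral_unique[OF this] have eq: "G (x + t *\<^sub>R b) - G x = integral {0..1} ?\<phi>"
    by (simp only: mult_1 mult_zero_left scaleR_zero_left add_0_right)
  have "ennreal ((G (x + t *\<^sub>R b) - G x)\<^sup>2) \<le> ennreal (integral {0..1} (\<lambda>l. (?\<phi> l)\<^sup>2))"
    unfolding eq by (intro ennreal_leI integral_square_le c\<phi>)
  also have "\<dots> = (\<integral>\<^sup>+l. ennreal ((?\<phi> l)\<^sup>2) * indicator {0..1} l \<partial>lborel)"
  proof -
    have "((\<lambda>l. (?\<phi> l)\<^sup>2) has_integral integral {0..1} (\<lambda>l. (?\<phi> l)\<^sup>2)) {0..1}"
      by (intro integrable_integral integrable_continuous_interval continuous_intros c\<phi>)
    from nn_integral_has_integral_lebesgue[OF _ this]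
    have "(\<integral>\<^sup>+l. ennreal (indicator {0..1} l * (?\<phi> l)\<^sup>2) \<partial>lborel) = ennreal (integral {0..1} (\<lambda>l. (?\<phi> l)\<^sup>2))" by simp
    moreover have "ennreal (indicator {0..1} l * (?\<phi> l)\<^sup>2) = ennreal ((?\<phi> l)\<^sup>2) * indicator {0..1} l" for l :: real
      by (auto simp: indicator_def)
    ultimately show ?thesis by simp
  qed
  finally show ?thesis by (simp add: power_mult_distrib)
qed

text \<open>The directions are added one at a time, each step costing a factor 2 from (A + B)^2
  \<le> 2 A^2 + 2 B^2. The assumptions \<open>inv\<close> and \<open>\<tau>inv\<close> say that
  every partial shift preserves the measure and leaves the lengths unchanged; this covers both
  constant shifts in z and \<sigma>-shifts whose length depends on z.\<close>

lemma shift_estimate: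
  fixes G :: "'a::euclidean_space \<Rightarrow> real" and \<tau> :: "'i \<Rightarrow> 'a \<Rightarrow> real"
  assumes G: "continuous_on UNIV G" and D: "\<And>i. pd (b i) G (D i)" "\<And>i. continuous_on UNIV (D i)" and \<tau>: "\<And>i. continuous_on UNIV (\<tau> i)"
    and inv: "\<And>S w \<Psi>. finite S \<Longrightarrow> \<Psi> \<in> borel_measurable borel \<Longrightarrow> (\<integral>\<^sup>+x. \<Psi> (x + (\<Sum>i\<in>S. (w i * \<tau> i x) *\<^sub>R b i)) \<partial>lborel) = (\<integral>\<^sup>+x. \<Psi> x \<partial>lborel)"
    and \<tau>inv: "\<And>S w j x. finite S \<Longrightarrow> \<tau> j (x + (\<Sum>i\<in>S. (w i * \<tau> i x) *\<^sub>R b i)) = \<tau> j x"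
    and I: "finite I"
  shows "(\<integral>\<^sup>+x. ennreal ((G (x + (\<Sum>i\<in>I. \<tau> i x *\<^sub>R b i)) - G x)\<^sup>2) \<partial>lborel) \<le> 2 ^ card I * (\<Sum>i\<in>I. \<integral>\<^sup>+x. ennreal ((\<tau> i x)\<^sup>2 * (D i x)\<^sup>2) \<partial>lborel)"
  using I
proof (induction I rule: finite_induct)
  case empty
  then show ?case by simp
next
  case (insert i I)
  let ?V = "\<lambda>x. \<Sum>i\<in>I. \<tau> i x *\<^sub>R b i"
  let ?E = "\<lambda>i. \<integral>\<^sup>+x. ennreal ((\<tau> i x)\<^sup>2 * (D i x)\<^sup>2) \<partial>lborel"
  have single: "(\<integral>\<^sup>+x. ennreal ((G (x + \<tau> i x *\<^sub>R b i) - G x)\<^sup>2) \<partial>lborel) \<le> ?E i"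
  proof -
    let ?\<Psi> = "\<lambda>x. ennreal ((\<tau> i x)\<^sup>2 * (D i x)\<^sup>2)"
    have m\<Psi>: "?\<Psi> \<in> borel_measurable borel"
      by (intro measurable_compose[OF _ measurable_ennreal] borel_measurable_continuous_onI continuous_intros \<tau> D)
    have "(\<integral>\<^sup>+x. ennreal ((G (x + \<tau> i x *\<^sub>R b i) - G x)\<^sup>2) \<partial>lborel)
      \<le> (\<integral>\<^sup>+x. \<integral>\<^sup>+l. ennreal ((\<tau> i x)\<^sup>2 * (D i (x + (l * \<tau> i x) *\<^sub>R b i))\<^sup>2) * indicator {0..1} l \<partial>lborel \<partial>lborel)"
      by (intro nn_integral_mono pd_increment_sq[OF D])
    also have "\<dots> = (\<integral>\<^sup>+l. \<integral>\<^sup>+x. ennreal ((\<tau> i x)\<^sup>2 * (D i (x + (l * \<tau> i x) *\<^sub>R b i))\<^sup>2) * indicator {0..1} l \<partial>lborel \<partial>lborel)"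
    proof -
      let ?F = "\<lambda>p::'a \<times> real. ennreal ((\<tau> i (fst p))\<^sup>2 * (D i (fst p + (snd p * \<tau> i (fst p)) *\<^sub>R b i))\<^sup>2) * indicator (UNIV \<times> {0..1}) p"
      have "continuous_on UNIV (\<lambda>p::'a \<times> real. (\<tau> i (fst p))\<^sup>2 * (D i (fst p + (snd p * \<tau> i (fst p)) *\<^sub>R b i))\<^sup>2)"
        by (intro continuous_intros continuous_on_compose2[OF \<tau>] continuous_on_compose2[OF D(2)]) auto
      then have "(\<lambda>p::'a \<times> real. (\<tau> i (fst p))\<^sup>2 * (D i (fst p + (snd p * \<tau> i (fst p)) *\<^sub>R b i))\<^sup>2) \<in> borel_measurable borel"
        by (rule borel_measurable_continuous_onI)
      moreover have "UNIV \<times> {0..1} \<in> sets (borel :: ('a \<times> real) measure)"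
        by (intro borel_closed closed_Times) auto
      ultimately have "?F \<in> borel_measurable borel" by measurable
      from nn_integral_lborel_swap[OF this] show ?thesis by (simp add: indicator_times)
    qed
    also have "\<dots> = (\<integral>\<^sup>+l. ?E i * indicator {0..1} l \<partial>(lborel :: real measure))"
    proof (rule nn_integral_cong)
      fix l :: real
      have "(\<integral>\<^sup>+x. ?\<Psi> (x + (\<Sum>j\<in>{i}. (l * \<tau> j x) *\<^sub>R b j)) \<partial>lborel) = ?E i"
        by (rule inv[where w="\<lambda>_. l", OF _ m\<Psi>]) simp
      moreover have "\<tau> i (x + (\<Sum>j\<in>{i}. (l * \<tau> j x) *\<^sub>R b j)) = \<tau> i x" for x
        by (rule \<tau>inv[where w="\<lambda>_. l"]) simp
      ultimately have e: "(\<integral>\<^sup>+x. ennreal ((\<tau> i x)\<^sup>2 * (D i (x + (l * \<tau> i x) *\<^sub>R b i))\<^sup>2) \<partial>lborel) = ?E i" by simp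
      have "(\<integral>\<^sup>+x. ennreal ((\<tau> i x)\<^sup>2 * (D i (x + (l * \<tau> i x) *\<^sub>R b i))\<^sup>2) * indicator {0..1} l \<partial>lborel) =
        (\<integral>\<^sup>+x. ennreal ((\<tau> i x)\<^sup>2 * (D i (x + (l * \<tau> i x) *\<^sub>R b i))\<^sup>2) \<partial>lborel) * indicator {0..1} l"
        by (cases "l \<in> {0..1}") auto
      then show "(\<integral>\<^sup>+x. ennreal ((\<tau> i x)\<^sup>2 * (D i (x + (l * \<tau> i x) *\<^sub>R b i))\<^sup>2) * indicator {0..1} l \<partial>lborel) = ?E i * indicator {0..1} l"
        using e by simp
    qed
    also have "\<dots> = ?E i" by (simp add: nn_integral_cmult_indicator)
    finally show ?thesis .
  qed
  let ?g = "\<lambda>x. ennreal ((G (x + \<tau> i x *\<^sub>R b i) - G x)\<^sup>2)"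
  have mg: "?g \<in> borel_measurable borel"
    by (intro measurable_compose[OF _ measurable_ennreal] borel_measurable_continuous_onI continuous_intros \<tau> continuous_on_compose2[OF G]) auto
  have mV: "(\<lambda>x. ennreal ((G (x + ?V x) - G x)\<^sup>2)) \<in> borel_measurable borel"
    by (intro measurable_compose[OF _ measurable_ennreal] borel_measurable_continuous_onI continuous_intros \<tau> continuous_on_compose2[OF G]) auto
  have mgV: "(\<lambda>x. ?g (x + ?V x)) \<in> borel_measurable borel"
    by (intro measurable_compose[OF _ measurable_ennreal] borel_measurable_continuous_onI continuous_intros continuous_on_compose2[OF \<tau>] \<tau> continuous_on_compose2[OF G]) auto
  have Vinv: "\<tau> i (x + ?V x) = \<tau> i x" for x using \<tau>inv[OF insert.hyps(1), of i x "\<lambda>_. 1"] by simp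
  have "(\<integral>\<^sup>+x. ennreal ((G (x + (\<Sum>i\<in>insert i I. \<tau> i x *\<^sub>R b i)) - G x)\<^sup>2) \<partial>lborel)
     \<le> (\<integral>\<^sup>+x. 2 * ?g (x + ?V x) + 2 * ennreal ((G (x + ?V x) - G x)\<^sup>2) \<partial>lborel)"
  proof (rule nn_integral_mono)
    fix x
    have e: "x + (\<Sum>i\<in>insert i I. \<tau> i x *\<^sub>R b i) = (x + ?V x) + \<tau> i (x + ?V x) *\<^sub>R b i"
      using insert.hyps by (simp add: Vinv algebra_simps)
    have "(A - C)\<^sup>2 \<le> 2 * (A - B)\<^sup>2 + 2 * (B - C)\<^sup>2" for A B C :: real
      using zero_le_power2[of "A - 2 * B + C"] by (simp add: power2_eq_square algebra_simps)
    then have "ennreal ((G (x + (\<Sum>i\<in>insert i I. \<tau> i x *\<^sub>R b i)) - G x)\<^sup>2)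
      \<le> ennreal (2 * (G ((x + ?V x) + \<tau> i (x + ?V x) *\<^sub>R b i) - G (x + ?V x))\<^sup>2 + 2 * (G (x + ?V x) - G x)\<^sup>2)"
      unfolding e by (rule ennreal_leI)
    then show "ennreal ((G (x + (\<Sum>i\<in>insert i I. \<tau> i x *\<^sub>R b i)) - G x)\<^sup>2) \<le> 2 * ?g (x + ?V x) + 2 * ennreal ((G (x + ?V x) - G x)\<^sup>2)"
      by (simp add: ennreal_plus ennreal_mult)
  qed
  also have "\<dots> = 2 * (\<integral>\<^sup>+x. ?g (x + ?V x) \<partial>lborel) + 2 * (\<integral>\<^sup>+x. ennreal ((G (x + ?V x) - G x)\<^sup>2) \<partial>lborel)"
    using mgV mV by (subst nn_integral_add) (auto simp: nn_integral_cmult)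
  also have "(\<integral>\<^sup>+x. ?g (x + ?V x) \<partial>lborel) = (\<integral>\<^sup>+x. ?g x \<partial>lborel)"
    using inv[OF insert.hyps(1) mg, of "\<lambda>_. 1"] by simp
  also have "2 * (\<integral>\<^sup>+x. ?g x \<partial>lborel) + 2 * (\<integral>\<^sup>+x. ennreal ((G (x + ?V x) - G x)\<^sup>2) \<partial>lborel)
     \<le> 2 * ?E i + 2 * (2 ^ card I * (\<Sum>i\<in>I. ?E i))"
    by (intro add_mono mult_left_mono single insert.IH) auto
  also have "\<dots> \<le> 2 ^ card (insert i I) * (\<Sum>i\<in>insert i I. ?E i)"
  proof -
    have "(2::ennreal) \<le> 2 * 2 ^ card I"
    proof -
      have "(1::ennreal) \<le> 2 ^ card I" by (rule one_le_power) simp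
      then have "2 * (1::ennreal) \<le> 2 * 2 ^ card I" by (rule mult_left_mono) simp
      then show ?thesis by simp
    qed
    then have "2 * ?E i \<le> 2 * 2 ^ card I * ?E i" by (rule mult_right_mono) simp
    then show ?thesis using insert.hyps by (simp add: distrib_left mult.assoc add_mono)
  qed
  finally show ?case .
qed

text \<open>
  The shift in \<open>\<sigma>\<close> is scaled with the new value of \<open>z\<close>, so that \<open>v \<mapsto> transl \<alpha> v x\<close> is injective with
  Jacobian \<open>|z + h|\<^bsup>\<alpha>k\<^esup>\<close>, which is bounded below when \<open>h\<close> points away from \<open>-z\<close>.
\<close>

definition transl :: "real \<Rightarrow> (real^'m::finite) \<times> (real^'k::finite) \<Rightarrow> (real^'m) \<times> (real^'k) \<Rightarrow> (real^'m) \<times> (real^'k)" where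
  "transl \<alpha> v x = (fst x + fst v, snd x + (norm (fst x + fst v) powr \<alpha>) *\<^sub>R snd v)"

lemma continuous_transl:
  fixes f g :: "'a::topological_space \<Rightarrow> (real^'m::finite) \<times> (real^'k::finite)"
  assumes "\<alpha> > 0" "continuous_on S f" "continuous_on S g"
  shows "continuous_on S (\<lambda>y. transl \<alpha> (f y) (g y))"
  unfolding transl_def using assms by (intro continuous_intros continuous_on_powr') auto

lemma sum_ez: "(\<Sum>i\<in>UNIV. (h $ i) *\<^sub>R (ez i :: (real^'m::finite) \<times> (real^'k::finite))) = (h, 0)"
proof -
  have "(\<Sum>i\<in>UNIV. (h $ i) *\<^sub>R axis i (1::real)) = h"
    using basis_expansion[of h] by (simp add: scalar_mult_eq_scaleR)
  then show ?thesis by (simp add: prod_eq_iff fst_sum snd_sum)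
qed

lemma sum_es: "(\<Sum>j\<in>UNIV. (s $ j) *\<^sub>R (es j :: (real^'m::finite) \<times> (real^'k::finite))) = (0, s)"
proof -
  have "(\<Sum>j\<in>UNIV. (s $ j) *\<^sub>R axis j (1::real)) = s"
    using basis_expansion[of s] by (simp add: scalar_mult_eq_scaleR)
  then show ?thesis by (simp add: prod_eq_iff fst_sum snd_sum)
qed

lemma ennreal_sum_cmult_le:
  fixes c :: "'i \<Rightarrow> 'a::euclidean_space \<Rightarrow> real"
  assumes le: "\<And>i x. i \<in> I \<Longrightarrow> c i x \<le> K * d i x" and K: "K \<ge> 0" and d: "\<And>i x. d i x \<ge> 0" and m: "\<And>i. d i \<in> borel_measurable borel"
  shows "(\<Sum>i\<in>I. \<integral>\<^sup>+x. ennreal (c i x) \<partial>lborel) \<le> ennreal K * (\<integral>\<^sup>+x. ennreal (\<Sum>i\<in>I. d i x) \<partial>lborel)"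
proof -
  have "(\<Sum>i\<in>I. \<integral>\<^sup>+x. ennreal (c i x) \<partial>lborel) \<le> (\<Sum>i\<in>I. ennreal K * (\<integral>\<^sup>+x. ennreal (d i x) \<partial>lborel))"
  proof (rule sum_mono)
    fix i assume i: "i \<in> I"
    have "(\<integral>\<^sup>+x. ennreal (c i x) \<partial>lborel) \<le> (\<integral>\<^sup>+x. ennreal K * ennreal (d i x) \<partial>lborel)"
      by (intro nn_integral_mono) (use le[OF i] K in \<open>simp add: ennreal_mult'[symmetric] ennreal_leI\<close>)
    also have "\<dots> = ennreal K * (\<integral>\<^sup>+x. ennreal (d i x) \<partial>lborel)"
      by (rule nn_integral_cmult) (use m in simp)
    finally show "(\<integral>\<^sup>+x. ennreal (c i x) \<partial>lborel) \<le> ennreal K * (\<integral>\<^sup>+x. ennreal (d i x) \<partial>lborel)" .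
  qed
  also have "\<dots> = ennreal K * (\<integral>\<^sup>+x. (\<Sum>i\<in>I. ennreal (d i x)) \<partial>lborel)"
    using m by (simp add: nn_integral_sum sum_distrib_left)
  also have "\<dots> = ennreal K * (\<integral>\<^sup>+x. ennreal (\<Sum>i\<in>I. d i x) \<partial>lborel)" using d by simp
  finally show ?thesis .
qed

text \<open>\<open>transl\<close> is a shift in z followed by a \<sigma>-shift taken at the new z.
  Each leg falls under \<open>shift_estimate\<close>, and the second is evaluated at the shifted
  point, which translation invariance undoes.\<close>

lemma transl_estimate:
  fixes G :: "(real^'m::finite) \<times> (real^'k::finite) \<Rightarrow> real"
  assumes \<alpha>: "\<alpha> > 0" and G: "continuous_on UNIV G" and D: "\<And>b. b \<in> Basis \<Longrightarrow> pd b G (G1 b)" "\<And>b. b \<in> Basis \<Longrightarrow> continuous_on UNIV (G1 b)"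
    and h: "\<And>i. \<bar>fst v $ i\<bar> \<le> 2 * \<delta>" and s: "\<And>j. \<bar>snd v $ j\<bar> \<le> \<delta>"
  shows "(\<integral>\<^sup>+x. ennreal ((G (transl \<alpha> v x) - G x)\<^sup>2) \<partial>lborel) \<le> ennreal (8 * 2 ^ (CARD('m) + CARD('k)) * \<delta>\<^sup>2) * (\<integral>\<^sup>+x. ennreal (gradsq \<alpha> G1 x) \<partial>lborel)"
proof -
  let ?E = "\<integral>\<^sup>+x. ennreal (gradsq \<alpha> G1 x) \<partial>lborel"
  note c = G D(2)[OF ez_Basis] D(2)[OF es_Basis] continuous_gweight[OF \<alpha>]
  let ?h = "(fst v, 0) :: (real^'m) \<times> (real^'k)"
  \<comment> \<open>The factor 2 undoes the 1/2 in the coefficient of the \<sigma>-fields, so that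
    the total shift is |z|^\<alpha> times \<open>snd v\<close>.\<close>
  define \<tau> where "\<tau> = (\<lambda>j (x::(real^'m) \<times> (real^'k)). (2 * gweight \<alpha> x) * (snd v $ j))"
  have c\<tau>: "continuous_on S (\<tau> j)" for S j unfolding \<tau>_def by (intro continuous_intros c)
  have \<tau>es: "(\<Sum>j\<in>UNIV. \<tau> j x *\<^sub>R (es j :: (real^'m) \<times> (real^'k))) = (0, (norm (fst x) powr \<alpha>) *\<^sub>R snd v)" for x :: "(real^'m) \<times> (real^'k)"
  proof -
    have "(\<Sum>j\<in>UNIV. \<tau> j x *\<^sub>R es j) = (2 * gweight \<alpha> x) *\<^sub>R (\<Sum>j\<in>UNIV. (snd v $ j) *\<^sub>R (es j :: (real^'m) \<times> (real^'k)))"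
      by (simp add: \<tau>_def scaleR_sum_right)
    then show ?thesis unfolding sum_es by (simp add: gweight_def)
  qed
  have A: "(\<integral>\<^sup>+x. ennreal ((G (x + ?h) - G x)\<^sup>2) \<partial>lborel) \<le> ennreal (2 ^ CARD('m) * (4 * \<delta>\<^sup>2)) * ?E"
  proof -
    have "(\<integral>\<^sup>+x. ennreal ((G (x + (\<Sum>i\<in>UNIV. (fst v $ i) *\<^sub>R ez i)) - G x)\<^sup>2) \<partial>lborel)
      \<le> 2 ^ card (UNIV::'m set) * (\<Sum>i\<in>UNIV. \<integral>\<^sup>+x. ennreal ((fst v $ i)\<^sup>2 * (G1 (ez i) x)\<^sup>2) \<partial>lborel)"
    proof (rule shift_estimate[where \<tau>="\<lambda>i _. fst v $ i" and b=ez])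
      show "(\<integral>\<^sup>+x. \<Psi> (x + (\<Sum>i\<in>S. (w i * (fst v $ i)) *\<^sub>R ez i)) \<partial>lborel) = (\<integral>\<^sup>+x. \<Psi> x \<partial>lborel)"
        if "\<Psi> \<in> borel_measurable borel" for S w and \<Psi> :: "(real^'m) \<times> (real^'k) \<Rightarrow> ennreal"
        by (rule nn_integral_lborel_shift[OF that])
    qed (use c D(1)[OF ez_Basis] in auto)
    also have "(\<Sum>i\<in>UNIV. \<integral>\<^sup>+x. ennreal ((fst v $ i)\<^sup>2 * (G1 (ez i) x)\<^sup>2) \<partial>lborel)
       \<le> ennreal (4 * \<delta>\<^sup>2) * (\<integral>\<^sup>+x. ennreal (\<Sum>i\<in>UNIV. (G1 (ez i) x)\<^sup>2) \<partial>lborel)"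
    proof (rule ennreal_sum_cmult_le)
      fix i :: 'm and x :: "(real^'m) \<times> (real^'k)"
      have "(fst v $ i)\<^sup>2 \<le> (2 * \<delta>)\<^sup>2" using h[of i] by (intro abs_le_square_iff[THEN iffD1]) linarith
      then show "(fst v $ i)\<^sup>2 * (G1 (ez i) x)\<^sup>2 \<le> 4 * \<delta>\<^sup>2 * (G1 (ez i) x)\<^sup>2"
        by (intro mult_right_mono) (auto simp: power_mult_distrib)
    qed (auto intro!: borel_measurable_continuous_onI continuous_intros c)
    also have "(\<integral>\<^sup>+x. ennreal (\<Sum>i\<in>UNIV. (G1 (ez i) x)\<^sup>2) \<partial>lborel) \<le> ?E"
      by (intro nn_integral_mono ennreal_leI) (simp add: gradsq_def sum_nonneg)
    finally have "(\<integral>\<^sup>+x. ennreal ((G (x + ?h) - G x)\<^sup>2) \<partial>lborel) \<le> 2 ^ card (UNIV::'m set) * (ennreal (4 * \<delta>\<^sup>2) * ?E)"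
      unfolding sum_ez by (simp add: mult_left_mono)
    also have "\<dots> = ennreal (2 ^ CARD('m) * (4 * \<delta>\<^sup>2)) * ?E"
      by (subst ennreal_mult) (auto simp: mult.assoc ennreal_power[symmetric])
    finally show ?thesis .
  qed
  let ?B = "\<lambda>y. ennreal ((G (y + (0, (norm (fst y) powr \<alpha>) *\<^sub>R snd v)) - G y)\<^sup>2)"
  have B: "(\<integral>\<^sup>+y. ?B y \<partial>lborel) \<le> ennreal (2 ^ CARD('k) * (4 * \<delta>\<^sup>2)) * ?E"
  proof -
    have "(\<integral>\<^sup>+x. ennreal ((G (x + (\<Sum>j\<in>UNIV. \<tau> j x *\<^sub>R es j)) - G x)\<^sup>2) \<partial>lborel)
      \<le> 2 ^ card (UNIV::'k set) * (\<Sum>j\<in>UNIV. \<integral>\<^sup>+x. ennreal ((\<tau> j x)\<^sup>2 * (G1 (es j) x)\<^sup>2) \<partial>lborel)"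
    proof (rule shift_estimate)
      have inc: "x + (\<Sum>j\<in>S. (w j * \<tau> j x) *\<^sub>R es j) = (fst x + 0, snd x + (norm (fst x) powr \<alpha>) *\<^sub>R (\<Sum>j\<in>S. (w j * (snd v $ j)) *\<^sub>R axis j (1::real)))"
        for S w and x :: "(real^'m) \<times> (real^'k)"
        by (auto simp: prod_eq_iff fst_sum snd_sum \<tau>_def gweight_def scaleR_sum_right intro!: sum.cong)
      show "(\<integral>\<^sup>+x. \<Psi> (x + (\<Sum>j\<in>S. (w j * \<tau> j x) *\<^sub>R es j)) \<partial>lborel) = (\<integral>\<^sup>+x. \<Psi> x \<partial>lborel)"
        if m: "\<Psi> \<in> borel_measurable borel" for S w and \<Psi> :: "(real^'m) \<times> (real^'k) \<Rightarrow> ennreal"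
        unfolding inc
      proof (rule nn_integral_shear[OF m])
        show "(\<lambda>z::real^'m. (norm z powr \<alpha>) *\<^sub>R (\<Sum>j\<in>S. (w j * (snd v $ j)) *\<^sub>R axis j (1::real))) \<in> borel_measurable borel"
          using \<alpha> by (intro borel_measurable_continuous_onI continuous_on_scaleR continuous_on_const continuous_on_powr' continuous_on_norm continuous_on_id) auto
      qed
      show "\<tau> j (x + (\<Sum>j\<in>S. (w j * \<tau> j x) *\<^sub>R es j)) = \<tau> j x" for S w j and x :: "(real^'m) \<times> (real^'k)"
        unfolding inc by (simp add: \<tau>_def gweight_def)
    qed (use c c\<tau> D(1)[OF es_Basis] in auto)
    also have "(\<Sum>j\<in>UNIV. \<integral>\<^sup>+x. ennreal ((\<tau> j x)\<^sup>2 * (G1 (es j) x)\<^sup>2) \<partial>lborel)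
       \<le> ennreal (4 * \<delta>\<^sup>2) * (\<integral>\<^sup>+x. ennreal (\<Sum>j\<in>UNIV. (gweight \<alpha> x)\<^sup>2 * (G1 (es j) x)\<^sup>2) \<partial>lborel)"
    proof (rule ennreal_sum_cmult_le)
      fix j :: 'k and x :: "(real^'m) \<times> (real^'k)"
      have "(snd v $ j)\<^sup>2 \<le> \<delta>\<^sup>2" using s[of j] by (intro abs_le_square_iff[THEN iffD1]) linarith
      then have "(snd v $ j)\<^sup>2 * (4 * (gweight \<alpha> x)\<^sup>2 * (G1 (es j) x)\<^sup>2) \<le> \<delta>\<^sup>2 * (4 * (gweight \<alpha> x)\<^sup>2 * (G1 (es j) x)\<^sup>2)"
        by (intro mult_right_mono) auto
      then show "(\<tau> j x)\<^sup>2 * (G1 (es j) x)\<^sup>2 \<le> 4 * \<delta>\<^sup>2 * ((gweight \<alpha> x)\<^sup>2 * (G1 (es j) x)\<^sup>2)"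
        by (simp add: \<tau>_def power_mult_distrib mult_ac)
    qed (auto intro!: borel_measurable_continuous_onI continuous_intros c)
    also have "(\<integral>\<^sup>+x. ennreal (\<Sum>j\<in>UNIV. (gweight \<alpha> x)\<^sup>2 * (G1 (es j) x)\<^sup>2) \<partial>lborel) \<le> ?E"
      by (intro nn_integral_mono ennreal_leI) (simp add: gradsq_def sum_nonneg sum_distrib_left)
    finally have "(\<integral>\<^sup>+y. ?B y \<partial>lborel) \<le> 2 ^ card (UNIV::'k set) * (ennreal (4 * \<delta>\<^sup>2) * ?E)"
      unfolding \<tau>es by (simp add: mult_left_mono)
    also have "\<dots> = ennreal (2 ^ CARD('k) * (4 * \<delta>\<^sup>2)) * ?E"
      by (subst ennreal_mult) (auto simp: mult.assoc ennreal_power[symmetric])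
    finally show ?thesis .
  qed
  have mB: "?B \<in> borel_measurable borel"
    using \<alpha> by (intro measurable_compose[OF _ measurable_ennreal] borel_measurable_continuous_onI continuous_intros continuous_on_powr' continuous_on_compose2[OF G]) auto
  have mA: "(\<lambda>x. ennreal ((G (x + ?h) - G x)\<^sup>2)) \<in> borel_measurable borel"
    by (intro measurable_compose[OF _ measurable_ennreal] borel_measurable_continuous_onI continuous_intros continuous_on_compose2[OF G] G) auto
  have mB': "(\<lambda>x. ?B (x + ?h)) \<in> borel_measurable borel"
    by (rule measurable_compose[OF _ mB]) simp
  have "(\<integral>\<^sup>+x. ennreal ((G (transl \<alpha> v x) - G x)\<^sup>2) \<partial>lborel) \<le> (\<integral>\<^sup>+x. 2 * ?B (x + ?h) + 2 * ennreal ((G (x + ?h) - G x)\<^sup>2) \<partial>lborel)"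
  proof (rule nn_integral_mono)
    fix x :: "(real^'m) \<times> (real^'k)"
    have e: "transl \<alpha> v x = (x + ?h) + (0, (norm (fst (x + ?h)) powr \<alpha>) *\<^sub>R snd v)"
      by (simp add: transl_def prod_eq_iff)
    have "(A - C)\<^sup>2 \<le> 2 * (A - B)\<^sup>2 + 2 * (B - C)\<^sup>2" for A B C :: real
      using zero_le_power2[of "A - 2 * B + C"] by (simp add: power2_eq_square algebra_simps)
    then have "ennreal ((G (transl \<alpha> v x) - G x)\<^sup>2)
      \<le> ennreal (2 * (G ((x + ?h) + (0, (norm (fst (x + ?h)) powr \<alpha>) *\<^sub>R snd v)) - G (x + ?h))\<^sup>2 + 2 * (G (x + ?h) - G x)\<^sup>2)"
      unfolding e by (rule ennreal_leI)
    then show "ennreal ((G (transl \<alpha> v x) - G x)\<^sup>2) \<le> 2 * ?B (x + ?h) + 2 * ennreal ((G (x + ?h) - G x)\<^sup>2)"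
      by (simp add: ennreal_plus ennreal_mult)
  qed
  also have "\<dots> = 2 * (\<integral>\<^sup>+x. ?B (x + ?h) \<partial>lborel) + 2 * (\<integral>\<^sup>+x. ennreal ((G (x + ?h) - G x)\<^sup>2) \<partial>lborel)"
    using mB' mA by (subst nn_integral_add) (auto simp: nn_integral_cmult)
  also have "(\<integral>\<^sup>+x. ?B (x + ?h) \<partial>lborel) = (\<integral>\<^sup>+x. ?B x \<partial>lborel)" by (rule nn_integral_lborel_shift[OF mB])
  also have "2 * (\<integral>\<^sup>+x. ?B x \<partial>lborel) + 2 * (\<integral>\<^sup>+x. ennreal ((G (x + ?h) - G x)\<^sup>2) \<partial>lborel)
     \<le> 2 * (ennreal (2 ^ CARD('k) * (4 * \<delta>\<^sup>2)) * ?E) + 2 * (ennreal (2 ^ CARD('m) * (4 * \<delta>\<^sup>2)) * ?E)"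
    by (intro add_mono mult_left_mono A B) auto
  also have "\<dots> = ennreal (8 * (2 ^ CARD('k) + 2 ^ CARD('m)) * \<delta>\<^sup>2) * ?E"
  proof -
    have *: "ennreal (2 * a + 2 * b) = 2 * ennreal a + 2 * ennreal b" if "a \<ge> 0" "b \<ge> 0" for a b
      using that by (simp add: ennreal_plus ennreal_mult)
    have "ennreal (8 * (2 ^ CARD('k) + 2 ^ CARD('m)) * \<delta>\<^sup>2) = ennreal (2 * (2 ^ CARD('k) * (4 * \<delta>\<^sup>2)) + 2 * (2 ^ CARD('m) * (4 * \<delta>\<^sup>2)))"
      by (intro arg_cong[where f=ennreal]) (simp add: algebra_simps)
    also have "\<dots> = 2 * ennreal (2 ^ CARD('k) * (4 * \<delta>\<^sup>2)) + 2 * ennreal (2 ^ CARD('m) * (4 * \<delta>\<^sup>2))"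
      by (rule *) auto
    finally show ?thesis by (simp add: algebra_simps)
  qed
  also have "\<dots> \<le> ennreal (8 * 2 ^ (CARD('m) + CARD('k)) * \<delta>\<^sup>2) * ?E"
  proof (rule mult_right_mono, rule ennreal_leI)
    have "a + b \<le> a * b" if "a \<ge> 2" "b \<ge> 2" for a b :: real
      using mult_mono[of 1 "a - 1" 1 "b - 1"] that by (simp add: algebra_simps)
    moreover have "(2::real) ^ 1 \<le> 2 ^ CARD('m)" "(2::real) ^ 1 \<le> 2 ^ CARD('k)"
      by (intro power_increasing; simp add: Suc_leI)+
    ultimately have "(2::real) ^ CARD('k) + 2 ^ CARD('m) \<le> 2 ^ CARD('k) * 2 ^ CARD('m)" by simp
    then show "8 * ((2::real) ^ CARD('k) + 2 ^ CARD('m)) * \<delta>\<^sup>2 \<le> 8 * 2 ^ (CARD('m) + CARD('k)) * \<delta>\<^sup>2"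
      by (intro mult_right_mono mult_left_mono) (auto simp: power_add mult.commute)
  qed auto
  finally show ?thesis .
qed

lemma nn_integral_fibre_measurable:
  fixes \<Psi> :: "'a::euclidean_space \<times> 'b::euclidean_space \<Rightarrow> ennreal"
  assumes "\<Psi> \<in> borel_measurable borel"
  shows "(\<lambda>s. \<Psi> (z, s)) \<in> borel_measurable borel" "(\<lambda>z. \<integral>\<^sup>+s. \<Psi> (z, s) \<partial>lborel) \<in> borel_measurable borel"
proof -
  have m: "\<Psi> \<in> borel_measurable (lborel \<Otimes>\<^sub>M lborel)" using assms by (simp add: lborel_prod)
  show "(\<lambda>s. \<Psi> (z, s)) \<in> borel_measurable borel"
    using measurable_Pair_compose_split[of "\<lambda>x y. \<Psi> (x, y)" lborel lborel borel "\<lambda>_. z" borel "\<lambda>s. s"] m by simp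
  have "(\<lambda>z. \<integral>\<^sup>+s. \<Psi> (z, s) \<partial>lborel) \<in> borel_measurable lborel"
    by (rule lborel.borel_measurable_nn_integral_fst[OF m])
  then show "(\<lambda>z. \<integral>\<^sup>+s. \<Psi> (z, s) \<partial>lborel) \<in> borel_measurable borel" by simp
qed

lemma emeasure_cube:
  fixes a :: real
  assumes "\<delta> \<ge> 0"
  shows "emeasure lborel (cbox (vec a, 0) (vec (a + \<delta>), vec \<delta>) :: ((real^'m::finite) \<times> (real^'k::finite)) set) = ennreal (\<delta> ^ (CARD('m) + CARD('k)))"
proof -
  let ?l = "(vec a, 0) :: (real^'m) \<times> (real^'k)" and ?u = "(vec (a + \<delta>), vec \<delta>) :: (real^'m) \<times> (real^'k)"
  have d: "(?u - ?l) \<bullet> b = \<delta>" if "b \<in> Basis" for b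
    using that by (auto simp: Basis_prod_def Basis_vec_def inner_axis inner_diff_left)
  have "emeasure lborel (cbox ?l ?u) = ennreal (\<Prod>b\<in>Basis. (?u - ?l) \<bullet> b)"
  proof (rule emeasure_lborel_cbox)
    fix b :: "(real^'m) \<times> (real^'k)" assume "b \<in> Basis"
    from d[OF this] assms have "?u \<bullet> b - ?l \<bullet> b \<ge> 0" by (simp only: inner_diff_left)
    then show "?l \<bullet> b \<le> ?u \<bullet> b" by linarith
  qed
  also have "(\<Prod>b\<in>Basis. (?u - ?l) \<bullet> b) = \<delta> ^ (CARD('m) + CARD('k))" using d by simp
  finally show ?thesis .
qed

text \<open>For fixed h the \<sigma>-part of \<open>transl\<close> is a homothety with factor |z +
  h|^\<alpha> \<ge> \<delta>^\<alpha> in k dimensions, so integrating over s costs at most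
  \<delta>^(-\<alpha> k). The integration over h is a translation.\<close>

lemma transl_average:
  fixes G :: "(real^'m::finite) \<times> (real^'k::finite) \<Rightarrow> real"
  assumes \<alpha>: "\<alpha> > 0" and \<delta>: "\<delta> > 0" and G: "continuous_on UNIV G" and p: "p > 0"
    and x: "\<And>h. h \<in> cbox (vec a) (vec (a + \<delta>)) \<Longrightarrow> norm (fst x + h) \<ge> \<delta>"
  shows "(\<integral>\<^sup>+v. ennreal (\<bar>G (transl \<alpha> v x)\<bar> powr p) * indicator (cbox (vec a, 0) (vec (a + \<delta>), vec \<delta>)) v \<partial>lborel)
    \<le> ennreal (\<delta> powr (- \<alpha> * CARD('k))) * (\<integral>\<^sup>+y. ennreal (\<bar>G y\<bar> powr p) \<partial>lborel)"
proof -
  let ?P = "cbox (vec a, 0) (vec (a + \<delta>), vec \<delta>) :: ((real^'m) \<times> (real^'k)) set"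
  let ?g = "\<lambda>y. ennreal (\<bar>G y\<bar> powr p)"
  let ?A = "ennreal (\<delta> powr (- \<alpha> * CARD('k)))"
  have mg: "?g \<in> borel_measurable borel"
    using p by (intro measurable_compose[OF _ measurable_ennreal] borel_measurable_continuous_onI continuous_on_powr' continuous_intros G) auto
  have mT: "(\<lambda>v. ?g (transl \<alpha> v x)) \<in> borel_measurable borel"
    by (rule measurable_compose[OF _ mg]) (intro borel_measurable_continuous_onI continuous_transl[OF \<alpha>] continuous_intros)
  have m: "(\<lambda>v. ?g (transl \<alpha> v x) * indicator ?P v) \<in> borel_measurable borel"
    using mT by measurable
  have "(\<integral>\<^sup>+v. ?g (transl \<alpha> v x) * indicator ?P v \<partial>lborel) = (\<integral>\<^sup>+h. \<integral>\<^sup>+s. ?g (transl \<alpha> (h, s) x) * indicator ?P (h, s) \<partial>lborel \<partial>lborel)"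
    by (rule nn_integral_lborel_Pair[OF m])
  also have "\<dots> \<le> (\<integral>\<^sup>+h. ?A * (\<integral>\<^sup>+s. ?g (fst x + h, s) \<partial>lborel) \<partial>lborel)"
  proof (rule nn_integral_mono)
    fix h :: "real^'m"
    show "(\<integral>\<^sup>+s. ?g (transl \<alpha> (h, s) x) * indicator ?P (h, s) \<partial>lborel) \<le> ?A * (\<integral>\<^sup>+s. ?g (fst x + h, s) \<partial>lborel)"
    proof (cases "h \<in> cbox (vec a) (vec (a + \<delta>))")
      case False
      then have "indicator ?P (h, s) = (0::ennreal)" for s by (simp add: cbox_Pair_eq indicator_def)
      then show ?thesis by simp
    next
      case True
      define c where "c = norm (fst x + h) powr \<alpha>"
      have n: "norm (fst x + h) \<ge> \<delta>" by (rule x[OF True])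
      then have "norm (fst x + h) > 0" using \<delta> by linarith
      then have c: "c > 0" by (simp add: c_def)
      have "(\<integral>\<^sup>+s. ?g (transl \<alpha> (h, s) x) * indicator ?P (h, s) \<partial>lborel) \<le> (\<integral>\<^sup>+s. ?g (fst x + h, snd x + c *\<^sub>R s) \<partial>lborel)"
        by (intro nn_integral_mono) (auto simp: indicator_def transl_def c_def)
      also have "\<dots> \<le> ?A * (ennreal (c ^ CARD('k)) * (\<integral>\<^sup>+s. ?g (fst x + h, snd x + c *\<^sub>R s) \<partial>lborel))"
      proof -
        have "1 = \<delta> powr (- \<alpha> * CARD('k)) * (\<delta> powr \<alpha>) ^ CARD('k)"
          using \<delta> by (simp add: powr_realpow[symmetric] powr_powr powr_add[symmetric])
        also have "\<dots> \<le> \<delta> powr (- \<alpha> * CARD('k)) * c ^ CARD('k)"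
          unfolding c_def using n \<delta> \<alpha> by (intro mult_left_mono power_mono powr_mono2) auto
        finally have "ennreal 1 \<le> ennreal (\<delta> powr (- \<alpha> * CARD('k)) * c ^ CARD('k))" by (rule ennreal_leI)
        then have "1 \<le> ?A * ennreal (c ^ CARD('k))" by (simp add: ennreal_mult')
        then have "1 * (\<integral>\<^sup>+s. ?g (fst x + h, snd x + c *\<^sub>R s) \<partial>lborel) \<le> ?A * ennreal (c ^ CARD('k)) * (\<integral>\<^sup>+s. ?g (fst x + h, snd x + c *\<^sub>R s) \<partial>lborel)"
          by (rule mult_right_mono) simp
        then show ?thesis by (simp add: mult.assoc)
      qed
      also have "ennreal (c ^ CARD('k)) * (\<integral>\<^sup>+s. ?g (fst x + h, snd x + c *\<^sub>R s) \<partial>lborel) = (\<integral>\<^sup>+s. ?g (fst x + h, s) \<partial>lborel)"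
        using nn_integral_lborel_affine[OF nn_integral_fibre_measurable(1)[OF mg] c, of "fst x + h" "snd x"] by simp
      finally show ?thesis .
    qed
  qed
  also have "\<dots> = ?A * (\<integral>\<^sup>+h. \<integral>\<^sup>+s. ?g (fst x + h, s) \<partial>lborel \<partial>lborel)"
  proof (rule nn_integral_cmult)
    have "(\<lambda>h. fst x + h) \<in> borel \<rightarrow>\<^sub>M borel" by simp
    from measurable_compose[OF this nn_integral_fibre_measurable(2)[OF mg]]
    show "(\<lambda>h. \<integral>\<^sup>+s. ?g (fst x + h, s) \<partial>lborel) \<in> borel_measurable lborel" by simp
  qed
  also have "(\<integral>\<^sup>+h. \<integral>\<^sup>+s. ?g (fst x + h, s) \<partial>lborel \<partial>lborel) = (\<integral>\<^sup>+y. ?g y \<partial>lborel)"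
    using nn_integral_lborel_shift[OF nn_integral_fibre_measurable(2)[OF mg], of "fst x"] nn_integral_lborel_Pair[OF mg]
    by (simp add: add.commute)
  finally show ?thesis .
qed

text \<open>Below the truncation level L, b^2 is at most L^(2/p - 1) |b|^p and a is compared with b.
  Above it |b|^p / L > 1 and a^2 is bounded trivially; averaged over b, this last term has a small
  coefficient and can be absorbed.\<close>

lemma square_le_truncated:
  fixes a b L p :: real
  assumes p: "0 < p" "p < 2" and L: "L > 0"
  shows "a\<^sup>2 \<le> (2 * (b - a)\<^sup>2 + 2 * L powr (2 / p - 1) * \<bar>b\<bar> powr p) + a\<^sup>2 / L * \<bar>b\<bar> powr p"
proof (cases "\<bar>b\<bar> powr p \<le> L")
  case True
  have "b\<^sup>2 \<le> L powr (2 / p - 1) * \<bar>b\<bar> powr p"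
  proof (cases "b = 0")
    case False
    have "b\<^sup>2 = \<bar>b\<bar> powr (p * (2 / p - 1) + p)" using False p by (simp add: algebra_simps)
    also have "\<dots> = (\<bar>b\<bar> powr p) powr (2 / p - 1) * \<bar>b\<bar> powr p" by (simp only: powr_add powr_powr)
    also have "\<dots> \<le> L powr (2 / p - 1) * \<bar>b\<bar> powr p"
      using True p by (intro mult_right_mono powr_mono2) auto
    finally show ?thesis .
  qed simp
  moreover have "a\<^sup>2 \<le> 2 * (b - a)\<^sup>2 + 2 * b\<^sup>2"
    using zero_le_power2[of "2 * b - a"] by (simp add: power2_eq_square algebra_simps)
  moreover have "0 \<le> a\<^sup>2 / L * \<bar>b\<bar> powr p" using L by simp
  ultimately show ?thesis by linarith
next
  case False
  then have "a\<^sup>2 / L * L \<le> a\<^sup>2 / L * \<bar>b\<bar> powr p" using L by (intro mult_left_mono) auto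
  moreover have "a\<^sup>2 / L * L = a\<^sup>2" using L by simp
  moreover have "0 \<le> 2 * L powr (2 / p - 1) * \<bar>b\<bar> powr p" by simp
  ultimately show ?thesis using zero_le_power2[of "b - a"] by linarith
qed

text \<open>G(x) is compared with G(\<open>transl v x\<close>) for v in a cube of side \<delta>. The
  difference is controlled by the gradient, the shifted values by the p-th power integral. The set
  \<open>H\<close> restricts x so that the shifts lead away from z = 0, where the Jacobian would
  degenerate.\<close>

lemma nash_half:
  fixes G :: "(real^'m::finite) \<times> (real^'k::finite) \<Rightarrow> real"
  assumes \<alpha>: "\<alpha> > 0" and G: "continuous_on UNIV G" and D: "\<And>b. b \<in> Basis \<Longrightarrow> pd b G (G1 b)" "\<And>b. b \<in> Basis \<Longrightarrow> continuous_on UNIV (G1 b)"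
    and \<delta>: "\<delta> > 0" and p: "0 < p" "p < 2" and I: "(\<integral>\<^sup>+x. ennreal (\<bar>G x\<bar> powr p) \<partial>lborel) \<le> ennreal I" "I > 0"
    and H: "closed H" "\<And>z h. z \<in> H \<Longrightarrow> h \<in> cbox (vec a) (vec (a + \<delta>)) \<Longrightarrow> norm (z + h) \<ge> \<delta>" and a: "\<bar>a\<bar> \<le> 2 * \<delta>" "\<bar>a + \<delta>\<bar> \<le> 2 * \<delta>"
  shows "(\<integral>\<^sup>+x. ennreal ((G x)\<^sup>2) * indicator H (fst x) \<partial>lborel)
    \<le> ennreal (32 * 2 ^ (CARD('m) + CARD('k)) * \<delta>\<^sup>2) * (\<integral>\<^sup>+x. ennreal (gradsq \<alpha> G1 x) \<partial>lborel)
     + ennreal (4 * (2 * \<delta> powr (- (real CARD('m) + real CARD('k) + \<alpha> * real CARD('k)))) powr (2 / p - 1) * I powr (2 / p))"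
proof -
  define V where "V = \<delta> ^ (CARD('m) + CARD('k))"
  \<comment> \<open>With this level the average of |b|^p / L over the cube is at most 1/2, so the
    trivial term is absorbed into the left side.\<close>
  define L where "L = 2 * \<delta> powr (- (real CARD('m) + real CARD('k) + \<alpha> * real CARD('k))) * I"
  define M where "M = 2 * L powr (2 / p - 1)"
  define C where "C = 8 * 2 ^ (CARD('m) + CARD('k)) * \<delta>\<^sup>2"
  let ?P = "cbox (vec a, 0) (vec (a + \<delta>), vec \<delta>) :: ((real^'m) \<times> (real^'k)) set"
  let ?E = "\<integral>\<^sup>+x. ennreal (gradsq \<alpha> G1 x) \<partial>lborel"
  let ?b = "\<lambda>v x. \<bar>G (transl \<alpha> v x)\<bar> powr p"
  let ?d = "\<lambda>v x. (G (transl \<alpha> v x) - G x)\<^sup>2"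
  have V: "V > 0" and L: "L > 0" using \<delta> I(2) by (auto simp: V_def L_def)
  have M: "M \<ge> 0" and C: "C \<ge> 0" by (auto simp: M_def C_def)
  have eP: "emeasure lborel ?P = ennreal V" unfolding V_def by (rule emeasure_cube) (use \<delta> in simp)
  have cb: "continuous_on UNIV (\<lambda>q. ?b (fst q) (snd q))" and cd: "continuous_on UNIV (\<lambda>q. ?d (fst q) (snd q))"
    using p by (intro continuous_intros continuous_on_powr' continuous_on_compose2[OF G] continuous_transl[OF \<alpha>]; simp)+
  have mb: "(\<lambda>q. ennreal (?b (fst q) (snd q))) \<in> borel_measurable borel" and md: "(\<lambda>q. ennreal (?d (fst q) (snd q))) \<in> borel_measurable borel"
    using borel_measurable_continuous_onI[OF cb] borel_measurable_continuous_onI[OF cd] by auto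
  have cTv: "continuous_on UNIV (\<lambda>v. transl \<alpha> v x)" for x by (intro continuous_transl[OF \<alpha>] continuous_intros)
  have mbv: "(\<lambda>v. ennreal (?b v x)) \<in> borel_measurable borel" and mdv: "(\<lambda>v. ennreal (?d v x)) \<in> borel_measurable borel" for x
    using p by (intro measurable_compose[OF _ measurable_ennreal] borel_measurable_continuous_onI continuous_intros continuous_on_powr' continuous_on_compose2[OF G cTv]; simp)+
  have cTx: "continuous_on UNIV (\<lambda>x. transl \<alpha> v x)" for v by (intro continuous_transl[OF \<alpha>] continuous_intros)
  have mbx: "(\<lambda>x. ennreal (?b v x)) \<in> borel_measurable borel" and mdx: "(\<lambda>x. ennreal (?d v x)) \<in> borel_measurable borel" for v
    using p by (intro measurable_compose[OF _ measurable_ennreal] borel_measurable_continuous_onI continuous_intros continuous_on_powr' continuous_on_compose2[OF G cTx] G; simp)+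
  let ?W = "\<lambda>v x. (ennreal 2 * ennreal (?d v x) + ennreal M * ennreal (?b v x)) * indicator ?P v"
  have pointwise: "ennreal (V / 2) * (ennreal ((G x)\<^sup>2) * indicator H (fst x)) \<le> (\<integral>\<^sup>+v. ?W v x \<partial>lborel)" for x
  proof (cases "fst x \<in> H")
    case False
    then show ?thesis by simp
  next
    case True
    define g where "g = (G x)\<^sup>2"
    have g: "g \<ge> 0" by (simp add: g_def)
    have "ennreal (g * V) = (\<integral>\<^sup>+v. ennreal g * indicator ?P v \<partial>lborel)"
      using g V by (simp add: nn_integral_cmult_indicator eP ennreal_mult)
    also have "\<dots> \<le> (\<integral>\<^sup>+v. ?W v x + ennreal (g / L) * (ennreal (?b v x) * indicator ?P v) \<partial>lborel)"
    proof (rule nn_integral_mono)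
      fix v :: "(real^'m) \<times> (real^'k)"
      have "g \<le> (2 * ?d v x + M * ?b v x) + g / L * ?b v x"
        unfolding g_def M_def by (rule square_le_truncated[OF p L])
      then have "ennreal g \<le> ennreal ((2 * ?d v x + M * ?b v x) + g / L * ?b v x)" by (rule ennreal_leI)
      also have "\<dots> = (ennreal 2 * ennreal (?d v x) + ennreal M * ennreal (?b v x)) + ennreal (g / L) * ennreal (?b v x)"
        using M g L by (simp only: ennreal_plus ennreal_mult[symmetric] zero_le_power2 powr_ge_zero zero_le_mult_iff add_nonneg_nonneg divide_nonneg_pos) (simp add: ennreal_plus)
      finally show "ennreal g * indicator ?P v \<le> ?W v x + ennreal (g / L) * (ennreal (?b v x) * indicator ?P v)"
        by (auto simp: indicator_def)
    qed
    also have "\<dots> = (\<integral>\<^sup>+v. ?W v x \<partial>lborel) + ennreal (g / L) * (\<integral>\<^sup>+v. ennreal (?b v x) * indicator ?P v \<partial>lborel)"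
    proof (subst nn_integral_add)
      show "(\<lambda>v. ?W v x) \<in> borel_measurable lborel" using mdv[of x] mbv[of x] by measurable
      show "(\<lambda>v. ennreal (g / L) * (ennreal (?b v x) * indicator ?P v)) \<in> borel_measurable lborel" using mbv[of x] by measurable
      show "(\<integral>\<^sup>+v. ?W v x \<partial>lborel) + (\<integral>\<^sup>+v. ennreal (g / L) * (ennreal (?b v x) * indicator ?P v) \<partial>lborel) =
        (\<integral>\<^sup>+v. ?W v x \<partial>lborel) + ennreal (g / L) * (\<integral>\<^sup>+v. ennreal (?b v x) * indicator ?P v \<partial>lborel)"
        using mbv[of x] by (subst nn_integral_cmult) auto
    qed
    also have "\<dots> \<le> (\<integral>\<^sup>+v. ?W v x \<partial>lborel) + ennreal (g * V / 2)"
    proof (rule add_left_mono)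
      have "(\<integral>\<^sup>+v. ennreal (?b v x) * indicator ?P v \<partial>lborel) \<le> ennreal (\<delta> powr (- \<alpha> * CARD('k))) * (\<integral>\<^sup>+y. ennreal (\<bar>G y\<bar> powr p) \<partial>lborel)"
        by (rule transl_average[OF \<alpha> \<delta> G p(1)]) (rule H(2)[OF True])
      also have "\<dots> \<le> ennreal (\<delta> powr (- \<alpha> * CARD('k))) * ennreal I" by (intro mult_left_mono I) auto
      also have "\<dots> = ennreal (\<delta> powr (- \<alpha> * CARD('k)) * I)" using I by (simp add: ennreal_mult)
      finally have "ennreal (g / L) * (\<integral>\<^sup>+v. ennreal (?b v x) * indicator ?P v \<partial>lborel) \<le> ennreal (g / L) * ennreal (\<delta> powr (- \<alpha> * CARD('k)) * I)"
        by (rule mult_left_mono) simp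
      also have "\<dots> = ennreal (g / L * (\<delta> powr (- \<alpha> * CARD('k)) * I))" using g L by (subst ennreal_mult'[symmetric]) auto
      also have "g / L * (\<delta> powr (- \<alpha> * CARD('k)) * I) = g * V / 2"
      proof -
        have "\<delta> powr (- \<alpha> * CARD('k)) = \<delta> powr (real CARD('m) + real CARD('k)) * \<delta> powr (- (real CARD('m) + real CARD('k) + \<alpha> * real CARD('k)))"
          by (simp add: powr_add[symmetric])
        also have "\<delta> powr (real CARD('m) + real CARD('k)) = V" unfolding V_def using \<delta> powr_realpow[of \<delta> "CARD('m) + CARD('k)"] by simp
        finally have "\<delta> powr (- \<alpha> * CARD('k)) * I = V * L / 2" unfolding L_def by simp
        then show ?thesis using L by (simp only:) simp
      qed
      finally show "ennreal (g / L) * (\<integral>\<^sup>+v. ennreal (?b v x) * indicator ?P v \<partial>lborel) \<le> ennreal (g * V / 2)" .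
    qed
    finally have "ennreal (g * V) \<le> (\<integral>\<^sup>+v. ?W v x \<partial>lborel) + ennreal (g * V / 2)" .
    then have "ennreal (g * V / 2) \<le> (\<integral>\<^sup>+v. ?W v x \<partial>lborel)"
    \<comment> \<open>Absorption means subtracting a finite quantity in \<open>ennreal\<close>; if
      the other integral is infinite there is nothing to prove.\<close>
    proof (cases "\<integral>\<^sup>+v. ?W v x \<partial>lborel")
      case (real y)
      then have "g * V \<le> y + g * V / 2" using \<open>ennreal (g * V) \<le> _\<close> g V by (simp add: ennreal_plus[symmetric] del: ennreal_plus)
      then show ?thesis using real by (simp add: ennreal_leI)
    qed simp
    then show ?thesis using True V g by (simp add: g_def ennreal_mult'[symmetric] mult.commute)
  qed
  have "ennreal (V / 2) * (\<integral>\<^sup>+x. ennreal ((G x)\<^sup>2) * indicator H (fst x) \<partial>lborel) = (\<integral>\<^sup>+x. ennreal (V / 2) * (ennreal ((G x)\<^sup>2) * indicator H (fst x)) \<partial>lborel)"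
  proof (rule nn_integral_cmult[symmetric])
    have "(\<lambda>x::(real^'m) \<times> (real^'k). indicator (H \<times> UNIV) x :: ennreal) \<in> borel_measurable borel"
      by (rule borel_measurable_indicator) (intro borel_closed closed_Times H closed_UNIV)
    moreover have "(\<lambda>x. ennreal ((G x)\<^sup>2)) \<in> borel_measurable borel"
      by (intro measurable_compose[OF _ measurable_ennreal] borel_measurable_continuous_onI continuous_intros G)
    ultimately have "(\<lambda>x. ennreal ((G x)\<^sup>2) * indicator (H \<times> UNIV) x) \<in> borel_measurable lborel" by measurable
    moreover have "indicator (H \<times> UNIV) x = (indicator H (fst x) :: ennreal)" for x :: "(real^'m) \<times> (real^'k)"
      by (cases x) (simp add: indicator_times)
    ultimately show "(\<lambda>x. ennreal ((G x)\<^sup>2) * indicator H (fst x)) \<in> borel_measurable lborel" by simp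
  qed
  also have "\<dots> \<le> (\<integral>\<^sup>+x. \<integral>\<^sup>+v. ?W v x \<partial>lborel \<partial>lborel)" by (intro nn_integral_mono pointwise)
  also have "\<dots> = (\<integral>\<^sup>+v. \<integral>\<^sup>+x. ?W v x \<partial>lborel \<partial>lborel)"
  proof -
    have "(\<lambda>q::((real^'m) \<times> (real^'k)) \<times> (real^'m) \<times> (real^'k). indicator (?P \<times> UNIV) q :: ennreal) \<in> borel_measurable borel"
      by (rule borel_measurable_indicator) (intro borel_closed closed_Times closed_cbox closed_UNIV)
    then have "(\<lambda>q. (ennreal 2 * ennreal (?d (fst q) (snd q)) + ennreal M * ennreal (?b (fst q) (snd q))) * indicator (?P \<times> UNIV) q) \<in> borel_measurable borel"
      using md mb by measurable
    from nn_integral_lborel_swap[OF this] show ?thesis by (simp add: indicator_times)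
  qed
  also have "\<dots> \<le> (\<integral>\<^sup>+v. (ennreal (2 * C) * ?E + ennreal (M * I)) * indicator ?P v \<partial>lborel)"
  proof (rule nn_integral_mono)
    fix v :: "(real^'m) \<times> (real^'k)"
    show "(\<integral>\<^sup>+x. ?W v x \<partial>lborel) \<le> (ennreal (2 * C) * ?E + ennreal (M * I)) * indicator ?P v"
    proof (cases "v \<in> ?P")
      case True
      obtain h s where v: "v = (h, s)" by (cases v)
      have hs: "h \<in> cbox (vec a) (vec (a + \<delta>))" "s \<in> cbox 0 (vec \<delta>)" using True unfolding v by (auto simp: cbox_Pair_eq)
      have "(\<integral>\<^sup>+x. ?W v x \<partial>lborel) = ennreal 2 * (\<integral>\<^sup>+x. ennreal (?d v x) \<partial>lborel) + ennreal M * (\<integral>\<^sup>+x. ennreal (?b v x) \<partial>lborel)"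
        using True mbx[of v] mdx[of v] by (simp add: nn_integral_add nn_integral_cmult)
      also have "\<dots> \<le> ennreal 2 * (ennreal C * ?E) + ennreal M * ennreal I"
      proof (intro add_mono mult_left_mono)
        show "(\<integral>\<^sup>+x. ennreal (?d v x) \<partial>lborel) \<le> ennreal C * ?E" unfolding C_def
        proof (rule transl_estimate[OF \<alpha> G D])
          show "\<bar>fst v $ i\<bar> \<le> 2 * \<delta>" for i using hs(1) a unfolding v mem_box_cart by (auto dest!: spec[of _ i])
          show "\<bar>snd v $ j\<bar> \<le> \<delta>" for j using hs(2) unfolding v mem_box_cart by (auto dest!: spec[of _ j])
        qed
        let ?g = "\<lambda>y. ennreal (\<bar>G y\<bar> powr p)"
        have "?g \<in> borel_measurable borel"
          using p by (intro measurable_compose[OF _ measurable_ennreal] borel_measurable_continuous_onI continuous_on_powr' continuous_intros G) auto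
        moreover have "(\<lambda>z. (norm (z + h) powr \<alpha>) *\<^sub>R s) \<in> borel_measurable borel"
          using \<alpha> by (intro borel_measurable_continuous_onI continuous_intros continuous_on_powr') auto
        ultimately have "(\<integral>\<^sup>+x. ennreal (?b v x) \<partial>lborel) = (\<integral>\<^sup>+y. ?g y \<partial>lborel)"
          unfolding transl_def v fst_conv snd_conv by (rule nn_integral_shear)
        then show "(\<integral>\<^sup>+x. ennreal (?b v x) \<partial>lborel) \<le> ennreal I" using I by simp
      qed auto
      also have "\<dots> = ennreal (2 * C) * ?E + ennreal (M * I)"
        using C M I(2) by (simp add: ennreal_mult mult.assoc)
      finally show ?thesis using True by simp
    qed simp
  qed
  also have "\<dots> = (ennreal (2 * C) * ?E + ennreal (M * I)) * ennreal V" by (simp add: nn_integral_cmult_indicator eP)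
  finally have "ennreal (V / 2) * (\<integral>\<^sup>+x. ennreal ((G x)\<^sup>2) * indicator H (fst x) \<partial>lborel) \<le> (ennreal (2 * C) * ?E + ennreal (M * I)) * ennreal V" .
  from mult_left_mono[OF this, of "ennreal (2 / V)"]
  have "ennreal (2 / V) * ennreal (V / 2) * (\<integral>\<^sup>+x. ennreal ((G x)\<^sup>2) * indicator H (fst x) \<partial>lborel) \<le> ennreal (2 / V) * ennreal V * (ennreal (2 * C) * ?E + ennreal (M * I))"
    by (simp add: mult_ac)
  also have "ennreal (2 / V) * ennreal (V / 2) = 1" using V by (simp add: ennreal_mult'[symmetric])
  also have "ennreal (2 / V) * ennreal V = ennreal 2" using V by (subst ennreal_mult'[symmetric]) auto
  also have "ennreal 2 * (ennreal (2 * C) * ?E + ennreal (M * I)) = ennreal (4 * C) * ?E + ennreal (2 * M * I)"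
  proof -
    have "ennreal 2 * ennreal (2 * C) = ennreal (4 * C)" "ennreal 2 * ennreal (M * I) = ennreal (2 * M * I)"
      using C M I(2) by (simp_all only: ennreal_mult'[symmetric] zero_le_numeral) (simp_all add: mult.assoc)
    then show ?thesis by (simp only: distrib_left mult.assoc[symmetric])
  qed
  also have "4 * C = 32 * 2 ^ (CARD('m) + CARD('k)) * \<delta>\<^sup>2" by (simp add: C_def)
  also have "2 * M * I = 4 * (2 * \<delta> powr (- (real CARD('m) + real CARD('k) + \<alpha> * real CARD('k)))) powr (2 / p - 1) * I powr (2 / p)"
  proof -
    have "I powr (2 / p) = I powr (2 / p - 1) * I powr 1" by (simp only: powr_add[symmetric]) simp
    then show ?thesis using I(2) by (simp add: M_def L_def powr_mult)
  qed
  finally show ?thesis by simp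
qed

text \<open>The space is split by the sign of one z-coordinate. On each half the cube of shifts is
  placed on the same side, at distance \<delta> from 0 (a = \<delta>, respectively a = -2 \<delta>),
  so that the shifted point always satisfies |z + h| \<ge> \<delta>.\<close>

theorem nash:
  fixes G :: "(real^'m::finite) \<times> (real^'k::finite) \<Rightarrow> real"
  assumes \<alpha>: "\<alpha> > 0" and G: "continuous_on UNIV G" and D: "\<And>b. b \<in> Basis \<Longrightarrow> pd b G (G1 b)" "\<And>b. b \<in> Basis \<Longrightarrow> continuous_on UNIV (G1 b)"
    and \<delta>: "\<delta> > 0" and p: "0 < p" "p < 2" and I: "(\<integral>\<^sup>+x. ennreal (\<bar>G x\<bar> powr p) \<partial>lborel) \<le> ennreal I" "I > 0"
  shows "(\<integral>\<^sup>+x. ennreal ((G x)\<^sup>2) \<partial>lborel)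
    \<le> ennreal (64 * 2 ^ (CARD('m) + CARD('k)) * \<delta>\<^sup>2) * (\<integral>\<^sup>+x. ennreal (gradsq \<alpha> G1 x) \<partial>lborel)
     + ennreal (8 * (2 * \<delta> powr (- (real CARD('m) + real CARD('k) + \<alpha> * real CARD('k)))) powr (2 / p - 1) * I powr (2 / p))"
proof -
  define i0 :: 'm where "i0 = undefined"
  let ?E = "\<integral>\<^sup>+x. ennreal (gradsq \<alpha> G1 x) \<partial>lborel"
  let ?X = "4 * (2 * \<delta> powr (- (real CARD('m) + real CARD('k) + \<alpha> * real CARD('k)))) powr (2 / p - 1) * I powr (2 / p)"
  let ?C = "32 * 2 ^ (CARD('m) + CARD('k)) * \<delta>\<^sup>2"
  let ?H1 = "{z::real^'m. 0 \<le> z $ i0}" and ?H2 = "{z::real^'m. z $ i0 \<le> 0}"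
  have 1: "(\<integral>\<^sup>+x. ennreal ((G x)\<^sup>2) * indicator ?H1 (fst x) \<partial>lborel) \<le> ennreal ?C * ?E + ennreal ?X"
  proof (rule nash_half[OF \<alpha> G D \<delta> p I, where a=\<delta>])
    show "closed ?H1" by (intro closed_Collect_le continuous_intros)
    show "norm (z + h) \<ge> \<delta>" if "z \<in> ?H1" "h \<in> cbox (vec \<delta>) (vec (\<delta> + \<delta>))" for z h
      using that component_le_norm_cart[of "z + h" i0] \<delta> by (auto simp: mem_box_cart dest!: spec[of _ i0])
  qed (use \<delta> in auto)
  have 2: "(\<integral>\<^sup>+x. ennreal ((G x)\<^sup>2) * indicator ?H2 (fst x) \<partial>lborel) \<le> ennreal ?C * ?E + ennreal ?X"
  proof (rule nash_half[OF \<alpha> G D \<delta> p I, where a="- 2 * \<delta>"])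
    show "closed ?H2" by (intro closed_Collect_le continuous_intros)
    show "norm (z + h) \<ge> \<delta>" if "z \<in> ?H2" "h \<in> cbox (vec (- 2 * \<delta>)) (vec (- 2 * \<delta> + \<delta>))" for z h
      using that component_le_norm_cart[of "z + h" i0] \<delta> by (auto simp: mem_box_cart dest!: spec[of _ i0])
  qed (use \<delta> in auto)
  have m: "(\<lambda>x. ennreal ((G x)\<^sup>2) * indicator H (fst x)) \<in> borel_measurable lborel" if "closed H" for H :: "(real^'m) set"
  proof -
    have "(\<lambda>x::(real^'m) \<times> (real^'k). indicator (H \<times> UNIV) x :: ennreal) \<in> borel_measurable borel"
      by (rule borel_measurable_indicator) (intro borel_closed closed_Times that closed_UNIV)
    moreover have "(\<lambda>x. ennreal ((G x)\<^sup>2)) \<in> borel_measurable borel"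
      by (intro measurable_compose[OF _ measurable_ennreal] borel_measurable_continuous_onI continuous_intros G)
    ultimately have "(\<lambda>x. ennreal ((G x)\<^sup>2) * indicator (H \<times> UNIV) x) \<in> borel_measurable lborel" by measurable
    moreover have "indicator (H \<times> UNIV) x = (indicator H (fst x) :: ennreal)" for x :: "(real^'m) \<times> (real^'k)"
      by (cases x) (simp add: indicator_times)
    ultimately show ?thesis by simp
  qed
  have cl: "closed ?H1" "closed ?H2" by (intro closed_Collect_le continuous_intros)+
  have "(\<integral>\<^sup>+x. ennreal ((G x)\<^sup>2) \<partial>lborel) \<le> (\<integral>\<^sup>+x. ennreal ((G x)\<^sup>2) * indicator ?H1 (fst x) + ennreal ((G x)\<^sup>2) * indicator ?H2 (fst x) \<partial>lborel)"
    by (rule nn_integral_mono) (auto simp: indicator_def)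
  also have "\<dots> = (\<integral>\<^sup>+x. ennreal ((G x)\<^sup>2) * indicator ?H1 (fst x) \<partial>lborel) + (\<integral>\<^sup>+x. ennreal ((G x)\<^sup>2) * indicator ?H2 (fst x) \<partial>lborel)"
    by (rule nn_integral_add[OF m[OF cl(1)] m[OF cl(2)]])
  also have "\<dots> \<le> (ennreal ?C * ?E + ennreal ?X) + (ennreal ?C * ?E + ennreal ?X)" by (rule add_mono[OF 1 2])
  also have "\<dots> = ennreal (?C + ?C) * ?E + ennreal (?X + ?X)"
    by (subst (1 2) ennreal_plus) (auto simp: algebra_simps)
  finally show ?thesis by (simp only: mult_2[symmetric]) (simp add: mult.assoc)
qed

section \<open>The Nash inequality for a solution times a radial cutoff\<close>

context solution_cutoff
begin

text \<open>The inequality is applied to the cutoff times the approximating functions, and the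
  gradient is eliminated by testing the equation with the squared cutoff times F_n. The strict bound
  on the p-th power integral survives approximation for large n.\<close>

lemma nash_cutoff:
  assumes \<delta>: "\<delta> > 0" and p: "0 < p" "p < 2" and I: "(LINT x|lborel. \<bar>h (tau \<alpha> x) * f x\<bar> powr p) < I"
  shows "(LINT x|lborel. (h (tau \<alpha> x) * f x)\<^sup>2)
    \<le> 64 * 2 ^ (CARD('m) + CARD('k)) * \<delta>\<^sup>2 * (LINT x|lborel. (f x)\<^sup>2 * grad_inner \<alpha> hgrad hgrad x + \<kappa>\<^sup>2 * (h (tau \<alpha> x) * f x)\<^sup>2)
     + 8 * (2 * \<delta> powr (- (real CARD('m) + real CARD('k) + \<alpha> * real CARD('k)))) powr (2 / p - 1) * I powr (2 / p)"
proof -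
  obtain F F1 F2 where F: "\<And>n. C2 (F n) (F1 n) (F2 n)"
    "uniform_limit KK F f sequentially"
    "uniform_limit KK (\<lambda>n x. Bop \<alpha> (F2 n) x + \<kappa>\<^sup>2 * F n x) (\<lambda>x. 0) sequentially"
    using approx_sequence[OF KK_compact sub] by blast
  note F' = C2_D[OF F(1)]
  let ?k = "\<lambda>x::(real^'m) \<times> (real^'k). h (tau \<alpha> x)"
  define S where "S = grad_inner \<alpha> (hgrad :: (real^'m) \<times> (real^'k) \<Rightarrow> (real^'m) \<times> (real^'k) \<Rightarrow> real) hgrad"
  define A where "A = 64 * 2 ^ (CARD('m) + CARD('k)) * \<delta>\<^sup>2"
  define B where "B = 8 * (2 * \<delta> powr (- (real CARD('m) + real CARD('k) + \<alpha> * real CARD('k)))) powr (2 / p - 1) * I powr (2 / p)"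
  have A: "A \<ge> 0" and B: "B \<ge> 0" by (auto simp: A_def B_def)
  have I0: "I > 0"
  proof -
    have "0 \<le> (LINT x|lborel. \<bar>?k x * f x\<bar> powr p)" by (rule integral_nonneg_AE) simp
    then show ?thesis using I by linarith
  qed
  have cS: "continuous_on X S" for X
    unfolding S_def grad_inner_def by (intro continuous_intros cont_hgrad continuous_gweight \<alpha>)
  have zS: "S x = 0" if "x \<notin> KK" for x
    using H_zero(2)[OF that] by (simp add: S_def grad_inner_hgrad)
  let ?G = "\<lambda>n x. ?k x * F n x"
  let ?G1 = "\<lambda>n b x. hgrad b x * F n x + ?k x * F1 n b x"
  have pG: "pd b (?G n) (?G1 n b)" if "b \<in> Basis" for n b
    by (rule pd_mult[OF pd_h F'(2)]) (use that in auto)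
  have cG: "continuous_on UNIV (?G n)" for n by (intro continuous_intros cont_h F')
  have cG1: "continuous_on UNIV (?G1 n b)" if "b \<in> Basis" for n b
    using that by (intro continuous_intros cont_h cont_hgrad F')
  let ?r = "\<lambda>n x. Bop \<alpha> (F2 n) x + \<kappa>\<^sup>2 * F n x"
  let ?E = "\<lambda>n x. (F n x * F n x) * S x + \<kappa>\<^sup>2 * (?G n x * ?G n x) - (?G n x * ?k x) * ?r n x"
  \<comment> \<open>The identity |\<nabla>(k F)|^2 = F^2 |\<nabla>k|^2 + \<nabla>(k^2 F) \<cdot>
    \<nabla>F for horizontal gradients; the last term is integrated with the weak form of the
    equation.\<close>
  have grad_eq: "gradsq \<alpha> (?G1 n) x = ?E n x + (grad_inner \<alpha> (\<lambda>b x. ?G1 n b x * ?k x + ?G n x * hgrad b x) (F1 n) x + ?G n x * ?k x * Bop \<alpha> (F2 n) x)" for n x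
  proof -
    have sym: "grad_inner \<alpha> u v x = grad_inner \<alpha> v u x" for u v :: "(real^'m) \<times> (real^'k) \<Rightarrow> (real^'m) \<times> (real^'k) \<Rightarrow> real"
      by (simp add: grad_inner_def mult.commute)
    have "gradsq \<alpha> (?G1 n) x = grad_inner \<alpha> hgrad (?G1 n) x * F n x + ?k x * grad_inner \<alpha> (F1 n) (?G1 n) x"
      unfolding grad_inner_self[symmetric] grad_inner_mult ..
    also have "\<dots> = (S x * F n x + ?k x * grad_inner \<alpha> (F1 n) hgrad x) * F n x + ?k x * (grad_inner \<alpha> hgrad (F1 n) x * F n x + ?k x * grad_inner \<alpha> (F1 n) (F1 n) x)"
      unfolding sym[of hgrad "?G1 n"] sym[of "F1 n" "?G1 n"] grad_inner_mult S_def ..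
    finally show ?thesis unfolding grad_inner_mult sym[of "F1 n" hgrad] by (simp add: algebra_simps)
  qed
  have wf: "integrable lborel (\<lambda>x. grad_inner \<alpha> (\<lambda>b x. ?G1 n b x * ?k x + ?G n x * hgrad b x) (F1 n) x + ?G n x * ?k x * Bop \<alpha> (F2 n) x)"
    "(LINT x|lborel. grad_inner \<alpha> (\<lambda>b x. ?G1 n b x * ?k x + ?G n x * hgrad b x) (F1 n) x + ?G n x * ?k x * Bop \<alpha> (F2 n) x) = 0" for n
  proof -
    have u: "continuous_on UNIV (\<lambda>x. ?G n x * ?k x)" "\<And>b. b \<in> Basis \<Longrightarrow> pd b (\<lambda>x. ?G n x * ?k x) (\<lambda>x. ?G1 n b x * ?k x + ?G n x * hgrad b x)"
      "\<And>b. b \<in> Basis \<Longrightarrow> continuous_on UNIV (\<lambda>x. ?G1 n b x * ?k x + ?G n x * hgrad b x)"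
      "\<And>x. x \<notin> KK \<Longrightarrow> ?G n x * ?k x = 0"
      using H_zero by (auto intro!: continuous_on_mult continuous_on_add cont_h cont_hgrad cG cG1 pd_mult[OF pG pd_h] F')
    show "integrable lborel (\<lambda>x. grad_inner \<alpha> (\<lambda>b x. ?G1 n b x * ?k x + ?G n x * hgrad b x) (F1 n) x + ?G n x * ?k x * Bop \<alpha> (F2 n) x)"
      by (rule weak_form(1)[OF \<alpha> F(1) u(1-3) KK_compact u(4)])
    show "(LINT x|lborel. grad_inner \<alpha> (\<lambda>b x. ?G1 n b x * ?k x + ?G n x * hgrad b x) (F1 n) x + ?G n x * ?k x * Bop \<alpha> (F2 n) x) = 0"
      by (rule weak_form(2)[OF \<alpha> F(1) u(1-3) KK_compact u(4)])
  qed
  have cE: "continuous_on KK (?E n)" for n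
    by (intro continuous_intros cont_h cS continuous_C2_ops[OF F(1) \<alpha>])
  have zE: "?E n x = 0" if "x \<notin> KK" for n x using H_zero[OF that] zS[OF that] by simp
  have intE: "integrable lborel (?E n)" for n by (rule integrable_on_compact_support[OF KK_compact cE zE])
  have grad: "integrable lborel (gradsq \<alpha> (?G1 n))" "(LINT x|lborel. gradsq \<alpha> (?G1 n) x) = (LINT x|lborel. ?E n x)" for n
  proof -
    have eq: "gradsq \<alpha> (?G1 n) = (\<lambda>x. ?E n x + (grad_inner \<alpha> (\<lambda>b x. ?G1 n b x * ?k x + ?G n x * hgrad b x) (F1 n) x + ?G n x * ?k x * Bop \<alpha> (F2 n) x))"
      using grad_eq by blast
    show "integrable lborel (gradsq \<alpha> (?G1 n))" unfolding eq by (rule Bochner_Integration.integrable_add[OF intE wf(1)])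
    show "(LINT x|lborel. gradsq \<alpha> (?G1 n) x) = (LINT x|lborel. ?E n x)"
      unfolding eq Bochner_Integration.integral_add[OF intE wf(1)] wf(2) by simp
  qed
  have cP: "continuous_on KK (\<lambda>x. \<bar>?G n x\<bar> powr p)" for n
    using p by (intro continuous_on_powr' continuous_intros cont_h continuous_C2_ops[OF F(1) \<alpha>]) auto
  have zP: "\<bar>?G n x\<bar> powr p = 0" if "x \<notin> KK" for n x using H_zero[OF that] by simp
  have intP: "integrable lborel (\<lambda>x. \<bar>?G n x\<bar> powr p)" for n by (rule integrable_on_compact_support[OF KK_compact cP zP])
  have intQ: "integrable lborel (\<lambda>x. (?G n x)\<^sup>2)" for n
    by (rule integrable_on_compact_support[OF KK_compact]) (auto intro!: continuous_intros cont_h continuous_C2_ops[OF F(1) \<alpha>] simp: H_zero)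
  have nash_n: "(LINT x|lborel. (?G n x)\<^sup>2) \<le> A * (LINT x|lborel. ?E n x) + B" if "(LINT x|lborel. \<bar>?G n x\<bar> powr p) \<le> I" for n
  proof -
    have "(\<integral>\<^sup>+x. ennreal (\<bar>?G n x\<bar> powr p) \<partial>lborel) \<le> ennreal I"
      using that by (simp add: nn_integral_eq_integral[OF intP] ennreal_leI)
    from nash[OF \<alpha> cG pG cG1 \<delta> p this I0]
    have "(\<integral>\<^sup>+x. ennreal ((?G n x)\<^sup>2) \<partial>lborel) \<le> ennreal A * (\<integral>\<^sup>+x. ennreal (gradsq \<alpha> (?G1 n) x) \<partial>lborel) + ennreal B"
      unfolding A_def B_def by blast
    moreover have g0: "gradsq \<alpha> (?G1 n) x \<ge> 0" for x by (simp add: gradsq_def sum_nonneg)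
    ultimately have "ennreal (LINT x|lborel. (?G n x)\<^sup>2) \<le> ennreal A * ennreal (LINT x|lborel. ?E n x) + ennreal B"
      by (simp add: nn_integral_eq_integral[OF intQ] nn_integral_eq_integral[OF grad(1)] grad(2))
    also have "\<dots> = ennreal (A * (LINT x|lborel. ?E n x) + B)"
    proof -
      have "0 \<le> (LINT x|lborel. ?E n x)" unfolding grad(2)[symmetric] by (rule integral_nonneg_AE) (simp add: g0)
      then show ?thesis using A B by (simp add: ennreal_mult)
    qed
    finally show ?thesis
      using A B integral_nonneg_AE[of "gradsq \<alpha> (?G1 n)" lborel] g0 by (subst (asm) ennreal_le_iff) (auto simp: grad(2))
  qed
  have uG: "uniform_limit KK ?G (\<lambda>x. ?k x * f x) sequentially"
    by (intro uniform_limit_KK_cmult F cont_h continuous_on_KK)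
  have "(\<lambda>n. LINT x|lborel. \<bar>?G n x\<bar> powr p) \<longlonglongrightarrow> (LINT x|lborel. \<bar>?k x * f x\<bar> powr p)"
  proof (rule integral_uniform_limit[OF KK_compact _ cP zP])
    have "continuous_on KK (\<lambda>x. ?k x * f x)" by (intro continuous_on_mult cont_h continuous_on_KK)
    from bdd[OF this] obtain M where M: "\<And>x. x \<in> KK \<Longrightarrow> \<bar>?k x * f x\<bar> \<le> M" unfolding bounded_iff by auto
    show "uniform_limit KK (\<lambda>n x. \<bar>?G n x\<bar> powr p) (\<lambda>x. \<bar>?k x * f x\<bar> powr p) sequentially"
    proof (rule uniform_limit_compose_uniformly_continuous_on[OF uG, where B="{- M - 1..M + 1}"])
      show "uniformly_continuous_on {- M - 1..M + 1} (\<lambda>t. \<bar>t\<bar> powr p)"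
        using p by (intro compact_uniformly_continuous continuous_on_powr' continuous_intros) auto
      show "\<forall>\<^sub>F n in sequentially. \<forall>x\<in>KK. ?G n x \<in> {- M - 1..M + 1}"
        using uniform_limitD[OF uG zero_less_one]
      proof eventually_elim
        case (elim n)
        show ?case
        proof
          fix x assume x: "x \<in> KK"
          show "?G n x \<in> {- M - 1..M + 1}" using elim[rule_format, OF x] M[OF x] unfolding dist_real_def by (simp add: abs_le_iff abs_less_iff)
        qed
      qed
    qed simp
    show "\<bar>?k x * f x\<bar> powr p = 0" if "x \<notin> KK" for x using H_zero(1)[OF that] by simp
  qed
  then have ev: "\<forall>\<^sub>F n in sequentially. (LINT x|lborel. \<bar>?G n x\<bar> powr p) < I" by (rule order_tendstoD) (rule I)
  have ckf: "continuous_on KK (\<lambda>x. ?k x * f x)" by (intro continuous_on_mult cont_h continuous_on_KK)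
  have 1: "(\<lambda>n. LINT x|lborel. (?G n x)\<^sup>2) \<longlonglongrightarrow> (LINT x|lborel. (?k x * f x)\<^sup>2)"
    unfolding power2_eq_square
    by (rule integral_uniform_limit[OF KK_compact]) (auto intro!: uniform_limit_KK_mult uG ckf continuous_on_mult cont_h continuous_C2_ops[OF F(1) \<alpha>] simp: H_zero)
  have 2: "(\<lambda>n. LINT x|lborel. ?E n x) \<longlonglongrightarrow> (LINT x|lborel. (f x * f x) * S x + \<kappa>\<^sup>2 * ((?k x * f x) * (?k x * f x)) - ((?k x * f x) * ?k x) * 0)"
  proof (rule integral_uniform_limit[OF KK_compact _ cE zE])
    have uS: "uniform_limit KK (\<lambda>n. S) S sequentially" by (rule uniform_limit_const)
    have uk: "uniform_limit KK (\<lambda>n. ?k) ?k sequentially" by (rule uniform_limit_const)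
    show "uniform_limit KK ?E (\<lambda>x. (f x * f x) * S x + \<kappa>\<^sup>2 * ((?k x * f x) * (?k x * f x)) - ((?k x * f x) * ?k x) * 0) sequentially"
      by (intro uniform_limit_minus uniform_limit_add uniform_limit_KK_mult F uG uS uk cS continuous_on_KK ckf uniform_limit_KK_cmult continuous_on_const continuous_on_mult cont_h)
    show "(f x * f x) * S x + \<kappa>\<^sup>2 * ((?k x * f x) * (?k x * f x)) - ((?k x * f x) * ?k x) * 0 = 0" if "x \<notin> KK" for x
      using H_zero(1)[OF that] zS[OF that] by simp
  qed
  have "(LINT x|lborel. (?k x * f x)\<^sup>2) \<le> A * (LINT x|lborel. (f x * f x) * S x + \<kappa>\<^sup>2 * ((?k x * f x) * (?k x * f x)) - ((?k x * f x) * ?k x) * 0) + B"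
  proof (rule tendsto_le[OF sequentially_bot tendsto_add[OF tendsto_mult[OF tendsto_const 2] tendsto_const] 1])
    show "\<forall>\<^sub>F n in sequentially. (LINT x|lborel. (?G n x)\<^sup>2) \<le> A * (LINT x|lborel. ?E n x) + B"
      using ev by eventually_elim (rule nash_n, simp)
  qed
  then show ?thesis by (simp add: A_def B_def S_def power2_eq_square)
qed

end

context grushin_exterior
begin

text \<open>For a radial cutoff the squared gradient times f^2 is (g')^2 times \<open>wn\<close>,
  and \<open>wn\<close> \<le> f^2.\<close>

lemma nash_radial:
  assumes g: "C1c R\<^sub>0 g g'" and \<delta>: "\<delta> > 0" and p: "0 < p" "p < 2" and I: "(LINT x|lborel. \<bar>g (rho x) * f x\<bar> powr p) < I"
  shows "J (\<lambda>r a b c d n. (g r)\<^sup>2 * b) \<le> 64 * 2 ^ (CARD('m) + CARD('k)) * \<delta>\<^sup>2 * (J (\<lambda>r a b c d n. (g' r)\<^sup>2 * b) + \<kappa>\<^sup>2 * J (\<lambda>r a b c d n. (g r)\<^sup>2 * b))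
     + 8 * (2 * \<delta> powr (- (real CARD('m) + real CARD('k) + \<alpha> * real CARD('k)))) powr (2 / p - 1) * I powr (2 / p)"
proof -
  obtain h h' T t0 where sc: "solution_cutoff \<alpha> \<kappa> {x. rho x > R\<^sub>0} f U V h h' T t0"
    and e: "\<forall>x. h (tau \<alpha> x) = g (rho x)" "\<forall>x. 2 * (\<alpha> + 1) * h' (tau \<alpha> x) = rho x * g' (rho x) / tau \<alpha> x"
    by (rule radial_solution_cutoff[OF g])
  note e1 = e(1)[rule_format] and e2 = e(2)[rule_format]
  interpret solution_cutoff \<alpha> \<kappa> "{x. rho x > R\<^sub>0}" f U V h h' T t0 by (rule sc)
  have "Cc R\<^sub>0 (\<lambda>r. (k r)\<^sup>2)" if "Cc R\<^sub>0 k" for k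
  proof -
    have "continuous_on {R\<^sub>0<..} k" using that unfolding Cc_def by (auto intro: continuous_on_subset)
    from Cc_mult[OF that this] show ?thesis by (simp add: power2_eq_square)
  qed
  note sq = this[OF C1c_Cc(1)[OF g]] this[OF C1c_Cc(2)[OF g]]
  have "(f x)\<^sup>2 * grad_inner \<alpha> hgrad hgrad x = (g' (rho x))\<^sup>2 * wn x" for x
  proof -
    have "grad_inner \<alpha> hgrad hgrad x = zpow (2 * \<alpha>) x * tau \<alpha> x * (2 * (\<alpha> + 1) * h' (tau \<alpha> x))\<^sup>2"
      unfolding grad_inner_hgrad dil_hgrad by (simp add: power2_eq_square)
    then show ?thesis unfolding e2 by (simp add: wn_def power2_eq_square)
  qed
  then have "(LINT x|lborel. (f x)\<^sup>2 * grad_inner \<alpha> hgrad hgrad x + \<kappa>\<^sup>2 * (h (tau \<alpha> x) * f x)\<^sup>2)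
    = J (\<lambda>r a b c d n. (g' r)\<^sup>2 * n + \<kappa>\<^sup>2 * ((g r)\<^sup>2 * b))"
    by (simp add: J_def ev_def e1 power_mult_distrib)
  also have "\<dots> \<le> J (\<lambda>r a b c d n. (g' r)\<^sup>2 * b + \<kappa>\<^sup>2 * ((g r)\<^sup>2 * b))"
    by (rule J_mono) (auto intro!: adm_add adm_cmult adm_basic sq mult_left_mono)
  also have "\<dots> = J (\<lambda>r a b c d n. (g' r)\<^sup>2 * b) + \<kappa>\<^sup>2 * J (\<lambda>r a b c d n. (g r)\<^sup>2 * b)"
    by (subst J_add) (auto intro!: adm_cmult adm_basic sq simp: J_cmult)
  finally have E: "(LINT x|lborel. (f x)\<^sup>2 * grad_inner \<alpha> hgrad hgrad x + \<kappa>\<^sup>2 * (h (tau \<alpha> x) * f x)\<^sup>2)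
    \<le> J (\<lambda>r a b c d n. (g' r)\<^sup>2 * b) + \<kappa>\<^sup>2 * J (\<lambda>r a b c d n. (g r)\<^sup>2 * b)" .
  have "J (\<lambda>r a b c d n. (g r)\<^sup>2 * b) = (LINT x|lborel. (h (tau \<alpha> x) * f x)\<^sup>2)"
    by (simp add: J_def ev_def e1 power_mult_distrib)
  also have "\<dots> \<le> 64 * 2 ^ (CARD('m) + CARD('k)) * \<delta>\<^sup>2 * (LINT x|lborel. (f x)\<^sup>2 * grad_inner \<alpha> hgrad hgrad x + \<kappa>\<^sup>2 * (h (tau \<alpha> x) * f x)\<^sup>2)
     + 8 * (2 * \<delta> powr (- (real CARD('m) + real CARD('k) + \<alpha> * real CARD('k)))) powr (2 / p - 1) * I powr (2 / p)"
    by (rule nash_cutoff[OF \<delta> p]) (use I in \<open>simp add: e1\<close>)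
  also have "\<dots> \<le> 64 * 2 ^ (CARD('m) + CARD('k)) * \<delta>\<^sup>2 * (J (\<lambda>r a b c d n. (g' r)\<^sup>2 * b) + \<kappa>\<^sup>2 * J (\<lambda>r a b c d n. (g r)\<^sup>2 * b))
     + 8 * (2 * \<delta> powr (- (real CARD('m) + real CARD('k) + \<alpha> * real CARD('k)))) powr (2 / p - 1) * I powr (2 / p)"
    by (intro add_right_mono mult_left_mono E) simp
  finally show ?thesis .
qed

end

section \<open>Slow growth from integrability\<close>

definition ramp :: "real \<Rightarrow> real" where "ramp u = 1 - (max 0 (1 - (max 0 u)\<^sup>2))\<^sup>2"

definition ramp' :: "real \<Rightarrow> real" where "ramp' u = 4 * max 0 u * max 0 (1 - (max 0 u)\<^sup>2)"

lemma ramp_props: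
  shows "0 \<le> ramp u" "ramp u \<le> 1" "u \<le> 0 \<Longrightarrow> ramp u = 0" "u \<ge> 1 \<Longrightarrow> ramp u = 1" "\<bar>ramp' u\<bar> \<le> 4"
    "(ramp has_real_derivative ramp' u) (at u)" "continuous_on S ramp'"
proof -
  have "(max 0 (1 - (max 0 u)\<^sup>2))\<^sup>2 \<le> 1\<^sup>2" by (rule power_mono) auto
  then show "0 \<le> ramp u" by (simp add: ramp_def)
  show "ramp u \<le> 1" "u \<le> 0 \<Longrightarrow> ramp u = 0" by (auto simp: ramp_def)
  have m0: "max 0 (1 - (max 0 u)\<^sup>2) = 0" if "u \<ge> 1"
  proof -
    have "1 \<le> u\<^sup>2" by (rule one_le_power[OF that])
    then have "max 0 (1 - u\<^sup>2) = 0" by (intro max_absorb1) linarith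
    moreover have "max 0 u = u" using that by simp
    ultimately show ?thesis by simp
  qed
  then show "u \<ge> 1 \<Longrightarrow> ramp u = 1" by (simp add: ramp_def)
  show "\<bar>ramp' u\<bar> \<le> 4"
  proof (cases "u \<ge> 1")
    case False
    then have "max 0 u * max 0 (1 - (max 0 u)\<^sup>2) \<le> 1 * 1" by (intro mult_mono) auto
    then show ?thesis by (simp add: ramp'_def abs_mult)
  qed (simp add: ramp'_def m0)
  show "(ramp has_real_derivative ramp' u) (at u)"
  proof -
    have "((\<lambda>u. 1 - (max 0 u)\<^sup>2) has_real_derivative - (2 * max 0 u)) (at u)"
      using DERIV_diff[OF DERIV_const[of 1] max_sq_DERIV[of u]] by simp
    from DERIV_chain2[OF max_sq_DERIV this]
    have "((\<lambda>u. (max 0 (1 - (max 0 u)\<^sup>2))\<^sup>2) has_real_derivative 2 * max 0 (1 - (max 0 u)\<^sup>2) * - (2 * max 0 u)) (at u)" .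
    from DERIV_diff[OF DERIV_const[of 1] this] show ?thesis
      unfolding ramp_def[abs_def] ramp'_def by (simp add: algebra_simps)
  qed
  show "continuous_on S ramp'" unfolding ramp'_def[abs_def] by (intro continuous_intros)
qed

definition plateau :: "real \<Rightarrow> real \<Rightarrow> real \<Rightarrow> real \<Rightarrow> real" where
  "plateau e l u r = ramp ((r - l) / e) * ramp ((u - r) / e)"

definition plateau' :: "real \<Rightarrow> real \<Rightarrow> real \<Rightarrow> real \<Rightarrow> real" where
  "plateau' e l u r = (ramp' ((r - l) / e) / e) * ramp ((u - r) / e) - ramp ((r - l) / e) * (ramp' ((u - r) / e) / e)"

lemma plateau_props:
  assumes e: "e > 0"
  shows "0 \<le> plateau e l u r" "plateau e l u r \<le> 1" "r \<notin> {l..u} \<Longrightarrow> plateau e l u r = 0"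
    "r \<in> {l + e..u - e} \<Longrightarrow> plateau e l u r = 1" "\<bar>plateau' e l u r\<bar> \<le> 8 / e" "R < l \<Longrightarrow> C1c R (plateau e l u) (plateau' e l u)"
proof -
  show "0 \<le> plateau e l u r" "plateau e l u r \<le> 1"
    unfolding plateau_def using ramp_props(1,2) by (auto intro: mult_le_one)
  have 0: "r \<notin> {l..u} \<Longrightarrow> plateau e l u r = 0" for r
    unfolding plateau_def using e by (auto simp: not_le ramp_props(3) divide_nonpos_pos)
  then show "r \<notin> {l..u} \<Longrightarrow> plateau e l u r = 0" .
  show "r \<in> {l + e..u - e} \<Longrightarrow> plateau e l u r = 1"
    unfolding plateau_def using e by (simp add: ramp_props(4))
  have b: "\<bar>(ramp' s / e) * ramp t\<bar> \<le> 4 / e" for s t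
  proof -
    have "\<bar>ramp' s\<bar> * \<bar>ramp t\<bar> \<le> 4 * 1" using ramp_props(1,2)[of t] by (intro mult_mono ramp_props) auto
    then show ?thesis using e by (simp add: abs_mult divide_right_mono)
  qed
  show "\<bar>plateau' e l u r\<bar> \<le> 8 / e"
  proof -
    have "\<bar>plateau' e l u r\<bar> \<le> \<bar>(ramp' ((r - l) / e) / e) * ramp ((u - r) / e)\<bar> + \<bar>(ramp' ((u - r) / e) / e) * ramp ((r - l) / e)\<bar>"
      unfolding plateau'_def mult.commute[of "ramp ((r - l) / e)"] by (rule abs_triangle_ineq4)
    also have "\<dots> \<le> 4 / e + 4 / e" by (intro add_mono b)
    finally show ?thesis by simp
  qed
  show "C1c R (plateau e l u) (plateau' e l u)" if R: "R < l"
    unfolding C1c_def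
  proof (intro conjI allI exI)
    fix r
    have "((\<lambda>r. (r - l) / e) has_real_derivative 1 / e) (at r)" using e by (auto intro!: derivative_eq_intros)
    note 1 = DERIV_chain2[OF ramp_props(6) this]
    have "((\<lambda>r. (u - r) / e) has_real_derivative - 1 / e) (at r)" using e by (auto intro!: derivative_eq_intros)
    note 2 = DERIV_chain2[OF ramp_props(6) this]
    from DERIV_mult[OF 1 2] show "(plateau e l u has_real_derivative plateau' e l u r) (at r)"
      unfolding plateau_def[abs_def] plateau'_def by (simp add: algebra_simps)
  next
    have c: "continuous_on UNIV ramp" using DERIV_continuous_on[OF has_field_derivative_at_within[OF ramp_props(6)]] .
    show "continuous_on UNIV (plateau' e l u)" unfolding plateau'_def[abs_def]
      by (intro continuous_intros continuous_on_compose2[OF c] continuous_on_compose2[OF ramp_props(7)[of UNIV]]) (use e in auto)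
    show "R < l" by (rule R)
    show "r \<notin> {l..u} \<longrightarrow> plateau e l u r = 0" for r using 0 by blast
  qed
qed

text \<open>Iteration produces a geometric series of ratio at most 1/2. The a priori bound K is
  multiplied by \<theta>^n and disappears from the conclusion.\<close>

lemma iterate_bound:
  fixes a :: "nat \<Rightarrow> real"
  assumes step: "\<And>j. a j \<le> \<theta> * a (Suc j) + D * M ^ j" and \<theta>: "0 \<le> \<theta>" "\<theta> < 1" "\<theta> * M \<le> 1 / 2" "M \<ge> 0" and D: "D \<ge> 0"
    and bound: "\<And>j. a j \<le> K"
  shows "a 0 \<le> 2 * D"
proof -
  have a_n: "a 0 \<le> \<theta> ^ n * a n + D * (\<Sum>j<n. (\<theta> * M) ^ j)" for n
  proof (induction n)
    case (Suc n)
    have "\<theta> ^ n * a n \<le> \<theta> ^ n * (\<theta> * a (Suc n) + D * M ^ n)" using \<theta> by (intro mult_left_mono step) auto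
    then show ?case using Suc by (simp add: algebra_simps power_mult_distrib)
  qed simp
  have s: "(\<Sum>j<n. (\<theta> * M) ^ j) \<le> 2" for n
  proof -
    have "(\<Sum>j<n. (\<theta> * M) ^ j) \<le> (\<Sum>j<n. (1 / 2) ^ j)" using \<theta> by (intro sum_mono power_mono) auto
    also have "\<dots> = 2 * (1 - (1 / 2) ^ n)" by (simp add: sum_gp_strict)
    also have "\<dots> \<le> 2" by simp
    finally show ?thesis .
  qed
  have "(\<lambda>n. \<theta> ^ n * K + D * 2) \<longlonglongrightarrow> 0 * K + D * 2" using \<theta> by (intro tendsto_intros LIMSEQ_power_zero) auto
  moreover have "a 0 \<le> \<theta> ^ n * K + D * 2" for n
    using a_n[of n] mult_left_mono[OF bound[of n], of "\<theta> ^ n"] mult_left_mono[OF s[of n] D] \<theta> by simp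
  ultimately show ?thesis using LIMSEQ_le_const[of "\<lambda>n. \<theta> ^ n * K + D * 2" "0 * K + D * 2" "a 0"] by (simp add: mult.commute)
qed

section \<open>Integrability exponents below 2\<close>

context grushin_exterior
begin

lemma Cc_power2: assumes "Cc R g" shows "Cc R (\<lambda>r. (g r)\<^sup>2)"
proof -
  have "continuous_on {R<..} g" using assms unfolding Cc_def by (auto intro: continuous_on_subset)
  from Cc_mult[OF assms this] show ?thesis by (simp add: power2_eq_square)
qed

lemma J_mono_b:
  assumes "Cc R\<^sub>0 g" "Cc R\<^sub>0 h" "\<And>r. g r \<le> h r"
  shows "J (\<lambda>r a b c d n. g r * b) \<le> J (\<lambda>r a b c d n. h r * b)"
  by (rule J_mono) (auto intro!: adm_basic assms mult_right_mono)

lemma radial_Lp_le: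
  assumes g: "Cc R\<^sub>0 g" "\<And>r. \<bar>g r\<bar> \<le> 1" and p: "p > 0" and I: "(\<integral>\<^sup>+x\<in>{x. rho x > R\<^sub>0}. ennreal (\<bar>f x\<bar> powr p) \<partial>lborel) \<le> ennreal I" "I \<ge> 0"
  shows "(LINT x|lborel. \<bar>g (rho x) * f x\<bar> powr p) \<le> I"
proof -
  obtain r1 r2 where r: "R\<^sub>0 < r1" "\<forall>r. r \<notin> {r1..r2} \<longrightarrow> g r = 0" and c: "continuous_on UNIV g"
    using g(1) unfolding Cc_def by blast
  have "Cc R\<^sub>0 (\<lambda>r. \<bar>g r\<bar> powr p)" unfolding Cc_def
  proof (intro conjI exI allI)
    show "continuous_on UNIV (\<lambda>r. \<bar>g r\<bar> powr p)" using p c by (intro continuous_on_powr' continuous_intros) auto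
    show "R\<^sub>0 < r1" by (rule r)
    show "r \<notin> {r1..r2} \<longrightarrow> \<bar>g r\<bar> powr p = 0" for r using r(2) p by auto
  qed
  moreover have "continuous_on {x. rho x > R\<^sub>0} (\<lambda>x. \<bar>f x\<bar> powr p)"
    using p by (intro continuous_on_powr' continuous_intros cf) auto
  ultimately have "integrable lborel (\<lambda>x. \<bar>g (rho x)\<bar> powr p * \<bar>f x\<bar> powr p)" by (rule radial_integrable)
  then have i: "integrable lborel (\<lambda>x. \<bar>g (rho x) * f x\<bar> powr p)" by (simp add: abs_mult powr_mult)
  have "ennreal (LINT x|lborel. \<bar>g (rho x) * f x\<bar> powr p) = (\<integral>\<^sup>+x. ennreal (\<bar>g (rho x) * f x\<bar> powr p) \<partial>lborel)"
    by (rule nn_integral_eq_integral[OF i, symmetric]) simp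
  also have "\<dots> \<le> (\<integral>\<^sup>+x\<in>{x. rho x > R\<^sub>0}. ennreal (\<bar>f x\<bar> powr p) \<partial>lborel)"
  proof (rule nn_integral_mono)
    fix x
    show "ennreal (\<bar>g (rho x) * f x\<bar> powr p) \<le> ennreal (\<bar>f x\<bar> powr p) * indicator {x. rho x > R\<^sub>0} x"
    proof (cases "rho x > R\<^sub>0")
      case True
      have "\<bar>g (rho x)\<bar> * \<bar>f x\<bar> \<le> 1 * \<bar>f x\<bar>" by (intro mult_right_mono g) auto
      then have "\<bar>g (rho x) * f x\<bar> powr p \<le> \<bar>f x\<bar> powr p" using p by (intro powr_mono2) (auto simp: abs_mult)
      then show ?thesis using True by (simp add: ennreal_leI)
    next
      case False
      then show ?thesis using Cc_zero[OF g(1)] p by simp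
    qed
  qed
  also have "\<dots> \<le> ennreal I" by (rule I)
  finally show ?thesis using I(2) by simp
qed

text \<open>On nested shells with gaps halving at each step the gradient of the cutoff costs a
  factor 4^j. Taking \<delta> = c/2^j in the Nash inequality cancels this factor, while its second
  term grows only geometrically, like M^j; \<open>iterate_bound\<close> then gives a bound
  independent of R.\<close>

lemma slow_growth_subquadratic:
  assumes p: "0 < p" "p < 2" and fin: "(\<integral>\<^sup>+x\<in>{x. rho x > R\<^sub>0}. ennreal (\<bar>f x\<bar> powr p) \<partial>lborel) < \<infinity>"
  shows slow_growth
proof -
  define N where "N = real CARD('m) + real CARD('k) + \<alpha> * real CARD('k)"
  have N: "N \<ge> 0" using \<alpha> by (simp add: N_def)
  define I0 where "I0 = enn2real (\<integral>\<^sup>+x\<in>{x. rho x > R\<^sub>0}. ennreal (\<bar>f x\<bar> powr p) \<partial>lborel)"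
  have I0: "(\<integral>\<^sup>+x\<in>{x. rho x > R\<^sub>0}. ennreal (\<bar>f x\<bar> powr p) \<partial>lborel) \<le> ennreal I0" "I0 \<ge> 0"
    using fin by (auto simp: I0_def)
  define C1 where "C1 = (64 * 2 ^ (CARD('m) + CARD('k)) :: real)"
  define \<gamma> where "\<gamma> = N * (2 / p - 1)"
  define M where "M = 2 powr \<gamma>"
  have \<gamma>: "\<gamma> \<ge> 0" unfolding \<gamma>_def using N p by (intro mult_nonneg_nonneg) auto
  have M: "M \<ge> 1" unfolding M_def using \<gamma> by (simp add: ge_one_powr_ge_zero)
  have C1: "C1 > 0" by (simp add: C1_def)
  define Y where "Y = C1 * (256 + \<kappa>\<^sup>2)"
  have Y: "Y > 0" unfolding Y_def using C1 by (simp add: add_pos_nonneg)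
  \<comment> \<open>Chosen so that Y c^2 = 1/(2M): this is the contraction factor \<theta> at every
    step, with \<theta> M = 1/2.\<close>
  define c where "c = sqrt (1 / (2 * M * Y))"
  have c: "c > 0" unfolding c_def using M Y by simp
  have c2: "c\<^sup>2 = 1 / (2 * M * Y)" unfolding c_def using M Y by (intro real_sqrt_pow2) simp
  define \<theta> where "\<theta> = 1 / (2 * M)"
  have \<theta>: "Y * c\<^sup>2 = \<theta>" "0 \<le> \<theta>" "\<theta> < 1" "\<theta> * M \<le> 1 / 2"
    using Y M by (auto simp: c2 \<theta>_def)
  define D where "D = 8 * 2 powr (2 / p - 1) * c powr (- \<gamma>) * (I0 + 1) powr (2 / p)"
  have D: "D \<ge> 0" by (simp add: D_def)
  have bound: "J (\<lambda>r a b c d n. h r * b) \<le> 2 * D"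
    if R: "R \<ge> R\<^sub>0 + 2" and h: "Cc R\<^sub>0 h" "\<And>r. h r \<le> 1" "\<And>r. r \<notin> {R..4*R} \<Longrightarrow> h r = 0" for R h
  proof -
    \<comment> \<open>The shells grow from [R, 4R] at j = 0 towards [R - 1, 4R + 1], and
      \<open>e j\<close> is the gap between consecutive ones: \<open>g j\<close> is 1 on the j-th
      shell and supported in the next, where \<open>g (Suc j)\<close> is 1.\<close>
    define e where "e = (\<lambda>j::nat. 1 / 2 ^ Suc j :: real)"
    define l where "l = (\<lambda>j::nat. R - 1 + 1 / 2 ^ j)"
    define u where "u = (\<lambda>j::nat. 4 * R + 1 - 1 / 2 ^ j)"
    define g where "g = (\<lambda>j. plateau (e j) (l (Suc j)) (u (Suc j)))"
    define g' where "g' = (\<lambda>j. plateau' (e j) (l (Suc j)) (u (Suc j)))"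
    have e: "e j > 0" for j by (simp add: e_def)
    have le: "l (Suc j) + e j = l j" "u (Suc j) - e j = u j" for j by (auto simp: l_def u_def e_def)
    have lR: "R\<^sub>0 < l j" "R - 1 \<le> l j" "u j \<le> 4 * R + 1" for j
    proof -
      have "1 / 2 ^ j > (0::real)" by simp
      then show "R\<^sub>0 < l j" "R - 1 \<le> l j" "u j \<le> 4 * R + 1" using R unfolding l_def u_def by linarith+
    qed
    have g01: "0 \<le> g j r" "g j r \<le> 1" and gd: "\<bar>g' j r\<bar> \<le> 8 / e j" for j r
      unfolding g_def g'_def by (rule plateau_props[OF e])+
    have gz: "g j r = 0" if "r \<notin> {l (Suc j)..u (Suc j)}" for j r
      unfolding g_def by (rule plateau_props(3)[OF e that])
    have g1: "g j r = 1" if "r \<in> {l j..u j}" for j r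
      unfolding g_def by (rule plateau_props(4)[OF e]) (use that le in simp)
    have gC: "C1c R\<^sub>0 (g j) (g' j)" for j
      unfolding g_def g'_def by (rule plateau_props(6)[OF e lR(1)])
    have gc: "Cc R\<^sub>0 (\<lambda>r. (g j r)\<^sup>2)" "Cc R\<^sub>0 (\<lambda>r. (g' j r)\<^sup>2)" for j
      using C1c_Cc[OF gC] by (auto intro: Cc_power2)
    have gz': "g' j r = 0" if "r \<notin> {l (Suc j)..u (Suc j)}" for j r
      using DERIV_zero_outside[of "g j" "g' j" "l (Suc j)" "u (Suc j)"] gC[of j] gz that unfolding C1c_def by blast
    define a where "a = (\<lambda>j. J (\<lambda>r a b c d n. (g j r)\<^sup>2 * b))"
    have a0: "a j \<ge> 0" for j unfolding a_def J_def ev_def by (rule integral_nonneg_AE) simp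
    have g_mono: "(g j r)\<^sup>2 \<le> (g (Suc j) r)\<^sup>2" for j r
    proof (cases "r \<in> {l (Suc j)..u (Suc j)}")
      case True
      then show ?thesis using g1[OF True] g01[of j r] power_mono[of "g j r" 1 2] by simp
    qed (simp add: gz)
    \<comment> \<open>The derivative is at most 8 / \<open>e j\<close> = 16 * 2^j, whose square is
      256 * 4^j, and it lives where \<open>g (Suc j)\<close> is 1.\<close>
    have d_mono: "(g' j r)\<^sup>2 \<le> 256 * 4 ^ j * (g (Suc j) r)\<^sup>2" for j r
    proof (cases "r \<in> {l (Suc j)..u (Suc j)}")
      case True
      have "\<bar>g' j r\<bar>\<^sup>2 \<le> (8 / e j)\<^sup>2" by (rule power_mono[OF gd]) simp
      also have "\<dots> = 256 * 4 ^ j" by (simp add: e_def power_mult_distrib power2_eq_square flip: power_mult_distrib)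
      finally show ?thesis using g1[OF True] by simp
    qed (simp add: gz')
    have step: "a j \<le> \<theta> * a (Suc j) + D * M ^ j" for j
    proof -
      define \<delta> where "\<delta> = c / 2 ^ j"
      have \<delta>: "\<delta> > 0" using c by (simp add: \<delta>_def)
      have "(LINT x|lborel. \<bar>g j (rho x) * f x\<bar> powr p) \<le> I0"
        by (rule radial_Lp_le[OF C1c_Cc(1)[OF gC] _ p(1) I0]) (use g01 in \<open>simp add: abs_of_nonneg\<close>)
      then have "(LINT x|lborel. \<bar>g j (rho x) * f x\<bar> powr p) < I0 + 1" by simp
      from nash_radial[OF gC \<delta> p this, folded N_def C1_def]
      have "a j \<le> C1 * \<delta>\<^sup>2 * (J (\<lambda>r a b c d n. (g' j r)\<^sup>2 * b) + \<kappa>\<^sup>2 * a j) + 8 * (2 * \<delta> powr (- N)) powr (2 / p - 1) * (I0 + 1) powr (2 / p)"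
        unfolding a_def .
      also have "8 * (2 * \<delta> powr (- N)) powr (2 / p - 1) * (I0 + 1) powr (2 / p) = D * M ^ j"
      proof -
        have "(\<delta> powr (- N)) powr (2 / p - 1) = \<delta> powr (- \<gamma>)" unfolding powr_powr \<gamma>_def by simp
        also have "\<dots> = c powr (- \<gamma>) * M ^ j"
        proof -
          have "(2 ^ j) powr \<gamma> = M ^ j" unfolding M_def by (simp add: powr_realpow[symmetric] powr_powr mult.commute)
          then show ?thesis using c unfolding \<delta>_def by (simp add: powr_divide powr_minus field_simps)
        qed
        finally show ?thesis by (simp add: D_def powr_mult)
      qed
      also have "C1 * \<delta>\<^sup>2 * (J (\<lambda>r a b c d n. (g' j r)\<^sup>2 * b) + \<kappa>\<^sup>2 * a j) \<le> C1 * \<delta>\<^sup>2 * ((256 * 4 ^ j + \<kappa>\<^sup>2 * 4 ^ j) * a (Suc j))"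
      proof (rule mult_left_mono)
        have "J (\<lambda>r a b c d n. (g' j r)\<^sup>2 * b) \<le> J (\<lambda>r a b c d n. (256 * 4 ^ j * (g (Suc j) r)\<^sup>2) * b)"
          by (rule J_mono_b[OF gc(2) Cc_cmult[OF gc(1)] d_mono])
        also have "\<dots> = 256 * 4 ^ j * a (Suc j)"
          unfolding a_def J_cmult[symmetric] by (simp add: mult.assoc)
        finally have 1: "J (\<lambda>r a b c d n. (g' j r)\<^sup>2 * b) \<le> 256 * 4 ^ j * a (Suc j)" .
        have "a j \<le> a (Suc j)" unfolding a_def by (rule J_mono_b[OF gc(1) gc(1) g_mono])
        also have "\<dots> \<le> 4 ^ j * a (Suc j)" using mult_right_mono[of 1 "4 ^ j" "a (Suc j)"] a0 by simp
        finally have "\<kappa>\<^sup>2 * a j \<le> \<kappa>\<^sup>2 * (4 ^ j * a (Suc j))" by (rule mult_left_mono) simp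
        with 1 show "J (\<lambda>r a b c d n. (g' j r)\<^sup>2 * b) + \<kappa>\<^sup>2 * a j \<le> (256 * 4 ^ j + \<kappa>\<^sup>2 * 4 ^ j) * a (Suc j)"
          by (simp add: algebra_simps)
      qed (use C1 in simp)
      also have "C1 * \<delta>\<^sup>2 * ((256 * 4 ^ j + \<kappa>\<^sup>2 * 4 ^ j) * a (Suc j)) = \<theta> * a (Suc j)"
      proof -
        have "((2::real) ^ j)\<^sup>2 = 4 ^ j" by (simp add: power2_eq_square flip: power_mult_distrib)
        then have "\<delta>\<^sup>2 * 4 ^ j = c\<^sup>2" unfolding \<delta>_def by (simp add: power_divide)
        then have "C1 * (\<delta>\<^sup>2 * 4 ^ j) * (256 + \<kappa>\<^sup>2) = \<theta>" using \<theta>(1) by (simp add: Y_def mult_ac)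
        moreover have "C1 * \<delta>\<^sup>2 * ((256 * 4 ^ j + \<kappa>\<^sup>2 * 4 ^ j) * a (Suc j)) = C1 * (\<delta>\<^sup>2 * 4 ^ j) * (256 + \<kappa>\<^sup>2) * a (Suc j)"
          by (simp add: algebra_simps)
        ultimately show ?thesis by simp
      qed
      finally show ?thesis by simp
    qed
    have "a 0 \<le> 2 * D"
    proof (rule iterate_bound[OF step \<theta>(2-4) _ D])
      show "M \<ge> 0" using M by simp
      \<comment> \<open>One cutoff dominating all \<open>g j\<close>, which supplies the a priori
        bound uniform in j; its dependence on R is harmless.\<close>
      define H where "H = plateau (1 / 2) (R - 3 / 2) (4 * R + 3 / 2)"
      have CH: "Cc R\<^sub>0 H" unfolding H_def using R by (intro C1c_Cc(1)[OF plateau_props(6)]) auto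
      show "a j \<le> J (\<lambda>r a b c d n. H r * b)" for j unfolding a_def
      proof (rule J_mono_b[OF gc(1) CH])
        fix r
        show "(g j r)\<^sup>2 \<le> H r"
        proof (cases "r \<in> {l (Suc j)..u (Suc j)}")
          case True
          then have "H r = 1" unfolding H_def using lR(2,3)[of "Suc j"] by (intro plateau_props(4)) auto
          then show ?thesis using g01[of j r] power_mono[of "g j r" 1 2] by simp
        next
          case False
          then show ?thesis unfolding H_def by (simp add: gz plateau_props(1))
        qed
      qed
    qed
    moreover have "J (\<lambda>r a b c d n. h r * b) \<le> a 0" unfolding a_def
    proof (rule J_mono_b[OF h(1) gc(1)])
      fix r
      show "h r \<le> (g 0 r)\<^sup>2"
      proof (cases "r \<in> {R..4 * R}")
        case True
        then have "r \<in> {l 0..u 0}" by (simp add: l_def u_def)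
        from g1[OF this] show ?thesis using h(2) by simp
      qed (simp add: h(3))
    qed
    ultimately show ?thesis by linarith
  qed
  show ?thesis unfolding slow_growth_def
  proof (intro allI impI)
    fix \<epsilon> R' :: real assume \<epsilon>: "\<epsilon> > 0"
    define R where "R = max R' (max (R\<^sub>0 + 2) (2 * D / \<epsilon>))"
    have "2 * D / \<epsilon> \<le> R" by (simp add: R_def)
    then have "2 * D \<le> \<epsilon> * R" using \<epsilon> by (simp add: pos_divide_le_eq mult.commute)
    moreover have "R \<ge> R\<^sub>0 + 2" "R \<ge> R'" by (auto simp: R_def)
    ultimately show "\<exists>R\<ge>R'. \<forall>h. Cc R\<^sub>0 h \<longrightarrow> (\<forall>r. 0 \<le> h r \<and> h r \<le> 1) \<longrightarrow> (\<forall>r. r \<notin> {R..4*R} \<longrightarrow> h r = 0) \<longrightarrow>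
      J (\<lambda>r a b c d n. h r * b) \<le> \<epsilon> * R"
      using bound by (intro exI[of _ R]) (meson order_trans)
  qed
qed

end

section \<open>Volume growth and integrability exponents from 2 on\<close>

lemma emeasure_vec_cbox:
  assumes "a \<ge> 0"
  shows "emeasure lborel (cbox (vec (- a)) (vec a) :: (real^'n::finite) set) = ennreal ((2 * a) ^ CARD('n))"
proof -
  let ?l = "vec (- a) :: real^'n" and ?u = "vec a :: real^'n"
  have d: "?l \<bullet> b = - a" "?u \<bullet> b = a" if "b \<in> Basis" for b
    using that by (auto simp: Basis_vec_def inner_axis)
  have "emeasure lborel (cbox ?l ?u) = ennreal (\<Prod>b\<in>Basis. (?u - ?l) \<bullet> b)"
    by (rule emeasure_lborel_cbox) (use d assms in simp)
  also have "(\<Prod>b\<in>Basis. (?u - ?l) \<bullet> b) = (2 * a) ^ CARD('n)" using d by (simp add: inner_diff_left)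
  finally show ?thesis .
qed

text \<open>The gauge ball lies in a box with half-sides r in the z-directions and r^(\<alpha> + 1)
  in the \<sigma>-directions, and the exponents add up to the homogeneous dimension.\<close>

lemma emeasure_gauge_ball:
  fixes r :: real
  assumes \<alpha>: "\<alpha> > 0" and r: "r > 0"
  shows "emeasure lborel {x::(real^'m::finite) \<times> (real^'k::finite). pseudo_gauge \<alpha> x \<le> r} \<le> ennreal (2 ^ (CARD('m) + CARD('k)) * r powr hom_dim TYPE('m) TYPE('k) \<alpha>)"
proof -
  let ?s = "r powr (\<alpha> + 1)"
  let ?A = "cbox (vec (- r)) (vec r) :: (real^'m) set" and ?B = "cbox (vec (- ?s)) (vec ?s) :: (real^'k) set"
  have "{x::(real^'m) \<times> (real^'k). pseudo_gauge \<alpha> x \<le> r} \<subseteq> ?A \<times> ?B"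
  proof (intro subsetI, elim CollectE)
    fix x :: "(real^'m) \<times> (real^'k)" assume x: "pseudo_gauge \<alpha> x \<le> r"
    have "tau \<alpha> x \<le> r powr (2 * (\<alpha> + 1))"
      unfolding tau_eq_gauge[OF \<alpha>] using x \<alpha> by (intro powr_mono2 pseudo_gauge_nonneg) auto
    then have le: "norm (fst x) powr (2 * (\<alpha> + 1)) + 4 * (\<alpha> + 1)\<^sup>2 * (norm (snd x))\<^sup>2 \<le> r powr (2 * (\<alpha> + 1))"
      unfolding tau_def .
    have "0 \<le> norm (fst x) powr (2 * (\<alpha> + 1))" "0 \<le> 4 * (\<alpha> + 1)\<^sup>2 * (norm (snd x))\<^sup>2" by simp_all
    with le have 1: "norm (fst x) powr (2 * (\<alpha> + 1)) \<le> r powr (2 * (\<alpha> + 1))" and 2: "4 * (\<alpha> + 1)\<^sup>2 * (norm (snd x))\<^sup>2 \<le> r powr (2 * (\<alpha> + 1))"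
      by argo+
    have "norm (fst x) \<le> r"
    proof (rule ccontr)
      assume "\<not> norm (fst x) \<le> r"
      then have "r powr (2 * (\<alpha> + 1)) < norm (fst x) powr (2 * (\<alpha> + 1))" using r \<alpha> by (intro powr_less_mono2) auto
      then show False using 1 by simp
    qed
    moreover have "norm (snd x) \<le> ?s"
    proof -
      have "1\<^sup>2 \<le> (\<alpha> + 1)\<^sup>2" using \<alpha> by (intro power_mono) auto
      then have "1 * (norm (snd x))\<^sup>2 \<le> 4 * (\<alpha> + 1)\<^sup>2 * (norm (snd x))\<^sup>2" by (intro mult_right_mono) auto
      also have "\<dots> \<le> ?s\<^sup>2" using 2 unfolding power2_eq_square powr_add[symmetric] mult_2 .
      finally have "(norm (snd x))\<^sup>2 \<le> ?s\<^sup>2" by simp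
      then show ?thesis by (rule power2_le_imp_le) simp
    qed
    ultimately have "\<bar>fst x $ i\<bar> \<le> r" "\<bar>snd x $ j\<bar> \<le> ?s" for i j
      using component_le_norm_cart[of "fst x" i] component_le_norm_cart[of "snd x" j] by linarith+
    then show "x \<in> ?A \<times> ?B" by (auto simp: mem_Times_iff mem_box_cart abs_le_iff minus_le_iff)
  qed
  then have "emeasure lborel {x::(real^'m) \<times> (real^'k). pseudo_gauge \<alpha> x \<le> r} \<le> emeasure lborel (?A \<times> ?B)"
    by (rule emeasure_mono) (auto intro!: borel_closed closed_Times)
  also have "\<dots> = emeasure (lborel \<Otimes>\<^sub>M lborel) (?A \<times> ?B)" by (simp add: lborel_prod)
  also have "\<dots> = emeasure lborel ?A * emeasure lborel ?B"
    by (rule lborel.emeasure_pair_measure_Times) auto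
  also have "\<dots> = ennreal ((2 * r) ^ CARD('m) * (2 * ?s) ^ CARD('k))"
    using r by (simp add: emeasure_vec_cbox ennreal_mult)
  also have "(2 * r) ^ CARD('m) * (2 * ?s) ^ CARD('k) = 2 ^ (CARD('m) + CARD('k)) * r powr hom_dim TYPE('m) TYPE('k) \<alpha>"
  proof -
    have "r ^ CARD('m) = r powr real CARD('m)" using r by (simp add: powr_realpow)
    moreover have "?s ^ CARD('k) = r powr ((\<alpha> + 1) * real CARD('k))"
      unfolding powr_powr[symmetric] using r by (intro powr_realpow[symmetric]) simp
    ultimately show ?thesis unfolding hom_dim_def powr_add power_mult_distrib power_add by simp
  qed
  finally show ?thesis .
qed

context grushin_exterior
begin

text \<open>Where |f| \<le> s the mass is estimated by s^2 times the volume; where |f| > s it is at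
  most s^(2 - p) times the tail of the p-th power integral. The level s is tuned to R so that each
  contribution is at most half of \<epsilon> R.\<close>

lemma slow_growth_superquadratic:
  assumes Q3: "Q \<ge> 3" and p: "2 \<le> p" "p \<le> 2 * Q / (Q - 1)"
    and fin: "(\<integral>\<^sup>+x\<in>{x. rho x > R\<^sub>0}. ennreal (\<bar>f x\<bar> powr p) \<partial>lborel) < \<infinity>"
  shows slow_growth
  unfolding slow_growth_def
proof (intro allI impI)
  fix \<epsilon> R' :: real assume \<epsilon>: "\<epsilon> > 0"
  let ?\<Omega> = "{x. rho x > R\<^sub>0}"
  let ?g = "\<lambda>x. ennreal (\<bar>f x\<bar> powr p) * indicator ?\<Omega> x"
  define C where "C = 2 ^ (CARD('m) + CARD('k)) * 4 powr Q"
  have C: "C > 0" by (simp add: C_def)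
  \<comment> \<open>C R^Q bounds the volume of \<rho> \<le> 4R, and \<eta> makes s^2 C R^Q equal to
    \<epsilon> R / 2. The number \<open>t\<close> below is the size of the tail that makes the other
    contribution equally small.\<close>
  define \<eta> where "\<eta> = sqrt (\<epsilon> / (2 * C))"
  have \<eta>: "\<eta> > 0" "\<eta>\<^sup>2 * C = \<epsilon> / 2" using \<epsilon> C by (auto simp: \<eta>_def)
  define t where "t = \<epsilon> / 2 * \<eta> powr (p - 2)"
  have t: "t > 0" using \<epsilon> \<eta> by (simp add: t_def)
  have mg: "?g \<in> borel_measurable lborel"
  proof -
    have "continuous_on ?\<Omega> (\<lambda>x. \<bar>f x\<bar> powr p)" using p by (intro continuous_on_powr' continuous_intros cf) auto
    then have "(\<lambda>x. indicator ?\<Omega> x *\<^sub>R (\<bar>f x\<bar> powr p)) \<in> borel_measurable borel"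
      by (intro borel_measurable_continuous_on_indicator borel_open open_gauge \<alpha>)
    then have m: "(\<lambda>x. ennreal (indicator ?\<Omega> x *\<^sub>R (\<bar>f x\<bar> powr p))) \<in> borel_measurable borel" by measurable
    have eq: "(\<lambda>x. ennreal (indicator ?\<Omega> x *\<^sub>R (\<bar>f x\<bar> powr p))) = ?g" by (auto simp: fun_eq_iff indicator_def)
    show ?thesis using m unfolding eq by simp
  qed
  have mr: "{x::(real^'m) \<times> (real^'k). r \<le> rho x} \<in> sets lborel" "{x::(real^'m) \<times> (real^'k). rho x \<le> r} \<in> sets lborel" for r :: real
    by (simp_all add: borel_closed closed_Collect_le continuous_gauge \<alpha>)
  \<comment> \<open>The tails of a finite integral tend to 0, by monotone convergence for decreasing
    sequences; the limit function is 0 because each x has finite gauge.\<close>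
  obtain n :: nat where n: "(\<integral>\<^sup>+x. ?g x * indicator {x. real n \<le> rho x} x \<partial>lborel) < ennreal t"
  proof -
    let ?G = "\<lambda>n x. ?g x * indicator {x. real n \<le> rho x} x"
    have "(\<integral>\<^sup>+x. (INF n. ?G n x) \<partial>lborel) = (INF n. \<integral>\<^sup>+x. ?G n x \<partial>lborel)"
    proof (rule nn_integral_monotone_convergence_INF_decseq[where i=0])
      show "decseq ?G"
      proof (intro monotoneI le_funI mult_left_mono)
        fix i j :: nat and x :: "(real^'m) \<times> (real^'k)" assume "i \<le> j"
        then have "real i \<le> real j" by simp
        then show "indicator {x. real j \<le> rho x} x \<le> (indicator {x. real i \<le> rho x} x :: ennreal)" by (simp add: indicator_def)
      qed simp
      show "?G n \<in> borel_measurable lborel" for n using mg mr(1) by measurable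
      have "(\<integral>\<^sup>+x. ?G 0 x \<partial>lborel) = (\<integral>\<^sup>+x. ?g x \<partial>lborel)"
        by (intro nn_integral_cong) (simp add: pseudo_gauge_nonneg)
      then show "(\<integral>\<^sup>+x. ?G 0 x \<partial>lborel) < \<infinity>" using fin by simp
    qed
    moreover have "(INF n. ?G n x) = 0" for x
    proof -
      obtain n :: nat where "rho x < real n" using reals_Archimedean2 by blast
      then have "?G n x = 0" by simp
      moreover have "(INF n. ?G n x) \<le> ?G n x" by (rule INF_lower) simp
      ultimately have "(INF n. ?G n x) \<le> 0" by (simp only:)
      then show ?thesis by (simp only: le_zero_eq)
    qed
    ultimately have "(INF n. \<integral>\<^sup>+x. ?G n x \<partial>lborel) < ennreal t" using t by simp
    then show ?thesis using that unfolding INF_less_iff by blast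
  qed
  define R where "R = max (max R' 1) (max (R\<^sub>0 + 1) (real n))"
  have R: "R \<ge> R'" "R \<ge> 1" "R > R\<^sub>0" "R \<ge> real n" by (auto simp: R_def)
  define s where "s = \<eta> * R powr (- (Q - 1) / 2)"
  have s: "s > 0" using \<eta> R by (simp add: s_def)
  have split: "(f x)\<^sup>2 \<le> s powr (2 - p) * \<bar>f x\<bar> powr p + s\<^sup>2" for x
  proof (cases "\<bar>f x\<bar> \<le> s")
    case True
    then have "\<bar>f x\<bar>\<^sup>2 \<le> s\<^sup>2" by (rule power_mono) simp
    then show ?thesis by (simp add: add_increasing)
  next
    case False
    then have fp: "\<bar>f x\<bar> > 0" using s by linarith
    have "(f x)\<^sup>2 = \<bar>f x\<bar> powr (2 - p) * \<bar>f x\<bar> powr p" using fp by (simp add: powr_add[symmetric])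
    also have "\<dots> \<le> s powr (2 - p) * \<bar>f x\<bar> powr p"
      using False s p by (intro mult_right_mono powr_mono2') auto
    finally show ?thesis by (simp add: add_increasing2)
  qed
  have A: "s powr (2 - p) * t \<le> \<epsilon> / 2 * R"
  proof -
    have "s powr (2 - p) = \<eta> powr (2 - p) * R powr ((Q - 1) * (p - 2) / 2)"
      using \<eta> R unfolding s_def by (simp add: powr_mult powr_powr algebra_simps)
    also have "\<dots> \<le> \<eta> powr (2 - p) * R powr 1"
    proof (intro mult_left_mono powr_mono)
      \<comment> \<open>Here the critical exponent enters: it says exactly that s^(2 - p) grows at
        most linearly in R.\<close>
      have "p * (Q - 1) \<le> 2 * Q" using p(2) Q3 by (simp add: field_simps)
      then show "(Q - 1) * (p - 2) / 2 \<le> 1" by (simp add: algebra_simps)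
    qed (use R in auto)
    finally have "s powr (2 - p) * t \<le> \<eta> powr (2 - p) * R * t" using R t by (intro mult_right_mono) auto
    also have "\<dots> = \<epsilon> / 2 * R * (\<eta> powr (2 - p) * \<eta> powr (p - 2))" unfolding t_def by simp
    also have "\<eta> powr (2 - p) * \<eta> powr (p - 2) = 1" using \<eta> by (simp add: powr_add[symmetric])
    finally show ?thesis by simp
  qed
  have B: "s\<^sup>2 * (2 ^ (CARD('m) + CARD('k)) * (4 * R) powr Q) = \<epsilon> / 2 * R"
  proof -
    have "(R powr (- (Q - 1) / 2))\<^sup>2 * R powr Q = R powr 1"
      unfolding power2_eq_square by (simp only: powr_add[symmetric]) (simp add: field_simps)
    then have "s\<^sup>2 * (2 ^ (CARD('m) + CARD('k)) * (4 * R) powr Q) = \<eta>\<^sup>2 * C * R"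
      using R unfolding s_def C_def by (simp add: power_mult_distrib powr_mult)
    then show ?thesis using \<eta> by simp
  qed
  have "J (\<lambda>r a b c d n. h r * b) \<le> \<epsilon> * R" if h: "Cc R\<^sub>0 h" "\<forall>r. 0 \<le> h r \<and> h r \<le> 1" "\<forall>r. r \<notin> {R..4*R} \<longrightarrow> h r = 0" for h
  proof -
    have i: "integrable lborel (\<lambda>x. h (rho x) * (f x)\<^sup>2)" by (rule radial_integrable[OF h(1) continuous_weights(2)])
    have "ennreal (J (\<lambda>r a b c d n. h r * b)) = (\<integral>\<^sup>+x. ennreal (h (rho x) * (f x)\<^sup>2) \<partial>lborel)"
      unfolding J_def ev_def by (rule nn_integral_eq_integral[OF i, symmetric]) (use h in simp)
    also have "\<dots> \<le> (\<integral>\<^sup>+x. ennreal (s powr (2 - p)) * (?g x * indicator {x. real n \<le> rho x} x) + ennreal (s\<^sup>2) * indicator {x. rho x \<le> 4 * R} x \<partial>lborel)"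
    proof (rule nn_integral_mono)
      fix x
      show "ennreal (h (rho x) * (f x)\<^sup>2) \<le> ennreal (s powr (2 - p)) * (?g x * indicator {x. real n \<le> rho x} x) + ennreal (s\<^sup>2) * indicator {x. rho x \<le> 4 * R} x"
      proof (cases "rho x \<in> {R..4*R}")
        case True
        have "h (rho x) * (f x)\<^sup>2 \<le> 1 * (f x)\<^sup>2" using h by (intro mult_right_mono) auto
        also have "\<dots> \<le> s powr (2 - p) * \<bar>f x\<bar> powr p + s\<^sup>2" using split by simp
        finally have "ennreal (h (rho x) * (f x)\<^sup>2) \<le> ennreal (s powr (2 - p) * \<bar>f x\<bar> powr p + s\<^sup>2)" by (rule ennreal_leI)
        then show ?thesis using True R by (simp add: ennreal_plus ennreal_mult)
      qed (use h in simp)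
    qed
    also have "\<dots> = ennreal (s powr (2 - p)) * (\<integral>\<^sup>+x. ?g x * indicator {x. real n \<le> rho x} x \<partial>lborel) + ennreal (s\<^sup>2) * emeasure lborel {x. rho x \<le> 4 * R}"
    proof -
      have m1: "(\<lambda>x. ?g x * indicator {x. real n \<le> rho x} x) \<in> borel_measurable lborel" using mg mr(1) by measurable
      have m2: "(\<lambda>x. ennreal (s powr (2 - p)) * (?g x * indicator {x. real n \<le> rho x} x)) \<in> borel_measurable lborel" using m1 by measurable
      have m3: "(\<lambda>x. ennreal (s\<^sup>2) * indicator {x. rho x \<le> 4 * R} x) \<in> borel_measurable lborel" using mr(2) by measurable
      show ?thesis unfolding nn_integral_add[OF m2 m3] nn_integral_cmult[OF m1] nn_integral_cmult_indicator[OF mr(2)] ..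
    qed
    also have "\<dots> \<le> ennreal (s powr (2 - p)) * ennreal t + ennreal (s\<^sup>2) * ennreal (2 ^ (CARD('m) + CARD('k)) * (4 * R) powr Q)"
    proof (intro add_mono mult_left_mono)
      show "emeasure lborel {x. rho x \<le> 4 * R} \<le> ennreal (2 ^ (CARD('m) + CARD('k)) * (4 * R) powr Q)"
        unfolding Q by (rule emeasure_gauge_ball[OF \<alpha>]) (use R in simp)
    qed (use n in auto)
    also have "\<dots> = ennreal (s powr (2 - p) * t + s\<^sup>2 * (2 ^ (CARD('m) + CARD('k)) * (4 * R) powr Q))"
      using t by (subst ennreal_plus) (auto simp: ennreal_mult)
    also have "\<dots> \<le> ennreal (\<epsilon> * R)" using A by (intro ennreal_leI) (simp add: B)
    finally show ?thesis using \<epsilon> R by simp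
  qed
  then show "\<exists>R\<ge>R'. \<forall>h. Cc R\<^sub>0 h \<longrightarrow> (\<forall>r. 0 \<le> h r \<and> h r \<le> 1) \<longrightarrow> (\<forall>r. r \<notin> {R..4*R} \<longrightarrow> h r = 0) \<longrightarrow>
      J (\<lambda>r a b c d n. h r * b) \<le> \<epsilon> * R"
    using R(1) by blast
qed

end

theorem theorem1p2:
  fixes \<alpha> R\<^sub>0 \<kappa> p Q :: real
    and f :: "(real^'m::finite) \<times> (real^'k::finite) \<Rightarrow> real"
    and \<Omega>\<^sub>0 :: "((real^'m) \<times> (real^'k)) set"
  defines "Q \<equiv> hom_dim TYPE('m) TYPE('k) \<alpha>"
    and "\<Omega>\<^sub>0 \<equiv> {x. pseudo_gauge \<alpha> x > R\<^sub>0}"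
  assumes "\<alpha> > 0" and "Q \<ge> 3"
    and "R\<^sub>0 > 0" and "\<kappa> > 0"
    and "f \<in> Gamma2 \<alpha> \<Omega>\<^sub>0"
    and "\<And>x. x \<in> \<Omega>\<^sub>0 \<Longrightarrow> baouendi_grushin \<alpha> \<Omega>\<^sub>0 f x = - \<kappa>\<^sup>2 * f x"
    and "0 < p" and "p \<le> 2 * Q / (Q - 1)"
    and "(\<integral>\<^sup>+x\<in>\<Omega>\<^sub>0. ennreal (\<bar>f x\<bar> powr p) \<partial>lborel) < \<infinity>"
  shows "\<forall>x\<in>\<Omega>\<^sub>0. f x = 0"
proof
  fix x assume x: "x \<in> \<Omega>\<^sub>0"
  have o: "open \<Omega>\<^sub>0" unfolding \<Omega>\<^sub>0_def by (rule open_gauge[OF assms(3)])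
  have G1: "f \<in> Gamma1 \<alpha> \<Omega>\<^sub>0" using assms(7) by (simp add: Gamma2_def)
  interpret grushin_exterior \<alpha> \<kappa> R\<^sub>0 f "\<lambda>i. X_deriv \<alpha> \<Omega>\<^sub>0 (Inl i) f" "\<lambda>j. X_deriv \<alpha> \<Omega>\<^sub>0 (Inr j) f" Q
    unfolding grushin_exterior_def grushin_exterior_axioms_def grushin_solution_def \<Omega>\<^sub>0_def[symmetric]
  proof (intro conjI allI impI)
    show "continuous_on \<Omega>\<^sub>0 f" using G1 by (simp add: Gamma1_def)
    fix K :: "((real^'m) \<times> (real^'k)) set" and e :: real
    assume K: "compact K" "K \<subseteq> \<Omega>\<^sub>0" and e: "e > 0"
    show "\<exists>F F1 F2. C2 F F1 F2 \<and> (\<forall>x\<in>K. \<bar>F x - f x\<bar> \<le> e \<and>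
      (\<forall>i. \<bar>F1 (ez i) x - X_deriv \<alpha> \<Omega>\<^sub>0 (Inl i) f x\<bar> \<le> e) \<and> (\<forall>j. \<bar>gweight \<alpha> x * F1 (es j) x - X_deriv \<alpha> \<Omega>\<^sub>0 (Inr j) f x\<bar> \<le> e) \<and>
      \<bar>Bop \<alpha> F2 x + \<kappa>\<^sup>2 * F x\<bar> * (1 + (\<Sum>j\<in>UNIV. \<bar>F1 (es j) x\<bar>)) \<le> e)"
    proof (rule Gamma2_approx[OF o assms(3) assms(7) _ K e])
      show "baouendi_grushin \<alpha> \<Omega>\<^sub>0 f x = - \<kappa>\<^sup>2 * f x" if "x \<in> \<Omega>\<^sub>0" for x by (rule assms(8)[OF that])
      fix F F1 F2
      assume F: "C2 F F1 F2" "\<And>x. x \<in> K \<Longrightarrow> \<bar>F x - f x\<bar> \<le> e"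
        "\<And>x i. x \<in> K \<Longrightarrow> \<bar>F1 (ez i) x - X_deriv \<alpha> \<Omega>\<^sub>0 (Inl i) f x\<bar> \<le> e"
        "\<And>x j. x \<in> K \<Longrightarrow> \<bar>gweight \<alpha> x * F1 (es j) x - X_deriv \<alpha> \<Omega>\<^sub>0 (Inr j) f x\<bar> \<le> e"
        "\<And>x. x \<in> K \<Longrightarrow> \<bar>(\<Sum>i\<in>UNIV. F2 (ez i) (ez i) x) + (gweight \<alpha> x)\<^sup>2 * (\<Sum>j\<in>UNIV. F2 (es j) (es j) x) + \<kappa>\<^sup>2 * F x\<bar>
          * (1 + (\<Sum>j\<in>UNIV. \<bar>F1 (es j) x\<bar>)) \<le> e"
      show ?thesis unfolding Bop_def by (intro exI[of _ F] exI[of _ F1] exI[of _ F2] conjI ballI allI F)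
    qed
  qed (use assms o X_deriv_props(1)[OF G1] in auto)
  have fin: "(\<integral>\<^sup>+x\<in>{x. rho x > R\<^sub>0}. ennreal (\<bar>f x\<bar> powr p) \<partial>lborel) < \<infinity>"
    using assms(11) by (simp add: \<Omega>\<^sub>0_def)
  have slow_growth
    using slow_growth_subquadratic[OF assms(9) _ fin] slow_growth_superquadratic[OF assms(4) _ assms(10) fin] by linarith
  then show "f x = 0" using vanishing assms(4,6) x by (simp add: \<Omega>\<^sub>0_def)
qed

end
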